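(* Let $N\in\{1,2,3\}$, let $\Omega\subset\mathbb{R}^N$ be a bounded domain, and let $\lambda_1,\lambda_2,\mu_1,\mu_2,\beta$ be positive constants. There exists a positive constant $\Lambda=\Lambda(\lambda_1,\lambda_2,\mu_1,\mu_2,\beta,S_4)$, depending only on the listed quantities, such that for all $f,g\in L^{4/3}(\Omega)$, both nonzero, with $\max\{\|f\|_{4/3},\|g\|_{4/3}\}<\Lambda$, the system $$\begin{cases}-\Delta u+\lambda_1u=\mu_1u^3+\beta uv^2+f(x), & x\in\Omega,\\ -\Delta v+\lambda_2v=\mu_2v^3+\beta u^2v+g(x), & x\in\Omega,\\ u=v=0, & x\in\partial\Omega,\end{cases}$$ has two (distinct) nontrivial solutions. Furthermore, if in addition $f$ and $g$ are both positive, then the system has one positive ground state solution and one positive bound state solution, and these two solutions are distinct.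
   Context: $\|\cdot\|_p$ is the norm of $L^p(\Omega)$. $S_4$ is the best Sobolev constant of the embedding $H_0^1(\Omega)\hookrightarrow L^4(\Omega)$, i.e. the smallest constant with $\|u\|_4\le S_4\left(\int_\Omega|\nabla u|^2\right)^{1/2}$ for all $u\in H_0^1(\Omega)$. Let $H=H_0^1(\Omega)\times H_0^1(\Omega)$ with norm $\|(u,v)\|=\left(\int_\Omega(|\nabla u|^2+\lambda_1u^2)+\int_\Omega(|\nabla v|^2+\lambda_2v^2)\right)^{1/2}$. A (weak) solution of the system is $(u,v)\in H$ such that for all $(\varphi,\psi)\in H$, $$\int_\Omega\big(\nabla u\nabla\varphi+\nabla v\nabla\psi+\lambda_1u\varphi+\lambda_2v\psi-\mu_1u^3\varphi-\mu_2v^3\psi-\beta uv^2\varphi-\beta u^2v\psi-f\varphi-g\psi\big)dx=0;$$ equivalently, a critical point of the $C^1$ energy functional $J:H\to\mathbb{R}$, $$J(u,v)=\frac12\|(u,v)\|^2-\frac14\Big(\mu_1\|u\|_4^4+\mu_2\|v\|_4^4+2\beta\int_\Omega u^2v^2\Big)-\int_\Omega(fu+gv).$$ A solution $(u,v)$ is nontrivial if both components are nonzero. A function is called positive if it is nonnegative (a.e.) and nonzero. A positive ground state solution is a solution which has the least energy $J$ among all nonzero solutions and whose two components are both positive. A bound state solution is a solution of finite energy; it is positive if both of its components are positive. *)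

theory Defs
  imports "HOL-Analysis.Analysis"
begin

text \<open>
  Elements of function spaces over \<open>\<Omega>\<close> are represented by total functions on the ambient
  Euclidean space. Values outside \<open>\<Omega>\<close> are irrelevant, and equality of elements is equality
  almost everywhere with respect to \<^term>\<open>lebesgue_on \<Omega>\<close>.
\<close>

definition domain :: "'a::euclidean_space set \<Rightarrow> bool" where
  "domain \<Omega> \<longleftrightarrow> open \<Omega> \<and> connected \<Omega> \<and> \<Omega> \<noteq> {}"


subsection \<open>Lebesgue spaces\<close>

definition Lp :: "real \<Rightarrow> 'a::euclidean_space set \<Rightarrow> ('a \<Rightarrow> 'b::euclidean_space) set" where
  "Lp p \<Omega> = {f \<in> borel_measurable (lebesgue_on \<Omega>).
               integrable (lebesgue_on \<Omega>) (\<lambda>x. norm (f x) powr p)}"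

definition Lp_norm :: "real \<Rightarrow> 'a::euclidean_space set \<Rightarrow> ('a \<Rightarrow> 'b::euclidean_space) \<Rightarrow> real" where
  "Lp_norm p \<Omega> f = (LINT x|lebesgue_on \<Omega>. norm (f x) powr p) powr (1 / p)"

definition nonzero_on :: "'a::euclidean_space set \<Rightarrow> ('a \<Rightarrow> real) \<Rightarrow> bool" where
  "nonzero_on \<Omega> f \<longleftrightarrow> \<not> (AE x in lebesgue_on \<Omega>. f x = 0)"

definition positive_on :: "'a::euclidean_space set \<Rightarrow> ('a \<Rightarrow> real) \<Rightarrow> bool" where
  "positive_on \<Omega> f \<longleftrightarrow> (AE x in lebesgue_on \<Omega>. 0 \<le> f x) \<and> nonzero_on \<Omega> f"


subsection \<open>The Sobolev space \<open>H\<^sub>0\<^sup>1\<close>\<close>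

primrec iterated_partial :: "'a::euclidean_space list \<Rightarrow> ('a \<Rightarrow> real) \<Rightarrow> 'a \<Rightarrow> real" where
  "iterated_partial [] f = f"
| "iterated_partial (b # bs) f = (\<lambda>x. frechet_derivative (iterated_partial bs f) (at x) b)"

definition smooth :: "('a::euclidean_space \<Rightarrow> real) \<Rightarrow> bool" where
  "smooth f \<longleftrightarrow> (\<forall>bs. set bs \<subseteq> Basis \<longrightarrow> (\<forall>x. iterated_partial bs f differentiable at x))"

definition test_functions :: "'a::euclidean_space set \<Rightarrow> ('a \<Rightarrow> real) set" where
  "test_functions \<Omega> = {\<phi>. smooth \<phi> \<and> compact (closure {x. \<phi> x \<noteq> 0}) \<and> closure {x. \<phi> x \<noteq> 0} \<subseteq> \<Omega>}"

definition is_L2_weak_gradient ::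
  "'a::euclidean_space set \<Rightarrow> ('a \<Rightarrow> real) \<Rightarrow> ('a \<Rightarrow> 'a) \<Rightarrow> bool" where
  "is_L2_weak_gradient \<Omega> u G \<longleftrightarrow> G \<in> Lp 2 \<Omega> \<and>
     (\<forall>\<phi> \<in> test_functions \<Omega>. \<forall>b \<in> Basis.
        (LINT x|lebesgue_on \<Omega>. u x * frechet_derivative \<phi> (at x) b)
          = - (LINT x|lebesgue_on \<Omega>. (G x \<bullet> b) * \<phi> x))"

definition H1 :: "'a::euclidean_space set \<Rightarrow> ('a \<Rightarrow> real) set" where
  "H1 \<Omega> = {u \<in> Lp 2 \<Omega>. \<exists>G. is_L2_weak_gradient \<Omega> u G}"

text \<open>On open \<open>\<Omega>\<close> the weak gradient is unique up to null sets, so the choice below only selects a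
  representative.\<close>

definition weak_gradient :: "'a::euclidean_space set \<Rightarrow> ('a \<Rightarrow> real) \<Rightarrow> 'a \<Rightarrow> 'a" where
  "weak_gradient \<Omega> u = (SOME G. is_L2_weak_gradient \<Omega> u G)"

definition H1_norm :: "'a::euclidean_space set \<Rightarrow> ('a \<Rightarrow> real) \<Rightarrow> real" where
  "H1_norm \<Omega> u =
     sqrt ((LINT x|lebesgue_on \<Omega>. (u x)\<^sup>2) + (LINT x|lebesgue_on \<Omega>. (norm (weak_gradient \<Omega> u x))\<^sup>2))"

definition H01 :: "'a::euclidean_space set \<Rightarrow> ('a \<Rightarrow> real) set" where
  "H01 \<Omega> = {u \<in> H1 \<Omega>. \<forall>\<epsilon>>0. \<exists>\<phi> \<in> test_functions \<Omega>. H1_norm \<Omega> (\<lambda>x. u x - \<phi> x) < \<epsilon>}"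

text \<open>Membership in \<open>L\<^sup>4\<close> is part of the embedding; without it a function that is not in \<open>L\<^sup>4\<close> would
  have the totalised norm 0.\<close>

definition sobolev_S4 :: "'a::euclidean_space set \<Rightarrow> real" where
  "sobolev_S4 \<Omega> = (LEAST S. \<forall>u \<in> H01 \<Omega>. u \<in> Lp 4 \<Omega> \<and>
     Lp_norm 4 \<Omega> u \<le> S * sqrt (LINT x|lebesgue_on \<Omega>. (norm (weak_gradient \<Omega> u x))\<^sup>2))"


subsection \<open>The system and its energy\<close>

definition weak_solution ::
  "real \<Rightarrow> real \<Rightarrow> real \<Rightarrow> real \<Rightarrow> real \<Rightarrow> 'a::euclidean_space set \<Rightarrow> ('a \<Rightarrow> real) \<Rightarrow> ('a \<Rightarrow> real) \<Rightarrow>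
   ('a \<Rightarrow> real) \<Rightarrow> ('a \<Rightarrow> real) \<Rightarrow> bool" where
  "weak_solution l1 l2 \<mu>1 \<mu>2 \<beta> \<Omega> f g u v \<longleftrightarrow> u \<in> H01 \<Omega> \<and> v \<in> H01 \<Omega> \<and>
     (\<forall>\<phi> \<in> H01 \<Omega>. \<forall>\<psi> \<in> H01 \<Omega>.
        (LINT x|lebesgue_on \<Omega>.
            weak_gradient \<Omega> u x \<bullet> weak_gradient \<Omega> \<phi> x + weak_gradient \<Omega> v x \<bullet> weak_gradient \<Omega> \<psi> x
          + l1 * u x * \<phi> x + l2 * v x * \<psi> x
          - \<mu>1 * u x ^ 3 * \<phi> x - \<mu>2 * v x ^ 3 * \<psi> x
          - \<beta> * u x * (v x)\<^sup>2 * \<phi> x - \<beta> * (u x)\<^sup>2 * v x * \<psi> x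
          - f x * \<phi> x - g x * \<psi> x) = 0)"

definition H_norm ::
  "real \<Rightarrow> real \<Rightarrow> 'a::euclidean_space set \<Rightarrow> ('a \<Rightarrow> real) \<Rightarrow> ('a \<Rightarrow> real) \<Rightarrow> real" where
  "H_norm l1 l2 \<Omega> u v =
     sqrt ((LINT x|lebesgue_on \<Omega>. (norm (weak_gradient \<Omega> u x))\<^sup>2 + l1 * (u x)\<^sup>2)
         + (LINT x|lebesgue_on \<Omega>. (norm (weak_gradient \<Omega> v x))\<^sup>2 + l2 * (v x)\<^sup>2))"

definition energy ::
  "real \<Rightarrow> real \<Rightarrow> real \<Rightarrow> real \<Rightarrow> real \<Rightarrow> 'a::euclidean_space set \<Rightarrow> ('a \<Rightarrow> real) \<Rightarrow> ('a \<Rightarrow> real) \<Rightarrow>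
   ('a \<Rightarrow> real) \<Rightarrow> ('a \<Rightarrow> real) \<Rightarrow> real" where
  "energy l1 l2 \<mu>1 \<mu>2 \<beta> \<Omega> f g u v =
     1/2 * (H_norm l1 l2 \<Omega> u v)\<^sup>2
     - 1/4 * (\<mu>1 * Lp_norm 4 \<Omega> u ^ 4 + \<mu>2 * Lp_norm 4 \<Omega> v ^ 4
              + 2 * \<beta> * (LINT x|lebesgue_on \<Omega>. (u x)\<^sup>2 * (v x)\<^sup>2))
     - (LINT x|lebesgue_on \<Omega>. f x * u x + g x * v x)"

definition nontrivial_solution ::
  "real \<Rightarrow> real \<Rightarrow> real \<Rightarrow> real \<Rightarrow> real \<Rightarrow> 'a::euclidean_space set \<Rightarrow> ('a \<Rightarrow> real) \<Rightarrow> ('a \<Rightarrow> real) \<Rightarrow>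
   ('a \<Rightarrow> real) \<Rightarrow> ('a \<Rightarrow> real) \<Rightarrow> bool" where
  "nontrivial_solution l1 l2 \<mu>1 \<mu>2 \<beta> \<Omega> f g u v \<longleftrightarrow>
     weak_solution l1 l2 \<mu>1 \<mu>2 \<beta> \<Omega> f g u v \<and> nonzero_on \<Omega> u \<and> nonzero_on \<Omega> v"

definition positive_ground_state ::
  "real \<Rightarrow> real \<Rightarrow> real \<Rightarrow> real \<Rightarrow> real \<Rightarrow> 'a::euclidean_space set \<Rightarrow> ('a \<Rightarrow> real) \<Rightarrow> ('a \<Rightarrow> real) \<Rightarrow>
   ('a \<Rightarrow> real) \<Rightarrow> ('a \<Rightarrow> real) \<Rightarrow> bool" where
  "positive_ground_state l1 l2 \<mu>1 \<mu>2 \<beta> \<Omega> f g u v \<longleftrightarrow>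
     weak_solution l1 l2 \<mu>1 \<mu>2 \<beta> \<Omega> f g u v \<and> positive_on \<Omega> u \<and> positive_on \<Omega> v \<and>
     (\<forall>w z. weak_solution l1 l2 \<mu>1 \<mu>2 \<beta> \<Omega> f g w z \<and> (nonzero_on \<Omega> w \<or> nonzero_on \<Omega> z) \<longrightarrow>
        energy l1 l2 \<mu>1 \<mu>2 \<beta> \<Omega> f g u v \<le> energy l1 l2 \<mu>1 \<mu>2 \<beta> \<Omega> f g w z)"

text \<open>Integrals are totalised, so \<^const>\<open>energy\<close> is always a real number; finiteness of the energy is
  the integrability of every integrand in it. The quadratic terms are integrable for every pair
  in \<open>H\<close> by the definition of \<^const>\<open>H1\<close>.\<close>

definition finite_energy ::
  "'a::euclidean_space set \<Rightarrow> ('a \<Rightarrow> real) \<Rightarrow> ('a \<Rightarrow> real) \<Rightarrow> ('a \<Rightarrow> real) \<Rightarrow> ('a \<Rightarrow> real) \<Rightarrow> bool" where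
  "finite_energy \<Omega> f g u v \<longleftrightarrow> u \<in> H1 \<Omega> \<and> v \<in> H1 \<Omega> \<and> u \<in> Lp 4 \<Omega> \<and> v \<in> Lp 4 \<Omega> \<and>
     integrable (lebesgue_on \<Omega>) (\<lambda>x. (u x)\<^sup>2 * (v x)\<^sup>2) \<and>
     integrable (lebesgue_on \<Omega>) (\<lambda>x. f x * u x + g x * v x)"

definition positive_bound_state ::
  "real \<Rightarrow> real \<Rightarrow> real \<Rightarrow> real \<Rightarrow> real \<Rightarrow> 'a::euclidean_space set \<Rightarrow> ('a \<Rightarrow> real) \<Rightarrow> ('a \<Rightarrow> real) \<Rightarrow>
   ('a \<Rightarrow> real) \<Rightarrow> ('a \<Rightarrow> real) \<Rightarrow> bool" where
  "positive_bound_state l1 l2 \<mu>1 \<mu>2 \<beta> \<Omega> f g u v \<longleftrightarrow>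
     weak_solution l1 l2 \<mu>1 \<mu>2 \<beta> \<Omega> f g u v \<and> finite_energy \<Omega> f g u v \<and>
     positive_on \<Omega> u \<and> positive_on \<Omega> v"

definition distinct_pairs ::
  "'a::euclidean_space set \<Rightarrow> ('a \<Rightarrow> real) \<Rightarrow> ('a \<Rightarrow> real) \<Rightarrow> ('a \<Rightarrow> real) \<Rightarrow> ('a \<Rightarrow> real) \<Rightarrow> bool" where
  "distinct_pairs \<Omega> u v w z \<longleftrightarrow> \<not> (AE x in lebesgue_on \<Omega>. u x = w x \<and> v x = z x)"

definition two_nontrivial_solutions ::
  "real \<Rightarrow> real \<Rightarrow> real \<Rightarrow> real \<Rightarrow> real \<Rightarrow> 'a::euclidean_space set \<Rightarrow> ('a \<Rightarrow> real) \<Rightarrow> ('a \<Rightarrow> real) \<Rightarrow> bool" where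
  "two_nontrivial_solutions l1 l2 \<mu>1 \<mu>2 \<beta> \<Omega> f g \<longleftrightarrow>
     (\<exists>u v w z. nontrivial_solution l1 l2 \<mu>1 \<mu>2 \<beta> \<Omega> f g u v \<and>
        nontrivial_solution l1 l2 \<mu>1 \<mu>2 \<beta> \<Omega> f g w z \<and> distinct_pairs \<Omega> u v w z)"

definition positive_ground_and_bound_states ::
  "real \<Rightarrow> real \<Rightarrow> real \<Rightarrow> real \<Rightarrow> real \<Rightarrow> 'a::euclidean_space set \<Rightarrow> ('a \<Rightarrow> real) \<Rightarrow> ('a \<Rightarrow> real) \<Rightarrow> bool" where
  "positive_ground_and_bound_states l1 l2 \<mu>1 \<mu>2 \<beta> \<Omega> f g \<longleftrightarrow>
     (\<exists>u v w z. positive_ground_state l1 l2 \<mu>1 \<mu>2 \<beta> \<Omega> f g u v \<and>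
        positive_bound_state l1 l2 \<mu>1 \<mu>2 \<beta> \<Omega> f g w z \<and> distinct_pairs \<Omega> u v w z)"

end

theory Submission
  imports Defs "HOL-Real_Asymp.Real_Asymp" "HOL-Complex_Analysis.Great_Picard" "HOL-Library.Function_Algebras"
begin

text \<open>
  For \<open>N \<le> 3\<close> the embedding of \<open>H\<^sub>0\<^sup>1\<close> into \<open>L\<^sup>4\<close> is compact; this follows from the bound
  \<open>\<parallel>M\<^sub>e \<phi> - \<phi>\<parallel>\<^sub>4\<^sup>4 \<le> C e\<^sup>4\<^sup>-\<^sup>N \<parallel>\<nabla>\<phi>\<parallel>\<^sub>2\<^sup>4\<close> for the means \<open>M\<^sub>e \<phi>\<close> of a test function over balls of radius \<open>e\<close>.
  If \<open>f\<close> and \<open>g\<close> are small, there is a radius \<open>\<rho>\<close> such that \<open>J\<close> is positive on the sphere of radius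
  \<open>\<rho>\<close> in \<open>H\<close>, while every solution outside the ball has positive energy. As \<open>J 0 = 0\<close>, a
  minimiser \<open>z\<^sub>0\<close> of \<open>J\<close> over the ball is a solution of least energy.

  For the second solution write \<open>J (z\<^sub>0 + w) = J z\<^sub>0 + a w / 2 - b w / 3 - c w / 4\<close> with \<open>a\<close>, \<open>b\<close>, \<open>c\<close>
  homogeneous of degree 2, 3, 4. As \<open>z\<^sub>0\<close> is small, \<open>a\<close> is coercive, so every ray meets the Nehari
  set \<open>{w \<noteq> 0. a w = b w + c w}\<close> in exactly one point, where the right-hand side is maximal along the
  ray. A minimiser over this set exists by compactness and is a further critical point.

  Passing to absolute values does not increase the Dirichlet integrals and does not decrease the
  other terms if \<open>f, g \<ge> 0\<close>, so both minimisers can then be chosen nonnegative. No component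
  vanishes, since otherwise the corresponding equation would read \<open>0 = f\<close> or \<open>0 = g\<close>.
\<close>

section \<open>Minimising quartic functionals\<close>

text \<open>Palais-Smale sequences and Lagrange multipliers are avoided. By compactness in
  \<open>L^4\<close> a bounded minimising sequence has a subsequence along which \<open>T\<close>
  and \<open>L\<close> converge, while \<open>E\<close> can only drop in the limit. The limit may
  thereby leave the Nehari set, but rescaling brings it back without raising the value. Criticality
  is then tested on one-parameter variations, each pushed back onto the set by the explicit root of
  a quadratic.

  One inequality, \<open>6 * K * S ^ 4 * \<rho>\<^sup>2 \<le> 1\<close>, fixes the radius. On the
  sphere it gives \<open>T z z z z \<le> E z z / 6\<close>, and for \<open>z0\<close> in the ball it
  gives \<open>3 * T z0 z0 w w \<le> E w w / 2\<close>, so the quadratic part at \<open>z0\<close>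
  stays coercive. The size of the data enters only through \<open>4 * \<eta> < \<rho>\<close>.

  Both minimisations carry a map \<open>m\<close>, the identity for general data and the passage to
  absolute values for nonnegative data. It acts on \<open>z0\<close> and on the increment
  separately, so that the second solution is a sum of nonnegative functions and the expansion around
  \<open>z0\<close> remains usable.\<close>

lemma minimising_sequence:
  fixes F :: "'a \<Rightarrow> real"
  assumes "A \<noteq> {}" "bdd_below (F ` A)"
  obtains z where "\<And>n::nat. z n \<in> A" "\<And>n. F (z n) < Inf (F ` A) + inverse (real (Suc n))"
    "(\<lambda>n. F (z n)) \<longlonglongrightarrow> Inf (F ` A)"
proof -
  let ?i = "Inf (F ` A)"
  have "\<exists>z. z \<in> A \<and> F z < ?i + inverse (real (Suc n))" for n
  proof -
    have "\<exists>y \<in> F ` A. y < ?i + inverse (real (Suc n))"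
      using assms(1) by (intro cInf_lessD) auto
    then show ?thesis by blast
  qed
  then obtain z where z: "\<And>n. z n \<in> A" "\<And>n. F (z n) < ?i + inverse (real (Suc n))"
    by metis
  have "(\<lambda>n. F (z n)) \<longlonglongrightarrow> ?i"
  proof (rule tendsto_sandwich[OF _ _ tendsto_const])
    show "(\<lambda>n. ?i + inverse (real (Suc n))) \<longlonglongrightarrow> ?i"
      using tendsto_add[OF tendsto_const LIMSEQ_inverse_real_of_nat, of ?i] by simp
    show "\<forall>\<^sub>F n in sequentially. ?i \<le> F (z n)"
      using z(1) assms(2) by (intro always_eventually allI cInf_lower) auto
    show "\<forall>\<^sub>F n in sequentially. F (z n) \<le> ?i + inverse (real (Suc n))"
      using less_imp_le[OF z(2)] by (intro always_eventually allI)
  qed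
  then show ?thesis using that z by blast
qed

text \<open>After the substitution \<open>b = a - c\<close> the difference of the two sides is
  \<open>(1 - t)\<^sup>2\<close> times a nonnegative factor. Eliminating \<open>b\<close> lets it
  have either sign, as the cubic form around a solution does.\<close>

lemma nehari_maximum:
  fixes a b c t :: real
  assumes "a = b + c" "0 \<le> a" "0 \<le> c" "0 \<le> t"
  shows "t\<^sup>2 * a / 2 - t^3 * b / 3 - t^4 * c / 4 \<le> a / 2 - b / 3 - c / 4"
proof -
  have "(a / 2 - b / 3 - c / 4) - (t\<^sup>2 * a / 2 - t^3 * b / 3 - t^4 * c / 4)
      = a * ((1 - t)\<^sup>2 * (1 + 2 * t)) / 6 + c * ((1 - t)\<^sup>2 * (1 + 2 * t + 3 * t\<^sup>2)) / 12"
    unfolding assms(1) by (simp add: field_simps power2_eq_square power3_eq_cube power4_eq_xxxx)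
  moreover have "0 \<le> a * ((1 - t)\<^sup>2 * (1 + 2 * t)) / 6" "0 \<le> c * ((1 - t)\<^sup>2 * (1 + 2 * t + 3 * t\<^sup>2)) / 12"
    using assms by simp_all
  ultimately show ?thesis by linarith
qed

text \<open>For positive \<open>a\<close> and \<open>c\<close>, the positive solution t of
  \<open>a = t * b + t\<^sup>2 * c\<close>, which is the critical point equation of
  \<open>t\<^sup>2 * a / 2 - t^3 * b / 3 - t^4 * c / 4\<close> divided by t. The closed formula
  makes its differentiability in \<open>a\<close>, \<open>b\<close>, \<open>c\<close>
  visible.\<close>

definition nehari_root :: "real \<Rightarrow> real \<Rightarrow> real \<Rightarrow> real" where
  "nehari_root a b c = (sqrt (b\<^sup>2 + 4 * a * c) - b) / (2 * c)"

lemma nehari_root: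
  assumes "0 < a" "0 < c"
  shows "0 < nehari_root a b c" "a = nehari_root a b c * b + (nehari_root a b c)\<^sup>2 * c"
proof -
  let ?d = "sqrt (b\<^sup>2 + 4 * a * c)"
  have pos: "b\<^sup>2 < b\<^sup>2 + 4 * a * c"
    using assms by simp
  have "\<bar>b\<bar> < ?d"
    using real_sqrt_less_mono[OF pos] by simp
  then show "0 < nehari_root a b c"
    using assms unfolding nehari_root_def by (auto intro!: divide_pos_pos)
  have sq: "?d\<^sup>2 = b\<^sup>2 + 4 * a * c"
    using pos by (intro real_sqrt_pow2) (smt (verit) zero_le_power2)
  have r: "2 * c * nehari_root a b c = ?d - b"
    using assms unfolding nehari_root_def by simp
  have "4 * c * (nehari_root a b c * b + (nehari_root a b c)\<^sup>2 * c)
      = 2 * b * (2 * c * nehari_root a b c) + (2 * c * nehari_root a b c)\<^sup>2"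
    by (simp add: power2_eq_square algebra_simps)
  also have "\<dots> = 4 * c * a"
    unfolding r using sq by (simp add: power2_eq_square algebra_simps)
  finally show "a = nehari_root a b c * b + (nehari_root a b c)\<^sup>2 * c"
    using assms by simp
qed

text \<open>By the envelope theorem the derivative of \<open>s \<mapsto> max\<^sub>t \<phi>(s, t)\<close> at \<open>s = 0\<close> is
  \<open>\<partial>\<^sub>s \<phi>(0, 1)\<close>, as the maximum over \<open>t\<close> at \<open>s = 0\<close> is attained at \<open>t = 1\<close>.\<close>

lemma nehari_minimum_derivative:
  fixes a b c :: "real \<Rightarrow> real"
  assumes a: "(a has_real_derivative a') (at 0)" and b: "(b has_real_derivative b') (at 0)"
    and c: "(c has_real_derivative c') (at 0)"
    and pos: "0 < a 0" "0 < c 0" and crit: "a 0 = b 0 + c 0"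
    and min: "\<And>s t. 0 < t \<Longrightarrow> 0 < a s \<Longrightarrow> 0 < c s \<Longrightarrow> a s = t * b s + t\<^sup>2 * c s \<Longrightarrow>
      a 0 / 2 - b 0 / 3 - c 0 / 4 \<le> t\<^sup>2 * a s / 2 - t^3 * b s / 3 - t^4 * c s / 4"
  shows "a' / 2 - b' / 3 - c' / 4 = 0"
proof -
  define r where "r s = nehari_root (a s) (b s) (c s)" for s
  have disc: "0 < (b 0)\<^sup>2 + 4 * a 0 * c 0"
    using pos by (smt (verit) mult_pos_pos zero_le_power2)
  \<comment> \<open>By \<open>a 0 = b 0 + c 0\<close> the discriminant is a perfect square, so the
    root at \<open>s = 0\<close> is 1.\<close>
  have "sqrt ((b 0)\<^sup>2 + 4 * a 0 * c 0) = b 0 + 2 * c 0"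
  proof (rule real_sqrt_unique)
    show "(b 0 + 2 * c 0)\<^sup>2 = (b 0)\<^sup>2 + 4 * a 0 * c 0"
      using crit by (simp add: power2_eq_square algebra_simps)
    show "0 \<le> b 0 + 2 * c 0"
      using crit pos by linarith
  qed
  then have r0: "r 0 = 1"
    using pos unfolding r_def nehari_root_def by simp
  have "\<exists>r'. (r has_real_derivative r') (at 0)"
    unfolding r_def nehari_root_def using disc pos
    by (intro exI) (rule derivative_eq_intros a b c refl | simp)+
  then obtain r' where r': "(r has_real_derivative r') (at 0)" ..
  define \<psi> where "\<psi> s = (r s)\<^sup>2 * a s / 2 - r s ^ 3 * b s / 3 - r s ^ 4 * c s / 4" for s
  have "(\<psi> has_real_derivative
      ((2 * r') * a 0 + a') / 2 - ((3 * r') * b 0 + b') / 3 - ((4 * r') * c 0 + c') / 4) (at 0)"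
    unfolding \<psi>_def
    by (rule derivative_eq_intros r' a b c refl | simp add: r0 field_simps)+
  \<comment> \<open>The derivative of \<open>r\<close> appears with the factor
    \<open>a 0 - b 0 - c 0\<close>, which is 0.\<close>
  then have "(\<psi> has_real_derivative (a' / 2 - b' / 3 - c' / 4) + r' * (a 0 - b 0 - c 0)) (at 0)"
    by (rule DERIV_cong) (simp add: field_simps)
  then have D: "(\<psi> has_real_derivative (a' / 2 - b' / 3 - c' / 4)) (at 0)"
    using crit by simp
  have ev: "\<forall>\<^sub>F s in at 0. 0 < a s \<and> 0 < c s"
    using order_tendstoD(1)[OF isContD[OF DERIV_isCont[OF a]] pos(1)]
      order_tendstoD(1)[OF isContD[OF DERIV_isCont[OF c]] pos(2)] by eventually_elim simp
  then obtain d where d: "0 < d" "\<And>s. s \<noteq> 0 \<Longrightarrow> \<bar>s\<bar> < d \<Longrightarrow> 0 < a s \<and> 0 < c s"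
    unfolding eventually_at by (auto simp: dist_real_def)
  have "\<psi> 0 \<le> \<psi> s" if "\<bar>s\<bar> < d" for s
  proof -
    have s: "0 < a s" "0 < c s"
      using d(2)[of s] that pos by (cases "s = 0"; auto)+
    show ?thesis
      using min[OF nehari_root(1)[OF s] s nehari_root(2)[OF s]] r0
      unfolding \<psi>_def r_def[symmetric] by simp
  qed
  then show ?thesis
    using DERIV_local_min[OF D d(1)] by simp
qed

text \<open>In the application \<open>V\<close> consists of pairs of functions, \<open>E\<close> is
  the inner product, \<open>T\<close> the polarised quartic part, \<open>L\<close> the pairing with
  the data and \<open>q\<close> the sum of the \<open>L^4\<close> norms. Two bounds on
  \<open>L\<close> are kept apart: \<open>C\<close> gives continuity for convergence in
  \<open>q\<close>, and \<open>\<eta>\<close> measures the data against the energy norm. The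
  assumption \<open>compact\<close> returns a limit in \<open>q\<close> and also the limit
  \<open>e\<close> of the energies, which may exceed the energy of the limit. In \<open>m_T2\<close>
  and \<open>m_T3\<close> the slots of the first solution already carry \<open>m\<close>, because
  that solution has the form \<open>m x\<close>.\<close>

locale quartic_energy =
  fixes V :: "'v::real_vector set"
    and E :: "'v \<Rightarrow> 'v \<Rightarrow> real"
    and T :: "'v \<Rightarrow> 'v \<Rightarrow> 'v \<Rightarrow> 'v \<Rightarrow> real"
    and L :: "'v \<Rightarrow> real"
    and q :: "'v \<Rightarrow> real"
    and m :: "'v \<Rightarrow> 'v"
    and K k S \<eta> \<rho> C :: real
  assumes V: "subspace V"
    and E_add: "\<lbrakk>x \<in> V; y \<in> V; z \<in> V\<rbrakk> \<Longrightarrow> E (x + y) z = E x z + E y z"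
    and E_scale: "\<lbrakk>x \<in> V; z \<in> V\<rbrakk> \<Longrightarrow> E (r *\<^sub>R x) z = r * E x z"
    and E_sym: "\<lbrakk>x \<in> V; z \<in> V\<rbrakk> \<Longrightarrow> E x z = E z x"
    and E_nonneg: "x \<in> V \<Longrightarrow> 0 \<le> E x x"
    and T_add: "\<lbrakk>x \<in> V; y \<in> V; a \<in> V; b \<in> V; c \<in> V\<rbrakk> \<Longrightarrow> T (x + y) a b c = T x a b c + T y a b c"
    and T_scale: "\<lbrakk>x \<in> V; a \<in> V; b \<in> V; c \<in> V\<rbrakk> \<Longrightarrow> T (r *\<^sub>R x) a b c = r * T x a b c"
    and T_sym12: "\<lbrakk>x \<in> V; a \<in> V; b \<in> V; c \<in> V\<rbrakk> \<Longrightarrow> T x a b c = T a x b c"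
    and T_sym23: "\<lbrakk>x \<in> V; a \<in> V; b \<in> V; c \<in> V\<rbrakk> \<Longrightarrow> T x a b c = T x b a c"
    and T_sym34: "\<lbrakk>x \<in> V; a \<in> V; b \<in> V; c \<in> V\<rbrakk> \<Longrightarrow> T x a b c = T x a c b"
    and L_add: "\<lbrakk>x \<in> V; y \<in> V\<rbrakk> \<Longrightarrow> L (x + y) = L x + L y"
    and L_scale: "x \<in> V \<Longrightarrow> L (r *\<^sub>R x) = r * L x"
    and q_nonneg: "x \<in> V \<Longrightarrow> 0 \<le> q x"
    and T_bound: "\<lbrakk>x \<in> V; a \<in> V; b \<in> V; c \<in> V\<rbrakk> \<Longrightarrow> \<bar>T x a b c\<bar> \<le> K * (q x * q a * q b * q c)"
    and T_lower: "x \<in> V \<Longrightarrow> k * q x ^ 4 \<le> T x x x x"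
    and q_bound: "x \<in> V \<Longrightarrow> q x \<le> S * sqrt (E x x)"
    and L_q: "x \<in> V \<Longrightarrow> \<bar>L x\<bar> \<le> C * q x"
    and L_E: "x \<in> V \<Longrightarrow> \<bar>L x\<bar> \<le> \<eta> * sqrt (E x x)"
    and constants: "0 < K" "0 < k" "0 < S" "0 < \<rho>" "4 * \<eta> < \<rho>" "6 * K * S ^ 4 * \<rho>\<^sup>2 \<le> 1"
    and compact: "\<And>z M. \<lbrakk>\<And>n. z n \<in> V; \<And>n. E (z n) (z n) \<le> M\<rbrakk> \<Longrightarrow>
      \<exists>r z0 e. strict_mono (r :: nat \<Rightarrow> nat) \<and> z0 \<in> V \<and> (\<lambda>n. q (z (r n) - z0)) \<longlonglongrightarrow> 0 \<and>
        (\<lambda>n. E (z (r n)) (z (r n))) \<longlonglongrightarrow> e \<and> E z0 z0 \<le> e"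
    and nontrivial: "\<exists>w \<in> V. 0 < q w"
    and m_V: "x \<in> V \<Longrightarrow> m x \<in> V"
    and m_E: "x \<in> V \<Longrightarrow> E (m x) (m x) \<le> E x x"
    and m_T4: "x \<in> V \<Longrightarrow> T x x x x \<le> T (m x) (m x) (m x) (m x)"
    and m_T2: "\<lbrakk>x \<in> V; y \<in> V\<rbrakk> \<Longrightarrow> T (m x) (m x) y y \<le> T (m x) (m x) (m y) (m y)"
    and m_T3: "\<lbrakk>x \<in> V; y \<in> V\<rbrakk> \<Longrightarrow> T (m x) y y y \<le> T (m x) (m y) (m y) (m y)"
    and m_L: "x \<in> V \<Longrightarrow> L x \<le> L (m x)"
begin

section \<open>Polynomial expansion and continuity of the functional\<close>

definition J :: "'v \<Rightarrow> real" where
  "J z = E z z / 2 - T z z z z / 4 - L z"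

definition DJ :: "'v \<Rightarrow> 'v \<Rightarrow> real" where
  "DJ z h = E z h - T z z z h - L h"

lemma V_simps [simp]: "0 \<in> V" "x \<in> V \<Longrightarrow> y \<in> V \<Longrightarrow> x + y \<in> V" "x \<in> V \<Longrightarrow> r *\<^sub>R x \<in> V"
  "x \<in> V \<Longrightarrow> y \<in> V \<Longrightarrow> x - y \<in> V"
  using V by (auto simp: subspace_0 subspace_add subspace_scale subspace_diff)

lemma E_add2: "\<lbrakk>x \<in> V; y \<in> V; z \<in> V\<rbrakk> \<Longrightarrow> E z (x + y) = E z x + E z y"
  and E_scale2: "\<lbrakk>x \<in> V; z \<in> V\<rbrakk> \<Longrightarrow> E z (r *\<^sub>R x) = r * E z x"
  using E_add E_scale E_sym by simp_all

lemma T_add2: "\<lbrakk>x \<in> V; y \<in> V; a \<in> V; b \<in> V; c \<in> V\<rbrakk> \<Longrightarrow> T a (x + y) b c = T a x b c + T a y b c"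
  and T_scale2: "\<lbrakk>x \<in> V; a \<in> V; b \<in> V; c \<in> V\<rbrakk> \<Longrightarrow> T a (r *\<^sub>R x) b c = r * T a x b c"
  using T_add T_scale T_sym12 by simp_all

lemma T_add3: "\<lbrakk>x \<in> V; y \<in> V; a \<in> V; b \<in> V; c \<in> V\<rbrakk> \<Longrightarrow> T a b (x + y) c = T a b x c + T a b y c"
  and T_scale3: "\<lbrakk>x \<in> V; a \<in> V; b \<in> V; c \<in> V\<rbrakk> \<Longrightarrow> T a b (r *\<^sub>R x) c = r * T a b x c"
  using T_add2 T_scale2 T_sym23 by simp_all

lemma T_add4: "\<lbrakk>x \<in> V; y \<in> V; a \<in> V; b \<in> V; c \<in> V\<rbrakk> \<Longrightarrow> T a b c (x + y) = T a b c x + T a b c y"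
  and T_scale4: "\<lbrakk>x \<in> V; a \<in> V; b \<in> V; c \<in> V\<rbrakk> \<Longrightarrow> T a b c (r *\<^sub>R x) = r * T a b c x"
  using T_add3 T_scale3 T_sym34 by simp_all

lemmas multilinear = E_add E_add2 E_scale E_scale2 T_add T_add2 T_add3 T_add4
  T_scale T_scale2 T_scale3 T_scale4 L_add L_scale

lemma T_perm:
  assumes "x \<in> V" "y \<in> V"
  shows "T x x y x = T x x x y" "T x y x x = T x x x y" "T y x x x = T x x x y"
    "T x y x y = T x x y y" "T x y y x = T x x y y" "T y x x y = T x x y y"
    "T y x y x = T x x y y" "T y y x x = T x x y y"
    "T y x y y = T x y y y" "T y y x y = T x y y y" "T y y y x = T x y y y"
  using assms T_sym12 T_sym23 T_sym34 by metis+

lemma J_0: "J 0 = 0"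
  using E_scale[of 0 0 0] T_scale[of 0 0 0 0 0] L_scale[of 0 0] by (simp add: J_def)

lemma E_square_add:
  assumes "z \<in> V" "h \<in> V"
  shows "E (z + h) (z + h) = E z z + 2 * E z h + E h h"
  using assms E_sym[of h z] by (simp add: E_add E_add2)

lemma T4_add:
  assumes "z \<in> V" "h \<in> V"
  shows "T (z + h) (z + h) (z + h) (z + h)
    = T z z z z + 4 * T z z z h + 6 * T z z h h + 4 * T z h h h + T h h h h"
proof -
  have "T (z + h) (z + h) (z + h) (z + h)
    = T z z (z + h) (z + h) + T z h (z + h) (z + h) + (T h z (z + h) (z + h) + T h h (z + h) (z + h))"
    using assms by (simp only: T_add T_add2 V_simps)
  also have "\<dots> = T z z z z + 4 * T z z z h + 6 * T z z h h + 4 * T z h h h + T h h h h"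
    using assms by (simp only: T_add3 T_add4 V_simps T_perm[OF assms])
  finally show ?thesis .
qed

text \<open>\<open>J\<close> is a polynomial of degree four on every line, so the expansion is
  exact. The coefficients 3/2 and 1 are the binomial coefficients 6 and 4 divided by the 4 in
  \<open>J\<close>.\<close>

lemma J_add:
  assumes "z \<in> V" "h \<in> V"
  shows "J (z + h) = J z + DJ z h + (E h h - 3 * T z z h h) / 2 - T z h h h - T h h h h / 4"
  unfolding J_def DJ_def E_square_add[OF assms] T4_add[OF assms] L_add[OF assms]
  by (simp add: field_simps)

lemma J_derivative:
  assumes "z \<in> V" "h \<in> V"
  shows "((\<lambda>s. J (z + s *\<^sub>R h)) has_real_derivative DJ z h) (at 0)"
proof -
  have "J (z + s *\<^sub>R h) = J z + s * DJ z h + s\<^sup>2 * (E h h - 3 * T z z h h) / 2 - s^3 * T z h h h - s^4 * T h h h h / 4" for s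
    unfolding J_add[OF assms(1) V_simps(3)[OF assms(2)]]
    using assms by (simp add: DJ_def E_scale E_scale2 T_scale T_scale2 T_scale3 T_scale4 L_scale
      power2_eq_square power3_eq_cube power4_eq_xxxx algebra_simps)
  then show ?thesis
    by (simp only:) (rule derivative_eq_intros refl | simp)+
qed

lemma T_diff: "\<lbrakk>x \<in> V; y \<in> V; a \<in> V; b \<in> V; c \<in> V\<rbrakk> \<Longrightarrow> T (x - y) a b c = T x a b c - T y a b c"
  using T_add[of "x - y" y a b c] by simp

lemma L_diff: "\<lbrakk>x \<in> V; y \<in> V\<rbrakk> \<Longrightarrow> L (x - y) = L x - L y"
  using L_add[of "x - y" y] by simp

lemma L_tendsto:
  assumes "\<And>n. z n \<in> V" "z0 \<in> V" "(\<lambda>n. q (z n - z0)) \<longlonglongrightarrow> 0"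
  shows "(\<lambda>n. L (z n)) \<longlonglongrightarrow> L z0"
proof -
  have "(\<lambda>n. L (z n) - L z0) \<longlonglongrightarrow> 0"
  proof (rule Lim_null_comparison)
    show "\<forall>\<^sub>F n in sequentially. norm (L (z n) - L z0) \<le> C * q (z n - z0)"
      using L_q assms by (auto simp flip: L_diff)
    show "(\<lambda>n. C * q (z n - z0)) \<longlonglongrightarrow> 0"
      using tendsto_mult_right_zero[OF assms(3)] .
  qed
  then show ?thesis by (simp add: LIM_zero_iff)
qed

lemma T_tendsto1:
  assumes V: "\<And>n. x n \<in> V" "x0 \<in> V" "\<And>n. a n \<in> V" "\<And>n. b n \<in> V" "\<And>n. c n \<in> V"
    and B: "\<And>n. q (a n) \<le> B" "\<And>n. q (b n) \<le> B" "\<And>n. q (c n) \<le> B"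
    and lim: "(\<lambda>n. q (x n - x0)) \<longlonglongrightarrow> 0"
  shows "(\<lambda>n. T (x n) (a n) (b n) (c n) - T x0 (a n) (b n) (c n)) \<longlonglongrightarrow> 0"
proof (rule Lim_null_comparison)
  have "norm (T (x n) (a n) (b n) (c n) - T x0 (a n) (b n) (c n)) \<le> K * B^3 * q (x n - x0)" for n
  proof -
    have B0: "0 \<le> B" using q_nonneg[OF V(3)] B(1) by (rule order_trans)
    have "norm (T (x n) (a n) (b n) (c n) - T x0 (a n) (b n) (c n)) = \<bar>T (x n - x0) (a n) (b n) (c n)\<bar>"
      using V by (simp add: T_diff)
    also have "\<dots> \<le> K * (q (x n - x0) * q (a n) * q (b n) * q (c n))"
      using V by (intro T_bound) auto
    also have "\<dots> \<le> K * (q (x n - x0) * B * B * B)"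
      using V B B0 constants by (intro mult_left_mono mult_mono mult_nonneg_nonneg q_nonneg) auto
    finally show ?thesis by (simp add: power3_eq_cube mult_ac)
  qed
  then show "\<forall>\<^sub>F n in sequentially. norm (T (x n) (a n) (b n) (c n) - T x0 (a n) (b n) (c n)) \<le> K * B^3 * q (x n - x0)"
    by simp
  show "(\<lambda>n. K * B ^ 3 * q (x n - x0)) \<longlonglongrightarrow> 0"
    using tendsto_mult_right_zero[OF lim] .
qed

text \<open>The varying arguments are replaced by the limit one at a time. In each replacement the
  other slots enter only through a bound on \<open>q\<close>, so \<open>T_tendsto1\<close> applies
  while they still vary; symmetry then moves a varying argument to the front. \<open>B'\<close> also
  bounds the limit and \<open>z0\<close>.\<close>

lemma T_tendsto:
  assumes V: "\<And>n. x n \<in> V" "x0 \<in> V" "z0 \<in> V"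
    and B: "\<And>n. q (x n) \<le> B" and lim: "(\<lambda>n. q (x n - x0)) \<longlonglongrightarrow> 0"
  shows "(\<lambda>n. T (x n) (x n) (x n) (x n)) \<longlonglongrightarrow> T x0 x0 x0 x0"
    and "(\<lambda>n. T z0 (x n) (x n) (x n)) \<longlonglongrightarrow> T z0 x0 x0 x0"
    and "(\<lambda>n. T z0 z0 (x n) (x n)) \<longlonglongrightarrow> T z0 z0 x0 x0"
proof -
  define B' where "B' = max B (max (q x0) (q z0))"
  have B': "q (x n) \<le> B'" "q x0 \<le> B'" "q z0 \<le> B'" for n
    using B[of n] unfolding B'_def by auto
  note t1 = T_tendsto1[OF V(1,2) _ _ _ _ _ _ lim]
  have step: "(\<lambda>n. T (x n) (a n) (b n) (c n)) \<longlonglongrightarrow> l"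
    if "(\<lambda>n. T x0 (a n) (b n) (c n)) \<longlonglongrightarrow> l" "\<And>n. a n \<in> V" "\<And>n. b n \<in> V" "\<And>n. c n \<in> V"
      "\<And>n. q (a n) \<le> B'" "\<And>n. q (b n) \<le> B'" "\<And>n. q (c n) \<le> B'" for a b c l
    using tendsto_add[OF t1[of a b c B'] that(1)] that by simp
  have 0: "(\<lambda>n. T (x n) a b c) \<longlonglongrightarrow> T x0 a b c" if "a \<in> V" "b \<in> V" "c \<in> V" "q a \<le> B'" "q b \<le> B'" "q c \<le> B'" for a b c
    using that by (intro step) auto
  have 1: "(\<lambda>n. T (x n) (x n) b c) \<longlonglongrightarrow> T x0 x0 b c" if "b \<in> V" "c \<in> V" "q b \<le> B'" "q c \<le> B'" for b c
  proof (intro step)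
    have "T x0 (x n) b c = T (x n) x0 b c" for n
      using T_sym12 V that by blast
    then show "(\<lambda>n. T x0 (x n) b c) \<longlonglongrightarrow> T x0 x0 b c"
      using 0[of x0 b c] that B' V by simp
  qed (use that B' V in auto)
  have 2: "(\<lambda>n. T (x n) (x n) (x n) c) \<longlonglongrightarrow> T x0 x0 x0 c" if "c \<in> V" "q c \<le> B'" for c
  proof (intro step)
    have "T x0 (x n) (x n) c = T (x n) (x n) x0 c" for n
      using T_sym12[of x0 "x n" "x n" c] T_sym23[of "x n" x0 "x n" c] V that by simp
    then show "(\<lambda>n. T x0 (x n) (x n) c) \<longlonglongrightarrow> T x0 x0 x0 c"
      using 1[of x0 c] that B' V by simp
  qed (use that B' V in auto)
  have 3: "(\<lambda>n. T (x n) (x n) (x n) (x n)) \<longlonglongrightarrow> T x0 x0 x0 x0"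
  proof (intro step)
    have "T x0 (x n) (x n) (x n) = T (x n) (x n) (x n) x0" for n
      using T_perm(3)[of "x n" x0] V by simp
    then show "(\<lambda>n. T x0 (x n) (x n) (x n)) \<longlonglongrightarrow> T x0 x0 x0 x0"
      using 2[of x0] B' V by simp
  qed (use B' V in auto)
  show "(\<lambda>n. T (x n) (x n) (x n) (x n)) \<longlonglongrightarrow> T x0 x0 x0 x0"
    by (fact 3)
  show "(\<lambda>n. T z0 (x n) (x n) (x n)) \<longlonglongrightarrow> T z0 x0 x0 x0"
    using 2[OF V(3)] B' V T_perm(3)[of _ z0] by simp
  show "(\<lambda>n. T z0 z0 (x n) (x n)) \<longlonglongrightarrow> T z0 z0 x0 x0"
    using 1[OF V(3,3)] B' V T_perm(8)[of z0] by simp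
qed

lemma q_pos_if_T4_pos: "x \<in> V \<Longrightarrow> 0 < T x x x x \<Longrightarrow> 0 < q x"
  using T_bound[of x x x x] q_nonneg[of x] by (cases "q x = 0") auto

lemma T4_pos: "x \<in> V \<Longrightarrow> 0 < q x \<Longrightarrow> 0 < T x x x x"
  using T_lower[of x] constants by (smt (verit) mult_pos_pos zero_less_power)

lemma E_pos: "x \<in> V \<Longrightarrow> 0 < q x \<Longrightarrow> 0 < E x x"
  using q_bound[of x] E_nonneg[of x] constants by (cases "E x x = 0") auto

lemma q_le:
  assumes "x \<in> V" "E x x \<le> M"
  shows "q x \<le> S * sqrt M"
proof -
  have "S * sqrt (E x x) \<le> S * sqrt M"
    using assms constants by (intro mult_left_mono) auto
  then show ?thesis using q_bound[OF assms(1)] by simp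
qed

lemma q_power4:
  assumes "x \<in> V"
  shows "q x ^ 4 \<le> S ^ 4 * (E x x)\<^sup>2"
proof -
  have "q x ^ 4 \<le> (S * sqrt (E x x)) ^ 4"
    using q_bound q_nonneg assms by (intro power_mono) auto
  also have "\<dots> = S ^ 4 * ((sqrt (E x x))\<^sup>2)\<^sup>2"
    by (simp add: power_mult_distrib flip: power_mult)
  finally show ?thesis using E_nonneg[OF assms] by simp
qed

lemma T4_upper:
  assumes "x \<in> V"
  shows "T x x x x \<le> K * S ^ 4 * (E x x)\<^sup>2"
proof -
  have "T x x x x \<le> K * q x ^ 4"
    using T_bound[OF assms assms assms assms] by (simp add: power4_eq_xxxx mult_ac)
  also have "\<dots> \<le> K * (S ^ 4 * (E x x)\<^sup>2)"
    using q_power4[OF assms] constants by (intro mult_left_mono) auto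
  finally show ?thesis by (simp add: mult_ac)
qed

section \<open>A solution of least energy inside the ball\<close>

lemma J_lower:
  assumes "z \<in> V" "E z z \<le> M"
  shows "- (K * S ^ 4 * M\<^sup>2 / 4) - \<bar>\<eta>\<bar> * sqrt M \<le> J z"
proof -
  have "T z z z z \<le> K * S ^ 4 * M\<^sup>2"
  proof -
    have "K * S ^ 4 * (E z z)\<^sup>2 \<le> K * S ^ 4 * M\<^sup>2"
      using constants E_nonneg assms by (intro mult_left_mono power_mono) auto
    then show ?thesis using T4_upper[OF assms(1)] by simp
  qed
  moreover have "L z \<le> \<bar>\<eta>\<bar> * sqrt M"
  proof -
    have "\<eta> * sqrt (E z z) \<le> \<bar>\<eta>\<bar> * sqrt M"
      using assms E_nonneg by (intro mult_mono) auto
    then show ?thesis using L_E[OF assms(1)] by simp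
  qed
  ultimately show ?thesis
    using E_nonneg[OF assms(1)] unfolding J_def by simp
qed

text \<open>With \<open>T z z z z \<le> \<rho>\<^sup>2 / 6\<close> and
  \<open>L z < \<rho>\<^sup>2 / 4\<close>, the value exceeds
  \<open>(1/2 - 1/24 - 1/4) * \<rho>\<^sup>2\<close>.\<close>

lemma J_pos_on_sphere:
  assumes "z \<in> V" "E z z = \<rho>\<^sup>2"
  shows "0 < J z"
proof -
  have "T z z z z \<le> 1 / 6 * \<rho>\<^sup>2"
  proof -
    have "T z z z z \<le> K * S ^ 4 * \<rho>\<^sup>2 * \<rho>\<^sup>2"
      using T4_upper[OF assms(1)] assms(2) by (simp add: power2_eq_square mult_ac)
    also have "\<dots> \<le> 1 / 6 * \<rho>\<^sup>2"
      using constants by (intro mult_right_mono) auto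
    finally show ?thesis .
  qed
  moreover have "L z \<le> \<eta> * \<rho>"
    using L_E[OF assms(1)] assms(2) constants by simp
  moreover have "\<eta> * \<rho> < \<rho> / 4 * \<rho>"
    using constants by (intro mult_strict_right_mono) auto
  moreover have "0 < \<rho>\<^sup>2" "\<rho> / 4 * \<rho> = \<rho>\<^sup>2 / 4"
    using constants by (auto simp: power2_eq_square)
  ultimately show ?thesis
    unfolding J_def assms(2) by linarith
qed

text \<open>\<open>J\<close> is unbounded below, so far out only critical points can be controlled.
  There \<open>DJ z z = 0\<close> removes \<open>T\<close> and leaves
  \<open>E z z / 4 - 3 / 4 * L z\<close>, whose linear term is dominated because
  \<open>\<eta> < \<rho> / 4\<close>.\<close>

lemma J_pos_outside_ball:
  assumes "z \<in> V" "DJ z z = 0" "\<rho>\<^sup>2 < E z z"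
  shows "0 < J z"
proof -
  have J: "J z = E z z / 4 - 3 / 4 * L z"
    using assms(2) unfolding J_def DJ_def by simp
  have r: "\<rho> < sqrt (E z z)"
    using assms(3) constants by (simp add: real_less_rsqrt)
  have pos: "0 < E z z"
    using assms(3) by (smt (verit) zero_le_power2)
  have "L z \<le> \<eta> * sqrt (E z z)"
    using L_E[OF assms(1)] by simp
  also have "\<dots> \<le> \<rho> / 4 * sqrt (E z z)"
    using constants E_nonneg[OF assms(1)] by (intro mult_right_mono) auto
  also have "\<dots> < sqrt (E z z) / 4 * sqrt (E z z)"
    using r pos by (intro mult_strict_right_mono) auto
  also have "\<dots> = E z z / 4"
    using pos by simp
  finally show ?thesis
    using pos unfolding J by linarith
qed

text \<open>Only \<open>E\<close> can drop in the limit. The drop lowers \<open>J\<close> and keeps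
  the limit in the ball, so lower semicontinuity of \<open>E\<close> suffices.\<close>

lemma ball_minimum:
  obtains z0 where "z0 \<in> V" "E z0 z0 \<le> \<rho>\<^sup>2" "\<And>z. z \<in> V \<Longrightarrow> E z z \<le> \<rho>\<^sup>2 \<Longrightarrow> J z0 \<le> J z"
proof -
  define D where "D = {z \<in> V. E z z \<le> \<rho>\<^sup>2}"
  have ne: "D \<noteq> {}"
    unfolding D_def using E_scale[of 0 0 0] by (auto intro!: exI[of _ 0])
  have bdd: "bdd_below (J ` D)"
    unfolding D_def by (rule bdd_belowI2) (auto intro!: J_lower)
  define i where "i = Inf (J ` D)"
  obtain z where z: "\<And>n. z n \<in> D" and Jlim: "(\<lambda>n. J (z n)) \<longlonglongrightarrow> i"
    by (rule minimising_sequence[OF ne bdd, folded i_def]) (rule that)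
  have i_le: "i \<le> J w" if "w \<in> D" for w
    unfolding i_def using that bdd by (intro cInf_lower) auto
  have zV: "\<And>n. z n \<in> V" "\<And>n. E (z n) (z n) \<le> \<rho>\<^sup>2"
    using z unfolding D_def by auto
  obtain r z0 e where r: "strict_mono (r :: nat \<Rightarrow> nat)" and z0: "z0 \<in> V"
    and q0: "(\<lambda>n. q (z (r n) - z0)) \<longlonglongrightarrow> 0"
    and e: "(\<lambda>n. E (z (r n)) (z (r n))) \<longlonglongrightarrow> e" "E z0 z0 \<le> e"
    using compact[of z, OF zV] by blast
  have e\<rho>: "e \<le> \<rho>\<^sup>2"
    using zV(2) by (intro LIMSEQ_le_const2[OF e(1)]) auto
  have qb: "q (z (r n)) \<le> S * sqrt (\<rho>\<^sup>2)" for n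
    using q_le zV by blast
  have "(\<lambda>n. J (z (r n))) \<longlonglongrightarrow> e / 2 - T z0 z0 z0 z0 / 4 - L z0"
    unfolding J_def
    by (intro tendsto_intros e(1) T_tendsto(1)[OF _ z0 z0 qb q0] L_tendsto[OF _ z0 q0] zV) simp_all
  from LIMSEQ_unique[OF LIMSEQ_subseq_LIMSEQ[OF Jlim r], unfolded o_def, OF this]
  have "i = e / 2 - T z0 z0 z0 z0 / 4 - L z0" .
  then have "J z0 \<le> i"
    unfolding J_def using e(2) by simp
  then show ?thesis
    using that[of z0] z0 e(2) e\<rho> i_le unfolding D_def by fastforce
qed

lemma first_solution:
  obtains z0 where "z0 \<in> V" "E (m z0) (m z0) \<le> \<rho>\<^sup>2" "\<And>h. h \<in> V \<Longrightarrow> DJ (m z0) h = 0"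
    "\<And>z. z \<in> V \<Longrightarrow> (\<And>h. h \<in> V \<Longrightarrow> DJ z h = 0) \<Longrightarrow> J (m z0) \<le> J z"
proof -
  obtain z1 where z1: "z1 \<in> V" "E z1 z1 \<le> \<rho>\<^sup>2" "\<And>z. z \<in> V \<Longrightarrow> E z z \<le> \<rho>\<^sup>2 \<Longrightarrow> J z1 \<le> J z"
    by (rule ball_minimum) blast
  define z0 where "z0 = m z1"
  have z0: "z0 \<in> V" "E z0 z0 \<le> \<rho>\<^sup>2"
    using m_V m_E[of z1] z1 unfolding z0_def by force+
  have "J z0 \<le> J z1"
    using m_E[OF z1(1)] m_T4[OF z1(1)] m_L[OF z1(1)] unfolding J_def z0_def by linarith
  then have min: "\<And>z. z \<in> V \<Longrightarrow> E z z \<le> \<rho>\<^sup>2 \<Longrightarrow> J z0 \<le> J z"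
    using z1(3) by force
  \<comment> \<open>Comparison with 0, where \<open>J\<close> vanishes, keeps the minimiser off the
    sphere; in the open ball it can be varied in every direction.\<close>
  have J0: "J z0 \<le> 0"
    using min[of 0] J_0 E_scale[of 0 0 0] by simp
  then have "E z0 z0 \<noteq> \<rho>\<^sup>2"
    using J_pos_on_sphere[OF z0(1)] by force
  then have inner: "E z0 z0 < \<rho>\<^sup>2"
    using z0(2) by simp
  have "DJ z0 h = 0" if h: "h \<in> V" for h
  proof -
    have "((\<lambda>s. E (z0 + s *\<^sub>R h) (z0 + s *\<^sub>R h)) \<longlongrightarrow> E z0 z0 + 2 * (0 * E z0 h) + 0 * (0 * E h h)) (at 0)"
      using h z0 by (simp only: E_square_add V_simps E_scale E_scale2) (intro tendsto_intros)
    then have "\<forall>\<^sub>F s in at 0. E (z0 + s *\<^sub>R h) (z0 + s *\<^sub>R h) < \<rho>\<^sup>2"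
      using inner by (intro order_tendstoD(2)) auto
    then obtain d where d: "0 < d" "\<And>s. s \<noteq> 0 \<Longrightarrow> \<bar>s\<bar> < d \<Longrightarrow> E (z0 + s *\<^sub>R h) (z0 + s *\<^sub>R h) < \<rho>\<^sup>2"
      unfolding eventually_at by (auto simp: dist_real_def)
    have "J (z0 + 0 *\<^sub>R h) \<le> J (z0 + s *\<^sub>R h)" if "\<bar>0 - s\<bar> < d" for s
      using d(2)[of s] that min[of "z0 + s *\<^sub>R h"] z0 h by (cases "s = 0") auto
    then show ?thesis
      using DERIV_local_min[OF J_derivative[OF z0(1) h] d(1)] by blast
  qed
  \<comment> \<open>Solutions in the ball are compared by minimality, those outside by
    \<open>J z0 \<le> 0 < J z\<close>.\<close>
  moreover have "J z0 \<le> J z" if "z \<in> V" "\<And>h. h \<in> V \<Longrightarrow> DJ z h = 0" for z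
    using min[OF that(1)] J_pos_outside_ball[OF that(1) that(2)[OF that(1)]] J0 by fastforce
  ultimately show ?thesis
    using that[of z1] z1(1) z0 unfolding z0_def by blast
qed

section \<open>A second critical point on the Nehari set around the first\<close>

context
  fixes z0 :: 'v
  assumes z0: "z0 \<in> V" "E z0 z0 \<le> \<rho>\<^sup>2"
begin

text \<open>The parts of \<open>J\<close> of order two, three and four at \<open>z0\<close>, scaled
  so that for critical \<open>z0\<close> the derivative of \<open>J (z0 + t *\<^sub>R w)\<close> in
  t is \<open>t * qa w - t\<^sup>2 * qb w - t^3 * qc w\<close>.\<close>

definition qa :: "'v \<Rightarrow> real" where "qa w = E w w - 3 * T z0 z0 w w"
definition qb :: "'v \<Rightarrow> real" where "qb w = 3 * T z0 w w w"
definition qc :: "'v \<Rightarrow> real" where "qc w = T w w w w"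

text \<open>\<open>0 < q w\<close> takes the place of \<open>w \<noteq> 0\<close>: a pair of
  functions that vanish almost everywhere need not be the zero vector, yet its \<open>q\<close> is
  0.\<close>

definition nehari :: "'v set" where "nehari = {w \<in> V. 0 < q w \<and> qa w = qb w + qc w}"

text \<open>\<open>T z0 z0 w w\<close> is at most \<open>K * (q z0)\<^sup>2 * (q w)\<^sup>2\<close>,
  and \<open>q z0 \<le> S * \<rho>\<close>; the condition on \<open>\<rho>\<close> turns three times
  this into at most half of \<open>E w w\<close>.\<close>

lemma qa_lower:
  assumes "w \<in> V"
  shows "E w w / 2 \<le> qa w"
proof -
  have "(q z0 * q w)\<^sup>2 \<le> ((S * \<rho>) * (S * sqrt (E w w)))\<^sup>2"
  proof (intro power_mono mult_mono)
    show "q z0 \<le> S * \<rho>"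
      using q_le[OF z0] constants by simp
  qed (use assms z0 q_nonneg q_bound constants in auto)
  also have "\<dots> = S ^ 4 * \<rho>\<^sup>2 * E w w"
    using E_nonneg[OF assms] by (simp add: power_mult_distrib power2_eq_square power4_eq_xxxx mult_ac)
  finally have "K * (q z0 * q w)\<^sup>2 \<le> K * (S ^ 4 * \<rho>\<^sup>2 * E w w)"
    using constants by (intro mult_left_mono) auto
  moreover have "T z0 z0 w w \<le> K * (q z0 * q w)\<^sup>2"
    using T_bound[OF z0(1) z0(1) assms assms] by (simp add: power2_eq_square mult_ac)
  moreover have "6 * K * S ^ 4 * \<rho>\<^sup>2 * E w w \<le> 1 * E w w"
    using constants E_nonneg[OF assms] by (intro mult_right_mono) auto
  ultimately show ?thesis
    unfolding qa_def by (simp add: mult_ac)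
qed

lemma qa_pos: "w \<in> V \<Longrightarrow> 0 < q w \<Longrightarrow> 0 < qa w"
  using qa_lower[of w] E_pos[of w] by linarith

lemma qc_pos: "w \<in> V \<Longrightarrow> 0 < q w \<Longrightarrow> 0 < qc w"
  using T4_pos unfolding qc_def .

lemma q_scale_pos:
  assumes "w \<in> V" "0 < q w" "0 < t"
  shows "0 < q (t *\<^sub>R w)"
  using T4_pos[OF assms(1,2)] assms
  by (intro q_pos_if_T4_pos) (simp_all add: T_scale T_scale2 T_scale3 T_scale4)

lemma q_forms_scale:
  assumes "w \<in> V"
  shows "qa (t *\<^sub>R w) = t\<^sup>2 * qa w" "qb (t *\<^sub>R w) = t^3 * qb w" "qc (t *\<^sub>R w) = t^4 * qc w"
  using assms z0 unfolding qa_def qb_def qc_def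
  by (simp_all add: E_scale E_scale2 T_scale T_scale2 T_scale3 T_scale4 power2_eq_square
      power3_eq_cube power4_eq_xxxx algebra_simps)

lemma nehari_projection:
  assumes "w \<in> V" "0 < q w"
  obtains t where "0 < t" "t *\<^sub>R w \<in> nehari"
proof -
  define t where "t = nehari_root (qa w) (qb w) (qc w)"
  have t: "0 < t" "qa w = t * qb w + t\<^sup>2 * qc w"
    unfolding t_def using nehari_root[OF qa_pos[OF assms] qc_pos[OF assms]] by auto
  have "qa (t *\<^sub>R w) = qb (t *\<^sub>R w) + qc (t *\<^sub>R w)"
    unfolding q_forms_scale[OF assms(1)] t(2)
    by (simp add: power2_eq_square power3_eq_cube power4_eq_xxxx algebra_simps)
  then show ?thesis
    using that t q_scale_pos[OF assms t(1)] assms unfolding nehari_def by auto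
qed

lemma J_translate:
  assumes "\<And>h. h \<in> V \<Longrightarrow> DJ z0 h = 0" "w \<in> V"
  shows "J (z0 + w) = J z0 + (qa w / 2 - qb w / 3 - qc w / 4)"
  unfolding J_add[OF z0(1) assms(2)] qa_def qb_def qc_def using assms by simp

text \<open>Keeps minimising sequences away from 0. For \<open>r = sqrt (E w w)\<close> the
  constraint gives \<open>r\<^sup>2 / 2 \<le> qb w + qc w\<close>, and the right-hand side is of
  order three and four in \<open>r\<close>, so \<open>r\<close> cannot be small.\<close>

lemma nehari_lower_bound:
  obtains \<delta> where "0 < \<delta>" "\<And>w. w \<in> nehari \<Longrightarrow> \<delta> \<le> qa w"
proof -
  \<comment> \<open>\<open>B\<close> majorises the sum of both coefficients: for
    \<open>r < 1\<close> the inequality becomes \<open>1 / 2 \<le> B * r\<close>, which excludes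
    \<open>r < 1 / (4 * B)\<close>.\<close>
  define B where "B = 3 * K * S ^ 4 * \<rho> + K * S ^ 4 + 1"
  have B: "1 \<le> B" unfolding B_def using constants by simp
  have "min 1 (1 / (4 * B)) ^ 2 / 2 \<le> qa w" if w: "w \<in> nehari" for w
  proof -
    define r where "r = sqrt (E w w)"
    have wV: "w \<in> V" "0 < q w" and eq: "qa w = qb w + qc w"
      using w unfolding nehari_def by auto
    have r: "0 < r" "r\<^sup>2 = E w w"
      unfolding r_def using E_pos[OF wV] by auto
    have qw: "q w \<le> S * r" "q z0 \<le> S * \<rho>"
      unfolding r_def using q_bound[OF wV(1)] q_le[OF z0] constants by auto
    have "q z0 * q w * q w * q w \<le> (S * \<rho>) * (S * r) * (S * r) * (S * r)"
      using qw wV z0 q_nonneg constants r(1) by (intro mult_mono) auto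
    then have "K * (q z0 * q w * q w * q w) \<le> K * (S ^ 4 * \<rho> * r ^ 3)"
      using constants by (intro mult_left_mono) (auto simp: power4_eq_xxxx power3_eq_cube mult_ac)
    then have b: "qb w \<le> 3 * K * S ^ 4 * \<rho> * r ^ 3"
      unfolding qb_def using T_bound[OF z0(1) wV(1) wV(1) wV(1)] by (simp add: mult_ac)
    have c: "qc w \<le> K * S ^ 4 * r ^ 4"
    proof -
      have "r ^ 4 = (E w w)\<^sup>2" unfolding r(2)[symmetric] by (simp flip: power_mult)
      then show ?thesis unfolding qc_def using T4_upper[OF wV(1)] by simp
    qed
    have "r\<^sup>2 / 2 \<le> 3 * K * S ^ 4 * \<rho> * r ^ 3 + K * S ^ 4 * r ^ 4"
      using qa_lower[OF wV(1)] eq b c r(2) by linarith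
    also have "\<dots> = r\<^sup>2 * (3 * K * S ^ 4 * \<rho> * r + K * S ^ 4 * r\<^sup>2)"
      by (simp add: power2_eq_square power3_eq_cube power4_eq_xxxx algebra_simps)
    finally have *: "1 / 2 \<le> 3 * K * S ^ 4 * \<rho> * r + K * S ^ 4 * r\<^sup>2"
      using r(1) by (simp add: mult_le_cancel_left_pos[of "r\<^sup>2" "1/2", simplified])
    have "min 1 (1 / (4 * B)) \<le> r"
    proof (rule ccontr)
      assume "\<not> min 1 (1 / (4 * B)) \<le> r"
      then have r1: "r < 1" "r < 1 / (4 * B)" by auto
      have "r\<^sup>2 \<le> r" using r1(1) r(1) unfolding power2_eq_square by (simp add: mult_left_le)
      then have "K * S ^ 4 * r\<^sup>2 \<le> K * S ^ 4 * r"
        using constants by (intro mult_left_mono) auto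
      then have "1 / 2 \<le> B * r"
        using * r(1) unfolding B_def by (simp add: algebra_simps)
      moreover have "B * r < 1 / 4"
        using r1(2) B by (simp add: field_simps)
      ultimately show False by simp
    qed
    then have "(min 1 (1 / (4 * B)))\<^sup>2 \<le> r\<^sup>2"
      using B by (intro power_mono) auto
    then show ?thesis
      using qa_lower[OF wV(1)] r(2) by linarith
  qed
  then show ?thesis
    using that[of "min 1 (1 / (4 * B)) ^ 2 / 2"] B by auto
qed

text \<open>Eliminates the form \<open>qb\<close>, which has no sign. On the Nehari set the value is
  thus nonnegative and controls \<open>qa\<close>, hence \<open>E\<close>.\<close>

lemma nehari_value: "w \<in> nehari \<Longrightarrow> qa w / 2 - qb w / 3 - qc w / 4 = qa w / 6 + qc w / 12"
  unfolding nehari_def by (simp add: field_simps)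

text \<open>The limit \<open>w\<close> of a minimising sequence may violate the constraint, since
  \<open>qa w\<close> can be smaller than the limit \<open>a\<close> of the values of
  \<open>qa\<close>. The numbers \<open>a\<close>, \<open>qb w\<close>, \<open>qc w\<close> do
  satisfy it, so \<open>nehari_maximum\<close> bounds the value at every rescaling by the infimum.
  Passing from \<open>w\<close> to \<open>m w\<close> goes in the favourable direction in each of
  the three terms.\<close>

lemma nehari_minimum:
  assumes m: "\<And>w. w \<in> V \<Longrightarrow> T z0 z0 w w \<le> T z0 z0 (m w) (m w)" "\<And>w. w \<in> V \<Longrightarrow> T z0 w w w \<le> T z0 (m w) (m w) (m w)"
  obtains w t where "w \<in> V" "0 < t" "t *\<^sub>R m w \<in> nehari"
    "\<And>x. x \<in> nehari \<Longrightarrow> qa (t *\<^sub>R m w) / 2 - qb (t *\<^sub>R m w) / 3 - qc (t *\<^sub>R m w) / 4 \<le> qa x / 2 - qb x / 3 - qc x / 4"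
proof -
  define I where "I w = qa w / 2 - qb w / 3 - qc w / 4" for w
  have I: "I w = qa w / 6 + qc w / 12" if "w \<in> nehari" for w
    unfolding I_def using nehari_value[OF that] .
  have I_ge: "qa w / 6 \<le> I w" "0 \<le> I w" if "w \<in> nehari" for w
    using I[OF that] qa_pos[of w] qc_pos[of w] that unfolding nehari_def by auto
  obtain w0 where "w0 \<in> V" "0 < q w0" using nontrivial by blast
  then have ne: "nehari \<noteq> {}" using nehari_projection by blast
  have bdd: "bdd_below (I ` nehari)"
    using I_ge(2) by (rule bdd_belowI2)
  define i where "i = Inf (I ` nehari)"
  obtain z where z: "\<And>n. z n \<in> nehari" "\<And>n. I (z n) < i + inverse (real (Suc n))"
    and Ilim: "(\<lambda>n. I (z n)) \<longlonglongrightarrow> i"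
    by (rule minimising_sequence[OF ne bdd, folded i_def]) (rule that)
  have i_le: "i \<le> I w" if "w \<in> nehari" for w
    unfolding i_def using that bdd by (intro cInf_lower) auto
  have zV: "z n \<in> V" for n
    using z(1) unfolding nehari_def by auto
  \<comment> \<open>Combines \<open>qa (z n) / 6 \<le> I (z n) < i + 1\<close> with
    \<open>E \<le> 2 * qa\<close>.\<close>
  have zE: "E (z n) (z n) \<le> 12 * (i + 1)" for n
  proof -
    have "I (z n) < i + 1"
      using z(2)[of n] inverse_le_1_iff[of "real (Suc n)"] by auto
    then have "qa (z n) / 6 < i + 1"
      using I_ge(1)[OF z(1)[of n]] by simp
    then show ?thesis
      using qa_lower[OF zV[of n]] by simp
  qed
  obtain r w e where r: "strict_mono (r :: nat \<Rightarrow> nat)" and w: "w \<in> V"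
    and q0: "(\<lambda>n. q (z (r n) - w)) \<longlonglongrightarrow> 0"
    and e: "(\<lambda>n. E (z (r n)) (z (r n))) \<longlonglongrightarrow> e" "E w w \<le> e"
    using compact[of z, OF zV zE] by blast
  define a where "a = e - 3 * T z0 z0 w w"
  have q_le': "q (z (r n)) \<le> S * sqrt (12 * (i + 1))" for n
    using q_le[OF zV zE] .
  note T_lim = T_tendsto[OF zV w z0(1) q_le' q0]
  have alim: "(\<lambda>n. qa (z (r n))) \<longlonglongrightarrow> a"
    unfolding qa_def a_def by (intro tendsto_intros e(1) T_lim)
  have blim: "(\<lambda>n. qb (z (r n))) \<longlonglongrightarrow> qb w"
    unfolding qb_def by (intro tendsto_intros T_lim)
  have clim: "(\<lambda>n. qc (z (r n))) \<longlonglongrightarrow> qc w"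
    unfolding qc_def by (intro tendsto_intros T_lim)
  have "(\<lambda>n. qa (z (r n))) \<longlonglongrightarrow> qb w + qc w"
    using tendsto_add[OF blim clim] z(1) unfolding nehari_def by simp
  then have a_eq: "a = qb w + qc w"
    using alim LIMSEQ_unique by blast
  have "(\<lambda>n. I (z (r n))) \<longlonglongrightarrow> a / 2 - qb w / 3 - qc w / 4"
    unfolding I_def by (intro tendsto_intros alim blim clim) simp_all
  from LIMSEQ_unique[OF LIMSEQ_subseq_LIMSEQ[OF Ilim r], unfolded o_def, OF this]
  have i_eq: "i = a / 2 - qb w / 3 - qc w / 4" .
  obtain \<delta> where \<delta>: "0 < \<delta>" "\<And>w. w \<in> nehari \<Longrightarrow> \<delta> \<le> qa w"
    by (rule nehari_lower_bound) blast
  have a_pos: "\<delta> \<le> a"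
    using \<delta>(2)[OF z(1)] by (intro LIMSEQ_le_const[OF alim]) auto
  \<comment> \<open>Otherwise \<open>qb w\<close> and \<open>qc w\<close> vanish, hence also
    \<open>a\<close>, against the lower bound on the Nehari set.\<close>
  have "q w \<noteq> 0"
    using T_bound[OF z0(1) w w w] T_bound[OF w w w w] a_eq a_pos \<delta>(1) unfolding qb_def qc_def by auto
  then have qw: "0 < q w" using q_nonneg[OF w] by simp
  have mw: "m w \<in> V" using m_V[OF w] .
  have qmw: "0 < q (m w)"
    using m_T4[OF w] T4_pos[OF w qw] by (intro q_pos_if_T4_pos mw) simp
  obtain t where t: "0 < t" "t *\<^sub>R m w \<in> nehari"
    using nehari_projection[OF mw qmw] by blast
  have "I (t *\<^sub>R m w) = t\<^sup>2 * qa (m w) / 2 - t^3 * qb (m w) / 3 - t^4 * qc (m w) / 4"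
    unfolding I_def q_forms_scale[OF mw] by simp
  also have "\<dots> \<le> t\<^sup>2 * a / 2 - t^3 * qb w / 3 - t^4 * qc w / 4"
  proof (intro diff_mono divide_right_mono mult_left_mono)
    show "qa (m w) \<le> a"
      using m(1)[OF w] m_E[OF w] e(2) unfolding qa_def a_def by simp
    show "qb w \<le> qb (m w)"
      using m(2)[OF w] unfolding qb_def by simp
    show "qc w \<le> qc (m w)"
      using m_T4[OF w] unfolding qc_def by simp
  qed (use t in auto)
  also have "\<dots> \<le> i"
    unfolding i_eq using a_eq a_pos \<delta>(1) qc_pos[OF w qw] t(1) by (intro nehari_maximum) auto
  finally have "I (t *\<^sub>R m w) \<le> I x" if "x \<in> nehari" for x
    using i_le[OF that] by simp
  then show ?thesis
    using that[OF w t] unfolding I_def by blast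
qed

lemma qabc_derivatives:
  assumes "w \<in> V" "h \<in> V"
  shows "\<exists>a'. ((\<lambda>s. qa (w + s *\<^sub>R h)) has_real_derivative a') (at 0)"
    and "\<exists>b'. ((\<lambda>s. qb (w + s *\<^sub>R h)) has_real_derivative b') (at 0)"
    and "\<exists>c'. ((\<lambda>s. qc (w + s *\<^sub>R h)) has_real_derivative c') (at 0)"
proof -
  show "\<exists>a'. ((\<lambda>s. qa (w + s *\<^sub>R h)) has_real_derivative a') (at 0)"
    using assms z0 unfolding qa_def
    by (simp only: multilinear V_simps) (intro exI, (rule derivative_eq_intros refl)+)
  show "\<exists>b'. ((\<lambda>s. qb (w + s *\<^sub>R h)) has_real_derivative b') (at 0)"
    using assms z0 unfolding qb_def
    by (simp only: multilinear V_simps) (intro exI, (rule derivative_eq_intros refl)+)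
  show "\<exists>c'. ((\<lambda>s. qc (w + s *\<^sub>R h)) has_real_derivative c') (at 0)"
    using assms unfolding qc_def
    by (simp only: multilinear V_simps) (intro exI, (rule derivative_eq_intros refl)+)
qed

text \<open>Each variation of \<open>w\<close> is rescaled onto the Nehari set, where
  \<open>w\<close> is minimal, and \<open>nehari_minimum_derivative\<close> differentiates the
  resulting function of one variable. What it yields is the derivative of \<open>J\<close> at
  \<open>z0 + w\<close>, because \<open>J_translate\<close> also holds for increments off the Nehari
  set.\<close>

lemma nehari_minimum_critical:
  assumes crit: "\<And>h. h \<in> V \<Longrightarrow> DJ z0 h = 0" and w: "w \<in> nehari"
    and min: "\<And>x. x \<in> nehari \<Longrightarrow> qa w / 2 - qb w / 3 - qc w / 4 \<le> qa x / 2 - qb x / 3 - qc x / 4"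
    and h: "h \<in> V"
  shows "DJ (z0 + w) h = 0"
proof -
  have wV: "w \<in> V" "0 < q w" "qa w = qb w + qc w"
    using w unfolding nehari_def by auto
  obtain a' b' c' where D: "((\<lambda>s. qa (w + s *\<^sub>R h)) has_real_derivative a') (at 0)"
    "((\<lambda>s. qb (w + s *\<^sub>R h)) has_real_derivative b') (at 0)"
    "((\<lambda>s. qc (w + s *\<^sub>R h)) has_real_derivative c') (at 0)"
    using qabc_derivatives[OF wV(1) h] by blast
  have "a' / 2 - b' / 3 - c' / 4 = 0"
  proof (rule nehari_minimum_derivative[OF D])
    fix s t :: real
    assume t: "0 < t" and "0 < qa (w + s *\<^sub>R h)" and c: "0 < qc (w + s *\<^sub>R h)"
      and eq: "qa (w + s *\<^sub>R h) = t * qb (w + s *\<^sub>R h) + t\<^sup>2 * qc (w + s *\<^sub>R h)"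
    let ?x = "w + s *\<^sub>R h"
    have x: "?x \<in> V" using wV h by simp
    have "0 < q ?x"
      using q_pos_if_T4_pos[OF x] c unfolding qc_def by simp
    then have "0 < q (t *\<^sub>R ?x)"
      using q_scale_pos[OF x _ t] by blast
    moreover have "qa (t *\<^sub>R ?x) = qb (t *\<^sub>R ?x) + qc (t *\<^sub>R ?x)"
      unfolding q_forms_scale[OF x] eq
      by (simp add: power2_eq_square power3_eq_cube power4_eq_xxxx algebra_simps)
    ultimately have "t *\<^sub>R ?x \<in> nehari"
      using x unfolding nehari_def by simp
    from min[OF this]
    show "qa (w + 0 *\<^sub>R h) / 2 - qb (w + 0 *\<^sub>R h) / 3 - qc (w + 0 *\<^sub>R h) / 4
        \<le> t\<^sup>2 * qa ?x / 2 - t ^ 3 * qb ?x / 3 - t ^ 4 * qc ?x / 4"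
      unfolding q_forms_scale[OF x] by simp
  qed (use wV qa_pos[OF wV(1,2)] qc_pos[OF wV(1,2)] in simp_all)
  moreover have "((\<lambda>s. J (z0 + w + s *\<^sub>R h)) has_real_derivative a' / 2 - b' / 3 - c' / 4) (at 0)"
  proof -
    have "J (z0 + w + s *\<^sub>R h) = J z0 + (qa (w + s *\<^sub>R h) / 2 - qb (w + s *\<^sub>R h) / 3 - qc (w + s *\<^sub>R h) / 4)" for s
      using J_translate[OF crit, of "w + s *\<^sub>R h"] wV h by (simp add: add.assoc)
    then show ?thesis
      by (simp only:) (auto intro!: derivative_eq_intros D)
  qed
  ultimately show ?thesis
    using DERIV_unique[OF J_derivative[of "z0 + w" h]] z0 wV h by simp
qed

end

theorem two_critical_points:
  obtains x w t where "x \<in> V" "w \<in> V" "0 < t" "0 < q (m w)"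
    "\<And>h. h \<in> V \<Longrightarrow> DJ (m x) h = 0" "\<And>h. h \<in> V \<Longrightarrow> DJ (m x + t *\<^sub>R m w) h = 0"
    "\<And>z. z \<in> V \<Longrightarrow> (\<And>h. h \<in> V \<Longrightarrow> DJ z h = 0) \<Longrightarrow> J (m x) \<le> J z"
proof -
  obtain x where x: "x \<in> V" "E (m x) (m x) \<le> \<rho>\<^sup>2" "\<And>h. h \<in> V \<Longrightarrow> DJ (m x) h = 0"
    "\<And>z. z \<in> V \<Longrightarrow> (\<And>h. h \<in> V \<Longrightarrow> DJ z h = 0) \<Longrightarrow> J (m x) \<le> J z"
    by (rule first_solution) blast
  note ctx = m_V[OF x(1)] x(2)
  obtain w t where w: "w \<in> V" "0 < t" "t *\<^sub>R m w \<in> nehari (m x)"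
    "\<And>y. y \<in> nehari (m x) \<Longrightarrow> qa (m x) (t *\<^sub>R m w) / 2 - qb (m x) (t *\<^sub>R m w) / 3 - qc (t *\<^sub>R m w) / 4
      \<le> qa (m x) y / 2 - qb (m x) y / 3 - qc y / 4"
    using nehari_minimum[OF ctx] m_T2[OF x(1)] m_T3[OF x(1)] by metis
  have "0 < T (m w) (m w) (m w) (m w)"
  proof -
    have "0 < qc (t *\<^sub>R m w)"
      using w(1,3) m_V by (intro qc_pos[OF ctx]) (auto simp: nehari_def[OF ctx])
    then show ?thesis
      using w(2) m_V[OF w(1)] q_forms_scale(3)[OF ctx m_V[OF w(1)], of t]
      by (simp add: zero_less_mult_iff flip: qc_def[OF ctx])
  qed
  then have "0 < q (m w)"
    using q_pos_if_T4_pos m_V w(1) by blast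
  then show ?thesis
    using that[OF x(1) w(1,2) _ x(3) _ x(4)] nehari_minimum_critical[OF ctx x(3) w(3,4)] by blast
qed

end

section \<open>Smooth functions and test functions\<close>

text \<open>\<open>smooth\<close> quantifies over all iterated partial derivatives, which rarely
  have a usable closed form. Naming a family that contains them avoids computing them.\<close>

lemma smooth_coinduct:
  assumes "f \<in> F" and "\<And>g x. g \<in> F \<Longrightarrow> g differentiable at x"
    and "\<And>g b. g \<in> F \<Longrightarrow> b \<in> Basis \<Longrightarrow> (\<lambda>x. frechet_derivative g (at x) b) \<in> F"
  shows "smooth f"
proof -
  have "iterated_partial bs f \<in> F" if "set bs \<subseteq> Basis" for bs
    using that by (induction bs) (use assms in auto)
  then show ?thesis
    unfolding smooth_def using assms(2) by blast
qed

lemma smooth_imp_differentiable: "smooth f \<Longrightarrow> f differentiable at x"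
  unfolding smooth_def by (metis empty_subsetI iterated_partial.simps(1) list.set(1))

text \<open>The last entry of the list is differentiated first, so a further inner derivative is
  appended at the end.\<close>

lemma smooth_partial:
  assumes "smooth f" "b \<in> Basis"
  shows "smooth (\<lambda>x. frechet_derivative f (at x) b)"
proof -
  have "iterated_partial bs (\<lambda>x. frechet_derivative f (at x) b) = iterated_partial (bs @ [b]) f" for bs
    by (induction bs) auto
  then show ?thesis
    using assms unfolding smooth_def by simp
qed

text \<open>Sum and product rule never lead out of the hull. Closure under differentiation thus has
  to be checked on generators only, whose derivatives may lie anywhere in the hull.\<close>

inductive_set algebra_hull :: "('a \<Rightarrow> real) set \<Rightarrow> ('a \<Rightarrow> real) set" for G where
  base: "g \<in> G \<Longrightarrow> g \<in> algebra_hull G"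
| const: "(\<lambda>x. c) \<in> algebra_hull G"
| add: "f \<in> algebra_hull G \<Longrightarrow> g \<in> algebra_hull G \<Longrightarrow> (\<lambda>x. f x + g x) \<in> algebra_hull G"
| mult: "f \<in> algebra_hull G \<Longrightarrow> g \<in> algebra_hull G \<Longrightarrow> (\<lambda>x. f x * g x) \<in> algebra_hull G"

lemma frechet_derivative_apply:
  "(f has_derivative D) (at x) \<Longrightarrow> frechet_derivative f (at x) b = D b"
  using frechet_derivative_at by metis

lemma smooth_algebra_hull:
  fixes G :: "('a::euclidean_space \<Rightarrow> real) set"
  assumes diff: "\<And>g x. g \<in> G \<Longrightarrow> g differentiable at x"
    and partial: "\<And>g b. g \<in> G \<Longrightarrow> b \<in> Basis \<Longrightarrow> (\<lambda>x. frechet_derivative g (at x) b) \<in> algebra_hull G"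
    and f: "f \<in> algebra_hull G"
  shows "smooth f"
proof (rule smooth_coinduct[OF f])
  show d: "g differentiable at x" if "g \<in> algebra_hull G" for g x
    using that by induction (auto intro: diff)
  show "(\<lambda>x. frechet_derivative g (at x) b) \<in> algebra_hull G" if "g \<in> algebra_hull G" "b \<in> Basis" for g b
    using that(1)
  proof induction
    case (base g)
    then show ?case using partial that(2) by blast
  next
    case (const c)
    then show ?case by (simp add: algebra_hull.const)
  next
    case (add f g)
    have "frechet_derivative (\<lambda>x. f x + g x) (at x) b = frechet_derivative f (at x) b + frechet_derivative g (at x) b" for x
      using d[OF add(1), of x] d[OF add(2), of x]
      by (intro frechet_derivative_apply has_derivative_add) (auto simp: frechet_derivative_works)
    then show ?case using add by (simp add: algebra_hull.add)
  next
    case (mult f g)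
    have "frechet_derivative (\<lambda>x. f x * g x) (at x) b = f x * frechet_derivative g (at x) b + frechet_derivative f (at x) b * g x" for x
      using d[OF mult(1), of x] d[OF mult(2), of x]
      by (intro frechet_derivative_apply has_derivative_mult) (auto simp: frechet_derivative_works)
    then show ?case using mult by (simp add: algebra_hull.add algebra_hull.mult)
  qed
qed

lemma smooth_in_algebra_hull_smooth:
  assumes "f \<in> algebra_hull {g. smooth g}"
  shows "smooth f"
proof (rule smooth_algebra_hull[OF _ _ assms])
  show "g differentiable at x" if "g \<in> {g. smooth g}" for g :: "'a \<Rightarrow> real" and x
    using that smooth_imp_differentiable by blast
  show "(\<lambda>x. frechet_derivative g (at x) b) \<in> algebra_hull {g. smooth g}"
    if "g \<in> {g. smooth g}" "b \<in> Basis" for g :: "'a \<Rightarrow> real" and b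
    using that smooth_partial by (intro algebra_hull.base) blast
qed

lemma smooth_add:
  assumes "smooth f" "smooth g"
  shows "smooth (\<lambda>x. f x + g x)"
  by (rule smooth_in_algebra_hull_smooth, rule algebra_hull.add; rule algebra_hull.base; use assms in simp)

lemma smooth_mult:
  assumes "smooth f" "smooth g"
  shows "smooth (\<lambda>x. f x * g x)"
  by (rule smooth_in_algebra_hull_smooth, rule algebra_hull.mult; rule algebra_hull.base; use assms in simp)

lemma smooth_const: "smooth (\<lambda>x. c)"
  by (rule smooth_in_algebra_hull_smooth, rule algebra_hull.const)

lemma smooth_cmult: "smooth f \<Longrightarrow> smooth (\<lambda>x. c * f x)"
  by (rule smooth_mult[OF smooth_const])

lemma smooth_diff: "smooth f \<Longrightarrow> smooth g \<Longrightarrow> smooth (\<lambda>x. f x - g x)"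
  using smooth_add[of f "\<lambda>x. (-1) * g x"] smooth_cmult[of g "-1"] by simp

text \<open>Differentiating the root produces ever lower powers of \<open>(f x)\<^sup>2 + e\<close>.
  All real exponents are therefore generators at once: a partial derivative of \<open>p s\<close> is
  a smooth function times \<open>p (s - 1)\<close>.\<close>

lemma smooth_sqrt_square_plus:
  fixes f :: "'a::euclidean_space \<Rightarrow> real"
  assumes f: "smooth f" and e: "0 < e"
  shows "smooth (\<lambda>x. sqrt ((f x)\<^sup>2 + e))"
proof -
  define p where "p s = (\<lambda>x. ((f x)\<^sup>2 + e) powr s)" for s
  define G where "G = {g. smooth g} \<union> range p"
  have pos: "0 < (f x)\<^sup>2 + e" for x
    using e by (smt (verit) zero_le_power2)
  have D: "(p s has_derivative (\<lambda>h. (s * 2 * f x * frechet_derivative f (at x) h) * p (s - 1) x)) (at x)" for s x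
  proof -
    have "(f has_derivative frechet_derivative f (at x)) (at x)"
      using smooth_imp_differentiable[OF f] by (simp add: frechet_derivative_works)
    note fd = this
    have "((\<lambda>x. (f x)\<^sup>2 + e) has_derivative (\<lambda>h. 2 * f x * frechet_derivative f (at x) h)) (at x)"
      by (auto intro!: derivative_eq_intros fd simp: fun_eq_iff)
    moreover have "((\<lambda>y. y powr s) has_derivative (\<lambda>h. (s * ((f x)\<^sup>2 + e) powr (s - 1)) * h)) (at ((f x)\<^sup>2 + e))"
      using has_real_derivative_powr[OF pos[of x], of s] by (simp add: has_field_derivative_def)
    ultimately have "((\<lambda>x. ((f x)\<^sup>2 + e) powr s) has_derivative
        (\<lambda>h. (s * ((f x)\<^sup>2 + e) powr (s - 1)) * (2 * f x * frechet_derivative f (at x) h))) (at x)"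
      by (rule has_derivative_compose)
    then show ?thesis
      unfolding p_def by (simp add: mult_ac)
  qed
  have "smooth (p (1/2))"
  proof (rule smooth_algebra_hull[of G])
    show "g differentiable at x" if "g \<in> G" for g x
      using that differentiableI[OF D] smooth_imp_differentiable unfolding G_def by auto
    show "(\<lambda>x. frechet_derivative g (at x) b) \<in> algebra_hull G" if g: "g \<in> G" and "b \<in> Basis" for g b
    proof (cases "smooth g")
      case True
      then show ?thesis
        using that(2) by (auto intro!: algebra_hull.base smooth_partial simp: G_def)
    next
      case False
      then obtain s where s: "g = p s" using g unfolding G_def by auto
      have "(\<lambda>x. frechet_derivative g (at x) b) = (\<lambda>x. (s * 2 * f x * frechet_derivative f (at x) b) * p (s - 1) x)"
        unfolding s using frechet_derivative_apply[OF D] by blast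
      moreover have "\<dots> \<in> algebra_hull G"
      proof (rule algebra_hull.mult)
        show "(\<lambda>x. s * 2 * f x * frechet_derivative f (at x) b) \<in> algebra_hull G"
          using smooth_mult[OF smooth_cmult[OF f] smooth_partial[OF f that(2)], of "s * 2"]
          by (intro algebra_hull.base) (simp add: G_def)
        show "p (s - 1) \<in> algebra_hull G"
          by (intro algebra_hull.base) (simp add: G_def)
      qed
      ultimately show ?thesis by simp
    qed
  qed (auto intro!: algebra_hull.base simp: G_def)
  then show ?thesis
    unfolding p_def using pos by (simp add: powr_half_sqrt less_imp_le)
qed

text \<open>The classical flat function, multiplied by powers of \<open>inverse t\<close> to make
  the family closed under differentiation, which only shifts \<open>k\<close>.\<close>

definition flat_exp :: "nat \<Rightarrow> real \<Rightarrow> real" where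
  "flat_exp k t = (if t > 0 then inverse t ^ k * exp (- inverse t) else 0)"

lemma flat_exp_derivative:
  "(flat_exp k has_real_derivative - real k * flat_exp (Suc k) t + flat_exp (k + 2) t) (at t)"
proof (cases t "0::real" rule: linorder_cases)
  case less
  have "(flat_exp k has_real_derivative 0) (at t)"
    using less by (subst has_field_derivative_cong_ev[where g = "\<lambda>_. 0" and x = t and y = t, OF refl])
      (auto simp: flat_exp_def eventually_nhds intro!: exI[of _ "{..<0}"])
  then show ?thesis using less by (simp add: flat_exp_def)
next
  case greater
  have "((\<lambda>t. inverse t ^ k * exp (- inverse t)) has_real_derivative
      - real k * (inverse t ^ Suc k * exp (- inverse t)) + inverse t ^ (k + 2) * exp (- inverse t)) (at t)"
  proof -
    have 1: "((\<lambda>t. inverse t ^ k) has_real_derivative real k * (- (inverse t ^ Suc (Suc 0)) * inverse t ^ (k - Suc 0))) (at t)"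
      using greater by (intro DERIV_power DERIV_inverse) simp
    have 2: "((\<lambda>t. exp (- inverse t)) has_real_derivative exp (- inverse t) * inverse t ^ 2) (at t)"
      using greater by (auto intro!: derivative_eq_intros simp: power2_eq_square)
    have 3: "real k * (- (inverse t ^ Suc (Suc 0)) * inverse t ^ (k - Suc 0)) = - real k * inverse t ^ Suc k"
      by (cases k) (auto simp: algebra_simps)
    show ?thesis
      by (rule DERIV_cong[OF DERIV_mult[OF 1 2]]) (simp only: 3, simp add: power_add power2_eq_square algebra_simps)
  qed
  then have "(flat_exp k has_real_derivative
      - real k * (inverse t ^ Suc k * exp (- inverse t)) + inverse t ^ (k + 2) * exp (- inverse t)) (at t)"
    using greater by (subst has_field_derivative_cong_ev[where x = t and y = t, OF refl])
      (auto simp: flat_exp_def eventually_nhds intro!: exI[of _ "{0<..}"])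
  then show ?thesis using greater by (simp add: flat_exp_def)
next
  case equal
  \<comment> \<open>At 0 the difference quotient vanishes on the left, and on the right the
    exponential beats every power of \<open>inverse s\<close>.\<close>
  have "((\<lambda>s. (flat_exp k s - flat_exp k 0) / (s - 0)) \<longlongrightarrow> 0) (at 0)"
  proof (rule filterlim_split_at)
    have "((\<lambda>s::real. (inverse s ^ k * exp (- inverse s)) / s) \<longlongrightarrow> 0) (at_right 0)"
      by real_asymp
    then show "((\<lambda>s. (flat_exp k s - flat_exp k 0) / (s - 0)) \<longlongrightarrow> 0) (at_right 0)"
      by (rule Lim_transform_eventually) (auto simp: flat_exp_def eventually_at_filter)
    show "((\<lambda>s. (flat_exp k s - flat_exp k 0) / (s - 0)) \<longlongrightarrow> 0) (at_left 0)"
      by (rule Lim_transform_eventually[OF tendsto_const]) (auto simp: flat_exp_def eventually_at_filter)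
  qed
  then show ?thesis
    unfolding has_field_derivative_iff using equal by (simp add: flat_exp_def)
qed

text \<open>The squared distance is a polynomial, so the centre needs no special care. As
  \<open>c\<close> grows the bump tends to the indicator of the open ball.\<close>

definition ball_bump :: "'a::euclidean_space \<Rightarrow> real \<Rightarrow> real \<Rightarrow> 'a \<Rightarrow> real" where
  "ball_bump a r c x = flat_exp 0 (c * (r\<^sup>2 - (norm (x - a))\<^sup>2))"

lemma ball_bump_range: "0 \<le> ball_bump a r c x" "ball_bump a r c x \<le> 1"
  unfolding ball_bump_def flat_exp_def by (auto simp del: inverse_mult_distrib)

lemma ball_bump_pos_iff:
  assumes "0 < c" "0 < r"
  shows "0 < ball_bump a r c x \<longleftrightarrow> x \<in> ball a r"
proof -
  have "(norm (x - a))\<^sup>2 < r\<^sup>2 \<longleftrightarrow> norm (x - a) < r"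
    using assms(2) power_strict_mono[of "norm (x - a)" r 2] power_less_imp_less_base[of "norm (x - a)" 2 r]
    by auto
  then show ?thesis
    using assms(1) unfolding ball_bump_def flat_exp_def
    by (auto simp: zero_less_mult_iff dist_norm norm_minus_commute)
qed

lemma smooth_ball_bump: "smooth (ball_bump a r c)"
proof -
  define p where "p k = (\<lambda>x. flat_exp k (c * (r\<^sup>2 - (norm (x - a))\<^sup>2)))" for k
  define G where "G = range p \<union> {\<lambda>x. x \<bullet> b | b. True}"
  have D: "(p k has_derivative (\<lambda>h. (- real k * p (Suc k) x + p (k + 2) x) * (- 2 * c * (x \<bullet> h - a \<bullet> h)))) (at x)" for k x
  proof -
    have "((\<lambda>x. c * (r\<^sup>2 - (norm (x - a))\<^sup>2)) has_derivative (\<lambda>h. - 2 * c * (x \<bullet> h - a \<bullet> h))) (at x)"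
      unfolding power2_norm_eq_inner
      by (auto intro!: derivative_eq_intros simp: fun_eq_iff inner_commute algebra_simps)
    from has_derivative_compose[OF this flat_exp_derivative[unfolded has_field_derivative_def, of k]]
    show ?thesis unfolding p_def by (simp add: mult_ac)
  qed
  have L: "((\<lambda>x. x \<bullet> b) has_derivative (\<lambda>h. h \<bullet> b)) (at x)" for b x :: 'a
    by (auto intro!: derivative_eq_intros)
  have "smooth (p 0)"
  proof (rule smooth_algebra_hull[of G])
    show "g differentiable at x" if "g \<in> G" for g x
      using that differentiableI[OF D] differentiableI[OF L] unfolding G_def by auto
    show "(\<lambda>x. frechet_derivative g (at x) b) \<in> algebra_hull G" if "g \<in> G" "b \<in> Basis" for g b
      using that(1) unfolding G_def
    proof (elim UnE)
      assume "g \<in> range p"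
      then obtain k where k: "g = p k" by auto
      have "(\<lambda>x. frechet_derivative g (at x) b) = (\<lambda>x. (- real k * p (Suc k) x + p (k + 2) x) * (- 2 * c * (x \<bullet> b + - (a \<bullet> b))))"
        unfolding k using frechet_derivative_apply[OF D] by auto
      moreover have "\<dots> \<in> algebra_hull (range p \<union> {\<lambda>x. x \<bullet> b | b. True})"
      proof (rule algebra_hull.mult)
        show "(\<lambda>x. - real k * p (Suc k) x + p (k + 2) x) \<in> algebra_hull (range p \<union> {\<lambda>x. x \<bullet> b | b. True})"
          by (rule algebra_hull.add, rule algebra_hull.mult, rule algebra_hull.const; rule algebra_hull.base; simp)
        show "(\<lambda>x. - 2 * c * (x \<bullet> b + - (a \<bullet> b))) \<in> algebra_hull (range p \<union> {\<lambda>x. x \<bullet> b | b. True})"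
          by (rule algebra_hull.mult, rule algebra_hull.const, rule algebra_hull.add,
              rule algebra_hull.base, blast, rule algebra_hull.const)
      qed
      ultimately show "(\<lambda>x. frechet_derivative g (at x) b) \<in> algebra_hull (range p \<union> {\<lambda>x. x \<bullet> b | b. True})" by simp
    next
      assume "g \<in> {\<lambda>x. x \<bullet> b | b. True}"
      then show "(\<lambda>x. frechet_derivative g (at x) b) \<in> algebra_hull (range p \<union> {\<lambda>x. x \<bullet> b | b. True})"
        using frechet_derivative_apply[OF L] by (auto simp: algebra_hull.const)
    qed
  qed (auto intro!: algebra_hull.base simp: G_def)
  then show ?thesis
    unfolding p_def ball_bump_def .
qed

section \<open>Test functions and the fundamental lemma of the calculus of variations\<close>

lemma compact_closed_subset: "compact K \<Longrightarrow> closed S \<Longrightarrow> S \<subseteq> K \<Longrightarrow> compact S"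
  by (metis compact_Int_closed inf.absorb_iff2)

lemma test_functionsI:
  assumes "smooth \<phi>" "compact K" "K \<subseteq> \<Omega>" "\<And>x. x \<notin> K \<Longrightarrow> \<phi> x = 0"
  shows "\<phi> \<in> test_functions \<Omega>"
proof -
  have "closure {x. \<phi> x \<noteq> 0} \<subseteq> K"
    using assms by (intro closure_minimal compact_imp_closed) auto
  then show ?thesis
    unfolding test_functions_def
    using assms(1,3) compact_closed_subset[OF assms(2) closed_closure] by blast
qed

lemma test_functionsE:
  assumes "\<phi> \<in> test_functions \<Omega>"
  obtains K where "smooth \<phi>" "compact K" "K \<subseteq> \<Omega>" "\<And>x. x \<notin> K \<Longrightarrow> \<phi> x = 0"
proof -
  have "\<phi> x = 0" if "x \<notin> closure {x. \<phi> x \<noteq> 0}" for x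
    using that closure_subset[of "{x. \<phi> x \<noteq> 0}"] by blast
  then show ?thesis
    using that[of "closure {x. \<phi> x \<noteq> 0}"] assms unfolding test_functions_def by blast
qed

lemma test_functions_add:
  assumes "\<phi> \<in> test_functions \<Omega>" "\<psi> \<in> test_functions \<Omega>"
  shows "(\<lambda>x. \<phi> x + \<psi> x) \<in> test_functions \<Omega>"
proof -
  obtain K L where "smooth \<phi>" "compact K" "K \<subseteq> \<Omega>" "\<And>x. x \<notin> K \<Longrightarrow> \<phi> x = 0"
    "smooth \<psi>" "compact L" "L \<subseteq> \<Omega>" "\<And>x. x \<notin> L \<Longrightarrow> \<psi> x = 0"
    using assms by (auto elim!: test_functionsE)
  then show ?thesis
    by (intro test_functionsI[of _ "K \<union> L"]) (auto intro: smooth_add)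
qed

lemma test_functions_mult:
  assumes "\<phi> \<in> test_functions \<Omega>" "smooth \<psi>"
  shows "(\<lambda>x. \<psi> x * \<phi> x) \<in> test_functions \<Omega>"
  using assms by (elim test_functionsE) (auto intro!: test_functionsI smooth_mult)

lemma test_functions_cmult:
  "\<phi> \<in> test_functions \<Omega> \<Longrightarrow> (\<lambda>x. c * \<phi> x) \<in> test_functions \<Omega>"
  by (intro test_functions_mult smooth_const)

lemma test_functions_diff:
  "\<phi> \<in> test_functions \<Omega> \<Longrightarrow> \<psi> \<in> test_functions \<Omega> \<Longrightarrow> (\<lambda>x. \<phi> x - \<psi> x) \<in> test_functions \<Omega>"
  using test_functions_add[of \<phi> \<Omega> "\<lambda>x. (-1) * \<psi> x"] test_functions_cmult[of \<psi> \<Omega> "-1"] by simp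

lemma test_functions_0: "(\<lambda>x. 0) \<in> test_functions \<Omega>"
  by (rule test_functionsI[of _ "{}"]) (auto intro: smooth_const)

lemma ball_bump_test_function:
  assumes "cball a r \<subseteq> \<Omega>" "0 < r" "0 < c"
  shows "ball_bump a r c \<in> test_functions \<Omega>"
proof (rule test_functionsI[OF smooth_ball_bump compact_cball assms(1)])
  show "ball_bump a r c x = 0" if "x \<notin> cball a r" for x
    using ball_bump_pos_iff[of c r a x] ball_bump_range(1)[of a r c x] that assms by auto
qed

lemma test_function_eq_0_outside: "\<phi> \<in> test_functions \<Omega> \<Longrightarrow> x \<notin> \<Omega> \<Longrightarrow> \<phi> x = 0"
  by (elim test_functionsE) auto

lemma continuous_test_function: "\<phi> \<in> test_functions \<Omega> \<Longrightarrow> continuous_on S \<phi>"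
  by (elim test_functionsE)
    (meson continuous_at_imp_continuous_on differentiable_imp_continuous_within smooth_imp_differentiable)

lemma borel_measurable_lebesgue_on:
  fixes f :: "'a::euclidean_space \<Rightarrow> 'b::topological_space"
  assumes "f \<in> borel_measurable borel"
  shows "f \<in> borel_measurable (lebesgue_on S)"
  using assms by (intro measurable_restrict_space1 measurable_completion) simp

lemma test_function_measurable:
  assumes "\<phi> \<in> test_functions \<Omega>"
  shows "\<phi> \<in> borel_measurable borel" "\<phi> \<in> borel_measurable (lebesgue_on S)"
proof -
  show "\<phi> \<in> borel_measurable borel"
    using continuous_test_function[OF assms] by (rule borel_measurable_continuous_onI)
  then show "\<phi> \<in> borel_measurable (lebesgue_on S)"
    by (rule borel_measurable_lebesgue_on)
qed

text \<open>Cover \<open>U\<close> by countably many balls whose closures lie in \<open>U\<close>,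
  and take 1 minus the product of \<open>1 - \<psi> n i\<close> over the first n balls, with bumps
  that sharpen as n grows. A point of \<open>U\<close> lies in some ball, whose factor alone sends
  the product to 0; outside \<open>U\<close> every factor is 1.\<close>

lemma test_functions_exhaust_open:
  assumes "open U" "U \<subseteq> \<Omega>"
  obtains \<Phi> where "\<And>n. \<Phi> n \<in> test_functions \<Omega>" "\<And>n x. 0 \<le> \<Phi> n x \<and> \<Phi> n x \<le> (1::real)"
    "\<And>x::'a::euclidean_space. (\<lambda>n. \<Phi> n x) \<longlonglongrightarrow> indicator U x"
proof (cases "U = {}")
  case True
  show ?thesis
    by (rule that[of "\<lambda>_ _. 0"]) (simp_all add: True test_functions_0)
next
  case False
  define F where "F = {ball a r | a r. 0 < r \<and> cball a r \<subseteq> U}"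
  have UF: "\<Union> F = U"
  proof
    show "U \<subseteq> \<Union> F"
    proof
      fix x assume "x \<in> U"
      then obtain r where "0 < r" "cball x r \<subseteq> U"
        using assms(1) unfolding open_contains_cball by blast
      then show "x \<in> \<Union> F"
        unfolding F_def by (intro UnionI[of "ball x r"]) auto
    qed
    show "\<Union> F \<subseteq> U"
      unfolding F_def using ball_subset_cball by blast
  qed
  have "open B" if "B \<in> F" for B
    using that unfolding F_def by auto
  then obtain F' where F': "F' \<subseteq> F" "countable F'" "\<Union> F' = U"
    using Lindelof[of F] UF by blast
  have "F' \<noteq> {}" using F'(3) False by auto
  then have B: "from_nat_into F' i \<in> F" for i
    using from_nat_into[of F' i] F'(1) by auto
  then have "\<forall>i. \<exists>a r. from_nat_into F' i = ball a r \<and> 0 < r \<and> cball a r \<subseteq> U"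
    unfolding F_def by blast
  then obtain a r where ar: "\<And>i. from_nat_into F' i = ball (a i) (r i)" "\<And>i. 0 < r i" "\<And>i. cball (a i) (r i) \<subseteq> U"
    by metis
  have Ueq: "U = (\<Union>i. ball (a i) (r i))"
    using F'(3) range_from_nat_into[OF \<open>F' \<noteq> {}\<close> F'(2)] ar(1) by (metis (no_types, lifting) image_cong)
  define \<psi> where "\<psi> n i = ball_bump (a i) (r i) (real (Suc n))" for n i
  define P where "P n k = (\<lambda>x. \<Prod>i<k. 1 - \<psi> n i x)" for n k
  have \<psi>: "0 \<le> \<psi> n i x" "\<psi> n i x \<le> 1" for n i x
    unfolding \<psi>_def using ball_bump_range by auto
  have P: "0 \<le> P n k x" "P n k x \<le> 1" for n k x
    unfolding P_def using \<psi> by (auto intro!: prod_nonneg prod_le_1 simp: field_simps)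
  have test: "(\<lambda>x. 1 - P n k x) \<in> test_functions \<Omega>" for n k
  proof (induction k)
    case 0
    then show ?case by (simp add: P_def test_functions_0)
  next
    case (Suc k)
    have b: "\<psi> n k \<in> test_functions \<Omega>"
      unfolding \<psi>_def using ar(2) order_trans[OF ar(3) assms(2)] by (intro ball_bump_test_function) simp_all
    have "(\<lambda>x. 1 - P n (Suc k) x) = (\<lambda>x. ((1 - P n k x) + \<psi> n k x) - (1 - P n k x) * \<psi> n k x)"
      by (simp add: P_def algebra_simps)
    moreover have "smooth (\<lambda>x. 1 - P n k x)"
      using Suc by (auto elim: test_functionsE)
    ultimately show ?case
      using b Suc by (auto intro!: test_functions_diff test_functions_add test_functions_mult)
  qed
  have lim: "(\<lambda>n. 1 - P n n x) \<longlonglongrightarrow> indicator U x" for x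
  proof (cases "x \<in> U")
    case True
    then obtain i where i: "x \<in> ball (a i) (r i)" using Ueq by auto
    have "P n n x \<le> 1 - \<psi> n i x" if "n > i" for n
    proof -
      have "P n n x = (1 - \<psi> n i x) * (\<Prod>j\<in>{..<n} - {i}. 1 - \<psi> n j x)"
        unfolding P_def using that by (intro prod.remove) auto
      also have "\<dots> \<le> (1 - \<psi> n i x) * 1"
        using \<psi> by (intro mult_left_mono prod_le_1) (auto simp: field_simps)
      finally show ?thesis by simp
    qed
    then have le: "\<forall>\<^sub>F n in sequentially. P n n x \<le> 1 - \<psi> n i x"
      by (rule eventually_mono[OF eventually_gt_at_top[of i]])
    define s where "s = (r i)\<^sup>2 - (norm (x - a i))\<^sup>2"
    have "norm (x - a i) < r i"
      using i by (simp add: dist_norm norm_minus_commute)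
    then have s: "0 < s"
      unfolding s_def using power_strict_mono[of "norm (x - a i)" "r i" 2] by simp
    have "(\<lambda>n. exp (- inverse (real (Suc n) * s))) \<longlonglongrightarrow> exp (- 0)"
    proof (intro tendsto_intros)
      have "(\<lambda>n. inverse (real (Suc n)) * inverse s) \<longlonglongrightarrow> 0"
        by (intro tendsto_mult_left_zero LIMSEQ_inverse_real_of_nat)
      then show "(\<lambda>n. inverse (real (Suc n) * s)) \<longlonglongrightarrow> 0"
        by (simp add: inverse_mult_distrib del: of_nat_Suc)
    qed
    moreover have "\<psi> n i x = exp (- inverse (real (Suc n) * s))" for n
      unfolding \<psi>_def ball_bump_def flat_exp_def s_def[symmetric] using s by simp
    ultimately have "(\<lambda>n. 1 - \<psi> n i x) \<longlonglongrightarrow> 1 - 1"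
      by (intro tendsto_intros) simp
    then have "(\<lambda>n. P n n x) \<longlonglongrightarrow> 0"
      using le P by (intro tendsto_sandwich[of "\<lambda>_. 0" "\<lambda>n. P n n x" _ "\<lambda>n. 1 - \<psi> n i x" 0]) auto
    from tendsto_diff[OF tendsto_const this, of 1] show ?thesis using True by simp
  next
    case False
    have "\<psi> n i x = 0" for n i
      using ball_bump_pos_iff[of "real (Suc n)" "r i" "a i" x] ar(2)[of i] \<psi>(1)[of n i x] False Ueq
      unfolding \<psi>_def by auto
    then show ?thesis using False by (simp add: P_def)
  qed
  show ?thesis
    by (rule that[of "\<lambda>n x. 1 - P n n x"]) (use test P lim in auto)
qed

text \<open>Vanishing integrals pass from test functions to indicators of open sets by dominated
  convergence, and from there to every measurable \<open>A\<close>, which up to a null set is a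
  countable intersection of open sets.\<close>

lemma fundamental_lemma:
  fixes g :: "'a::euclidean_space \<Rightarrow> real"
  assumes \<Omega>: "open \<Omega>" and g: "integrable (lebesgue_on \<Omega>) g"
    and test: "\<And>\<phi>. \<phi> \<in> test_functions \<Omega> \<Longrightarrow> (LINT x|lebesgue_on \<Omega>. g x * \<phi> x) = 0"
  shows "AE x in lebesgue_on \<Omega>. g x = 0"
proof -
  define M where "M = lebesgue_on \<Omega>"
  have g': "integrable M g" and [measurable]: "g \<in> borel_measurable M"
    using g unfolding M_def by auto
  have \<Omega>s: "\<Omega> \<in> sets lebesgue" using \<Omega> by auto
  have open_M: "U \<in> sets M" if "open U" "U \<subseteq> \<Omega>" for U
    unfolding M_def using that \<Omega>s by (subst sets_restrict_space_iff) auto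
  have op: "(LINT x|M. g x * indicator U x) = 0" if U: "open U" "U \<subseteq> \<Omega>" for U
  proof -
    obtain \<Phi> where \<Phi>: "\<And>n. \<Phi> n \<in> test_functions \<Omega>" "\<And>n x. 0 \<le> \<Phi> n x \<and> \<Phi> n x \<le> (1::real)"
      "\<And>x. (\<lambda>n. \<Phi> n x) \<longlonglongrightarrow> indicator U x"
      using test_functions_exhaust_open[OF U] by metis
    have [measurable]: "\<Phi> n \<in> borel_measurable M" for n
      unfolding M_def using \<Phi>(1) by (rule test_function_measurable)
    have [measurable]: "U \<in> sets M" using open_M[OF U] .
    have "(\<lambda>n. LINT x|M. g x * \<Phi> n x) \<longlonglongrightarrow> (LINT x|M. g x * indicator U x)"
    proof (rule integral_dominated_convergence[where w = "\<lambda>x. \<bar>g x\<bar>"])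
      show "AE x in M. norm (g x * \<Phi> n x) \<le> \<bar>g x\<bar>" for n
        using \<Phi>(2) by (auto simp: abs_mult intro!: mult_left_le)
    qed (use \<Phi> g' in \<open>auto intro!: tendsto_intros\<close>)
    then show ?thesis
      using test[OF \<Phi>(1)] unfolding M_def by (simp add: LIMSEQ_const_iff)
  qed
  have "AE x in M. g x = 0"
  proof (rule density_unique_real)
    fix A assume A: "A \<in> sets M"
    then have A': "A \<in> sets lebesgue" "A \<subseteq> \<Omega>"
      unfolding M_def using \<Omega>s by (auto simp: sets_restrict_space_iff)
    have "\<exists>T. open T \<and> A \<subseteq> T \<and> emeasure lebesgue (T - A) < ennreal (1 / real (Suc n))" for n
      using sets_lebesgue_outer_open[OF A'(1), of "1 / real (Suc n)"] by (metis of_nat_0_less_iff zero_less_Suc zero_less_divide_1_iff)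
    then obtain T where T: "\<And>n. open (T n)" "\<And>n. A \<subseteq> T n"
      "\<And>n. emeasure lebesgue (T n - A) < ennreal (1 / real (Suc n))"
      by metis
    \<comment> \<open>These finite intersections are open, and they decrease to \<open>G\<close>,
      which differs from \<open>A\<close> by a null set.\<close>
    define U where "U k = \<Omega> \<inter> (\<Inter>i<k. T i)" for k
    have U: "open (U k)" "U k \<subseteq> \<Omega>" for k
      unfolding U_def using \<Omega> T(1) by (auto intro!: open_INT)
    have Usets[measurable]: "U k \<in> sets M" for k
      using open_M[OF U] .
    define G where "G = \<Omega> \<inter> (\<Inter>i. T i)"
    have Gsets: "G \<in> sets lebesgue"
      unfolding G_def using \<Omega>s T(1) by (intro sets.Int sets.countable_INT) auto
    have "emeasure lebesgue (G - A) \<le> ennreal (1 / real (Suc n))" for n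
    proof -
      have "emeasure lebesgue (G - A) \<le> emeasure lebesgue (T n - A)"
        using A' T(1) by (intro emeasure_mono) (auto simp: G_def)
      then show ?thesis using T(3)[of n] by simp
    qed
    then have "emeasure lebesgue (G - A) \<le> 0"
    proof (intro LIMSEQ_le_const)
      show "(\<lambda>n. ennreal (1 / real (Suc n))) \<longlonglongrightarrow> 0"
        using tendsto_ennrealI[OF LIMSEQ_inverse_real_of_nat] by (simp add: inverse_eq_divide)
    qed auto
    then have "G - A \<in> null_sets lebesgue"
      using Gsets A' by (auto intro!: null_setsI)
    then have "AE x in lebesgue. x \<notin> G - A"
      by (rule AE_not_in)
    then have "AE x in lebesgue. x \<in> \<Omega> \<longrightarrow> x \<notin> G - A"
      by eventually_elim simp
    then have ae: "AE x in M. x \<notin> G - A"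
      unfolding M_def using AE_restrict_space_iff[of \<Omega> lebesgue] \<Omega>s by simp
    have AG: "A \<subseteq> G" unfolding G_def using A' T(2) by auto
    have "(\<lambda>k. LINT x|M. g x * indicator (U k) x) \<longlonglongrightarrow> (LINT x|M. g x * indicator A x)"
    proof (rule integral_dominated_convergence[where w = "\<lambda>x. \<bar>g x\<bar>"])
      show "AE x in M. norm (g x * indicator (U k) x) \<le> \<bar>g x\<bar>" for k
        by (auto simp: abs_mult indicator_def)
      show "AE x in M. (\<lambda>k. g x * indicator (U k) x) \<longlonglongrightarrow> g x * indicator A x"
        using ae
      proof eventually_elim
        case (elim x)
        have "(\<lambda>k. indicator (\<Inter>i<k. T i) x * indicator \<Omega> x :: real) \<longlonglongrightarrow> indicator (\<Inter>i. T i) x * indicator \<Omega> x"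
          by (intro tendsto_mult_right LIMSEQ_indicator_INT)
        moreover have "indicator (\<Inter>i<k. T i) x * indicator \<Omega> x = (indicator (U k) x :: real)" for k
          unfolding U_def by (auto simp: indicator_def)
        moreover have "indicator (\<Inter>i. T i) x * indicator \<Omega> x = (indicator A x :: real)"
          using elim AG by (auto simp: indicator_def G_def)
        ultimately show ?case by (intro tendsto_mult_left) simp
      qed
    qed (use A g' in auto)
    then have "(LINT x|M. g x * indicator A x) = 0"
      using op[OF U] by (simp add: LIMSEQ_const_iff)
    then show "(LINT x:A|M. g x) = (LINT x:A|M. 0)"
      by (simp add: set_lebesgue_integral_def mult.commute)
  qed (use g' in auto)
  then show ?thesis unfolding M_def .
qed

section \<open>Means of test functions over balls\<close>

definition grad :: "('a::euclidean_space \<Rightarrow> real) \<Rightarrow> 'a \<Rightarrow> 'a" where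
  "grad f x = (\<Sum>b\<in>Basis. frechet_derivative f (at x) b *\<^sub>R b)"

lemma grad_inner_Basis: "b \<in> Basis \<Longrightarrow> grad f x \<bullet> b = frechet_derivative f (at x) b"
  unfolding grad_def by (simp add: inner_sum_left inner_Basis sum.delta if_distrib cong: if_cong)

lemma has_derivative_grad:
  fixes f :: "'a::euclidean_space \<Rightarrow> real"
  assumes "f differentiable at x"
  shows "(f has_derivative (\<lambda>h. grad f x \<bullet> h)) (at x)"
proof -
  have D: "(f has_derivative frechet_derivative f (at x)) (at x)"
    using assms by (simp add: frechet_derivative_works)
  then have lin: "linear (frechet_derivative f (at x))"
    by (rule has_derivative_linear)
  have "frechet_derivative f (at x) h = grad f x \<bullet> h" for h
  proof -
    have "frechet_derivative f (at x) h = frechet_derivative f (at x) (\<Sum>b\<in>Basis. (h \<bullet> b) *\<^sub>R b)"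
      by (simp add: euclidean_representation)
    also have "\<dots> = grad f x \<bullet> h"
      unfolding grad_def linear_sum[OF lin] linear_scale[OF lin]
      by (simp add: inner_sum_left inner_commute[of h] mult.commute)
    finally show ?thesis .
  qed
  then show ?thesis using D by (metis (no_types, lifting) ext)
qed

lemma grad_eqI: "(f has_derivative (\<lambda>h. G \<bullet> h)) (at x) \<Longrightarrow> grad f x = G"
  by (rule euclidean_eqI) (simp add: grad_inner_Basis frechet_derivative_apply)

lemma grad_add:
  "f differentiable at x \<Longrightarrow> g differentiable at x \<Longrightarrow> grad (\<lambda>x. f x + g x) x = grad f x + grad g x"
  using has_derivative_add[OF has_derivative_grad has_derivative_grad, of f x g]
  by (intro grad_eqI) (simp add: inner_add_left)

lemma grad_cmult: "f differentiable at x \<Longrightarrow> grad (\<lambda>x. c * f x) x = c *\<^sub>R grad f x"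
  using has_derivative_mult_right[OF has_derivative_grad, of f x c]
  by (intro grad_eqI) simp

lemma grad_mult:
  "f differentiable at x \<Longrightarrow> g differentiable at x \<Longrightarrow> grad (\<lambda>x. f x * g x) x = f x *\<^sub>R grad g x + g x *\<^sub>R grad f x"
  using has_derivative_mult[OF has_derivative_grad has_derivative_grad, of f x g]
  by (intro grad_eqI) (simp add: inner_add_left mult.commute)

definition compactly_supported :: "('a::euclidean_space \<Rightarrow> 'b::real_normed_vector) \<Rightarrow> bool" where
  "compactly_supported f \<longleftrightarrow> continuous_on UNIV f \<and> (\<exists>K. compact K \<and> (\<forall>x. x \<notin> K \<longrightarrow> f x = 0))"

lemma compactly_supported_measurable: "compactly_supported f \<Longrightarrow> f \<in> borel_measurable borel"
  unfolding compactly_supported_def by (auto intro: borel_measurable_continuous_onI)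

lemma compactly_supported_integrable:
  fixes f :: "'a::euclidean_space \<Rightarrow> 'b::{banach, second_countable_topology}"
  assumes "compactly_supported f"
  shows "integrable lborel f"
proof -
  obtain K where K: "compact K" "\<And>x. x \<notin> K \<Longrightarrow> f x = 0" and c: "continuous_on K f"
    using assms unfolding compactly_supported_def by (auto intro: continuous_on_subset)
  have "integrable lborel (\<lambda>x. indicator K x *\<^sub>R f x)"
    using borel_integrable_compact[OF K(1) c] by (simp add: scaleR_conv_of_real)
  moreover have "(\<lambda>x. indicator K x *\<^sub>R f x) = f"
    using K(2) by (auto simp: indicator_def)
  ultimately show ?thesis by simp
qed

lemma compactly_supported_compose:
  assumes "compactly_supported f" "continuous_on UNIV h" "h 0 = 0"
  shows "compactly_supported (\<lambda>x. h (f x))"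
  using assms continuous_on_compose2[of UNIV h UNIV f] unfolding compactly_supported_def by auto

lemma compactly_supported_mult:
  fixes f :: "'a::euclidean_space \<Rightarrow> real"
  assumes "compactly_supported f" "continuous_on UNIV h"
  shows "compactly_supported (\<lambda>x. f x * h x)"
  using assms unfolding compactly_supported_def by (auto intro!: continuous_on_mult)

lemma compactly_supported_test_function: "\<phi> \<in> test_functions \<Omega> \<Longrightarrow> compactly_supported \<phi>"
  using continuous_test_function[of \<phi> \<Omega> UNIV] unfolding compactly_supported_def
  by (auto elim!: test_functionsE)

lemma test_function_differentiable: "\<phi> \<in> test_functions \<Omega> \<Longrightarrow> \<phi> differentiable at x"
  by (auto elim!: test_functionsE intro: smooth_imp_differentiable)

lemma grad_eq_0_outside:
  assumes "closed K" "\<And>x. x \<notin> K \<Longrightarrow> f x = 0" "x \<notin> K"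
  shows "grad f x = 0"
proof (rule grad_eqI)
  have "\<forall>\<^sub>F y in nhds x. 0 = f y"
    using assms by (intro eventually_nhds[THEN iffD2] exI[of _ "- K"]) auto
  then show "(f has_derivative (\<lambda>h. 0 \<bullet> h)) (at x)"
    using assms by (intro has_derivative_transform_eventually[of "\<lambda>_. 0" "\<lambda>h. 0 \<bullet> h" x UNIV f])
      (auto simp: eventually_at_filter elim: eventually_mono)
qed

lemma continuous_grad_test_function:
  assumes "\<phi> \<in> test_functions \<Omega>"
  shows "continuous_on UNIV (grad \<phi>)"
  unfolding grad_def
proof (intro continuous_on_sum continuous_on_scaleR continuous_on_const)
  fix b :: 'a assume b: "b \<in> Basis"
  have "smooth \<phi>" using assms by (auto elim: test_functionsE)
  from smooth_imp_differentiable[OF smooth_partial[OF this b]]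
  show "continuous_on UNIV (\<lambda>x. frechet_derivative \<phi> (at x) b)"
    by (meson continuous_at_imp_continuous_on differentiable_imp_continuous_within)
qed

lemma compactly_supported_grad:
  assumes "\<phi> \<in> test_functions \<Omega>"
  shows "compactly_supported (grad \<phi>)"
proof -
  obtain K where K: "compact K" "\<And>x. x \<notin> K \<Longrightarrow> \<phi> x = 0"
    using assms by (auto elim: test_functionsE)
  then have "grad \<phi> x = 0" if "x \<notin> K" for x
    using grad_eq_0_outside[of K \<phi> x] that compact_imp_closed by blast
  then show ?thesis
    using K(1) continuous_grad_test_function[OF assms] unfolding compactly_supported_def by blast
qed

lemma grad_test_function_outside:
  assumes "\<phi> \<in> test_functions \<Omega>" "x \<notin> \<Omega>"
  shows "grad \<phi> x = 0"
proof -
  obtain K where K: "compact K" "K \<subseteq> \<Omega>" "\<And>x. x \<notin> K \<Longrightarrow> \<phi> x = 0"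
    using assms by (auto elim: test_functionsE)
  then show ?thesis
    using grad_eq_0_outside[of K \<phi> x] assms(2) compact_imp_closed by blast
qed

section \<open>Translations, dilations and uniform averages\<close>

lemma nn_integral_translation:
  fixes f :: "'a::euclidean_space \<Rightarrow> ennreal"
  assumes [measurable]: "f \<in> borel_measurable borel"
  shows "(\<integral>\<^sup>+x. f (x + a) \<partial>lborel) = (\<integral>\<^sup>+x. f x \<partial>lborel)"
proof -
  have "(\<integral>\<^sup>+x. f x \<partial>lborel) = (\<integral>\<^sup>+x. f x \<partial>distr lborel borel ((+) a))"
    by (simp add: lborel_distr_plus)
  also have "\<dots> = (\<integral>\<^sup>+x. f (x + a) \<partial>lborel)"
    by (subst nn_integral_distr) (auto simp: add.commute)
  finally show ?thesis by simp
qed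

lemma nn_integral_affine:
  fixes f :: "'a::euclidean_space \<Rightarrow> ennreal"
  assumes [measurable]: "f \<in> borel_measurable borel" and c: "0 < c"
  shows "(\<integral>\<^sup>+y. f (x + c *\<^sub>R y) \<partial>lborel) = ennreal (1 / c ^ DIM('a)) * (\<integral>\<^sup>+x. f x \<partial>lborel)"
proof -
  have "(\<integral>\<^sup>+x. f x \<partial>lborel) = ennreal (c ^ DIM('a)) * (\<integral>\<^sup>+y. f (x + c *\<^sub>R y) \<partial>lborel)"
    using c by (subst lborel_affine[of c x]) (simp_all add: nn_integral_density nn_integral_distr nn_integral_cmult)
  then have "ennreal (1 / c ^ DIM('a)) * (\<integral>\<^sup>+x. f x \<partial>lborel)
      = ennreal (1 / c ^ DIM('a) * c ^ DIM('a)) * (\<integral>\<^sup>+y. f (x + c *\<^sub>R y) \<partial>lborel)"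
    using c by (simp only: mult.assoc[symmetric]) (subst ennreal_mult[symmetric]; simp)
  then show ?thesis using c by simp
qed

text \<open>Averages over the unit interval and the unit ball are encoded as probability measures,
  so that Jensen's inequality \<open>nn_integral_square_le\<close> carries no constants and Fubini
  exchanges the averages with Lebesgue measure.\<close>

definition unit_time :: "real measure" where
  "unit_time = uniform_measure lborel {0..1}"

definition unit_ball :: "'a::euclidean_space measure" where
  "unit_ball = uniform_measure lborel (cball 0 1)"

lemma sets_unit [measurable_cong]: "sets unit_time = sets borel" "sets unit_ball = sets borel"
  unfolding unit_time_def unit_ball_def by simp_all

lemma emeasure_unit: "emeasure unit_time (space unit_time) = 1" "emeasure unit_ball (space unit_ball) = 1"
proof -
  show "emeasure unit_time (space unit_time) = 1"
    unfolding unit_time_def by (simp add: divide_eq_1_ennreal)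
  have "0 < emeasure lborel (cball (0::'a) 1)"
    using content_cball_pos[of 1 "0::'a"] emeasure_lborel_cball_finite[of "0::'a" 1]
    by (simp add: measure_def enn2real_positive_iff)
  then show "emeasure (unit_ball :: 'a measure) (space unit_ball) = 1"
    unfolding unit_ball_def using emeasure_lborel_cball_finite[of "0::'a" 1]
    by (simp add: divide_eq_1_ennreal less_top)
qed

lemma finite_measure_unit: "finite_measure unit_time" "finite_measure unit_ball"
  by (auto intro!: finite_measureI simp: emeasure_unit)

lemma sigma_finite_unit: "sigma_finite_measure unit_time" "sigma_finite_measure unit_ball"
  using finite_measure_unit by (auto intro: finite_measure.axioms)

lemma nn_integral_square_le:
  assumes [measurable]: "f \<in> borel_measurable M" and "emeasure M (space M) = 1"
  shows "(\<integral>\<^sup>+x. f x \<partial>M)\<^sup>2 \<le> (\<integral>\<^sup>+x. (f x)\<^sup>2 \<partial>M)"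
  using Cauchy_Schwarz_nn_integral[of f M "\<lambda>_. 1"] assms by simp

lemma nn_integral_unit_time: "f \<in> borel_measurable borel \<Longrightarrow> (\<integral>\<^sup>+t. f t \<partial>unit_time) = (\<integral>\<^sup>+t. f t * indicator {0..1} t \<partial>lborel)"
  unfolding unit_time_def by (simp add: nn_integral_uniform_measure divide_ennreal_def)

lemma nn_integral_unit_ball_le:
  fixes f :: "'a::euclidean_space \<Rightarrow> ennreal"
  assumes [measurable]: "f \<in> borel_measurable borel"
  shows "(\<integral>\<^sup>+y. f y \<partial>unit_ball) \<le> ennreal (1 / measure lborel (cball (0::'a) 1)) * (\<integral>\<^sup>+y. f y \<partial>lborel)"
proof -
  have "(\<integral>\<^sup>+y. f y \<partial>unit_ball) = (\<integral>\<^sup>+y. f y * indicator (cball 0 1) y \<partial>lborel) / emeasure lborel (cball (0::'a) 1)"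
    unfolding unit_ball_def by (simp add: nn_integral_uniform_measure)
  also have "\<dots> \<le> (\<integral>\<^sup>+y. f y \<partial>lborel) / emeasure lborel (cball (0::'a) 1)"
    by (intro divide_right_mono_ennreal nn_integral_mono) (auto simp: indicator_def)
  also have "emeasure lborel (cball (0::'a) 1) = ennreal (measure lborel (cball (0::'a) 1))"
    using emeasure_lborel_cball_finite[of "0::'a" 1] by (simp add: emeasure_eq_ennreal_measure less_top)
  also have "(\<integral>\<^sup>+y. f y \<partial>lborel) / ennreal (measure lborel (cball (0::'a) 1))
      = ennreal (1 / measure lborel (cball (0::'a) 1)) * (\<integral>\<^sup>+y. f y \<partial>lborel)"
    using content_cball_pos[of 1 "0::'a"]
    by (simp add: divide_ennreal_def inverse_ennreal mult.commute inverse_eq_divide)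
  finally show ?thesis .
qed

lemma AE_unit_ball: "AE y in unit_ball. norm y \<le> 1"
  unfolding unit_ball_def
  by (rule AE_uniform_measureI) auto

lemma AE_unit_time: "AE t in unit_time. 0 < t \<and> t \<le> 1"
proof -
  have "AE t in lborel. t \<noteq> (0::real)"
    by (rule AE_lborel_singleton)
  then show ?thesis
    unfolding unit_time_def by (intro AE_uniform_measureI) (auto elim!: eventually_mono)
qed

definition ball_mean :: "real \<Rightarrow> ('a::euclidean_space \<Rightarrow> real) \<Rightarrow> 'a \<Rightarrow> real" where
  "ball_mean e f x = (LINT y|unit_ball. f (x + e *\<^sub>R y))"

lemma compactly_supported_bounded:
  assumes "compactly_supported f"
  obtains B where "0 \<le> B" "\<And>x. norm (f x) \<le> B"
proof -
  obtain K where K: "compact K" "\<And>x. x \<notin> K \<Longrightarrow> f x = 0" "continuous_on K f"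
    using assms unfolding compactly_supported_def by (auto intro: continuous_on_subset)
  have "bounded (f ` K)"
    using K by (intro compact_imp_bounded compact_continuous_image)
  then obtain B where B: "0 < B" "\<And>x. x \<in> K \<Longrightarrow> norm (f x) \<le> B"
    unfolding bounded_pos by auto
  then have "norm (f x) \<le> B" for x
    using K(2) by (cases "x \<in> K") auto
  then show ?thesis using that[of B] B(1) by simp
qed

lemma ball_mean_integrable:
  fixes f :: "'a::euclidean_space \<Rightarrow> real"
  assumes "compactly_supported f"
  shows "integrable unit_ball (\<lambda>y. f (x + e *\<^sub>R y))"
proof -
  have [measurable]: "f \<in> borel_measurable borel"
    using compactly_supported_measurable[OF assms] .
  obtain B where "\<And>x. norm (f x) \<le> B"
    using compactly_supported_bounded[OF assms] by metis
  then show ?thesis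
    by (intro finite_measure.integrable_const_bound[OF finite_measure_unit(2), where B = B]) auto
qed

lemma ball_mean_square_le:
  fixes f :: "'a::euclidean_space \<Rightarrow> real"
  assumes f: "compactly_supported f"
  shows "ennreal ((ball_mean e f x)\<^sup>2) \<le> (\<integral>\<^sup>+y. ennreal ((f (x + e *\<^sub>R y))\<^sup>2) \<partial>unit_ball)"
proof -
  have [measurable]: "f \<in> borel_measurable borel"
    using compactly_supported_measurable[OF f] .
  have "ennreal ((ball_mean e f x)\<^sup>2) = (ennreal \<bar>ball_mean e f x\<bar>)\<^sup>2"
    by (simp add: ennreal_power)
  also have "\<dots> \<le> (\<integral>\<^sup>+y. ennreal \<bar>f (x + e *\<^sub>R y)\<bar> \<partial>unit_ball)\<^sup>2"
    using integral_norm_bound_ennreal[OF ball_mean_integrable[OF f]]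
    unfolding ball_mean_def by (intro power_mono_ennreal) simp
  also have "\<dots> \<le> (\<integral>\<^sup>+y. (ennreal \<bar>f (x + e *\<^sub>R y)\<bar>)\<^sup>2 \<partial>unit_ball)"
    by (intro nn_integral_square_le) (auto simp: emeasure_unit)
  finally show ?thesis by (simp add: ennreal_power)
qed

text \<open>Jensen bounds the square of the mean by the mean of the squares. Extending that integral
  to the whole space and rescaling leaves the volume of a ball of radius \<open>e\<close> in the
  denominator.\<close>

lemma ball_mean_sup:
  fixes f :: "'a::euclidean_space \<Rightarrow> real"
  assumes f: "compactly_supported f" and e: "0 < e"
  shows "ennreal ((ball_mean e f x)\<^sup>2)
    \<le> ennreal (1 / (measure lborel (cball (0::'a) 1) * e ^ DIM('a))) * (\<integral>\<^sup>+x. ennreal ((f x)\<^sup>2) \<partial>lborel)"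
proof -
  have [measurable]: "f \<in> borel_measurable borel"
    using compactly_supported_measurable[OF f] .
  have "ennreal ((ball_mean e f x)\<^sup>2) \<le> (\<integral>\<^sup>+y. ennreal ((f (x + e *\<^sub>R y))\<^sup>2) \<partial>unit_ball)"
    by (rule ball_mean_square_le[OF f])
  also have "\<dots> \<le> ennreal (1 / measure lborel (cball (0::'a) 1)) * (\<integral>\<^sup>+y. ennreal ((f (x + e *\<^sub>R y))\<^sup>2) \<partial>lborel)"
    by (rule nn_integral_unit_ball_le) simp
  also have "(\<integral>\<^sup>+y. ennreal ((f (x + e *\<^sub>R y))\<^sup>2) \<partial>lborel) = ennreal (1 / e ^ DIM('a)) * (\<integral>\<^sup>+x. ennreal ((f x)\<^sup>2) \<partial>lborel)"
    by (rule nn_integral_affine[of "\<lambda>x. ennreal ((f x)\<^sup>2)"]) (use e in auto)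
  finally show ?thesis
    using e by (simp add: ennreal_mult[symmetric] mult.assoc[symmetric])
qed

lemma ball_mean_measurable:
  fixes f :: "'a::euclidean_space \<Rightarrow> real"
  assumes "compactly_supported f"
  shows "ball_mean e f \<in> borel_measurable borel"
proof -
  interpret sigma_finite_measure "unit_ball :: 'a measure" by (rule sigma_finite_unit)
  have [measurable]: "f \<in> borel_measurable borel"
    using compactly_supported_measurable[OF assms] .
  show ?thesis
    unfolding ball_mean_def by measurable
qed

lemma nn_integral_ball_mean:
  fixes f :: "'a::euclidean_space \<Rightarrow> ennreal"
  assumes [measurable]: "f \<in> borel_measurable borel"
  shows "(\<integral>\<^sup>+x. (\<integral>\<^sup>+y. f (x + c *\<^sub>R y) \<partial>unit_ball) \<partial>lborel) = (\<integral>\<^sup>+x. f x \<partial>lborel)"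
proof -
  interpret pair_sigma_finite "unit_ball :: 'a measure" "lborel :: 'a measure"
    by (intro pair_sigma_finite.intro sigma_finite_unit sigma_finite_lborel)
  have "(\<integral>\<^sup>+x. (\<integral>\<^sup>+y. f (x + c *\<^sub>R y) \<partial>unit_ball) \<partial>lborel) = (\<integral>\<^sup>+y. (\<integral>\<^sup>+x. f (x + c *\<^sub>R y) \<partial>lborel) \<partial>unit_ball)"
    by (rule Fubini') measurable
  also have "\<dots> = (\<integral>\<^sup>+y. (\<integral>\<^sup>+x. f x \<partial>lborel) \<partial>(unit_ball :: 'a measure))"
    by (simp add: nn_integral_translation)
  finally show ?thesis by (simp add: emeasure_unit)
qed

lemma ball_mean_L2:
  fixes f :: "'a::euclidean_space \<Rightarrow> real"
  assumes f: "compactly_supported f"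
  shows "(\<integral>\<^sup>+x. ennreal ((ball_mean e f x)\<^sup>2) \<partial>lborel) \<le> (\<integral>\<^sup>+x. ennreal ((f x)\<^sup>2) \<partial>lborel)"
proof -
  have [measurable]: "f \<in> borel_measurable borel"
    using compactly_supported_measurable[OF f] .
  have "(\<integral>\<^sup>+x. ennreal ((ball_mean e f x)\<^sup>2) \<partial>lborel) \<le> (\<integral>\<^sup>+x. (\<integral>\<^sup>+y. ennreal ((f (x + e *\<^sub>R y))\<^sup>2) \<partial>unit_ball) \<partial>lborel)"
    by (intro nn_integral_mono ball_mean_square_le f)
  also have "\<dots> = (\<integral>\<^sup>+x. ennreal ((f x)\<^sup>2) \<partial>lborel)"
    by (rule nn_integral_ball_mean) simp
  finally show ?thesis .
qed

text \<open>Fundamental theorem of calculus along the path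
  \<open>t \<mapsto> x + (c * t ^ k) *\<^sub>R y\<close>. The speed is left free:
  \<open>k = 1\<close> serves the translation estimate and \<open>k = 4\<close> the
  \<open>L^4\<close> bound.\<close>

lemma increment_bound:
  fixes \<phi> :: "'a::euclidean_space \<Rightarrow> real"
  assumes \<phi>: "\<phi> \<in> test_functions \<Omega>" and k: "0 < k" and c: "0 \<le> c"
  shows "ennreal \<bar>\<phi> (x + c *\<^sub>R y) - \<phi> x\<bar>
    \<le> (\<integral>\<^sup>+t. ennreal (c * real k * t ^ (k - 1) * norm y * norm (grad \<phi> (x + (c * t ^ k) *\<^sub>R y))) \<partial>unit_time)"
proof -
  have [measurable]: "grad \<phi> \<in> borel_measurable borel"
    using compactly_supported_measurable[OF compactly_supported_grad[OF \<phi>]] .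
  define F where "F t = \<phi> (x + (c * t ^ k) *\<^sub>R y)" for t :: real
  define F' where "F' t = grad \<phi> (x + (c * t ^ k) *\<^sub>R y) \<bullet> ((c * (real k * t ^ (k - 1))) *\<^sub>R y)" for t :: real
  have D: "(F has_vector_derivative F' t) (at t within {0..1})" for t
  proof -
    have "((\<lambda>t. x + (c * t ^ k) *\<^sub>R y) has_derivative (\<lambda>h. h *\<^sub>R ((c * (real k * t ^ (k - 1))) *\<^sub>R y))) (at t)"
      by (auto intro!: derivative_eq_intros simp: mult_ac)
    from has_derivative_compose[OF this has_derivative_grad[OF test_function_differentiable[OF \<phi>]]]
    show ?thesis
      unfolding has_vector_derivative_def F_def F'_def
      by (auto intro: has_derivative_at_withinI simp: mult_ac)
  qed
  have cont: "continuous_on {0..1} F'"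
    unfolding F'_def
    by (intro continuous_intros continuous_on_compose2[OF continuous_grad_test_function[OF \<phi>]]) auto
  have "(\<integral>t. indicator {0..1} t *\<^sub>R F' t \<partial>lborel) = F 1 - F 0"
    using D cont by (intro integral_FTC_atLeastAtMost) auto
  then have "ennreal \<bar>\<phi> (x + c *\<^sub>R y) - \<phi> x\<bar> = ennreal \<bar>\<integral>t. indicator {0..1} t *\<^sub>R F' t \<partial>lborel\<bar>"
    using k by (simp add: F_def zero_power)
  also have "\<dots> \<le> (\<integral>\<^sup>+t. ennreal (norm (indicator {0..1} t *\<^sub>R F' t)) \<partial>lborel)"
    using integral_norm_bound_ennreal[OF borel_integrable_compact[OF compact_Icc cont]] by simp
  also have "\<dots> \<le> (\<integral>\<^sup>+t. ennreal (c * real k * t ^ (k - 1) * norm y * norm (grad \<phi> (x + (c * t ^ k) *\<^sub>R y))) * indicator {0..1} t \<partial>lborel)"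
  proof (rule nn_integral_mono)
    fix t :: real
    have "\<bar>F' t\<bar> \<le> c * real k * t ^ (k - 1) * norm y * norm (grad \<phi> (x + (c * t ^ k) *\<^sub>R y))" if "t \<in> {0..1}"
      using Cauchy_Schwarz_ineq2[of "grad \<phi> (x + (c * t ^ k) *\<^sub>R y)" "(c * (real k * t ^ (k - 1))) *\<^sub>R y"] that c
      unfolding F'_def by (simp add: abs_mult mult_ac)
    then show "ennreal (norm (indicator {0..1} t *\<^sub>R F' t))
        \<le> ennreal (c * real k * t ^ (k - 1) * norm y * norm (grad \<phi> (x + (c * t ^ k) *\<^sub>R y))) * indicator {0..1} t"
      by (auto simp: indicator_def intro!: ennreal_leI)
  qed
  also have "\<dots> = (\<integral>\<^sup>+t. ennreal (c * real k * t ^ (k - 1) * norm y * norm (grad \<phi> (x + (c * t ^ k) *\<^sub>R y))) \<partial>unit_time)"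
    by (rule nn_integral_unit_time[symmetric]) measurable
  finally show ?thesis .
qed

text \<open>After Jensen and Fubini, translation invariance makes every point of the segment from
  \<open>x\<close> to \<open>x + h\<close> contribute the same integral.\<close>

lemma translation_estimate:
  fixes \<phi> :: "'a::euclidean_space \<Rightarrow> real"
  assumes \<phi>: "\<phi> \<in> test_functions \<Omega>"
  shows "(\<integral>\<^sup>+x. ennreal ((\<phi> (x + h) - \<phi> x)\<^sup>2) \<partial>lborel)
    \<le> ennreal ((norm h)\<^sup>2) * (\<integral>\<^sup>+x. ennreal ((norm (grad \<phi> x))\<^sup>2) \<partial>lborel)"
proof -
  have [measurable]: "grad \<phi> \<in> borel_measurable borel"
    using compactly_supported_measurable[OF compactly_supported_grad[OF \<phi>]] .
  interpret pair_sigma_finite unit_time "lborel :: 'a measure"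
    by (intro pair_sigma_finite.intro sigma_finite_unit sigma_finite_lborel)
  have "ennreal ((\<phi> (x + h) - \<phi> x)\<^sup>2) \<le> (\<integral>\<^sup>+t. ennreal ((norm h * norm (grad \<phi> (x + t *\<^sub>R h)))\<^sup>2) \<partial>unit_time)" for x
  proof -
    have "ennreal ((\<phi> (x + h) - \<phi> x)\<^sup>2) = (ennreal \<bar>\<phi> (x + h) - \<phi> x\<bar>)\<^sup>2"
      by (simp add: ennreal_power)
    also have "\<dots> \<le> (\<integral>\<^sup>+t. ennreal (norm h * norm (grad \<phi> (x + t *\<^sub>R h))) \<partial>unit_time)\<^sup>2"
      using increment_bound[OF \<phi>, of 1 1 x h] by (intro power_mono_ennreal) simp
    also have "\<dots> \<le> (\<integral>\<^sup>+t. (ennreal (norm h * norm (grad \<phi> (x + t *\<^sub>R h))))\<^sup>2 \<partial>unit_time)"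
      by (intro nn_integral_square_le) (auto simp: emeasure_unit)
    finally show ?thesis by (simp add: ennreal_power)
  qed
  then have "(\<integral>\<^sup>+x. ennreal ((\<phi> (x + h) - \<phi> x)\<^sup>2) \<partial>lborel)
      \<le> (\<integral>\<^sup>+x. (\<integral>\<^sup>+t. ennreal ((norm h * norm (grad \<phi> (x + t *\<^sub>R h)))\<^sup>2) \<partial>unit_time) \<partial>lborel)"
    by (intro nn_integral_mono)
  also have "\<dots> = (\<integral>\<^sup>+t. (\<integral>\<^sup>+x. ennreal ((norm h * norm (grad \<phi> (x + t *\<^sub>R h)))\<^sup>2) \<partial>lborel) \<partial>unit_time)"
    by (rule Fubini') measurable
  also have "\<dots> = (\<integral>\<^sup>+t. (\<integral>\<^sup>+x. ennreal ((norm h * norm (grad \<phi> x))\<^sup>2) \<partial>lborel) \<partial>unit_time)"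
    by (intro nn_integral_cong nn_integral_translation[of "\<lambda>x. ennreal ((norm h * norm (grad \<phi> x))\<^sup>2)"]) measurable
  also have "\<dots> = (\<integral>\<^sup>+x. ennreal ((norm h)\<^sup>2) * ennreal ((norm (grad \<phi> x))\<^sup>2) \<partial>lborel)"
    by (simp add: emeasure_unit power_mult_distrib ennreal_mult)
  also have "\<dots> = ennreal ((norm h)\<^sup>2) * (\<integral>\<^sup>+x. ennreal ((norm (grad \<phi> x))\<^sup>2) \<partial>lborel)"
    by (rule nn_integral_cmult) measurable
  finally show ?thesis .
qed

text \<open>Integrating along the rays \<open>t \<mapsto> x + e t\<^sup>4 y\<close> leaves the factor \<open>t\<^sup>1\<^sup>2 / t\<^sup>4\<^sup>N\<close> after
  the change of variables, which is bounded as \<open>N \<le> 3\<close>.\<close>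

lemma ball_mean_L4:
  fixes \<phi> :: "'a::euclidean_space \<Rightarrow> real"
  assumes \<phi>: "\<phi> \<in> test_functions \<Omega>" and e: "0 < e" and dim: "DIM('a) \<le> 3"
  shows "(\<integral>\<^sup>+x. ennreal ((ball_mean e \<phi> x - \<phi> x) ^ 4) \<partial>lborel)
    \<le> ennreal (256 / measure lborel (cball (0::'a) 1) * (e ^ 4 / e ^ DIM('a)))
      * (\<integral>\<^sup>+x. ennreal ((norm (grad \<phi> x))\<^sup>2) \<partial>lborel)\<^sup>2"
proof -
  define G where "G = (\<integral>\<^sup>+x. ennreal ((norm (grad \<phi> x))\<^sup>2) \<partial>lborel)"
  define v where "v = measure lborel (cball (0::'a) 1)"
  have v: "0 < v" unfolding v_def by (rule content_cball_pos) simp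
  have [measurable]: "grad \<phi> \<in> borel_measurable borel" "\<phi> \<in> borel_measurable borel"
    using compactly_supported_measurable[OF compactly_supported_grad[OF \<phi>]]
      compactly_supported_measurable[OF compactly_supported_test_function[OF \<phi>]] .
  interpret TB: pair_sigma_finite unit_time "unit_ball :: 'a measure"
    by (intro pair_sigma_finite.intro sigma_finite_unit)
  interpret TL: pair_sigma_finite unit_time "lborel :: 'a measure"
    by (intro pair_sigma_finite.intro sigma_finite_unit sigma_finite_lborel)
  define k where "k x t y = ennreal (4 * e * t ^ 3 * norm (grad \<phi> (x + (e * t ^ 4) *\<^sub>R y)))" for x t and y :: 'a
  \<comment> \<open>\<open>k\<close> is the integrand after using \<open>norm y \<le> 1\<close>.
    Jensen in t, then in y, then again in t turns the fourth power of the error into the average of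
    \<open>(A x t)\<^sup>2\<close>.\<close>
  define A where "A x t = (\<integral>\<^sup>+y. (k x t y)\<^sup>2 \<partial>unit_ball)" for x t
  have k_meas[measurable]: "(\<lambda>p. k (fst p) (fst (snd p)) (snd (snd p))) \<in> borel_measurable (borel \<Otimes>\<^sub>M borel \<Otimes>\<^sub>M borel)"
    unfolding k_def by measurable
  have kx[measurable]: "(\<lambda>(t, y). k x t y) \<in> borel_measurable (borel \<Otimes>\<^sub>M borel)" for x
    unfolding k_def by measurable
  have kxt[measurable]: "k x t \<in> borel_measurable borel" for x t
    unfolding k_def by measurable
  have A_meas[measurable]: "(\<lambda>(t, x). A x t) \<in> borel_measurable (borel \<Otimes>\<^sub>M borel)"
    unfolding A_def k_def split_beta'
    by (rule TB.M2.borel_measurable_nn_integral) measurable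
  have pointwise: "ennreal ((ball_mean e \<phi> x - \<phi> x) ^ 4) \<le> (\<integral>\<^sup>+t. (A x t)\<^sup>2 \<partial>unit_time)" for x
  proof -
    note int = ball_mean_integrable[OF compactly_supported_test_function[OF \<phi>], of x e]
      finite_measure.integrable_const[OF finite_measure_unit(2), of "\<phi> x"]
    have "measure (unit_ball :: 'a measure) (space unit_ball) = 1"
      by (simp add: measure_def emeasure_unit)
    then have "ball_mean e \<phi> x - \<phi> x = (LINT y|unit_ball. \<phi> (x + e *\<^sub>R y) - \<phi> x)"
      unfolding ball_mean_def Bochner_Integration.integral_diff[OF int] by simp
    then have "ennreal \<bar>ball_mean e \<phi> x - \<phi> x\<bar> \<le> (\<integral>\<^sup>+y. ennreal \<bar>\<phi> (x + e *\<^sub>R y) - \<phi> x\<bar> \<partial>unit_ball)"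
      using integral_norm_bound_ennreal[OF Bochner_Integration.integrable_diff[OF int]] by simp
    also have "\<dots> \<le> (\<integral>\<^sup>+y. (\<integral>\<^sup>+t. k x t y \<partial>unit_time) \<partial>unit_ball)"
    proof (rule nn_integral_mono_AE)
      show "AE y in unit_ball. ennreal \<bar>\<phi> (x + e *\<^sub>R y) - \<phi> x\<bar> \<le> (\<integral>\<^sup>+t. k x t y \<partial>unit_time)"
        using AE_unit_ball
      proof eventually_elim
        case (elim y)
        have "ennreal \<bar>\<phi> (x + e *\<^sub>R y) - \<phi> x\<bar>
            \<le> (\<integral>\<^sup>+t. ennreal (e * real 4 * t ^ (4 - 1) * norm y * norm (grad \<phi> (x + (e * t ^ 4) *\<^sub>R y))) \<partial>unit_time)"
          using e by (intro increment_bound[OF \<phi>]) auto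
        also have "\<dots> \<le> (\<integral>\<^sup>+t. k x t y \<partial>unit_time)"
        proof (rule nn_integral_mono_AE)
          show "AE t in unit_time. ennreal (e * real 4 * t ^ (4 - 1) * norm y * norm (grad \<phi> (x + (e * t ^ 4) *\<^sub>R y))) \<le> k x t y"
            using AE_unit_time
          proof eventually_elim
            case (elim t)
            have "e * 4 * t ^ 3 * norm y * norm (grad \<phi> (x + (e * t ^ 4) *\<^sub>R y))
                \<le> e * 4 * t ^ 3 * 1 * norm (grad \<phi> (x + (e * t ^ 4) *\<^sub>R y))"
              using elim \<open>norm y \<le> 1\<close> e by (intro mult_right_mono mult_left_mono) auto
            then show ?case
              unfolding k_def by (intro ennreal_leI) (simp add: mult_ac)
          qed
        qed
        finally show ?case .
      qed
    qed
    also have "\<dots> = (\<integral>\<^sup>+t. (\<integral>\<^sup>+y. k x t y \<partial>unit_ball) \<partial>unit_time)"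
      by (rule TB.Fubini') measurable
    finally have "(ennreal \<bar>ball_mean e \<phi> x - \<phi> x\<bar>)\<^sup>2 \<le> (\<integral>\<^sup>+t. (\<integral>\<^sup>+y. k x t y \<partial>unit_ball) \<partial>unit_time)\<^sup>2"
      by (rule power_mono_ennreal)
    also have "\<dots> \<le> (\<integral>\<^sup>+t. (\<integral>\<^sup>+y. k x t y \<partial>unit_ball)\<^sup>2 \<partial>unit_time)"
      by (intro nn_integral_square_le) (auto simp: emeasure_unit)
    also have "\<dots> \<le> (\<integral>\<^sup>+t. A x t \<partial>unit_time)"
      unfolding A_def by (intro nn_integral_mono nn_integral_square_le) (auto simp: emeasure_unit)
    finally have "((ennreal \<bar>ball_mean e \<phi> x - \<phi> x\<bar>)\<^sup>2)\<^sup>2 \<le> (\<integral>\<^sup>+t. A x t \<partial>unit_time)\<^sup>2"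
      by (rule power_mono_ennreal)
    also have "\<dots> \<le> (\<integral>\<^sup>+t. (A x t)\<^sup>2 \<partial>unit_time)"
      by (intro nn_integral_square_le) (auto simp: emeasure_unit)
    finally show ?thesis by (simp add: ennreal_power flip: power_mult)
  qed
  \<comment> \<open>For fixed t, \<open>A\<close> is bounded by \<open>c1 * G\<close> and has
    integral \<open>c2 * G\<close> over x; the product of both bounds the integral of its
    square.\<close>
  have slice: "(\<integral>\<^sup>+x. (A x t)\<^sup>2 \<partial>lborel) \<le> ennreal (256 / v * (e ^ 4 / e ^ DIM('a))) * G\<^sup>2" if t: "0 < t" "t \<le> 1" for t
  proof -
    define c1 where "c1 = 16 * e\<^sup>2 * t ^ 6 / (v * (e * t ^ 4) ^ DIM('a))"
    define c2 where "c2 = 16 * e\<^sup>2 * t ^ 6"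
    have c: "0 \<le> c1" "0 \<le> c2" unfolding c1_def c2_def using v e t by auto
    have ksq: "(k x t y)\<^sup>2 = ennreal c2 * ennreal ((norm (grad \<phi> (x + (e * t ^ 4) *\<^sub>R y)))\<^sup>2)" for x y
      unfolding k_def c2_def using e t
      by (simp add: ennreal_power power_mult_distrib ennreal_mult flip: power_mult)
    have A_eq: "A x t = ennreal c2 * (\<integral>\<^sup>+y. ennreal ((norm (grad \<phi> (x + (e * t ^ 4) *\<^sub>R y)))\<^sup>2) \<partial>unit_ball)" for x
      unfolding A_def ksq by (rule nn_integral_cmult) measurable
    have int_A: "(\<integral>\<^sup>+x. A x t \<partial>lborel) = ennreal c2 * G"
      unfolding A_eq G_def
      by (subst nn_integral_cmult, measurable) (simp add: nn_integral_ball_mean[of "\<lambda>x. ennreal ((norm (grad \<phi> x))\<^sup>2)"])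
    have A_le: "A x t \<le> ennreal c1 * G" for x
    proof -
      have "(\<integral>\<^sup>+y. ennreal ((norm (grad \<phi> (x + (e * t ^ 4) *\<^sub>R y)))\<^sup>2) \<partial>unit_ball)
          \<le> ennreal (1 / v) * (\<integral>\<^sup>+y. ennreal ((norm (grad \<phi> (x + (e * t ^ 4) *\<^sub>R y)))\<^sup>2) \<partial>lborel)"
        unfolding v_def by (rule nn_integral_unit_ball_le) measurable
      also have "\<dots> = ennreal (1 / v) * (ennreal (1 / (e * t ^ 4) ^ DIM('a)) * G)"
        unfolding G_def using e t by (subst nn_integral_affine[of "\<lambda>x. ennreal ((norm (grad \<phi> x))\<^sup>2)"]) auto
      finally have "A x t \<le> ennreal c2 * (ennreal (1 / v) * (ennreal (1 / (e * t ^ 4) ^ DIM('a)) * G))"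
        unfolding A_eq by (rule mult_left_mono) simp
      also have "\<dots> = ennreal c1 * G"
        unfolding c1_def c2_def using v e t by (simp add: ennreal_mult[symmetric] mult.assoc[symmetric])
      finally show ?thesis .
    qed
    have "(\<integral>\<^sup>+x. (A x t)\<^sup>2 \<partial>lborel) \<le> (\<integral>\<^sup>+x. (ennreal c1 * G) * A x t \<partial>lborel)"
      unfolding power2_eq_square by (intro nn_integral_mono mult_right_mono A_le) simp
    also have "\<dots> = (ennreal c1 * G) * (ennreal c2 * G)"
      unfolding int_A[symmetric] A_eq by (rule nn_integral_cmult) measurable
    also have "\<dots> = ennreal (c1 * c2) * G\<^sup>2"
      using c by (simp add: ennreal_mult power2_eq_square mult_ac)
    also have "\<dots> \<le> ennreal (256 / v * (e ^ 4 / e ^ DIM('a))) * G\<^sup>2"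
    proof (intro mult_right_mono ennreal_leI)
      have "c1 * c2 = 256 / v * (e ^ 4 / e ^ DIM('a)) * (t ^ 12 / t ^ (4 * DIM('a)))"
      proof -
        have "(e * t ^ 4) ^ DIM('a) = e ^ DIM('a) * t ^ (4 * DIM('a))"
          by (simp add: power_mult_distrib power_mult)
        moreover have "(16 * e\<^sup>2 * t ^ 6) * (16 * e\<^sup>2 * t ^ 6) = 256 * (e ^ 4 * t ^ 12)"
          by (simp add: power_numeral_reduce mult_ac)
        ultimately show ?thesis
          unfolding c1_def c2_def using v e t by (simp add: field_simps)
      qed
      also have "\<dots> \<le> 256 / v * (e ^ 4 / e ^ DIM('a)) * 1"
      proof (intro mult_left_mono)
        have "t ^ 12 \<le> t ^ (4 * DIM('a))"
          using t dim by (intro power_decreasing) auto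
        then show "t ^ 12 / t ^ (4 * DIM('a)) \<le> 1" using t by simp
      qed (use v e in auto)
      finally show "c1 * c2 \<le> 256 / v * (e ^ 4 / e ^ DIM('a))" by simp
    qed simp
    finally show ?thesis .
  qed
  have "(\<integral>\<^sup>+x. ennreal ((ball_mean e \<phi> x - \<phi> x) ^ 4) \<partial>lborel) \<le> (\<integral>\<^sup>+x. (\<integral>\<^sup>+t. (A x t)\<^sup>2 \<partial>unit_time) \<partial>lborel)"
    by (intro nn_integral_mono pointwise)
  also have "\<dots> = (\<integral>\<^sup>+t. (\<integral>\<^sup>+x. (A x t)\<^sup>2 \<partial>lborel) \<partial>unit_time)"
    by (rule TL.Fubini') measurable
  also have "\<dots> \<le> (\<integral>\<^sup>+t. ennreal (256 / v * (e ^ 4 / e ^ DIM('a))) * G\<^sup>2 \<partial>unit_time)"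
  proof (rule nn_integral_mono_AE)
    show "AE t in unit_time. (\<integral>\<^sup>+x. (A x t)\<^sup>2 \<partial>lborel) \<le> ennreal (256 / v * (e ^ 4 / e ^ DIM('a))) * G\<^sup>2"
      using AE_unit_time by eventually_elim (use slice in blast)
  qed
  also have "\<dots> = ennreal (256 / v * (e ^ 4 / e ^ DIM('a))) * G\<^sup>2"
    by (simp add: emeasure_unit)
  finally show ?thesis unfolding G_def v_def .
qed

section \<open>Sobolev inequality and compactness for test functions\<close>

lemma compactly_supported_translate:
  fixes f :: "'a::euclidean_space \<Rightarrow> 'b::real_normed_vector"
  assumes "compactly_supported f"
  shows "compactly_supported (\<lambda>x. f (x + h))"
proof -
  obtain K where K: "compact K" "\<And>x. x \<notin> K \<Longrightarrow> f x = 0" and c: "continuous_on UNIV f"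
    using assms unfolding compactly_supported_def by auto
  have "continuous_on UNIV (\<lambda>x. f (x + h))"
    by (rule continuous_on_compose2[OF c]) (auto intro!: continuous_intros)
  moreover have "compact ((\<lambda>x. x - h) ` K)"
    using K(1) by (intro compact_continuous_image continuous_intros)
  moreover have "f (x + h) = 0" if "x \<notin> (\<lambda>x. x - h) ` K" for x
    using that K(2)[of "x + h"] by (force simp: image_iff)
  ultimately show ?thesis
    unfolding compactly_supported_def by blast
qed

lemma compactly_supported_diff:
  assumes "compactly_supported f" "compactly_supported g"
  shows "compactly_supported (\<lambda>x. f x - g x)"
proof -
  obtain K L where "compact K" "\<And>x. x \<notin> K \<Longrightarrow> f x = 0" "compact L" "\<And>x. x \<notin> L \<Longrightarrow> g x = 0"
    using assms unfolding compactly_supported_def by metis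
  then have "compact (K \<union> L)" "\<And>x. x \<notin> K \<union> L \<Longrightarrow> f x - g x = 0"
    by auto
  then show ?thesis
    using assms unfolding compactly_supported_def by (auto intro!: continuous_on_diff)
qed

lemma nn_integral_compactly_supported:
  fixes f :: "'a::euclidean_space \<Rightarrow> real"
  assumes "compactly_supported f" "\<And>x. 0 \<le> f x"
  shows "(\<integral>\<^sup>+x. ennreal (f x) \<partial>lborel) = ennreal (LINT x|lborel. f x)"
  using compactly_supported_integrable[OF assms(1)] assms(2) by (intro nn_integral_eq_integral) auto

lemma compactly_supported_power:
  fixes f :: "'a::euclidean_space \<Rightarrow> real"
  assumes "compactly_supported f" "0 < n"
  shows "compactly_supported (\<lambda>x. f x ^ n)"
  using assms by (intro compactly_supported_compose[where h = "\<lambda>y. y ^ n"]) (auto intro!: continuous_intros simp: zero_power)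

lemma compactly_supported_norm_square:
  fixes f :: "'a::euclidean_space \<Rightarrow> 'b::real_normed_vector"
  assumes "compactly_supported f"
  shows "compactly_supported (\<lambda>x. (norm (f x))\<^sup>2)"
  using assms by (intro compactly_supported_compose[where h = "\<lambda>y. (norm y)\<^sup>2"]) (auto intro!: continuous_intros)

lemma translation_estimate_real:
  fixes \<phi> :: "'a::euclidean_space \<Rightarrow> real"
  assumes \<phi>: "\<phi> \<in> test_functions \<Omega>"
  shows "(LINT x|lborel. (\<phi> (x + h) - \<phi> x)\<^sup>2) \<le> (norm h)\<^sup>2 * (LINT x|lborel. (norm (grad \<phi> x))\<^sup>2)"
proof -
  have c: "compactly_supported (\<lambda>x. (\<phi> (x + h) - \<phi> x)\<^sup>2)" "compactly_supported (\<lambda>x. (norm (grad \<phi> x))\<^sup>2)"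
    using compactly_supported_test_function[OF \<phi>] compactly_supported_grad[OF \<phi>]
    by (auto intro!: compactly_supported_power compactly_supported_diff compactly_supported_translate compactly_supported_norm_square)
  show ?thesis
    using translation_estimate[OF \<phi>, of h]
    unfolding nn_integral_compactly_supported[OF c(1), simplified] nn_integral_compactly_supported[OF c(2), simplified]
    by (simp flip: ennreal_mult)
qed

text \<open>A translation by \<open>3 * R\<close> moves \<open>\<Omega>\<close> off itself, so on
  \<open>\<Omega>\<close> the increment of \<open>\<phi>\<close> equals \<open>- \<phi>\<close> and
  the translation estimate controls the whole \<open>L^2\<close> norm.\<close>

lemma poincare_test_function:
  fixes \<Omega> :: "'a::euclidean_space set"
  assumes "bounded \<Omega>"
  obtains C where "0 < C" "\<And>\<phi>. \<phi> \<in> test_functions \<Omega> \<Longrightarrow>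
    (LINT x|lborel. (\<phi> x)\<^sup>2) \<le> C * (LINT x|lborel. (norm (grad \<phi> x))\<^sup>2)"
proof -
  obtain R where R: "0 < R" "\<And>x. x \<in> \<Omega> \<Longrightarrow> norm x \<le> R"
    using assms unfolding bounded_pos by blast
  obtain b :: 'a where b: "b \<in> Basis" using nonempty_Basis by blast
  define h where "h = (3 * R) *\<^sub>R b"
  have h: "norm h = 3 * R" unfolding h_def using b R by simp
  have "(LINT x|lborel. (\<phi> x)\<^sup>2) \<le> (3 * R)\<^sup>2 * (LINT x|lborel. (norm (grad \<phi> x))\<^sup>2)" if \<phi>: "\<phi> \<in> test_functions \<Omega>" for \<phi>
  proof -
    have "(\<phi> x)\<^sup>2 \<le> (\<phi> (x + h) - \<phi> x)\<^sup>2" for x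
    proof (cases "x \<in> \<Omega>")
      case True
      have "x + h \<notin> \<Omega>"
      proof
        assume "x + h \<in> \<Omega>"
        then have "norm (x + h) \<le> R" "norm x \<le> R" using R True by auto
        moreover have "norm h \<le> norm (x + h) + norm x"
          using norm_triangle_ineq4[of "x + h" x] by simp
        ultimately show False using h R(1) by simp
      qed
      then show ?thesis using test_function_eq_0_outside[OF \<phi>] by simp
    next
      case False
      then show ?thesis using test_function_eq_0_outside[OF \<phi>] by simp
    qed
    then have "(LINT x|lborel. (\<phi> x)\<^sup>2) \<le> (LINT x|lborel. (\<phi> (x + h) - \<phi> x)\<^sup>2)"
      using compactly_supported_test_function[OF \<phi>]
      by (intro integral_mono compactly_supported_integrable)
        (auto intro!: compactly_supported_power compactly_supported_diff compactly_supported_translate)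
    also have "\<dots> \<le> (3 * R)\<^sup>2 * (LINT x|lborel. (norm (grad \<phi> x))\<^sup>2)"
      using translation_estimate_real[OF \<phi>, of h] h by simp
    finally show ?thesis .
  qed
  then show ?thesis
    using that[of "(3 * R)\<^sup>2"] R(1) by auto
qed

lemma power4_add_le: "((a::real) + b) ^ 4 \<le> 8 * (a ^ 4 + b ^ 4)"
proof -
  have "(a + b)\<^sup>2 \<le> 2 * (a\<^sup>2 + b\<^sup>2)"
    using zero_le_power2[of "a - b"] by (simp add: power2_eq_square algebra_simps)
  then have "((a + b)\<^sup>2)\<^sup>2 \<le> (2 * (a\<^sup>2 + b\<^sup>2))\<^sup>2"
    by (intro power_mono) auto
  moreover have "(2 * (a\<^sup>2 + b\<^sup>2))\<^sup>2 \<le> 8 * ((a\<^sup>2)\<^sup>2 + (b\<^sup>2)\<^sup>2)"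
    using zero_le_power2[of "a\<^sup>2 - b\<^sup>2"] by (simp add: power2_eq_square algebra_simps)
  ultimately show ?thesis by simp
qed

lemma power4_diff_le: "((a::real) - b) ^ 4 \<le> 8 * (a ^ 4 + b ^ 4)"
  using power4_add_le[of a "- b"] by simp

text \<open>\<open>\<phi>\<close> is its mean over unit balls minus the error of that mean. The
  error is covered by \<open>ball_mean_L4\<close> with radius 1. The mean is bounded and square
  integrable, so its fourth power is at most the square of its supremum times its own square. The
  constant depends on the dimension alone.\<close>

lemma test_function_L4:
  assumes dim: "DIM('a::euclidean_space) \<le> 3"
  obtains C where "0 < C" "\<And>(\<phi>::'a \<Rightarrow> real) \<Omega>. \<phi> \<in> test_functions \<Omega> \<Longrightarrow>
    (LINT x|lborel. \<phi> x ^ 4) \<le> C * ((LINT x|lborel. (\<phi> x)\<^sup>2) + (LINT x|lborel. (norm (grad \<phi> x))\<^sup>2))\<^sup>2"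
proof -
  define v where "v = measure lborel (cball (0::'a) 1)"
  have v: "0 < v" unfolding v_def by (rule content_cball_pos) simp
  define C where "C = 8 * (256 / v + 1 / v)"
  have "(LINT x|lborel. \<phi> x ^ 4) \<le> C * ((LINT x|lborel. (\<phi> x)\<^sup>2) + (LINT x|lborel. (norm (grad \<phi> x))\<^sup>2))\<^sup>2"
    if \<phi>: "\<phi> \<in> test_functions \<Omega>" for \<phi> :: "'a \<Rightarrow> real" and \<Omega>
  proof -
    define G where "G = (LINT x|lborel. (norm (grad \<phi> x))\<^sup>2)"
    define N where "N = (LINT x|lborel. (\<phi> x)\<^sup>2)"
    have c: "compactly_supported \<phi>" using compactly_supported_test_function[OF \<phi>] .
    have [measurable]: "\<phi> \<in> borel_measurable borel" "ball_mean 1 \<phi> \<in> borel_measurable borel"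
      using compactly_supported_measurable[OF c] ball_mean_measurable[OF c] .
    have G: "(\<integral>\<^sup>+x. ennreal ((norm (grad \<phi> x))\<^sup>2) \<partial>lborel) = ennreal G" "0 \<le> G"
      unfolding G_def using compactly_supported_grad[OF \<phi>]
      by (auto intro!: nn_integral_compactly_supported compactly_supported_norm_square)
    have N: "(\<integral>\<^sup>+x. ennreal ((\<phi> x)\<^sup>2) \<partial>lborel) = ennreal N" "0 \<le> N"
      unfolding N_def using c
      by (auto intro!: nn_integral_compactly_supported compactly_supported_power)
    have "ennreal (LINT x|lborel. \<phi> x ^ 4) = (\<integral>\<^sup>+x. ennreal (\<phi> x ^ 4) \<partial>lborel)"
      using c by (intro nn_integral_compactly_supported[symmetric] compactly_supported_power) auto
    also have "\<dots> \<le> (\<integral>\<^sup>+x. 8 * (ennreal ((ball_mean 1 \<phi> x - \<phi> x) ^ 4) + ennreal (ball_mean 1 \<phi> x ^ 4)) \<partial>lborel)"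
    proof (rule nn_integral_mono)
      fix x
      have "\<phi> x ^ 4 \<le> 8 * ((ball_mean 1 \<phi> x - \<phi> x) ^ 4 + ball_mean 1 \<phi> x ^ 4)"
        using power4_diff_le[of "ball_mean 1 \<phi> x" "ball_mean 1 \<phi> x - \<phi> x"] by simp
      then have "ennreal (\<phi> x ^ 4) \<le> ennreal (8 * ((ball_mean 1 \<phi> x - \<phi> x) ^ 4 + ball_mean 1 \<phi> x ^ 4))"
        by (rule ennreal_leI)
      then show "ennreal (\<phi> x ^ 4) \<le> 8 * (ennreal ((ball_mean 1 \<phi> x - \<phi> x) ^ 4) + ennreal (ball_mean 1 \<phi> x ^ 4))"
        by (simp add: ennreal_mult)
    qed
    also have "\<dots> = 8 * ((\<integral>\<^sup>+x. ennreal ((ball_mean 1 \<phi> x - \<phi> x) ^ 4) \<partial>lborel) + (\<integral>\<^sup>+x. ennreal (ball_mean 1 \<phi> x ^ 4) \<partial>lborel))"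
      by (simp add: nn_integral_cmult nn_integral_add)
    also have "\<dots> \<le> 8 * (ennreal (256 / v) * (ennreal G)\<^sup>2 + ennreal (1 / v) * ennreal N * ennreal N)"
    proof (intro mult_left_mono add_mono)
      show "(\<integral>\<^sup>+x. ennreal ((ball_mean 1 \<phi> x - \<phi> x) ^ 4) \<partial>lborel) \<le> ennreal (256 / v) * (ennreal G)\<^sup>2"
        using ball_mean_L4[OF \<phi> zero_less_one dim] unfolding v_def G by simp
      have "(\<integral>\<^sup>+x. ennreal (ball_mean 1 \<phi> x ^ 4) \<partial>lborel) \<le> (\<integral>\<^sup>+x. ennreal (1 / v) * ennreal N * ennreal ((ball_mean 1 \<phi> x)\<^sup>2) \<partial>lborel)"
      proof (rule nn_integral_mono)
        fix x
        have "ennreal (ball_mean 1 \<phi> x ^ 4) = ennreal ((ball_mean 1 \<phi> x)\<^sup>2) * ennreal ((ball_mean 1 \<phi> x)\<^sup>2)"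
          by (simp add: ennreal_mult[symmetric] power4_eq_xxxx power2_eq_square mult_ac)
        also have "\<dots> \<le> (ennreal (1 / v) * ennreal N) * ennreal ((ball_mean 1 \<phi> x)\<^sup>2)"
          using ball_mean_sup[OF c zero_less_one, of x] unfolding v_def N by (intro mult_right_mono) simp_all
        finally show "ennreal (ball_mean 1 \<phi> x ^ 4) \<le> ennreal (1 / v) * ennreal N * ennreal ((ball_mean 1 \<phi> x)\<^sup>2)" .
      qed
      also have "\<dots> = ennreal (1 / v) * ennreal N * (\<integral>\<^sup>+x. ennreal ((ball_mean 1 \<phi> x)\<^sup>2) \<partial>lborel)"
        by (rule nn_integral_cmult) measurable
      also have "\<dots> \<le> ennreal (1 / v) * ennreal N * ennreal N"
        using ball_mean_L2[OF c, of 1] unfolding N by (intro mult_left_mono) simp_all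
      finally show "(\<integral>\<^sup>+x. ennreal (ball_mean 1 \<phi> x ^ 4) \<partial>lborel) \<le> ennreal (1 / v) * ennreal N * ennreal N" .
    qed simp
    also have "\<dots> = ennreal (8 * (256 / v * G\<^sup>2 + 1 / v * N * N))"
    proof -
      have "ennreal (8 * (256 / v * G\<^sup>2 + 1 / v * N * N)) = ennreal 8 * (ennreal (256 / v * G\<^sup>2) + ennreal (1 / v * N * N))"
        using v G N by (subst ennreal_mult) (auto simp: ennreal_plus)
      also have "ennreal (256 / v * G\<^sup>2) = ennreal (256 / v) * (ennreal G)\<^sup>2"
        using v G by (simp add: ennreal_power ennreal_mult[symmetric])
      also have "ennreal (1 / v * N * N) = ennreal (1 / v) * ennreal N * ennreal N"
        using v N by (simp add: ennreal_mult[symmetric])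
      finally show ?thesis by simp
    qed
    finally have "(LINT x|lborel. \<phi> x ^ 4) \<le> 8 * (256 / v * G\<^sup>2 + 1 / v * N * N)"
      using v G N by (subst (asm) ennreal_le_iff) auto
    also have "\<dots> \<le> C * (N + G)\<^sup>2"
    proof -
      have "G\<^sup>2 \<le> (N + G)\<^sup>2" "N * N \<le> (N + G)\<^sup>2"
        using G N by (auto simp: power2_eq_square algebra_simps)
      then have "256 / v * G\<^sup>2 + 1 / v * (N * N) \<le> 256 / v * (N + G)\<^sup>2 + 1 / v * (N + G)\<^sup>2"
        using v by (intro add_mono mult_left_mono) auto
      then have "8 * (256 / v * G\<^sup>2 + 1 / v * (N * N)) \<le> 8 * (256 / v * (N + G)\<^sup>2 + 1 / v * (N + G)\<^sup>2)"
        by (rule mult_left_mono) simp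
      then show ?thesis unfolding C_def by (simp only: distrib_right mult.assoc)
    qed
    finally show ?thesis unfolding N_def G_def .
  qed
  then show ?thesis
    using that[of C] v unfolding C_def by auto
qed

section \<open>Integration by parts\<close>

lemma integral_translation:
  fixes f :: "'a::euclidean_space \<Rightarrow> real"
  assumes "f \<in> borel_measurable borel"
  shows "(LINT x|lborel. f (x + a)) = (LINT x|lborel. f x)"
proof -
  have "(LINT x|lborel. f x) = (LINT x|distr lborel borel ((+) a). f x)"
    by (simp add: lborel_distr_plus)
  also have "\<dots> = (LINT x|lborel. f (x + a))"
    using assms by (subst integral_distr) (auto simp: add.commute)
  finally show ?thesis by simp
qed

text \<open>Difference quotients have integral 0 by translation invariance. They share a Lipschitz
  bound and, for steps of at most 1, live in one ball, so the limit passes under the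
  integral.\<close>

lemma integral_partial_eq_0:
  fixes F :: "'a::euclidean_space \<Rightarrow> real"
  assumes F: "F \<in> test_functions \<Omega>"
  shows "(LINT x|lborel. grad F x \<bullet> b) = 0"
proof -
  have c: "compactly_supported F" using compactly_supported_test_function[OF F] .
  obtain K where K: "compact K" "\<And>x. x \<notin> K \<Longrightarrow> F x = 0"
    using F by (auto elim: test_functionsE)
  obtain R where R: "0 < R" "\<And>x. x \<in> K \<Longrightarrow> norm x \<le> R"
    using compact_imp_bounded[OF K(1)] unfolding bounded_pos by blast
  obtain B where B: "0 \<le> B" "\<And>x. norm (grad F x) \<le> B"
    using compactly_supported_bounded[OF compactly_supported_grad[OF F]] by metis
  have [measurable]: "F \<in> borel_measurable borel" "grad F \<in> borel_measurable borel"
    using compactly_supported_measurable[OF c] compactly_supported_measurable[OF compactly_supported_grad[OF F]] .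
  define h where "h n = inverse (real (Suc n))" for n
  have h: "0 < h n" "h n \<le> 1" "h \<longlonglongrightarrow> 0" for n
    unfolding h_def using LIMSEQ_inverse_real_of_nat by (auto simp: inverse_le_1_iff)
  define q where "q n x = (F (x + h n *\<^sub>R b) - F x) / h n" for n x
  have lip: "\<bar>F (x + y) - F x\<bar> \<le> B * norm y" for x y
  proof -
    have "norm (F (x + y) - F x) \<le> B * norm ((x + y) - x)"
    proof (rule differentiable_bound[of UNIV F "\<lambda>x h. grad F x \<bullet> h"])
      show "(F has_derivative (\<lambda>h. grad F z \<bullet> h)) (at z within UNIV)" for z
        using has_derivative_grad[OF test_function_differentiable[OF F]] by simp
      show "onorm (\<lambda>h. grad F z \<bullet> h) \<le> B" for z
      proof (rule onorm_le)
        fix h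
        have "\<bar>grad F z \<bullet> h\<bar> \<le> norm (grad F z) * norm h"
          by (rule Cauchy_Schwarz_ineq2)
        also have "\<dots> \<le> B * norm h"
          using B(2) by (rule mult_right_mono) simp
        finally show "norm (grad F z \<bullet> h) \<le> B * norm h" by simp
      qed
    qed auto
    then show ?thesis by simp
  qed
  have "(\<lambda>n. LINT x|lborel. q n x) \<longlonglongrightarrow> (LINT x|lborel. grad F x \<bullet> b)"
  proof (rule integral_dominated_convergence[where w = "\<lambda>x. B * norm b * indicator (cball 0 (R + norm b)) x"])
    show "integrable lborel (\<lambda>x. B * norm b * indicator (cball 0 (R + norm b)) x)"
      by (intro integrable_mult_right integrable_real_indicator emeasure_lborel_cball_finite) simp
    show "AE x in lborel. (\<lambda>n. q n x) \<longlonglongrightarrow> grad F x \<bullet> b"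
    proof (rule AE_I2)
      fix x
      have "((\<lambda>t. F (x + t *\<^sub>R b)) has_derivative (\<lambda>t. grad F x \<bullet> (t *\<^sub>R b))) (at 0)"
      proof (rule has_derivative_compose[of "\<lambda>t. x + t *\<^sub>R b" "\<lambda>t. t *\<^sub>R b" 0 UNIV F "\<lambda>h. grad F x \<bullet> h"])
        show "((\<lambda>t. x + t *\<^sub>R b) has_derivative (\<lambda>t. t *\<^sub>R b)) (at 0)"
          by (auto intro!: derivative_eq_intros)
        show "(F has_derivative (\<lambda>h. grad F x \<bullet> h)) (at (x + 0 *\<^sub>R b))"
          using has_derivative_grad[OF test_function_differentiable[OF F]] by simp
      qed
      then have "((\<lambda>t. F (x + t *\<^sub>R b)) has_field_derivative grad F x \<bullet> b) (at 0)"
        by (simp add: has_field_derivative_def mult.commute[of _ "grad F x \<bullet> b"])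
      then have "((\<lambda>t. (F (x + t *\<^sub>R b) - F x) / t) \<longlongrightarrow> grad F x \<bullet> b) (at 0)"
        unfolding has_field_derivative_iff by simp
      moreover have "filterlim h (at 0) sequentially"
        using h by (auto simp: filterlim_at intro!: always_eventually) (metis less_irrefl)
      ultimately show "(\<lambda>n. q n x) \<longlonglongrightarrow> grad F x \<bullet> b"
        unfolding q_def by (rule filterlim_compose)
    qed
    show "AE x in lborel. norm (q n x) \<le> B * norm b * indicator (cball 0 (R + norm b)) x" for n
    proof (rule AE_I2)
      fix x
      show "norm (q n x) \<le> B * norm b * indicator (cball 0 (R + norm b)) x"
      proof (cases "norm x \<le> R + norm b")
        case True
        have "\<bar>F (x + h n *\<^sub>R b) - F x\<bar> \<le> B * (h n * norm b)"
          using lip[of x "h n *\<^sub>R b"] h(1)[of n] by simp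
        then show ?thesis
          unfolding q_def using h(1)[of n] True by (simp add: abs_divide field_simps)
      next
        case False
        have "x \<notin> K" "x + h n *\<^sub>R b \<notin> K"
        proof -
          show "x \<notin> K" using R(2)[of x] False norm_ge_zero[of b] by linarith
          have "norm (h n *\<^sub>R b) \<le> norm b"
            using h(1,2)[of n] by (simp add: mult_left_le_one_le)
          moreover have "norm x \<le> norm (x + h n *\<^sub>R b) + norm (h n *\<^sub>R b)"
            using norm_triangle_ineq4[of "x + h n *\<^sub>R b" "h n *\<^sub>R b"] by simp
          ultimately show "x + h n *\<^sub>R b \<notin> K"
            using R(2)[of "x + h n *\<^sub>R b"] False by linarith
        qed
        then show ?thesis unfolding q_def using K(2) False by simp
      qed
    qed
  qed (auto simp: q_def)
  moreover have "(LINT x|lborel. q n x) = 0" for n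
    unfolding q_def
    using integral_translation[of F "h n *\<^sub>R b"] compactly_supported_integrable[OF c]
      compactly_supported_integrable[OF compactly_supported_translate[OF c]]
    by (simp add: Bochner_Integration.integral_diff)
  ultimately show ?thesis
    by (simp add: LIMSEQ_const_iff)
qed

lemma integration_by_parts_test:
  fixes \<phi> \<psi> :: "'a::euclidean_space \<Rightarrow> real"
  assumes \<phi>: "\<phi> \<in> test_functions \<Omega>" and \<psi>: "\<psi> \<in> test_functions \<Omega>'"
  shows "(LINT x|lborel. \<phi> x * (grad \<psi> x \<bullet> b)) = - (LINT x|lborel. (grad \<phi> x \<bullet> b) * \<psi> x)"
proof -
  have F: "(\<lambda>x. \<phi> x * \<psi> x) \<in> test_functions \<Omega>'"
    using \<phi> \<psi> by (intro test_functions_mult) (auto elim: test_functionsE)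
  have cont: "continuous_on UNIV (\<lambda>x. grad \<psi> x \<bullet> b)" "continuous_on UNIV (\<lambda>x. grad \<phi> x \<bullet> b)"
    using continuous_grad_test_function[OF \<phi>] continuous_grad_test_function[OF \<psi>]
    by (auto intro!: continuous_intros)
  have int: "integrable lborel (\<lambda>x. \<phi> x * (grad \<psi> x \<bullet> b))" "integrable lborel (\<lambda>x. \<psi> x * (grad \<phi> x \<bullet> b))"
    using cont compactly_supported_test_function[OF \<phi>] compactly_supported_test_function[OF \<psi>]
    by (auto intro!: compactly_supported_integrable compactly_supported_mult)
  have "0 = (LINT x|lborel. grad (\<lambda>x. \<phi> x * \<psi> x) x \<bullet> b)"
    using integral_partial_eq_0[OF F] by simp
  also have "\<dots> = (LINT x|lborel. \<phi> x * (grad \<psi> x \<bullet> b) + \<psi> x * (grad \<phi> x \<bullet> b))"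
    using test_function_differentiable[OF \<phi>] test_function_differentiable[OF \<psi>]
    by (simp add: grad_mult inner_add_left)
  also have "\<dots> = (LINT x|lborel. \<phi> x * (grad \<psi> x \<bullet> b)) + (LINT x|lborel. (grad \<phi> x \<bullet> b) * \<psi> x)"
    using int by (subst Bochner_Integration.integral_add) (auto simp: mult.commute)
  finally show ?thesis by simp
qed

section \<open>Convergence of means and compactness in L^4\<close>

lemma ball_mean_diff:
  fixes f g :: "'a::euclidean_space \<Rightarrow> real"
  assumes "compactly_supported f" "compactly_supported g"
  shows "ball_mean e (\<lambda>x. f x - g x) x = ball_mean e f x - ball_mean e g x"
  unfolding ball_mean_def using ball_mean_integrable[OF assms(1)] ball_mean_integrable[OF assms(2)]
  by (rule Bochner_Integration.integral_diff)

lemma ball_mean_lipschitz: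
  fixes \<phi> :: "'a::euclidean_space \<Rightarrow> real"
  assumes \<phi>: "\<phi> \<in> test_functions \<Omega>" and e: "0 < e"
  shows "(ball_mean e \<phi> y - ball_mean e \<phi> x)\<^sup>2
    \<le> 1 / (measure lborel (cball (0::'a) 1) * e ^ DIM('a)) * ((norm (y - x))\<^sup>2 * (LINT x|lborel. (norm (grad \<phi> x))\<^sup>2))"
proof -
  define h where "h = y - x"
  have c: "compactly_supported \<phi>" "compactly_supported (\<lambda>x. \<phi> (x + h))"
    using compactly_supported_test_function[OF \<phi>] compactly_supported_translate by blast+
  have v: "0 < measure lborel (cball (0::'a) 1)" by (rule content_cball_pos) simp
  have "ball_mean e \<phi> y - ball_mean e \<phi> x = ball_mean e (\<lambda>x. \<phi> (x + h) - \<phi> x) x"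
    unfolding ball_mean_diff[OF c(2,1)] by (simp add: ball_mean_def h_def algebra_simps)
  then have "ennreal ((ball_mean e \<phi> y - ball_mean e \<phi> x)\<^sup>2)
      \<le> ennreal (1 / (measure lborel (cball (0::'a) 1) * e ^ DIM('a))) * (\<integral>\<^sup>+x. ennreal ((\<phi> (x + h) - \<phi> x)\<^sup>2) \<partial>lborel)"
    using ball_mean_sup[OF compactly_supported_diff[OF c(2,1)] e, of x] by simp
  also have "(\<integral>\<^sup>+x. ennreal ((\<phi> (x + h) - \<phi> x)\<^sup>2) \<partial>lborel) = ennreal (LINT x|lborel. (\<phi> (x + h) - \<phi> x)\<^sup>2)"
    using c by (intro nn_integral_compactly_supported compactly_supported_power compactly_supported_diff) auto
  finally have "(ball_mean e \<phi> y - ball_mean e \<phi> x)\<^sup>2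
      \<le> 1 / (measure lborel (cball (0::'a) 1) * e ^ DIM('a)) * (LINT x|lborel. (\<phi> (x + h) - \<phi> x)\<^sup>2)"
    using v e by (simp flip: ennreal_mult)
  also have "\<dots> \<le> 1 / (measure lborel (cball (0::'a) 1) * e ^ DIM('a)) * ((norm h)\<^sup>2 * (LINT x|lborel. (norm (grad \<phi> x))\<^sup>2))"
    using v e by (intro mult_left_mono translation_estimate_real[OF \<phi>]) auto
  finally show ?thesis unfolding h_def .
qed

text \<open>The pointwise half of the Arzela-Ascoli argument: a common Lipschitz constant carries
  convergence from a dense set to all points.\<close>

lemma equi_lipschitz_convergent:
  fixes f :: "nat \<Rightarrow> 'a::euclidean_space \<Rightarrow> real"
  assumes D: "closure D = UNIV" and conv: "\<And>x. x \<in> D \<Longrightarrow> convergent (\<lambda>n. f n x)"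
    and lip: "\<And>n x y. \<bar>f n y - f n x\<bar> \<le> B * norm (y - x)"
  shows "convergent (\<lambda>n. f n x)"
proof -
  have "Cauchy (\<lambda>n. f n x)"
  proof (rule CauchyI)
    fix e :: real assume e: "0 < e"
    define d where "d = e / (4 * (\<bar>B\<bar> + 1))"
    have d: "0 < d" "\<bar>B\<bar> * d \<le> e / 4"
      unfolding d_def using e by (auto simp: field_simps)
    obtain y where y: "y \<in> D" "dist y x < d"
      using D d(1) closure_approachable[of x D] by auto
    have "\<bar>f n y - f n x\<bar> \<le> e / 4" for n
    proof -
      have "B * norm (y - x) \<le> \<bar>B\<bar> * d"
        using y(2) by (intro mult_mono) (auto simp: dist_norm)
      then show ?thesis using lip[of n y x] d(2) by simp
    qed
    note close = this
    obtain M where M: "\<And>m n. M \<le> m \<Longrightarrow> M \<le> n \<Longrightarrow> norm (f m y - f n y) < e / 4"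
      using CauchyD[OF convergent_Cauchy[OF conv[OF y(1)]], of "e / 4"] e by auto
    have "norm (f m x - f n x) < e" if "M \<le> m" "M \<le> n" for m n
      using close[of m] close[of n] M[OF that] by (simp add: abs_if split: if_splits)
    then show "\<exists>M. \<forall>m\<ge>M. \<forall>n\<ge>M. norm (f m x - f n x) < e" by blast
  qed
  then show ?thesis by (rule Cauchy_convergent)
qed

text \<open>One diagonal extraction over the countable set of pairs of a dense point and a radius
  index serves all radii at once. For each fixed radius the common Lipschitz bound then reaches the
  remaining points.\<close>

lemma ball_means_convergent_subsequence:
  fixes \<phi> :: "nat \<Rightarrow> 'a::euclidean_space \<Rightarrow> real"
  assumes \<phi>: "\<And>n. \<phi> n \<in> test_functions \<Omega>"
    and N: "\<And>n. (LINT x|lborel. (\<phi> n x)\<^sup>2) \<le> M" and G: "\<And>n. (LINT x|lborel. (norm (grad (\<phi> n) x))\<^sup>2) \<le> M"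
  obtains r U B where "strict_mono (r :: nat \<Rightarrow> nat)"
    "\<And>k x. (\<lambda>n. ball_mean (inverse (real (Suc k))) (\<phi> (r n)) x) \<longlonglongrightarrow> U k x"
    "\<And>k n x. \<bar>ball_mean (inverse (real (Suc k))) (\<phi> n) x\<bar> \<le> B k"
proof -
  define v where "v = measure lborel (cball (0::'a) 1)"
  have v: "0 < v" unfolding v_def by (rule content_cball_pos) simp
  define e where "e k = inverse (real (Suc k))" for k
  have e: "0 < e k" for k unfolding e_def by simp
  have "0 \<le> (LINT x|lborel. (\<phi> 0 x)\<^sup>2)" by simp
  then have M: "0 \<le> M" using N[of 0] by linarith
  define B where "B k = sqrt (1 / (v * e k ^ DIM('a)) * M)" for k
  have c: "compactly_supported (\<phi> n)" for n
    using compactly_supported_test_function[OF \<phi>] .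
  have bound: "\<bar>ball_mean (e k) (\<phi> n) x\<bar> \<le> B k" for k n x
  proof -
    have "ennreal ((ball_mean (e k) (\<phi> n) x)\<^sup>2) \<le> ennreal (1 / (v * e k ^ DIM('a))) * (\<integral>\<^sup>+x. ennreal ((\<phi> n x)\<^sup>2) \<partial>lborel)"
      unfolding v_def by (rule ball_mean_sup[OF c e])
    also have "(\<integral>\<^sup>+x. ennreal ((\<phi> n x)\<^sup>2) \<partial>lborel) = ennreal (LINT x|lborel. (\<phi> n x)\<^sup>2)"
      using c by (intro nn_integral_compactly_supported compactly_supported_power) auto
    also have "ennreal (1 / (v * e k ^ DIM('a))) * \<dots> \<le> ennreal (1 / (v * e k ^ DIM('a))) * ennreal M"
      by (intro mult_left_mono ennreal_leI N) simp
    finally have "(ball_mean (e k) (\<phi> n) x)\<^sup>2 \<le> 1 / (v * e k ^ DIM('a)) * M"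
      using v e[of k] M by (simp flip: ennreal_mult)
    then show ?thesis
      unfolding B_def by (intro real_le_rsqrt) simp
  qed
  have lip: "\<bar>ball_mean (e k) (\<phi> n) y - ball_mean (e k) (\<phi> n) x\<bar> \<le> B k * norm (y - x)" for k n x y
  proof -
    have "(ball_mean (e k) (\<phi> n) y - ball_mean (e k) (\<phi> n) x)\<^sup>2
        \<le> 1 / (v * e k ^ DIM('a)) * ((norm (y - x))\<^sup>2 * (LINT x|lborel. (norm (grad (\<phi> n) x))\<^sup>2))"
      unfolding v_def by (rule ball_mean_lipschitz[OF \<phi> e])
    also have "\<dots> \<le> 1 / (v * e k ^ DIM('a)) * ((norm (y - x))\<^sup>2 * M)"
      using v e[of k] by (intro mult_left_mono G) auto
    also have "\<dots> = (B k * norm (y - x))\<^sup>2"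
      unfolding B_def power_mult_distrib using v e[of k] M by (subst real_sqrt_pow2) auto
    finally show ?thesis
      using M v e[of k] by (subst (asm) abs_le_square_iff[symmetric]) (auto simp: B_def abs_mult)
  qed
  obtain D :: "'a set" where D: "countable D" "closure D = UNIV"
    using separable[of "UNIV :: 'a set"] by (metis top.extremum_uniqueI)
  \<comment> \<open>The division normalises all values into [-1, 1], as the selection theorem
    requires; the summand 1 prevents a zero denominator.\<close>
  define F where "F n p = ball_mean (e (snd p)) (\<phi> n) (fst p) / (B (snd p) + 1)" for n and p :: "'a \<times> nat"
  have B0: "0 \<le> B k" for k unfolding B_def using v e[of k] M by simp
  have F_le: "norm (F n p) \<le> 1" for n p
    unfolding F_def using bound[of "snd p" n "fst p"] B0[of "snd p"] by (simp add: abs_divide)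
  have "countable (D \<times> (UNIV :: nat set))"
    using D(1) by simp
  then obtain r where r: "strict_mono (r :: nat \<Rightarrow> nat)" "\<And>p. p \<in> D \<times> UNIV \<Longrightarrow> \<exists>l. (\<lambda>n. F (r n) p) \<longlonglongrightarrow> l"
    by (rule function_convergent_subsequence[OF _ F_le]) (rule that)
  have "convergent (\<lambda>n. ball_mean (e k) (\<phi> (r n)) x)" if xD: "x \<in> D" for k x
  proof -
    obtain l where "(\<lambda>n. F (r n) (x, k)) \<longlonglongrightarrow> l"
      using r(2)[of "(x, k)"] xD by auto
    then have "(\<lambda>n. F (r n) (x, k) * (B k + 1)) \<longlonglongrightarrow> l * (B k + 1)"
      by (intro tendsto_intros)
    then show ?thesis
      using B0[of k] unfolding F_def convergent_def by (auto simp: add_nonneg_eq_0_iff)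
  qed
  then have "convergent (\<lambda>n. ball_mean (e k) (\<phi> (r n)) x)" for k x
    using equi_lipschitz_convergent[OF D(2), of "\<lambda>n. ball_mean (e k) (\<phi> (r n))" "B k"] lip by blast
  then obtain U where "\<And>k x. (\<lambda>n. ball_mean (e k) (\<phi> (r n)) x) \<longlonglongrightarrow> U k x"
    unfolding convergent_def by metis
  then show ?thesis
    using that[OF r(1)] bound unfolding e_def by blast
qed

lemma power4_sum4_le: "((a::real) + b + (c + d)) ^ 4 \<le> 64 * (a ^ 4 + b ^ 4 + c ^ 4 + d ^ 4)"
proof -
  have "(a + b + (c + d)) ^ 4 \<le> 8 * ((a + b) ^ 4 + (c + d) ^ 4)"
    by (rule power4_add_le)
  also have "\<dots> \<le> 8 * (8 * (a ^ 4 + b ^ 4) + 8 * (c ^ 4 + d ^ 4))"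
    by (intro mult_left_mono add_mono power4_add_le) simp
  finally show ?thesis by simp
qed

lemma power4_commute: "((a::real) - b) ^ 4 = (b - a) ^ 4"
proof -
  have "((a - b)\<^sup>2)\<^sup>2 = ((b - a)\<^sup>2)\<^sup>2"
    unfolding power2_commute[of a b] ..
  then show ?thesis by simp
qed

text \<open>Kolmogorov's argument: replacing a function by its mean of radius
  \<open>1 / (k + 1)\<close> costs at most a multiple of \<open>1 / (k + 1)\<close>, uniformly in n,
  while for fixed k the means converge boundedly on \<open>\<Omega>\<close>.\<close>

lemma test_functions_L4_compact:
  fixes \<phi> :: "nat \<Rightarrow> 'a::euclidean_space \<Rightarrow> real"
  assumes \<Omega>: "open \<Omega>" "bounded \<Omega>" and dim: "DIM('a) \<le> 3" and \<phi>: "\<And>n. \<phi> n \<in> test_functions \<Omega>"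
    and N: "\<And>n. (LINT x|lborel. (\<phi> n x)\<^sup>2) \<le> M" and G: "\<And>n. (LINT x|lborel. (norm (grad (\<phi> n) x))\<^sup>2) \<le> M"
  obtains r where "strict_mono (r :: nat \<Rightarrow> nat)"
    "\<And>e. 0 < e \<Longrightarrow> \<exists>n0. \<forall>m\<ge>n0. \<forall>n\<ge>n0. (LINT x|lborel. (\<phi> (r m) x - \<phi> (r n) x) ^ 4) < e"
proof -
  define v where "v = measure lborel (cball (0::'a) 1)"
  have v: "0 < v" unfolding v_def by (rule content_cball_pos) simp
  have "0 \<le> (LINT x|lborel. (\<phi> 0 x)\<^sup>2)" by simp
  then have M: "0 \<le> M" using N[of 0] by linarith
  obtain r U B where r: "strict_mono (r :: nat \<Rightarrow> nat)"
    and U: "\<And>k x. (\<lambda>n. ball_mean (inverse (real (Suc k))) (\<phi> (r n)) x) \<longlonglongrightarrow> U k x"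
    and B: "\<And>k n x. \<bar>ball_mean (inverse (real (Suc k))) (\<phi> n) x\<bar> \<le> B k"
    by (rule ball_means_convergent_subsequence[OF \<phi> N G]) (rule that)
  define u where "u k n = ball_mean (inverse (real (Suc k))) (\<phi> (r n))" for k n
  have c: "compactly_supported (\<phi> n)" for n
    using compactly_supported_test_function[OF \<phi>] .
  have [measurable]: "u k n \<in> borel_measurable borel" "\<phi> n \<in> borel_measurable borel" for k n
    unfolding u_def using ball_mean_measurable[OF c] compactly_supported_measurable[OF c] .
  have ulim: "(\<lambda>n. u k n x) \<longlonglongrightarrow> U k x" for k x
    unfolding u_def by (rule U)
  have [measurable]: "U k \<in> borel_measurable borel" for k
    using ulim by (rule borel_measurable_LIMSEQ_real) measurable
  have ub: "\<bar>u k n x\<bar> \<le> B k" for k n x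
    unfolding u_def by (rule B)
  have Ub: "\<bar>U k x\<bar> \<le> B k" for k x
    using ub by (intro LIMSEQ_le_const2[OF tendsto_rabs[OF ulim]]) auto
  have [measurable]: "\<Omega> \<in> sets borel" using \<Omega>(1) by simp
  \<comment> \<open>Means spill over the boundary, and their constant bound is integrable only on a
    bounded set; hence the indicator.\<close>
  define \<delta> where "\<delta> k n = (\<integral>\<^sup>+x. ennreal ((u k n x - U k x) ^ 4) * indicator \<Omega> x \<partial>lborel)" for k n
  have \<delta>: "\<delta> k \<longlonglongrightarrow> 0" for k
  proof -
    have "(\<lambda>n. \<integral>\<^sup>+x. ennreal ((u k n x - U k x) ^ 4) * indicator \<Omega> x \<partial>lborel) \<longlonglongrightarrow> (\<integral>\<^sup>+x. 0 \<partial>(lborel :: 'a measure))"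
    proof (rule nn_integral_dominated_convergence[where w = "\<lambda>x. ennreal ((2 * B k) ^ 4) * indicator \<Omega> x"])
      show "AE x in lborel. ennreal ((u k n x - U k x) ^ 4) * indicator \<Omega> x \<le> ennreal ((2 * B k) ^ 4) * indicator \<Omega> x" for n
      proof (rule AE_I2)
        fix x
        have "\<bar>u k n x - U k x\<bar> \<le> 2 * B k"
          using ub[of k n x] Ub[of k x] by linarith
        then have "\<bar>u k n x - U k x\<bar> ^ 4 \<le> (2 * B k) ^ 4"
          by (rule power_mono) simp
        then show "ennreal ((u k n x - U k x) ^ 4) * indicator \<Omega> x \<le> ennreal ((2 * B k) ^ 4) * indicator \<Omega> x"
          by (intro mult_right_mono ennreal_leI) simp_all
      qed
      have "emeasure lborel \<Omega> < \<infinity>"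
        using emeasure_bounded_finite[OF \<Omega>(2)] by simp
      then show "(\<integral>\<^sup>+x. ennreal ((2 * B k) ^ 4) * indicator \<Omega> x \<partial>lborel) < \<infinity>"
        by (simp add: nn_integral_cmult ennreal_mult_less_top)
      show "AE x in lborel. (\<lambda>n. ennreal ((u k n x - U k x) ^ 4) * indicator \<Omega> x) \<longlonglongrightarrow> 0"
      proof (rule AE_I2)
        fix x
        have "(\<lambda>n. (u k n x - U k x) ^ 4) \<longlonglongrightarrow> (U k x - U k x) ^ 4"
          by (intro tendsto_intros ulim)
        then have "(\<lambda>n. ennreal ((u k n x - U k x) ^ 4)) \<longlonglongrightarrow> ennreal 0"
          by (intro tendsto_ennrealI) simp
        then show "(\<lambda>n. ennreal ((u k n x - U k x) ^ 4) * indicator \<Omega> x) \<longlonglongrightarrow> 0"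
          by (cases "x \<in> \<Omega>") auto
      qed
    qed measurable
    then show ?thesis unfolding \<delta>_def by simp
  qed
  define A where "A = 256 / v * M\<^sup>2"
  have A: "0 \<le> A" unfolding A_def using v by simp
  have smooth_err: "(\<integral>\<^sup>+x. ennreal ((u k n x - \<phi> (r n) x) ^ 4) * indicator \<Omega> x \<partial>lborel) \<le> ennreal (A / real (Suc k))" for k n
  proof -
    define e where "e = inverse (real (Suc k))"
    have e: "0 < e" "e \<le> 1" unfolding e_def by (auto simp: inverse_le_1_iff)
    have "(\<integral>\<^sup>+x. ennreal ((u k n x - \<phi> (r n) x) ^ 4) * indicator \<Omega> x \<partial>lborel)
        \<le> (\<integral>\<^sup>+x. ennreal ((ball_mean e (\<phi> (r n)) x - \<phi> (r n) x) ^ 4) \<partial>lborel)"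
      unfolding u_def e_def by (intro nn_integral_mono) (auto simp: indicator_def)
    also have "\<dots> \<le> ennreal (256 / v * (e ^ 4 / e ^ DIM('a))) * (\<integral>\<^sup>+x. ennreal ((norm (grad (\<phi> (r n)) x))\<^sup>2) \<partial>lborel)\<^sup>2"
      unfolding v_def by (rule ball_mean_L4[OF \<phi> e(1) dim])
    also have "\<dots> \<le> ennreal (256 / v * e) * (ennreal M)\<^sup>2"
    proof (rule mult_mono[OF ennreal_leI power_mono_ennreal])
      have "(\<integral>\<^sup>+x. ennreal ((norm (grad (\<phi> (r n)) x))\<^sup>2) \<partial>lborel) = ennreal (LINT x|lborel. (norm (grad (\<phi> (r n)) x))\<^sup>2)"
        using compactly_supported_grad[OF \<phi>]
        by (intro nn_integral_compactly_supported compactly_supported_norm_square) auto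
      then show "(\<integral>\<^sup>+x. ennreal ((norm (grad (\<phi> (r n)) x))\<^sup>2) \<partial>lborel) \<le> ennreal M"
        using ennreal_leI[OF G] by simp
      \<comment> \<open>Since the dimension is at most 3 and \<open>e \<le> 1\<close>, the quotient
        is at most \<open>e\<close> and the error vanishes with the radius.\<close>
      have "e ^ 4 = e ^ (4 - DIM('a)) * e ^ DIM('a)"
        using dim by (simp flip: power_add)
      then have "e ^ 4 / e ^ DIM('a) = e ^ (4 - DIM('a))"
        using e by simp
      also have "\<dots> \<le> e ^ 1"
        using e dim by (intro power_decreasing) auto
      finally show "256 / v * (e ^ 4 / e ^ DIM('a)) \<le> 256 / v * e"
        using v by (intro mult_left_mono) auto
    qed auto
    also have "\<dots> = ennreal (A / real (Suc k))"
    proof -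
      have "ennreal (256 / v * e) * (ennreal M)\<^sup>2 = ennreal (256 / v * e * M\<^sup>2)"
        using v M e by (simp only: ennreal_power[OF M]) (rule ennreal_mult[symmetric]; simp)
      also have "256 / v * e * M\<^sup>2 = A / real (Suc k)"
        unfolding A_def e_def by (simp add: inverse_eq_divide)
      finally show ?thesis .
    qed
    finally show ?thesis .
  qed
  have main: "ennreal (LINT x|lborel. (\<phi> (r m) x - \<phi> (r n) x) ^ 4)
      \<le> 64 * (ennreal (A / real (Suc k)) + ennreal (A / real (Suc k)) + \<delta> k m + \<delta> k n)" for k m n
  proof -
    have "ennreal (LINT x|lborel. (\<phi> (r m) x - \<phi> (r n) x) ^ 4) = (\<integral>\<^sup>+x. ennreal ((\<phi> (r m) x - \<phi> (r n) x) ^ 4) \<partial>lborel)"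
      using c by (intro nn_integral_compactly_supported[symmetric] compactly_supported_power compactly_supported_diff) auto
    also have "\<dots> \<le> (\<integral>\<^sup>+x. 64 * (ennreal ((u k m x - \<phi> (r m) x) ^ 4) * indicator \<Omega> x
        + ennreal ((u k n x - \<phi> (r n) x) ^ 4) * indicator \<Omega> x
        + ennreal ((u k m x - U k x) ^ 4) * indicator \<Omega> x + ennreal ((u k n x - U k x) ^ 4) * indicator \<Omega> x) \<partial>lborel)"
    proof (rule nn_integral_mono)
      fix x
      show "ennreal ((\<phi> (r m) x - \<phi> (r n) x) ^ 4) \<le> 64 * (ennreal ((u k m x - \<phi> (r m) x) ^ 4) * indicator \<Omega> x
        + ennreal ((u k n x - \<phi> (r n) x) ^ 4) * indicator \<Omega> x
        + ennreal ((u k m x - U k x) ^ 4) * indicator \<Omega> x + ennreal ((u k n x - U k x) ^ 4) * indicator \<Omega> x)"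
      proof (cases "x \<in> \<Omega>")
        case True
        have "(\<phi> (r m) x - \<phi> (r n) x) ^ 4 \<le> 64 * ((u k m x - \<phi> (r m) x) ^ 4 + (u k n x - \<phi> (r n) x) ^ 4
            + (u k m x - U k x) ^ 4 + (u k n x - U k x) ^ 4)"
          using power4_sum4_le[of "\<phi> (r m) x - u k m x" "u k n x - \<phi> (r n) x" "u k m x - U k x" "U k x - u k n x"]
          unfolding power4_commute[of "\<phi> (r m) x" "u k m x"] power4_commute[of "U k x"] by simp
        then have "ennreal ((\<phi> (r m) x - \<phi> (r n) x) ^ 4) \<le> ennreal (64 * ((u k m x - \<phi> (r m) x) ^ 4 + (u k n x - \<phi> (r n) x) ^ 4
            + (u k m x - U k x) ^ 4 + (u k n x - U k x) ^ 4))"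
          by (rule ennreal_leI)
        then show ?thesis using True by (simp add: ennreal_mult)
      next
        case False
        then show ?thesis using test_function_eq_0_outside[OF \<phi>] by simp
      qed
    qed
    also have "\<dots> = 64 * ((\<integral>\<^sup>+x. ennreal ((u k m x - \<phi> (r m) x) ^ 4) * indicator \<Omega> x \<partial>lborel)
        + (\<integral>\<^sup>+x. ennreal ((u k n x - \<phi> (r n) x) ^ 4) * indicator \<Omega> x \<partial>lborel) + \<delta> k m + \<delta> k n)"
      unfolding \<delta>_def by (simp add: nn_integral_cmult nn_integral_add)
    also have "\<dots> \<le> 64 * (ennreal (A / real (Suc k)) + ennreal (A / real (Suc k)) + \<delta> k m + \<delta> k n)"
      by (intro mult_left_mono add_mono smooth_err order_refl) simp
    finally show ?thesis .
  qed
  have "\<exists>n0. \<forall>m\<ge>n0. \<forall>n\<ge>n0. (LINT x|lborel. (\<phi> (r m) x - \<phi> (r n) x) ^ 4) < e" if e: "0 < e" for e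
  proof -
    \<comment> \<open>Four terms with the factor 64 of \<open>power4_sum4_le\<close> give
      \<open>256 * d = e / 2\<close>.\<close>
    define d where "d = e / 512"
    have d: "0 < d" unfolding d_def using e by simp
    obtain k where k: "A / d < real (Suc k)"
      using reals_Archimedean2[of "A / d"] by (meson less_trans lessI of_nat_less_iff)
    have kd: "A / real (Suc k) \<le> d"
      using k d by (simp add: field_simps)
    have "\<forall>\<^sub>F n in sequentially. \<delta> k n < ennreal d"
      using d by (intro order_tendstoD(2)[OF \<delta>]) simp
    then obtain n0 where n0: "\<And>n. n0 \<le> n \<Longrightarrow> \<delta> k n < ennreal d"
      unfolding eventually_sequentially by blast
    have "(LINT x|lborel. (\<phi> (r m) x - \<phi> (r n) x) ^ 4) < e" if "n0 \<le> m" "n0 \<le> n" for m n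
    proof -
      have "ennreal (LINT x|lborel. (\<phi> (r m) x - \<phi> (r n) x) ^ 4)
          \<le> 64 * (ennreal (A / real (Suc k)) + ennreal (A / real (Suc k)) + \<delta> k m + \<delta> k n)"
        by (rule main)
      also have "\<dots> \<le> 64 * (ennreal d + ennreal d + ennreal d + ennreal d)"
        using kd n0[OF that(1)] n0[OF that(2)] by (intro mult_left_mono add_mono ennreal_leI) auto
      also have "\<dots> = ennreal 64 * ennreal (d + d + d + d)"
        using d by (simp only: ennreal_plus[symmetric]) simp
      also have "\<dots> = ennreal (64 * (d + d + d + d))"
        using d by (intro ennreal_mult[symmetric]) auto
      finally have "(LINT x|lborel. (\<phi> (r m) x - \<phi> (r n) x) ^ 4) \<le> 64 * (d + d + d + d)"
        using d by (subst (asm) ennreal_le_iff) auto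
      then show ?thesis using e unfolding d_def by simp
    qed
    then show ?thesis by blast
  qed
  then show ?thesis using that r by blast
qed

section \<open>Square-integrable functions\<close>

definition L2 :: "'a measure \<Rightarrow> ('a \<Rightarrow> 'b::euclidean_space) \<Rightarrow> bool" where
  "L2 M f \<longleftrightarrow> f \<in> borel_measurable M \<and> integrable M (\<lambda>x. (norm (f x))\<^sup>2)"

text \<open>The square of the \<open>L^2\<close> norm: quadratic expansions stay polynomial, at the
  price of a factor 2 in the triangle inequality.\<close>

definition sqn :: "'a measure \<Rightarrow> ('a \<Rightarrow> 'b::euclidean_space) \<Rightarrow> real" where
  "sqn M f = (LINT x|M. (norm (f x))\<^sup>2)"

lemma L2_measurable [measurable_dest]: "L2 M f \<Longrightarrow> f \<in> borel_measurable M"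
  unfolding L2_def by simp

lemma L2_integrable: "L2 M f \<Longrightarrow> integrable M (\<lambda>x. (norm (f x))\<^sup>2)"
  unfolding L2_def by simp

lemma sqn_nonneg [simp]: "0 \<le> sqn M f"
  unfolding sqn_def by simp

lemma norm_add_square_le: "(norm (a + b))\<^sup>2 \<le> 2 * (norm a)\<^sup>2 + 2 * (norm b)\<^sup>2"
  for a b :: "'b::real_inner"
proof -
  have "0 \<le> (norm (a - b))\<^sup>2" by simp
  then show ?thesis
    by (simp add: power2_norm_eq_inner inner_add_left inner_add_right inner_diff_left inner_diff_right inner_commute)
qed

lemma L2_add:
  assumes "L2 M f" "L2 M g"
  shows "L2 M (\<lambda>x. f x + g x)"
proof -
  have [measurable]: "f \<in> borel_measurable M" "g \<in> borel_measurable M"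
    using assms by (auto simp: L2_def)
  have "integrable M (\<lambda>x. 2 * (norm (f x))\<^sup>2 + 2 * (norm (g x))\<^sup>2)"
    using assms by (auto simp: L2_def)
  then have "integrable M (\<lambda>x. (norm (f x + g x))\<^sup>2)"
    by (rule Bochner_Integration.integrable_bound) (auto simp: norm_add_square_le)
  then show ?thesis unfolding L2_def by simp
qed

lemma L2_scaleR: "L2 M f \<Longrightarrow> L2 M (\<lambda>x. c *\<^sub>R f x)"
  unfolding L2_def by (auto simp: power_mult_distrib)

lemma L2_cmult: "L2 M f \<Longrightarrow> L2 M (\<lambda>x. c * f x)" for f :: "'a \<Rightarrow> real"
  using L2_scaleR[of M f c] by simp

lemma L2_diff: "L2 M f \<Longrightarrow> L2 M g \<Longrightarrow> L2 M (\<lambda>x. f x - g x)"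
  using L2_add[of M f "\<lambda>x. (-1) *\<^sub>R g x"] L2_scaleR[of M g "-1"] by simp

lemma L2_0 [simp]: "L2 M (\<lambda>x. 0)"
  unfolding L2_def by simp

lemma sqn_add_le:
  assumes "L2 M f" "L2 M g"
  shows "sqn M (\<lambda>x. f x + g x) \<le> 2 * sqn M f + 2 * sqn M g"
proof -
  have "sqn M (\<lambda>x. f x + g x) \<le> (LINT x|M. 2 * (norm (f x))\<^sup>2 + 2 * (norm (g x))\<^sup>2)"
    unfolding sqn_def using assms L2_add[OF assms]
    by (intro integral_mono) (auto simp: L2_def norm_add_square_le)
  also have "\<dots> = 2 * sqn M f + 2 * sqn M g"
    unfolding sqn_def using assms by (simp add: L2_def)
  finally show ?thesis .
qed

lemma sqn_scaleR: "sqn M (\<lambda>x. c *\<^sub>R f x) = c\<^sup>2 * sqn M f"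
  unfolding sqn_def by (simp add: power_mult_distrib)

lemma sqn_minus_commute: "sqn M (\<lambda>x. f x - g x) = sqn M (\<lambda>x. g x - f x)"
  unfolding sqn_def by (simp add: norm_minus_commute)

lemma sqn_triangle:
  assumes "L2 M f" "L2 M g" "L2 M h"
  shows "sqn M (\<lambda>x. f x - h x) \<le> 2 * sqn M (\<lambda>x. f x - g x) + 2 * sqn M (\<lambda>x. g x - h x)"
  using sqn_add_le[OF L2_diff[OF assms(1,2)] L2_diff[OF assms(2,3)]] by simp

lemma sqn_cong_AE:
  assumes "AE x in M. f x = g x" "f \<in> borel_measurable M" "g \<in> borel_measurable M"
  shows "sqn M f = sqn M g"
  unfolding sqn_def using assms by (intro integral_cong_AE) auto

lemma L2_inner_integrable:
  assumes "L2 M f" "L2 M g"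
  shows "integrable M (\<lambda>x. f x \<bullet> g x)"
proof -
  have [measurable]: "f \<in> borel_measurable M" "g \<in> borel_measurable M"
    using assms by (auto simp: L2_def)
  have "integrable M (\<lambda>x. (norm (f x))\<^sup>2 + (norm (g x))\<^sup>2)"
    using assms by (auto simp: L2_def)
  then show ?thesis
  proof (rule Bochner_Integration.integrable_bound)
    show "AE x in M. norm (f x \<bullet> g x) \<le> norm ((norm (f x))\<^sup>2 + (norm (g x))\<^sup>2)"
    proof (rule AE_I2)
      fix x
      have "\<bar>f x \<bullet> g x\<bar> \<le> norm (f x) * norm (g x)" by (rule Cauchy_Schwarz_ineq2)
      moreover have "2 * (norm (f x) * norm (g x)) \<le> (norm (f x))\<^sup>2 + (norm (g x))\<^sup>2"
        using zero_le_power2[of "norm (f x) - norm (g x)"] by (simp add: power2_eq_square algebra_simps)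
      moreover have "0 \<le> norm (f x) * norm (g x)" by simp
      ultimately show "norm (f x \<bullet> g x) \<le> norm ((norm (f x))\<^sup>2 + (norm (g x))\<^sup>2)" by simp
    qed
  qed simp
qed

lemma L2_mult_integrable: "L2 M f \<Longrightarrow> L2 M g \<Longrightarrow> integrable M (\<lambda>x. f x * g x)" for f g :: "'a \<Rightarrow> real"
  using L2_inner_integrable[of M f g] by simp

lemma sqn_add_scale:
  assumes "L2 M f" "L2 M g"
  shows "sqn M (\<lambda>x. f x + t *\<^sub>R g x) = sqn M f + 2 * t * (LINT x|M. f x \<bullet> g x) + t\<^sup>2 * sqn M g"
proof -
  have "(norm (f x + t *\<^sub>R g x))\<^sup>2 = (norm (f x))\<^sup>2 + (2 * t) * (f x \<bullet> g x) + t\<^sup>2 * (norm (g x))\<^sup>2" for x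
    by (simp only: power2_norm_eq_inner)
      (simp add: inner_add_left inner_add_right inner_commute power2_eq_square algebra_simps)
  then show ?thesis
    unfolding sqn_def using L2_integrable[OF assms(1)] L2_integrable[OF assms(2)] L2_inner_integrable[OF assms]
    by simp
qed

lemma L2_cauchy_schwarz:
  assumes "L2 M f" "L2 M g"
  shows "(LINT x|M. f x \<bullet> g x)\<^sup>2 \<le> sqn M f * sqn M g"
proof -
  define i where "i = (LINT x|M. f x \<bullet> g x)"
  have nonneg: "0 \<le> sqn M f + 2 * t * i + t\<^sup>2 * sqn M g" for t
    unfolding i_def sqn_add_scale[OF assms, symmetric] by simp
  show ?thesis
  proof (cases "sqn M g = 0")
    case True
    have "i = 0"
    proof (rule ccontr)
      assume "i \<noteq> 0"
      \<comment> \<open>With vanishing leading coefficient the quadratic is affine, and this t gives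
        it the value -1.\<close>
      then show False
        using nonneg[of "- (sqn M f + 1) / (2 * i)"] True by (simp add: field_simps)
    qed
    then show ?thesis unfolding i_def by simp
  next
    case False
    then have g: "0 < sqn M g" using sqn_nonneg[of M g] by linarith
    \<comment> \<open>The quadratic is evaluated at its minimum
      \<open>t = - i / sqn M g\<close>.\<close>
    have "0 \<le> (sqn M f + 2 * (- i / sqn M g) * i + (- i / sqn M g)\<^sup>2 * sqn M g) * sqn M g"
      by (rule mult_nonneg_nonneg[OF nonneg]) (use g in simp)
    also have "\<dots> = sqn M f * sqn M g - i\<^sup>2"
      using g by (simp add: field_simps power2_eq_square)
    finally show ?thesis unfolding i_def by simp
  qed
qed

section \<open>Convergence and completeness in L^2\<close>

lemma L2_inner_tendsto:
  assumes f: "\<And>n. L2 M (f n)" "L2 M f0" and g: "L2 M g" and lim: "(\<lambda>n. sqn M (\<lambda>x. f n x - f0 x)) \<longlonglongrightarrow> 0"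
  shows "(\<lambda>n. LINT x|M. f n x \<bullet> g x) \<longlonglongrightarrow> (LINT x|M. f0 x \<bullet> g x)"
proof -
  have "(\<lambda>n. (LINT x|M. f n x \<bullet> g x) - (LINT x|M. f0 x \<bullet> g x)) \<longlonglongrightarrow> 0"
  proof (rule Lim_null_comparison)
    show "\<forall>\<^sub>F n in sequentially. norm ((LINT x|M. f n x \<bullet> g x) - (LINT x|M. f0 x \<bullet> g x))
        \<le> sqrt (sqn M (\<lambda>x. f n x - f0 x) * sqn M g)"
    proof (rule always_eventually, rule allI)
      fix n
      have "(LINT x|M. f n x \<bullet> g x) - (LINT x|M. f0 x \<bullet> g x) = (LINT x|M. (f n x - f0 x) \<bullet> g x)"
        using L2_inner_integrable[OF f(1) g] L2_inner_integrable[OF f(2) g]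
        by (simp add: inner_diff_left)
      then show "norm ((LINT x|M. f n x \<bullet> g x) - (LINT x|M. f0 x \<bullet> g x))
        \<le> sqrt (sqn M (\<lambda>x. f n x - f0 x) * sqn M g)"
        using L2_cauchy_schwarz[OF L2_diff[OF f(1) f(2)] g, of n] by (intro real_le_rsqrt) simp
    qed
    have "(\<lambda>n. sqrt (sqn M (\<lambda>x. f n x - f0 x) * sqn M g)) \<longlonglongrightarrow> sqrt (0 * sqn M g)"
      by (intro tendsto_intros lim)
    then show "(\<lambda>n. sqrt (sqn M (\<lambda>x. f n x - f0 x) * sqn M g)) \<longlonglongrightarrow> 0" by simp
  qed
  then show ?thesis by (simp add: LIM_zero_iff)
qed

lemma sqn_tendsto:
  assumes f: "\<And>n. L2 M (f n)" "L2 M f0" and lim: "(\<lambda>n. sqn M (\<lambda>x. f n x - f0 x)) \<longlonglongrightarrow> 0"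
  shows "(\<lambda>n. sqn M (f n)) \<longlonglongrightarrow> sqn M f0"
proof -
  have "sqn M (f n) = sqn M f0 + 2 * ((LINT x|M. f n x \<bullet> f0 x) - (LINT x|M. f0 x \<bullet> f0 x)) + sqn M (\<lambda>x. f n x - f0 x)" for n
  proof -
    have "(LINT x|M. f0 x \<bullet> (f n x - f0 x)) = (LINT x|M. f n x \<bullet> f0 x - f0 x \<bullet> f0 x)"
      by (intro Bochner_Integration.integral_cong refl) (simp only: inner_diff_right inner_commute)
    also have "\<dots> = (LINT x|M. f n x \<bullet> f0 x) - (LINT x|M. f0 x \<bullet> f0 x)"
      by (rule Bochner_Integration.integral_diff[OF L2_inner_integrable[OF f(1) f(2)] L2_inner_integrable[OF f(2) f(2)]])
    finally show ?thesis
      using sqn_add_scale[OF f(2) L2_diff[OF f(1) f(2)], of 1 n] by simp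
  qed
  moreover have "(\<lambda>n. sqn M f0 + 2 * ((LINT x|M. f n x \<bullet> f0 x) - (LINT x|M. f0 x \<bullet> f0 x)) + sqn M (\<lambda>x. f n x - f0 x))
      \<longlonglongrightarrow> sqn M f0 + 2 * ((LINT x|M. f0 x \<bullet> f0 x) - (LINT x|M. f0 x \<bullet> f0 x)) + 0"
    by (intro tendsto_intros lim L2_inner_tendsto f)
  ultimately show ?thesis by simp
qed

lemma nn_integral_sqn: "L2 M f \<Longrightarrow> (\<integral>\<^sup>+x. ennreal ((norm (f x))\<^sup>2) \<partial>M) = ennreal (sqn M f)"
  unfolding sqn_def L2_def by (intro nn_integral_eq_integral) auto

text \<open>With weights \<open>2 ^ k\<close> the integrals still sum to a finite value, so the
  weighted squares are summable almost everywhere. Pointwise, \<open>norm (a k x) \<le> (1 / 2) ^ k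
  + 2 ^ k * (norm (a k x))\<^sup>2\<close>.\<close>

lemma AE_summable_of_sqn:
  fixes a :: "nat \<Rightarrow> 'a \<Rightarrow> 'b::euclidean_space"
  assumes a: "\<And>k. L2 M (a k)" and s: "\<And>k. sqn M (a k) \<le> (1 / 4) ^ k"
  shows "AE x in M. summable (\<lambda>k. norm (a k x))"
proof -
  have [measurable]: "a k \<in> borel_measurable M" for k using a by (simp add: L2_def)
  have "(\<integral>\<^sup>+x. (\<Sum>k. ennreal (2 ^ k * (norm (a k x))\<^sup>2)) \<partial>M) = (\<Sum>k. \<integral>\<^sup>+x. ennreal (2 ^ k * (norm (a k x))\<^sup>2) \<partial>M)"
    by (rule nn_integral_suminf) measurable
  also have "\<dots> \<le> (\<Sum>k. ennreal ((1 / 2) ^ k))"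
  proof (rule suminf_le)
    fix k
    have "(\<integral>\<^sup>+x. ennreal (2 ^ k * (norm (a k x))\<^sup>2) \<partial>M) = ennreal (2 ^ k) * ennreal (sqn M (a k))"
      by (simp add: ennreal_mult nn_integral_cmult nn_integral_sqn[OF a])
    also have "\<dots> \<le> ennreal (2 ^ k * (1 / 4) ^ k)"
      using s[of k] by (simp add: ennreal_mult[symmetric] ennreal_leI mult_left_mono)
    also have "(2::real) ^ k * (1 / 4) ^ k = (1 / 2) ^ k"
      by (simp flip: power_mult_distrib)
    finally show "(\<integral>\<^sup>+x. ennreal (2 ^ k * (norm (a k x))\<^sup>2) \<partial>M) \<le> ennreal ((1 / 2) ^ k)" .
  qed auto
  also have "\<dots> = ennreal (\<Sum>k. (1 / 2) ^ k)"
    by (intro suminf_ennreal2 summable_geometric) auto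
  also have "\<dots> < \<infinity>" by simp
  finally have "(\<integral>\<^sup>+x. (\<Sum>k. ennreal (2 ^ k * (norm (a k x))\<^sup>2)) \<partial>M) \<noteq> \<infinity>" by simp
  then have "AE x in M. (\<Sum>k. ennreal (2 ^ k * (norm (a k x))\<^sup>2)) \<noteq> \<infinity>"
    by (intro nn_integral_PInf_AE) measurable
  then show ?thesis
  proof eventually_elim
    case (elim x)
    have "summable (\<lambda>k. 2 ^ k * (norm (a k x))\<^sup>2)"
      using elim by (intro summable_suminf_not_top) auto
    then have "summable (\<lambda>k. (1 / 2) ^ k + 2 ^ k * (norm (a k x))\<^sup>2)"
      by (intro summable_add summable_geometric) auto
    then show ?case
    proof (rule summable_comparison_test'[where N = 0])
      fix k :: nat
      have p: "(1 / 2 :: real) ^ k * 2 ^ k = 1" by (simp flip: power_mult_distrib)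
      have "norm (a k x) \<le> (1 / 2) ^ k + 2 ^ k * (norm (a k x))\<^sup>2"
      proof (cases "norm (a k x) \<le> (1 / 2) ^ k")
        case True
        moreover have "0 \<le> 2 ^ k * (norm (a k x))\<^sup>2" by simp
        ultimately show ?thesis by linarith
      next
        case False
        then have "(1 / 2) ^ k * 2 ^ k * norm (a k x) \<le> norm (a k x) * 2 ^ k * norm (a k x)"
          by (intro mult_right_mono) auto
        then have "norm (a k x) \<le> 2 ^ k * (norm (a k x))\<^sup>2"
          using p by (simp add: power2_eq_square mult_ac)
        then show ?thesis by (smt (verit) zero_le_power half_gt_zero)
      qed
      then show "norm (norm (a k x)) \<le> (1 / 2) ^ k + 2 ^ k * (norm (a k x))\<^sup>2" by simp
    qed
  qed
qed

lemma subseq_fast_Cauchy: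
  fixes d :: "nat \<Rightarrow> nat \<Rightarrow> real"
  assumes "\<And>e. 0 < e \<Longrightarrow> \<exists>N. \<forall>m\<ge>N. \<forall>n\<ge>N. d m n < e"
  obtains r where "strict_mono (r :: nat \<Rightarrow> nat)" "\<And>k. d (r (Suc k)) (r k) \<le> (1 / 4) ^ k"
proof -
  have "\<exists>N. \<forall>m\<ge>N. \<forall>n\<ge>N. d m n < (1 / 4) ^ k" for k by (rule assms) simp
  then obtain N where N: "\<And>k m n. N k \<le> m \<Longrightarrow> N k \<le> n \<Longrightarrow> d m n < (1 / 4) ^ k" by metis
  \<comment> \<open>Partial sums of \<open>N i + 1\<close> increase strictly and stay above each
    \<open>N k\<close>.\<close>
  define r where "r k = (\<Sum>i\<le>k. N i + 1)" for k
  have r_ge: "N k \<le> r k" for k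
  proof -
    have "N k + 1 \<le> (\<Sum>i\<le>k. N i + 1)" by (rule member_le_sum) auto
    then show ?thesis unfolding r_def by simp
  qed
  have r: "strict_mono r" by (rule strict_mono_Suc_iff[THEN iffD2]) (simp add: r_def)
  have "N k \<le> r (Suc k)" for k
    using r_ge[of k] strict_mono_less_eq[OF r, of k "Suc k"] by simp
  then show ?thesis
    using that[OF r] N r_ge by (meson less_imp_le)
qed

text \<open>Riesz-Fischer. A fast subsequence converges almost everywhere because its increments are
  summable; Fatou along it gives convergence in \<open>L^2\<close> of the whole sequence.\<close>

lemma L2_limit_AE_subseq:
  fixes f :: "nat \<Rightarrow> 'a \<Rightarrow> 'b::euclidean_space"
  assumes f: "\<And>n. L2 M (f n)"
    and cauchy: "\<And>e. 0 < e \<Longrightarrow> \<exists>N. \<forall>m\<ge>N. \<forall>n\<ge>N. sqn M (\<lambda>x. f m x - f n x) < e"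
  obtains r g where "L2 M g" "(\<lambda>n. sqn M (\<lambda>x. f n x - g x)) \<longlonglongrightarrow> 0"
    "strict_mono (r :: nat \<Rightarrow> nat)" "AE x in M. (\<lambda>k. f (r k) x) \<longlonglongrightarrow> g x"
proof -
  have [measurable]: "f n \<in> borel_measurable M" for n using f by (simp add: L2_def)
  obtain r where r: "strict_mono (r :: nat \<Rightarrow> nat)"
    and rk: "\<And>k. sqn M (\<lambda>x. f (r (Suc k)) x - f (r k) x) \<le> (1 / 4) ^ k"
    by (rule subseq_fast_Cauchy[of "\<lambda>m n. sqn M (\<lambda>x. f m x - f n x)"]) (erule cauchy, rule that)
  have "AE x in M. summable (\<lambda>k. norm (f (r (Suc k)) x - f (r k) x))"
    by (rule AE_summable_of_sqn[OF L2_diff[OF f f] rk])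
  then have conv: "AE x in M. convergent (\<lambda>k. f (r k) x)"
  proof eventually_elim
    case (elim x)
    then have "summable (\<lambda>k. f (r (Suc k)) x - f (r k) x)"
      by (rule summable_norm_cancel)
    then have "convergent (\<lambda>n. f (r 0) x + (\<Sum>k<n. f (r (Suc k)) x - f (r k) x))"
      unfolding summable_iff_convergent by (rule convergent_add[OF convergent_const])
    then show ?case by (simp add: sum_lessThan_telescope[of "\<lambda>k. f (r k) x"])
  qed
  define g where "g x = lim (\<lambda>k. f (r k) x)" for x
  have [measurable]: "g \<in> borel_measurable M"
    unfolding g_def by (rule borel_measurable_lim_metric) measurable
  have ae: "AE x in M. (\<lambda>k. f (r k) x) \<longlonglongrightarrow> g x"
    using conv unfolding g_def by eventually_elim (simp add: convergent_LIMSEQ_iff)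
  \<comment> \<open>The shift by \<open>k0\<close> lets a bound that holds only for large k be used
    under the liminf.\<close>
  have fatou: "(\<integral>\<^sup>+x. ennreal ((norm (f n x - g x))\<^sup>2) \<partial>M) \<le> ennreal e"
    if bound: "\<And>k. k0 \<le> k \<Longrightarrow> sqn M (\<lambda>x. f n x - f (r k) x) \<le> e" for n e k0
  proof -
    have "(\<integral>\<^sup>+x. ennreal ((norm (f n x - g x))\<^sup>2) \<partial>M)
        = (\<integral>\<^sup>+x. liminf (\<lambda>k. ennreal ((norm (f n x - f (r (k + k0)) x))\<^sup>2)) \<partial>M)"
    proof (rule nn_integral_cong_AE)
      show "AE x in M. ennreal ((norm (f n x - g x))\<^sup>2) = liminf (\<lambda>k. ennreal ((norm (f n x - f (r (k + k0)) x))\<^sup>2))"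
        using ae
      proof eventually_elim
        case (elim x)
        have "(\<lambda>k. f (r (k + k0)) x) \<longlonglongrightarrow> g x"
          using LIMSEQ_ignore_initial_segment[OF elim] .
        then have "(\<lambda>k. ennreal ((norm (f n x - f (r (k + k0)) x))\<^sup>2)) \<longlonglongrightarrow> ennreal ((norm (f n x - g x))\<^sup>2)"
          by (intro tendsto_ennrealI tendsto_intros)
        then show ?case by (rule lim_imp_Liminf[OF trivial_limit_sequentially, symmetric])
      qed
    qed
    also have "\<dots> \<le> liminf (\<lambda>k. \<integral>\<^sup>+x. ennreal ((norm (f n x - f (r (k + k0)) x))\<^sup>2) \<partial>M)"
      by (rule nn_integral_liminf) measurable
    also have "\<dots> = liminf (\<lambda>k. ennreal (sqn M (\<lambda>x. f n x - f (r (k + k0)) x)))"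
      by (simp add: nn_integral_sqn[OF L2_diff[OF f f]])
    also have "\<dots> \<le> liminf (\<lambda>k. ennreal e)"
      using bound by (intro Liminf_mono always_eventually) (auto intro!: ennreal_leI)
    finally show ?thesis by (simp add: Liminf_const)
  qed
  have sub: "\<exists>n0. \<forall>n\<ge>n0. (\<integral>\<^sup>+x. ennreal ((norm (f n x - g x))\<^sup>2) \<partial>M) \<le> ennreal e" if e: "0 < e" for e
  proof -
    obtain n0 where n0: "\<And>m n. n0 \<le> m \<Longrightarrow> n0 \<le> n \<Longrightarrow> sqn M (\<lambda>x. f m x - f n x) < e"
      using cauchy[OF e] by blast
    have "(\<integral>\<^sup>+x. ennreal ((norm (f n x - g x))\<^sup>2) \<partial>M) \<le> ennreal e" if "n0 \<le> n" for n
    proof (rule fatou[of n0])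
      show "sqn M (\<lambda>x. f n x - f (r k) x) \<le> e" if "n0 \<le> k" for k
        using n0[OF \<open>n0 \<le> n\<close>, of "r k"] seq_suble[OF r, of k] that by simp
    qed
    then show ?thesis by blast
  qed
  have L2_fg: "L2 M (\<lambda>x. f n x - g x)" if "(\<integral>\<^sup>+x. ennreal ((norm (f n x - g x))\<^sup>2) \<partial>M) \<le> ennreal e" for n e
  proof -
    have "(\<integral>\<^sup>+x. ennreal (norm ((norm (f n x - g x))\<^sup>2)) \<partial>M) < \<infinity>"
      using that by (simp add: le_less_trans)
    then show ?thesis
      unfolding L2_def by (auto intro!: integrableI_bounded)
  qed
  obtain n1 where n1: "\<And>n. n1 \<le> n \<Longrightarrow> (\<integral>\<^sup>+x. ennreal ((norm (f n x - g x))\<^sup>2) \<partial>M) \<le> ennreal 1"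
    using sub[of 1] by auto
  have g: "L2 M g"
    using L2_diff[OF f[of n1] L2_fg[OF n1[OF order_refl]]] by simp
  have "(\<lambda>n. sqn M (\<lambda>x. f n x - g x)) \<longlonglongrightarrow> 0"
  proof (rule LIMSEQ_I)
    fix e :: real assume e: "0 < e"
    obtain n0 where n0: "\<And>n. n0 \<le> n \<Longrightarrow> (\<integral>\<^sup>+x. ennreal ((norm (f n x - g x))\<^sup>2) \<partial>M) \<le> ennreal (e / 2)"
      using sub[of "e / 2"] e by auto
    have "sqn M (\<lambda>x. f n x - g x) < e" if "n0 \<le> n" for n
    proof -
      have "ennreal (sqn M (\<lambda>x. f n x - g x)) \<le> ennreal (e / 2)"
        using n0[OF that] by (simp add: nn_integral_sqn[OF L2_diff[OF f g]])
      then show ?thesis using e by simp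
    qed
    then show "\<exists>n0. \<forall>n\<ge>n0. norm (sqn M (\<lambda>x. f n x - g x) - 0) < e" by auto
  qed
  then show ?thesis using that[OF g _ r ae] by blast
qed

lemma L2_convergent_imp_Cauchy:
  assumes f: "\<And>n. L2 M (f n)" and g: "L2 M g" and lim: "(\<lambda>n. sqn M (\<lambda>x. f n x - g x)) \<longlonglongrightarrow> 0" and e: "0 < e"
  shows "\<exists>N. \<forall>m\<ge>N. \<forall>n\<ge>N. sqn M (\<lambda>x. f m x - f n x) < e"
proof -
  obtain N where N: "\<And>n. N \<le> n \<Longrightarrow> sqn M (\<lambda>x. f n x - g x) < e / 4"
    using LIMSEQ_D[OF lim, of "e / 4"] e by auto
  have "sqn M (\<lambda>x. f m x - f n x) < e" if "N \<le> m" "N \<le> n" for m n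
    using sqn_triangle[OF f[of m] g f[of n]] N[OF that(1)] N[OF that(2)] sqn_minus_commute[of M g "f n"] by simp
  then show ?thesis by blast
qed

lemma L2_limit_unique:
  assumes f: "\<And>n. L2 M (f n)" and g: "L2 M g" "(\<lambda>n. sqn M (\<lambda>x. f n x - g x)) \<longlonglongrightarrow> 0"
    and h: "L2 M h" "(\<lambda>n. sqn M (\<lambda>x. f n x - h x)) \<longlonglongrightarrow> 0"
  shows "AE x in M. g x = h x"
proof -
  have "(\<lambda>n. 2 * sqn M (\<lambda>x. f n x - g x) + 2 * sqn M (\<lambda>x. f n x - h x)) \<longlonglongrightarrow> 2 * 0 + 2 * 0"
    by (intro tendsto_intros g h)
  moreover have "sqn M (\<lambda>x. g x - h x) \<le> 2 * sqn M (\<lambda>x. f n x - g x) + 2 * sqn M (\<lambda>x. f n x - h x)" for n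
    using sqn_triangle[OF g(1) f[of n] h(1)] sqn_minus_commute[of M g "f n"] by simp
  ultimately have "sqn M (\<lambda>x. g x - h x) \<le> 0"
    by (intro LIMSEQ_le_const) auto
  then have "(LINT x|M. (norm (g x - h x))\<^sup>2) = 0"
    using sqn_nonneg[of M "\<lambda>x. g x - h x"] unfolding sqn_def by linarith
  then have "AE x in M. (norm (g x - h x))\<^sup>2 = 0"
    using L2_integrable[OF L2_diff[OF g(1) h(1)]] by (subst (asm) integral_nonneg_eq_0_iff_AE) auto
  then show ?thesis by eventually_elim simp
qed

lemma sqn_parallelogram:
  assumes "L2 M f" "L2 M g"
  shows "sqn M (\<lambda>x. f x - g x) + sqn M (\<lambda>x. f x + g x) = 2 * sqn M f + 2 * sqn M g"
  using sqn_add_scale[OF assms, of 1] sqn_add_scale[OF assms, of "-1"] by simp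

lemma sqn_midpoint_le:
  assumes "L2 M f" "L2 M g" "L2 M u"
  shows "sqn M (\<lambda>x. (1 / 2) *\<^sub>R (f x + g x) - u x) \<le> (sqn M (\<lambda>x. f x - u x) + sqn M (\<lambda>x. g x - u x)) / 2"
proof -
  have "(1 / 2) *\<^sub>R (f x + g x) - u x = (1 / 2) *\<^sub>R ((f x - u x) + (g x - u x))" for x
  proof -
    have "(1 / 2) *\<^sub>R ((f x - u x) + (g x - u x)) = (1 / 2) *\<^sub>R (f x + g x) - (1 / 2) *\<^sub>R (u x + u x)"
      by (simp add: algebra_simps)
    also have "(1 / 2) *\<^sub>R (u x + u x) = u x"
      by (simp flip: scaleR_2)
    finally show ?thesis by simp
  qed
  then have "sqn M (\<lambda>x. (1 / 2) *\<^sub>R (f x + g x) - u x) = sqn M (\<lambda>x. (f x - u x) + (g x - u x)) / 4"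
    by (simp only: sqn_scaleR) (simp add: power2_eq_square)
  also have "sqn M (\<lambda>x. (f x - u x) + (g x - u x)) \<le> 2 * sqn M (\<lambda>x. f x - u x) + 2 * sqn M (\<lambda>x. g x - u x)"
    by (intro sqn_add_le L2_diff assms)
  finally show ?thesis by simp
qed

section \<open>\<open>H\<^sub>0\<^sup>1\<close> as a completion of the test functions\<close>

lemma LIMSEQ_0_inverse_bound:
  fixes f :: "nat \<Rightarrow> real"
  assumes "\<And>n. 0 \<le> f n" "\<And>n. f n < inverse (real (Suc n))"
  shows "f \<longlonglongrightarrow> 0"
proof (rule tendsto_sandwich[OF _ _ tendsto_const LIMSEQ_inverse_real_of_nat])
  show "\<forall>\<^sub>F n in sequentially. 0 \<le> f n" using assms(1) by simp
  show "\<forall>\<^sub>F n in sequentially. f n \<le> inverse (real (Suc n))"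
    using less_imp_le[OF assms(2)] by (rule always_eventually[OF allI])
qed

lemma inner_Basis_square_le: "b \<in> Basis \<Longrightarrow> (x \<bullet> b)\<^sup>2 \<le> (norm x)\<^sup>2"
  using Basis_le_norm[of b x] power_mono[of "\<bar>x \<bullet> b\<bar>" "norm x" 2] by simp

locale bounded_domain =
  fixes \<Omega> :: "'a::euclidean_space set"
  assumes open_\<Omega>: "open \<Omega>" and bounded_\<Omega>: "bounded \<Omega>"
begin

abbreviation "M \<equiv> lebesgue_on \<Omega>"

lemma finite_measure_M: "finite_measure M"
proof (rule finite_measureI)
  have "emeasure M (space M) = emeasure lborel \<Omega>"
    using open_\<Omega> by (subst emeasure_restrict_space) auto
  then show "emeasure M (space M) \<noteq> \<infinity>"
    using emeasure_bounded_finite[OF bounded_\<Omega>] by simp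
qed

text \<open>Estimates for test functions live over \<open>lborel\<close>, where translations act,
  while the definitions use \<open>lebesgue_on \<Omega>\<close>. Functions vanishing outside
  \<open>\<Omega>\<close> pass between the two.\<close>

lemma integral_M_eq_lborel:
  fixes f :: "'a \<Rightarrow> 'b::{banach, second_countable_topology}"
  assumes f: "f \<in> borel_measurable borel" and out: "\<And>x. x \<notin> \<Omega> \<Longrightarrow> f x = 0"
  shows "integrable M f \<longleftrightarrow> integrable lborel f" "integral\<^sup>L M f = integral\<^sup>L lborel f"
proof -
  have eq: "(\<lambda>x. indicator \<Omega> x *\<^sub>R f x) = f"
    using out by (auto simp: indicator_def)
  have s: "\<Omega> \<inter> space lebesgue \<in> sets lebesgue"
    using open_\<Omega> by simp
  have f': "f \<in> borel_measurable lborel" using f by simp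
  show "integrable M f \<longleftrightarrow> integrable lborel f" "integral\<^sup>L M f = integral\<^sup>L lborel f"
    unfolding integrable_restrict_space[OF s] integral_restrict_space[OF s] eq
    using integrable_completion[OF f'] integral_completion[OF f'] by auto
qed

lemma compactly_supported_M:
  fixes f :: "'a \<Rightarrow> 'b::{banach, second_countable_topology}"
  assumes f: "compactly_supported f" and out: "\<And>x. x \<notin> \<Omega> \<Longrightarrow> f x = 0"
  shows "integrable M f" "integral\<^sup>L M f = integral\<^sup>L lborel f"
  using integral_M_eq_lborel[OF compactly_supported_measurable[OF f] out] compactly_supported_integrable[OF f] by auto

lemma L2_test:
  assumes "\<phi> \<in> test_functions \<Omega>"
  shows "L2 M \<phi>" "sqn M \<phi> = (LINT x|lborel. (\<phi> x)\<^sup>2)"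
proof -
  have c: "compactly_supported (\<lambda>x. (\<phi> x)\<^sup>2)"
    using compactly_supported_test_function[OF assms] by (rule compactly_supported_power) simp
  show "L2 M \<phi>" "sqn M \<phi> = (LINT x|lborel. (\<phi> x)\<^sup>2)"
    using compactly_supported_M[OF c] test_function_eq_0_outside[OF assms] test_function_measurable[OF assms]
    unfolding L2_def sqn_def by auto
qed

lemma L2_grad:
  assumes "\<phi> \<in> test_functions \<Omega>"
  shows "L2 M (grad \<phi>)" "sqn M (grad \<phi>) = (LINT x|lborel. (norm (grad \<phi> x))\<^sup>2)"
proof -
  have c: "compactly_supported (\<lambda>x. (norm (grad \<phi> x))\<^sup>2)"
    using compactly_supported_grad[OF assms] by (rule compactly_supported_norm_square)
  have m: "grad \<phi> \<in> borel_measurable M"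
    using compactly_supported_measurable[OF compactly_supported_grad[OF assms]] by (rule borel_measurable_lebesgue_on)
  show "L2 M (grad \<phi>)" "sqn M (grad \<phi>) = (LINT x|lborel. (norm (grad \<phi> x))\<^sup>2)"
    using compactly_supported_M[OF c] grad_test_function_outside[OF assms] m
    unfolding L2_def sqn_def by auto
qed

lemma L2_const: "L2 M (\<lambda>x. c)"
  unfolding L2_def using finite_measure.integrable_const[OF finite_measure_M] by simp

lemma L2_imp_integrable: "L2 M f \<Longrightarrow> integrable M f" for f :: "'a \<Rightarrow> real"
  using L2_mult_integrable[of M f "\<lambda>_. 1"] L2_const[of "1::real"] by simp

lemma powr_2_norm: "norm (a :: 'b::real_normed_vector) powr 2 = (norm a)\<^sup>2"
  by (cases "a = 0") simp_all

lemma Lp_2_iff: "f \<in> Lp 2 \<Omega> \<longleftrightarrow> L2 M f"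
  unfolding Lp_def L2_def by (simp add: powr_2_norm)

text \<open>\<open>H1lim u G\<close>: the pair \<open>(u, G)\<close> is the limit of \<open>(\<phi>\<^sub>n, \<nabla>\<phi>\<^sub>n)\<close> in \<open>L\<^sup>2\<close> for test functions
  \<open>\<phi>\<^sub>n\<close>, i.e. \<open>u \<in> H\<^sub>0\<^sup>1\<close> with weak gradient \<open>G\<close>.\<close>

definition H1lim :: "('a \<Rightarrow> real) \<Rightarrow> ('a \<Rightarrow> 'a) \<Rightarrow> bool" where
  "H1lim u G \<longleftrightarrow> L2 M u \<and> L2 M G \<and> (\<exists>\<phi>. (\<forall>n::nat. \<phi> n \<in> test_functions \<Omega>) \<and>
     (\<lambda>n. sqn M (\<lambda>x. \<phi> n x - u x)) \<longlonglongrightarrow> 0 \<and> (\<lambda>n. sqn M (\<lambda>x. grad (\<phi> n) x - G x)) \<longlonglongrightarrow> 0)"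

lemma H1limD: "H1lim u G \<Longrightarrow> L2 M u" "H1lim u G \<Longrightarrow> L2 M G"
  unfolding H1lim_def by auto

lemma H1limE:
  assumes "H1lim u G"
  obtains \<phi> where "\<And>n::nat. \<phi> n \<in> test_functions \<Omega>" "(\<lambda>n. sqn M (\<lambda>x. \<phi> n x - u x)) \<longlonglongrightarrow> 0"
    "(\<lambda>n. sqn M (\<lambda>x. grad (\<phi> n) x - G x)) \<longlonglongrightarrow> 0"
  using assms unfolding H1lim_def by blast

lemma H1lim_approx:
  assumes "H1lim u G" "0 < e"
  obtains \<phi> where "\<phi> \<in> test_functions \<Omega>" "sqn M (\<lambda>x. \<phi> x - u x) < e" "sqn M (\<lambda>x. grad \<phi> x - G x) < e"
proof -
  obtain \<phi> where \<phi>: "\<And>n::nat. \<phi> n \<in> test_functions \<Omega>" "(\<lambda>n. sqn M (\<lambda>x. \<phi> n x - u x)) \<longlonglongrightarrow> 0"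
    "(\<lambda>n. sqn M (\<lambda>x. grad (\<phi> n) x - G x)) \<longlonglongrightarrow> 0"
    using assms(1) by (rule H1limE) (rule that)
  have "\<forall>\<^sub>F n in sequentially. sqn M (\<lambda>x. \<phi> n x - u x) < e \<and> sqn M (\<lambda>x. grad (\<phi> n) x - G x) < e"
    using order_tendstoD(2)[OF \<phi>(2) assms(2)] order_tendstoD(2)[OF \<phi>(3) assms(2)] by eventually_elim simp
  then obtain n where "sqn M (\<lambda>x. \<phi> n x - u x) < e" "sqn M (\<lambda>x. grad (\<phi> n) x - G x) < e"
    unfolding eventually_sequentially by blast
  then show ?thesis using that \<phi>(1) by blast
qed

lemma H1limI_approx:
  assumes u: "L2 M u" and G: "L2 M G"
    and approx: "\<And>e. 0 < e \<Longrightarrow> \<exists>\<phi>\<in>test_functions \<Omega>. sqn M (\<lambda>x. \<phi> x - u x) < e \<and> sqn M (\<lambda>x. grad \<phi> x - G x) < e"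
  shows "H1lim u G"
proof -
  have "\<exists>\<phi>\<in>test_functions \<Omega>. sqn M (\<lambda>x. \<phi> x - u x) < inverse (real (Suc n)) \<and> sqn M (\<lambda>x. grad \<phi> x - G x) < inverse (real (Suc n))" for n
    by (rule approx) simp
  then obtain \<phi> where \<phi>: "\<And>n. \<phi> n \<in> test_functions \<Omega>" "\<And>n. sqn M (\<lambda>x. \<phi> n x - u x) < inverse (real (Suc n))"
    "\<And>n. sqn M (\<lambda>x. grad (\<phi> n) x - G x) < inverse (real (Suc n))"
    by metis
  have "(\<lambda>n. sqn M (\<lambda>x. \<phi> n x - u x)) \<longlonglongrightarrow> 0"
    by (rule LIMSEQ_0_inverse_bound[OF sqn_nonneg \<phi>(2)])
  moreover have "(\<lambda>n. sqn M (\<lambda>x. grad (\<phi> n) x - G x)) \<longlonglongrightarrow> 0"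
    by (rule LIMSEQ_0_inverse_bound[OF sqn_nonneg \<phi>(3)])
  ultimately show ?thesis
    unfolding H1lim_def using u G \<phi>(1) by blast
qed

lemma H1lim_test:
  assumes "\<phi> \<in> test_functions \<Omega>"
  shows "H1lim \<phi> (grad \<phi>)"
  using L2_test(1)[OF assms] L2_grad(1)[OF assms]
proof (rule H1limI_approx)
  show "\<exists>\<psi>\<in>test_functions \<Omega>. sqn M (\<lambda>x. \<psi> x - \<phi> x) < e \<and> sqn M (\<lambda>x. grad \<psi> x - grad \<phi> x) < e" if "0 < e" for e
    using that by (intro bexI[OF _ assms]) (simp add: sqn_def)
qed

text \<open>Diagonal argument. Each of the two errors is kept below \<open>e / 4\<close>, because
  \<open>sqn_triangle\<close> doubles it.\<close>

lemma H1lim_closed: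
  assumes H: "\<And>n. H1lim (u n) (G n)" and L: "L2 M u0" "L2 M G0"
    and lim: "(\<lambda>n. sqn M (\<lambda>x. u n x - u0 x)) \<longlonglongrightarrow> 0" "(\<lambda>n. sqn M (\<lambda>x. G n x - G0 x)) \<longlonglongrightarrow> 0"
  shows "H1lim u0 G0"
  using L
proof (rule H1limI_approx)
  fix e :: real assume e: "0 < e"
  have "\<forall>\<^sub>F n in sequentially. sqn M (\<lambda>x. u n x - u0 x) < e / 4 \<and> sqn M (\<lambda>x. G n x - G0 x) < e / 4"
    using order_tendstoD(2)[OF lim(1), of "e / 4"] order_tendstoD(2)[OF lim(2), of "e / 4"] e
    by (auto elim: eventually_elim2)
  then obtain n where n: "sqn M (\<lambda>x. u n x - u0 x) < e / 4" "sqn M (\<lambda>x. G n x - G0 x) < e / 4"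
    unfolding eventually_sequentially by blast
  obtain \<phi> where \<phi>: "\<phi> \<in> test_functions \<Omega>" "sqn M (\<lambda>x. \<phi> x - u n x) < e / 4" "sqn M (\<lambda>x. grad \<phi> x - G n x) < e / 4"
    using H1lim_approx[OF H, of "e / 4"] e by auto
  have "sqn M (\<lambda>x. \<phi> x - u0 x) < e"
    using sqn_triangle[OF L2_test(1)[OF \<phi>(1)] H1limD(1)[OF H] L(1), of n] \<phi>(2) n(1) by linarith
  moreover have "sqn M (\<lambda>x. grad \<phi> x - G0 x) < e"
    using sqn_triangle[OF L2_grad(1)[OF \<phi>(1)] H1limD(2)[OF H] L(2), of n] \<phi>(3) n(2) by linarith
  ultimately show "\<exists>\<phi>\<in>test_functions \<Omega>. sqn M (\<lambda>x. \<phi> x - u0 x) < e \<and> sqn M (\<lambda>x. grad \<phi> x - G0 x) < e"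
    using \<phi>(1) by blast
qed

lemma H1lim_add:
  assumes H: "H1lim u G" "H1lim v K"
  shows "H1lim (\<lambda>x. u x + v x) (\<lambda>x. G x + K x)"
proof (rule H1limI_approx)
  show "L2 M (\<lambda>x. u x + v x)" "L2 M (\<lambda>x. G x + K x)"
    using H by (auto intro!: L2_add dest: H1limD)
  fix e :: real assume e: "0 < e"
  obtain \<phi> where \<phi>: "\<phi> \<in> test_functions \<Omega>" "sqn M (\<lambda>x. \<phi> x - u x) < e / 4" "sqn M (\<lambda>x. grad \<phi> x - G x) < e / 4"
    using H1lim_approx[OF H(1), of "e / 4"] e by auto
  obtain \<psi> where \<psi>: "\<psi> \<in> test_functions \<Omega>" "sqn M (\<lambda>x. \<psi> x - v x) < e / 4" "sqn M (\<lambda>x. grad \<psi> x - K x) < e / 4"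
    using H1lim_approx[OF H(2), of "e / 4"] e by auto
  have "sqn M (\<lambda>x. (\<phi> x + \<psi> x) - (u x + v x)) = sqn M (\<lambda>x. (\<phi> x - u x) + (\<psi> x - v x))"
    by (simp add: algebra_simps)
  also have "\<dots> \<le> 2 * sqn M (\<lambda>x. \<phi> x - u x) + 2 * sqn M (\<lambda>x. \<psi> x - v x)"
    using H \<phi>(1) \<psi>(1) by (intro sqn_add_le L2_diff) (auto dest: H1limD intro: L2_test)
  finally have 1: "sqn M (\<lambda>x. (\<phi> x + \<psi> x) - (u x + v x)) < e"
    using \<phi>(2) \<psi>(2) by linarith
  have "sqn M (\<lambda>x. grad (\<lambda>x. \<phi> x + \<psi> x) x - (G x + K x)) = sqn M (\<lambda>x. (grad \<phi> x - G x) + (grad \<psi> x - K x))"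
    using grad_add[OF test_function_differentiable[OF \<phi>(1)] test_function_differentiable[OF \<psi>(1)]]
    by (simp add: algebra_simps)
  also have "\<dots> \<le> 2 * sqn M (\<lambda>x. grad \<phi> x - G x) + 2 * sqn M (\<lambda>x. grad \<psi> x - K x)"
    using H \<phi>(1) \<psi>(1) by (intro sqn_add_le L2_diff) (auto dest: H1limD intro: L2_grad)
  finally have 2: "sqn M (\<lambda>x. grad (\<lambda>x. \<phi> x + \<psi> x) x - (G x + K x)) < e"
    using \<phi>(3) \<psi>(3) by linarith
  show "\<exists>\<phi>\<in>test_functions \<Omega>. sqn M (\<lambda>x. \<phi> x - (u x + v x)) < e \<and> sqn M (\<lambda>x. grad \<phi> x - (G x + K x)) < e"
    by (rule bexI[OF _ test_functions_add[OF \<phi>(1) \<psi>(1)]]) (use 1 2 in simp)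
qed

lemma H1lim_cmult:
  assumes H: "H1lim u G"
  shows "H1lim (\<lambda>x. c * u x) (\<lambda>x. c *\<^sub>R G x)"
proof -
  obtain \<phi> where \<phi>: "\<And>n::nat. \<phi> n \<in> test_functions \<Omega>" "(\<lambda>n. sqn M (\<lambda>x. \<phi> n x - u x)) \<longlonglongrightarrow> 0"
    "(\<lambda>n. sqn M (\<lambda>x. grad (\<phi> n) x - G x)) \<longlonglongrightarrow> 0"
    using H by (rule H1limE) (rule that)
  have "sqn M (\<lambda>x. c * \<phi> n x - c * u x) = c\<^sup>2 * sqn M (\<lambda>x. \<phi> n x - u x)" for n
    using sqn_scaleR[of M c "\<lambda>x. \<phi> n x - u x"] by (simp add: right_diff_distrib)
  then have 1: "(\<lambda>n. sqn M (\<lambda>x. c * \<phi> n x - c * u x)) \<longlonglongrightarrow> 0"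
    using tendsto_mult_right_zero[OF \<phi>(2)] by simp
  have "sqn M (\<lambda>x. grad (\<lambda>x. c * \<phi> n x) x - c *\<^sub>R G x) = c\<^sup>2 * sqn M (\<lambda>x. grad (\<phi> n) x - G x)" for n
    using sqn_scaleR[of M c "\<lambda>x. grad (\<phi> n) x - G x"] grad_cmult[OF test_function_differentiable[OF \<phi>(1)]]
    by (simp add: scaleR_diff_right)
  then have 2: "(\<lambda>n. sqn M (\<lambda>x. grad (\<lambda>x. c * \<phi> n x) x - c *\<^sub>R G x)) \<longlonglongrightarrow> 0"
    using tendsto_mult_right_zero[OF \<phi>(3)] by simp
  show ?thesis
    unfolding H1lim_def using H1limD[OF H] 1 2 test_functions_cmult[OF \<phi>(1)]
    by (intro conjI L2_cmult L2_scaleR exI[of _ "\<lambda>n x. c * \<phi> n x"]) auto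
qed

lemma H1lim_diff: "H1lim u G \<Longrightarrow> H1lim v K \<Longrightarrow> H1lim (\<lambda>x. u x - v x) (\<lambda>x. G x - K x)"
  using H1lim_add[of u G "\<lambda>x. (-1) * v x" "\<lambda>x. (-1) *\<^sub>R K x"] H1lim_cmult[of v K "-1"] by simp

text \<open>Integration by parts holds for the approximating test functions, and both of its sides
  are \<open>L^2\<close> pairings with a fixed function, so they converge.\<close>

lemma weak_gradient_of_H1lim:
  assumes H: "H1lim u G"
  shows "is_L2_weak_gradient \<Omega> u G"
  unfolding is_L2_weak_gradient_def
proof (intro conjI ballI)
  show "G \<in> Lp 2 \<Omega>" using H1limD(2)[OF H] Lp_2_iff by blast
  fix \<psi> b assume \<psi>: "\<psi> \<in> test_functions \<Omega>" and b: "b \<in> (Basis :: 'a set)"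
  obtain \<phi> where \<phi>: "\<And>n::nat. \<phi> n \<in> test_functions \<Omega>" "(\<lambda>n. sqn M (\<lambda>x. \<phi> n x - u x)) \<longlonglongrightarrow> 0"
    "(\<lambda>n. sqn M (\<lambda>x. grad (\<phi> n) x - G x)) \<longlonglongrightarrow> 0"
    using H by (rule H1limE) (rule that)
  have contb: "continuous_on UNIV (\<lambda>x. grad \<psi> x \<bullet> b)"
    using continuous_grad_test_function[OF \<psi>] by (intro continuous_intros)
  have cs: "compactly_supported (\<lambda>x. (grad \<psi> x \<bullet> b)\<^sup>2)"
    using compactly_supported_grad[OF \<psi>]
    by (intro compactly_supported_compose[where h = "\<lambda>y. (y \<bullet> b)\<^sup>2"]) (auto intro!: continuous_intros)
  have D: "L2 M (\<lambda>x. grad \<psi> x \<bullet> b)"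
    unfolding L2_def
  proof
    show "(\<lambda>x. grad \<psi> x \<bullet> b) \<in> borel_measurable M"
      using contb by (intro borel_measurable_lebesgue_on borel_measurable_continuous_onI)
    show "integrable M (\<lambda>x. (norm (grad \<psi> x \<bullet> b))\<^sup>2)"
      using compactly_supported_M(1)[OF cs] grad_test_function_outside[OF \<psi>] by simp
  qed
  have P: "L2 M (\<lambda>x. \<psi> x *\<^sub>R b)"
  proof -
    have "integrable M (\<lambda>x. (norm (\<psi> x *\<^sub>R b))\<^sup>2)"
      using L2_integrable[OF L2_test(1)[OF \<psi>]] b by simp
    moreover have "\<psi> \<in> borel_measurable M" using L2_test(1)[OF \<psi>] by (simp add: L2_def)
    ultimately show ?thesis unfolding L2_def by simp
  qed
  have "(\<lambda>n. LINT x|M. \<phi> n x \<bullet> (grad \<psi> x \<bullet> b)) \<longlonglongrightarrow> (LINT x|M. u x \<bullet> (grad \<psi> x \<bullet> b))"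
    using \<phi>(1) H by (intro L2_inner_tendsto D \<phi>(2)) (auto intro: L2_test dest: H1limD)
  moreover have "(\<lambda>n. LINT x|M. grad (\<phi> n) x \<bullet> (\<psi> x *\<^sub>R b)) \<longlonglongrightarrow> (LINT x|M. G x \<bullet> (\<psi> x *\<^sub>R b))"
    using \<phi>(1) H by (intro L2_inner_tendsto P \<phi>(3)) (auto intro: L2_grad dest: H1limD)
  then have "(\<lambda>n. - (LINT x|M. grad (\<phi> n) x \<bullet> (\<psi> x *\<^sub>R b))) \<longlonglongrightarrow> - (LINT x|M. G x \<bullet> (\<psi> x *\<^sub>R b))"
    by (rule tendsto_minus)
  moreover have "(LINT x|M. \<phi> n x \<bullet> (grad \<psi> x \<bullet> b)) = - (LINT x|M. grad (\<phi> n) x \<bullet> (\<psi> x *\<^sub>R b))" for n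
  proof -
    have c1: "compactly_supported (\<lambda>x. \<phi> n x * (grad \<psi> x \<bullet> b))"
      by (rule compactly_supported_mult[OF compactly_supported_test_function[OF \<phi>(1)] contb])
    have "continuous_on UNIV (\<lambda>x. grad (\<phi> n) x \<bullet> b)"
      using continuous_grad_test_function[OF \<phi>(1)] by (intro continuous_intros)
    then have c2: "compactly_supported (\<lambda>x. \<psi> x * (grad (\<phi> n) x \<bullet> b))"
      by (rule compactly_supported_mult[OF compactly_supported_test_function[OF \<psi>]])
    show ?thesis
      using integration_by_parts_test[OF \<phi>(1) \<psi>, of n b] compactly_supported_M(2)[OF c1] compactly_supported_M(2)[OF c2]
        test_function_eq_0_outside[OF \<phi>(1)] test_function_eq_0_outside[OF \<psi>]
      by (simp add: mult.commute)
  qed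
  ultimately have "(LINT x|M. u x \<bullet> (grad \<psi> x \<bullet> b)) = - (LINT x|M. G x \<bullet> (\<psi> x *\<^sub>R b))"
    using LIMSEQ_unique by auto
  then show "(LINT x|M. u x * frechet_derivative \<psi> (at x) b) = - (LINT x|M. G x \<bullet> b * \<psi> x)"
    using grad_inner_Basis[OF b] by (simp add: mult.commute)
qed

lemma weak_gradient_unique:
  assumes "is_L2_weak_gradient \<Omega> u G" "is_L2_weak_gradient \<Omega> u K"
  shows "AE x in M. G x = K x"
proof -
  have GK: "L2 M G" "L2 M K"
    using assms unfolding is_L2_weak_gradient_def Lp_2_iff by auto
  have comp: "L2 M (\<lambda>x. F x \<bullet> b)" if "L2 M F" "b \<in> Basis" for F :: "'a \<Rightarrow> 'a" and b
  proof -
    have [measurable]: "F \<in> borel_measurable M" using that(1) by (simp add: L2_def)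
    have "integrable M (\<lambda>x. (norm (F x \<bullet> b))\<^sup>2)"
    proof (rule Bochner_Integration.integrable_bound[OF L2_integrable[OF that(1)]])
      show "AE x in M. norm ((norm (F x \<bullet> b))\<^sup>2) \<le> norm ((norm (F x))\<^sup>2)"
        using inner_Basis_square_le[OF that(2)] by simp
    qed measurable
    then show ?thesis unfolding L2_def by simp
  qed
  have "AE x in M. \<forall>b\<in>Basis. G x \<bullet> b - K x \<bullet> b = 0"
  proof (rule AE_finite_allI[OF finite_Basis])
    fix b :: 'a assume b: "b \<in> Basis"
    show "AE x in M. G x \<bullet> b - K x \<bullet> b = 0"
    proof (rule fundamental_lemma[OF open_\<Omega>])
      show "integrable M (\<lambda>x. G x \<bullet> b - K x \<bullet> b)"
        by (intro L2_imp_integrable L2_diff comp GK b)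
      fix \<phi> assume \<phi>: "\<phi> \<in> test_functions \<Omega>"
      have "(LINT x|M. (G x \<bullet> b) * \<phi> x) = (LINT x|M. (K x \<bullet> b) * \<phi> x)"
        using assms \<phi> b unfolding is_L2_weak_gradient_def by (metis (no_types, lifting) minus_equation_iff)
      then show "(LINT x|M. (G x \<bullet> b - K x \<bullet> b) * \<phi> x) = 0"
        using L2_mult_integrable[OF comp[OF GK(1) b] L2_test(1)[OF \<phi>]]
          L2_mult_integrable[OF comp[OF GK(2) b] L2_test(1)[OF \<phi>]]
        by (simp add: left_diff_distrib)
    qed
  qed
  then show ?thesis
    by eventually_elim (auto intro: euclidean_eqI)
qed

lemma weak_gradient_AE:
  assumes "is_L2_weak_gradient \<Omega> u G"
  shows "is_L2_weak_gradient \<Omega> u (weak_gradient \<Omega> u)" "AE x in M. weak_gradient \<Omega> u x = G x"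
proof -
  show "is_L2_weak_gradient \<Omega> u (weak_gradient \<Omega> u)"
    unfolding weak_gradient_def by (rule someI[of "is_L2_weak_gradient \<Omega> u", OF assms])
  then show "AE x in M. weak_gradient \<Omega> u x = G x"
    by (rule weak_gradient_unique[OF _ assms])
qed

text \<open>\<open>weak_gradient\<close> is a choice and not literally additive. To evaluate the
  norm of \<open>u - \<phi>\<close> it is enough to exhibit one weak gradient.\<close>

lemma is_weak_gradient_diff_test:
  assumes u: "L2 M u" "is_L2_weak_gradient \<Omega> u G" and \<phi>: "\<phi> \<in> test_functions \<Omega>"
  shows "is_L2_weak_gradient \<Omega> (\<lambda>x. u x - \<phi> x) (\<lambda>x. G x - grad \<phi> x)"
  unfolding is_L2_weak_gradient_def
proof (intro conjI ballI)
  have G: "L2 M G" using u unfolding is_L2_weak_gradient_def Lp_2_iff by auto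
  show "(\<lambda>x. G x - grad \<phi> x) \<in> Lp 2 \<Omega>"
    unfolding Lp_2_iff by (intro L2_diff G L2_grad \<phi>)
  fix \<psi> b assume \<psi>: "\<psi> \<in> test_functions \<Omega>" and b: "b \<in> (Basis :: 'a set)"
  have \<phi>w: "is_L2_weak_gradient \<Omega> \<phi> (grad \<phi>)"
    using weak_gradient_of_H1lim[OF H1lim_test[OF \<phi>]] .
  have D: "L2 M (\<lambda>x. frechet_derivative \<psi> (at x) b)"
  proof -
    have eq: "(\<lambda>x. frechet_derivative \<psi> (at x) b) = (\<lambda>x. grad \<psi> x \<bullet> b)"
      using grad_inner_Basis[OF b] by auto
    have [measurable]: "grad \<psi> \<in> borel_measurable M" using L2_grad(1)[OF \<psi>] by (simp add: L2_def)
    have "integrable M (\<lambda>x. (norm (grad \<psi> x \<bullet> b))\<^sup>2)"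
    proof (rule Bochner_Integration.integrable_bound[OF L2_integrable[OF L2_grad(1)[OF \<psi>]]])
      show "AE x in M. norm ((norm (grad \<psi> x \<bullet> b))\<^sup>2) \<le> norm ((norm (grad \<psi> x))\<^sup>2)"
        using inner_Basis_square_le[OF b] by simp
    qed measurable
    then show ?thesis unfolding eq L2_def by simp
  qed
  have P: "L2 M (\<lambda>x. \<psi> x *\<^sub>R b)"
  proof -
    have "integrable M (\<lambda>x. (norm (\<psi> x *\<^sub>R b))\<^sup>2)"
      using L2_integrable[OF L2_test(1)[OF \<psi>]] b by simp
    moreover have "\<psi> \<in> borel_measurable M" using L2_test(1)[OF \<psi>] by (simp add: L2_def)
    ultimately show ?thesis unfolding L2_def by simp
  qed
  have I: "integrable M (\<lambda>x. (F x \<bullet> b) * \<psi> x)" if "L2 M F" for F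
    using L2_inner_integrable[OF that P] by (simp add: mult.commute)
  show "(LINT x|M. (u x - \<phi> x) * frechet_derivative \<psi> (at x) b) = - (LINT x|M. (G x - grad \<phi> x) \<bullet> b * \<psi> x)"
    using u(2) \<phi>w \<psi> b L2_mult_integrable[OF u(1) D] L2_mult_integrable[OF L2_test(1)[OF \<phi>] D]
      I[OF G] I[OF L2_grad(1)[OF \<phi>]]
    unfolding is_L2_weak_gradient_def
    by (simp add: left_diff_distrib inner_diff_left)
qed

lemma H1_norm_square:
  assumes "L2 M u" "is_L2_weak_gradient \<Omega> u G"
  shows "H1_norm \<Omega> u = sqrt (sqn M u + sqn M G)"
proof -
  have L: "L2 M G" "L2 M (weak_gradient \<Omega> u)"
    using assms weak_gradient_AE(1)[OF assms(2)] unfolding is_L2_weak_gradient_def Lp_2_iff by auto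
  have "sqn M (weak_gradient \<Omega> u) = sqn M G"
    using weak_gradient_AE(2)[OF assms(2)] L by (intro sqn_cong_AE) (auto simp: L2_def)
  then show ?thesis unfolding H1_norm_def sqn_def by simp
qed

text \<open>Bridge from the definition, which goes through a chosen gradient and
  \<open>H1_norm\<close>, to approximating sequences, where the gradient is a free second
  component.\<close>

lemma H01_iff_H1lim: "u \<in> H01 \<Omega> \<longleftrightarrow> (\<exists>G. H1lim u G)"
proof
  assume u: "u \<in> H01 \<Omega>"
  then obtain G where G: "is_L2_weak_gradient \<Omega> u G" and Lu: "L2 M u"
    unfolding H01_def H1_def Lp_2_iff by auto
  have LG: "L2 M G" using G unfolding is_L2_weak_gradient_def Lp_2_iff by auto
  have "H1lim u G"
    using Lu LG
  proof (rule H1limI_approx)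
    fix e :: real assume "0 < e"
    then have "0 < sqrt e" by simp
    then obtain \<phi> where \<phi>: "\<phi> \<in> test_functions \<Omega>" "H1_norm \<Omega> (\<lambda>x. u x - \<phi> x) < sqrt e"
      using u unfolding H01_def by blast
    then have "sqn M (\<lambda>x. u x - \<phi> x) + sqn M (\<lambda>x. G x - grad \<phi> x) < e"
      using H1_norm_square[OF L2_diff[OF Lu L2_test(1)[OF \<phi>(1)]] is_weak_gradient_diff_test[OF Lu G \<phi>(1)]] by simp
    then have "sqn M (\<lambda>x. \<phi> x - u x) < e \<and> sqn M (\<lambda>x. grad \<phi> x - G x) < e"
      unfolding sqn_minus_commute[of M \<phi>] sqn_minus_commute[of M "grad \<phi>"]
      using sqn_nonneg[of M "\<lambda>x. u x - \<phi> x"] sqn_nonneg[of M "\<lambda>x. G x - grad \<phi> x"] by linarith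
    then show "\<exists>\<phi>\<in>test_functions \<Omega>. sqn M (\<lambda>x. \<phi> x - u x) < e \<and> sqn M (\<lambda>x. grad \<phi> x - G x) < e"
      using \<phi>(1) by blast
  qed
  then show "\<exists>G. H1lim u G" by blast
next
  assume "\<exists>G. H1lim u G"
  then obtain G where H: "H1lim u G" by blast
  have Lu: "L2 M u" and LG: "L2 M G" using H1limD[OF H] .
  have G: "is_L2_weak_gradient \<Omega> u G" using weak_gradient_of_H1lim[OF H] .
  have "\<exists>\<phi>\<in>test_functions \<Omega>. H1_norm \<Omega> (\<lambda>x. u x - \<phi> x) < e" if e: "0 < e" for e
  proof -
    obtain \<phi> where \<phi>: "\<phi> \<in> test_functions \<Omega>" "sqn M (\<lambda>x. \<phi> x - u x) < e\<^sup>2 / 2" "sqn M (\<lambda>x. grad \<phi> x - G x) < e\<^sup>2 / 2"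
      using H1lim_approx[OF H, of "e\<^sup>2 / 2"] e by auto
    then have "sqn M (\<lambda>x. u x - \<phi> x) + sqn M (\<lambda>x. G x - grad \<phi> x) < e\<^sup>2"
      unfolding sqn_minus_commute[of M \<phi>] sqn_minus_commute[of M "grad \<phi>"] by linarith
    then have "H1_norm \<Omega> (\<lambda>x. u x - \<phi> x) < sqrt (e\<^sup>2)"
      unfolding H1_norm_square[OF L2_diff[OF Lu L2_test(1)[OF \<phi>(1)]] is_weak_gradient_diff_test[OF Lu G \<phi>(1)]]
      by (rule real_sqrt_less_mono)
    then show ?thesis using \<phi>(1) e by auto
  qed
  then show "u \<in> H01 \<Omega>"
    unfolding H01_def H1_def Lp_2_iff using Lu G by auto
qed

lemma H1lim_weak_gradient:
  assumes "H1lim u G"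
  shows "AE x in M. weak_gradient \<Omega> u x = G x" "H1lim u (weak_gradient \<Omega> u)"
    "sqn M (weak_gradient \<Omega> u) = sqn M G"
proof -
  have w: "is_L2_weak_gradient \<Omega> u G" using weak_gradient_of_H1lim[OF assms] .
  show ae: "AE x in M. weak_gradient \<Omega> u x = G x" using weak_gradient_AE(2)[OF w] .
  have L: "L2 M (weak_gradient \<Omega> u)" "L2 M G"
    using weak_gradient_AE(1)[OF w] H1limD[OF assms] unfolding is_L2_weak_gradient_def Lp_2_iff by auto
  show "sqn M (weak_gradient \<Omega> u) = sqn M G"
    using ae L by (intro sqn_cong_AE) (auto simp: L2_def)
  have "sqn M (\<lambda>x. G x - weak_gradient \<Omega> u x) = sqn M (\<lambda>x. 0 :: 'a)"
    using ae L by (intro sqn_cong_AE) (auto simp: L2_def)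
  then have "(\<lambda>n::nat. sqn M (\<lambda>x. G x - weak_gradient \<Omega> u x)) \<longlonglongrightarrow> 0"
    by (simp add: sqn_def)
  then show "H1lim u (weak_gradient \<Omega> u)"
    using H1lim_closed[of "\<lambda>_. u" "\<lambda>_. G" u "weak_gradient \<Omega> u"] assms L H1limD(1)[OF assms]
    by (simp add: sqn_def)
qed

lemma H01D: "u \<in> H01 \<Omega> \<Longrightarrow> H1lim u (weak_gradient \<Omega> u)"
  using H01_iff_H1lim H1lim_weak_gradient(2) by blast

lemma H01I: "H1lim u G \<Longrightarrow> u \<in> H01 \<Omega>"
  using H01_iff_H1lim by blast

end

section \<open>Lower semicontinuity and compactness in \<open>H\<^sub>0\<^sup>1\<close>\<close>

lemma null_sequence_squeeze:
  fixes f g :: "nat \<Rightarrow> real"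
  assumes "\<And>n. 0 \<le> f n" "\<And>n. f n \<le> g n" "g \<longlonglongrightarrow> 0"
  shows "f \<longlonglongrightarrow> 0"
  by (rule tendsto_sandwich[OF always_eventually[OF allI] always_eventually[OF allI] tendsto_const assms(3)])
    (use assms in auto)

context bounded_domain
begin

text \<open>Instead of weak convergence: minimise the Dirichlet norm over the convex sets
  \<open>{w. \<parallel>w - u\<parallel>\<^sup>2 \<le> \<delta>}\<close>. By the parallelogram law the almost-minimisers form a Cauchy sequence as
  \<open>\<delta> \<rightarrow> 0\<close>, and their limit is \<open>u\<close>.\<close>

lemma H1lim_lsc:
  assumes H: "\<And>n. H1lim (u n) (G n)" and u0: "L2 M u0"
    and lim: "(\<lambda>n. sqn M (\<lambda>x. u n x - u0 x)) \<longlonglongrightarrow> 0" and bound: "\<And>n. sqn M (G n) \<le> c n" and c: "c \<longlonglongrightarrow> c0"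
  obtains G0 where "H1lim u0 G0" "sqn M G0 \<le> c0"
proof -
  define \<delta> where "\<delta> k = inverse (real (Suc k))" for k
  have \<delta>: "0 < \<delta> k" "\<delta> \<longlonglongrightarrow> 0" for k
    unfolding \<delta>_def using LIMSEQ_inverse_real_of_nat by auto
  have \<delta>_mono: "\<delta> m \<le> \<delta> k" if "k \<le> m" for k m
    unfolding \<delta>_def using that by (simp add: le_imp_inverse_le)
  \<comment> \<open>These sets are closed under midpoints and shrink with k, so the infima
    \<open>d k\<close> increase.\<close>
  define K where "K k = {(w, F). H1lim w F \<and> sqn M (\<lambda>x. w x - u0 x) \<le> \<delta> k}" for k
  define S where "S k = (\<lambda>(w, F). sqn M F) ` K k" for k
  define d where "d k = Inf (S k)" for k
  have bdd: "bdd_below (S k)" for k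
    unfolding S_def by (rule bdd_belowI2[of _ 0]) auto
  have ev: "\<forall>\<^sub>F n in sequentially. sqn M (G n) \<in> S k" for k
    using order_tendstoD(2)[OF lim \<delta>(1)[of k]]
  proof eventually_elim
    case (elim n)
    then have "(u n, G n) \<in> K k" unfolding K_def using H by auto
    then show ?case unfolding S_def by force
  qed
  have ne: "S k \<noteq> {}" for k
    using eventually_happens'[OF _ ev[of k]] by auto
  have d_le: "d k \<le> c0" for k
  proof (rule LIMSEQ_le_const[OF c])
    obtain N where N: "\<And>n. N \<le> n \<Longrightarrow> sqn M (G n) \<in> S k"
      using ev[of k] unfolding eventually_sequentially by blast
    have "d k \<le> c n" if "N \<le> n" for n
      using cInf_lower[OF N[OF that] bdd] bound[of n] unfolding d_def by simp
    then show "\<exists>N. \<forall>n\<ge>N. d k \<le> c n" by blast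
  qed
  have d_mono: "d k \<le> d m" if "k \<le> m" for k m
  proof -
    have "K m \<subseteq> K k" unfolding K_def using \<delta>_mono[OF that] by auto
    then have "S m \<subseteq> S k" unfolding S_def by auto
    then show ?thesis unfolding d_def by (rule cInf_superset_mono[OF ne bdd])
  qed
  have "incseq d" unfolding incseq_def using d_mono by blast
  then obtain d0 where d0: "d \<longlonglongrightarrow> d0" "\<And>k. d k \<le> d0"
    using incseq_convergent[of d c0] d_le by blast
  have d0_le: "d0 \<le> c0" using d_le by (intro LIMSEQ_le_const2[OF d0(1)]) auto
  have "\<exists>w F. (w, F) \<in> K k \<and> sqn M F < d k + \<delta> k" for k
  proof -
    have "Inf (S k) < d k + \<delta> k" unfolding d_def using \<delta>(1)[of k] by simp
    then obtain s where "s \<in> S k" "s < d k + \<delta> k" using cInf_lessD[OF ne] by blast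
    then show ?thesis unfolding S_def by auto
  qed
  then obtain w F where wF: "\<And>k. (w k, F k) \<in> K k" "\<And>k. sqn M (F k) < d k + \<delta> k" by metis
  have wH: "H1lim (w k) (F k)" and wd: "sqn M (\<lambda>x. w k x - u0 x) \<le> \<delta> k" for k
    using wF(1)[of k] unfolding K_def by auto
  \<comment> \<open>The midpoint of the two elements lies again in \<open>K k\<close>, so its
    Dirichlet norm is at least \<open>d k\<close>. In the parallelogram identity only the gap
    \<open>d0 - d k\<close> and the tolerance \<open>\<delta> k\<close> remain.\<close>
  have para: "sqn M (\<lambda>x. F k x - F m x) \<le> 2 * (d0 - d k) + 4 * \<delta> k" if "k \<le> m" for k m
  proof -
    have mid: "H1lim (\<lambda>x. (1 / 2) *\<^sub>R (w k x + w m x)) (\<lambda>x. (1 / 2) *\<^sub>R (F k x + F m x))"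
      using H1lim_cmult[OF H1lim_add[OF wH[of k] wH[of m]], of "1 / 2"] by simp
    have "sqn M (\<lambda>x. (1 / 2) *\<^sub>R (w k x + w m x) - u0 x) \<le> (sqn M (\<lambda>x. w k x - u0 x) + sqn M (\<lambda>x. w m x - u0 x)) / 2"
      using wH u0 by (intro sqn_midpoint_le) (auto dest: H1limD)
    also have "\<dots> \<le> \<delta> k"
      using wd[of k] wd[of m] \<delta>_mono[OF that] by simp
    finally have "(\<lambda>x. (1 / 2) *\<^sub>R (w k x + w m x), \<lambda>x. (1 / 2) *\<^sub>R (F k x + F m x)) \<in> K k"
      unfolding K_def using mid by simp
    then have "sqn M (\<lambda>x. (1 / 2) *\<^sub>R (F k x + F m x)) \<in> S k" unfolding S_def by force
    then have "d k \<le> sqn M (\<lambda>x. (1 / 2) *\<^sub>R (F k x + F m x))"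
      unfolding d_def by (rule cInf_lower[OF _ bdd])
    then have "4 * d k \<le> sqn M (\<lambda>x. F k x + F m x)"
      unfolding sqn_scaleR by (simp add: power2_eq_square)
    moreover have "sqn M (\<lambda>x. F k x - F m x) + sqn M (\<lambda>x. F k x + F m x) = 2 * sqn M (F k) + 2 * sqn M (F m)"
      using wH by (intro sqn_parallelogram) (auto dest: H1limD)
    ultimately have "sqn M (\<lambda>x. F k x - F m x) \<le> 2 * d0 - 2 * d k + 4 * \<delta> k"
      using wF(2)[of k] wF(2)[of m] d0(2)[of m] \<delta>_mono[OF that] by linarith
    then show ?thesis by (simp add: algebra_simps)
  qed
  have cauchy: "\<exists>N. \<forall>m\<ge>N. \<forall>n\<ge>N. sqn M (\<lambda>x. F m x - F n x) < e" if e: "0 < e" for e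
  proof -
    have "(\<lambda>k. 2 * (d0 - d k) + 4 * \<delta> k) \<longlonglongrightarrow> 2 * (d0 - d0) + 4 * 0"
      by (intro tendsto_intros d0 \<delta>)
    then have "\<forall>\<^sub>F k in sequentially. 2 * (d0 - d k) + 4 * \<delta> k < e"
      using e by (intro order_tendstoD(2)) auto
    then obtain N where N: "\<And>k. N \<le> k \<Longrightarrow> 2 * (d0 - d k) + 4 * \<delta> k < e"
      unfolding eventually_sequentially by blast
    have "sqn M (\<lambda>x. F m x - F n x) < e" if mn: "N \<le> m" "N \<le> n" for m n
    proof (cases "m \<le> n")
      case True
      then show ?thesis using para[of m n] N[OF mn(1)] by simp
    next
      case False
      then show ?thesis
        using para[of n m] N[OF mn(2)] sqn_minus_commute[of M "F m" "F n"] by simp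
    qed
    then show ?thesis by blast
  qed
  obtain r G0 where G0: "L2 M G0" "(\<lambda>n. sqn M (\<lambda>x. F n x - G0 x)) \<longlonglongrightarrow> 0"
    using L2_limit_AE_subseq[OF H1limD(2)[OF wH] cauchy] by blast
  have wlim: "(\<lambda>n. sqn M (\<lambda>x. w n x - u0 x)) \<longlonglongrightarrow> 0"
    by (rule null_sequence_squeeze[OF sqn_nonneg wd \<delta>(2)])
  have "H1lim u0 G0"
    by (rule H1lim_closed[OF wH u0 G0(1) wlim G0(2)])
  moreover have "sqn M G0 \<le> c0"
  proof (rule LIMSEQ_le)
    show "(\<lambda>n. sqn M (F n)) \<longlonglongrightarrow> sqn M G0"
      using wH G0 by (intro sqn_tendsto) (auto dest: H1limD)
    show "(\<lambda>n. c0 + \<delta> n) \<longlonglongrightarrow> c0"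
      using tendsto_add[OF tendsto_const \<delta>(2), of c0] by simp
    show "\<exists>N. \<forall>n\<ge>N. sqn M (F n) \<le> c0 + \<delta> n"
      using wF(2) d_le by (meson add_mono_thms_linordered_semiring(3) less_imp_le order_trans)
  qed
  ultimately show ?thesis using that by blast
qed

text \<open>\<open>sqrt (\<phi>\<^sup>2 + e\<^sup>2) - e\<close> smooths the absolute value.
  Subtracting e makes it vanish wherever \<open>\<phi>\<close> does, and its gradient is that of
  \<open>\<phi>\<close> times a factor of modulus at most 1. The smoothed functions converge in
  \<open>L^2\<close>; their gradients are only bounded, so the limit is taken by lower
  semicontinuity.\<close>

lemma H1lim_abs:
  assumes H: "H1lim u G"
  obtains G' where "H1lim (\<lambda>x. \<bar>u x\<bar>) G'" "sqn M G' \<le> sqn M G"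
proof -
  obtain \<phi> where \<phi>: "\<And>n::nat. \<phi> n \<in> test_functions \<Omega>" "(\<lambda>n. sqn M (\<lambda>x. \<phi> n x - u x)) \<longlonglongrightarrow> 0"
    "(\<lambda>n. sqn M (\<lambda>x. grad (\<phi> n) x - G x)) \<longlonglongrightarrow> 0"
    using H by (rule H1limE) (rule that)
  define e where "e n = inverse (real (Suc n))" for n
  have e: "0 < e n" "e \<longlonglongrightarrow> 0" for n
    unfolding e_def using LIMSEQ_inverse_real_of_nat by auto
  define \<psi> where "\<psi> n x = sqrt ((\<phi> n x)\<^sup>2 + (e n)\<^sup>2) - e n" for n x
  have \<psi>: "\<psi> n \<in> test_functions \<Omega>" for n
  proof -
    obtain K where K: "smooth (\<phi> n)" "compact K" "K \<subseteq> \<Omega>" "\<And>x. x \<notin> K \<Longrightarrow> \<phi> n x = 0"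
      using \<phi>(1)[of n] by (auto elim: test_functionsE)
    show ?thesis
    proof (rule test_functionsI[OF _ K(2,3)])
      show "smooth (\<psi> n)"
        unfolding \<psi>_def using e(1)[of n] by (intro smooth_diff smooth_sqrt_square_plus smooth_const K) simp
      show "\<psi> n x = 0" if "x \<notin> K" for x
        using K(4)[OF that] e(1)[of n] unfolding \<psi>_def by simp
    qed
  qed
  have grad_\<psi>: "norm (grad (\<psi> n) x) \<le> norm (grad (\<phi> n) x)" for n x
  proof -
    have pos: "0 < (\<phi> n x)\<^sup>2 + (e n)\<^sup>2"
      using e(1)[of n] by (simp add: add_nonneg_pos)
    have d\<phi>: "(\<phi> n has_derivative (\<lambda>h. grad (\<phi> n) x \<bullet> h)) (at x)"
      by (rule has_derivative_grad[OF test_function_differentiable[OF \<phi>(1)]])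
    have sq: "((\<lambda>y. (\<phi> n y)\<^sup>2 + (e n)\<^sup>2) has_derivative (\<lambda>h. 2 * \<phi> n x * (grad (\<phi> n) x \<bullet> h))) (at x)"
      by (auto intro!: derivative_eq_intros d\<phi> simp: fun_eq_iff)
    have "((\<lambda>y. sqrt ((\<phi> n y)\<^sup>2 + (e n)\<^sup>2)) has_derivative
        (\<lambda>h. (inverse (sqrt ((\<phi> n x)\<^sup>2 + (e n)\<^sup>2)) / 2) * (2 * \<phi> n x * (grad (\<phi> n) x \<bullet> h)))) (at x)"
      by (rule has_derivative_compose[OF sq DERIV_real_sqrt[OF pos, unfolded has_field_derivative_def]])
    then have "((\<lambda>y. sqrt ((\<phi> n y)\<^sup>2 + (e n)\<^sup>2)) has_derivative
        (\<lambda>h. ((\<phi> n x / sqrt ((\<phi> n x)\<^sup>2 + (e n)\<^sup>2)) *\<^sub>R grad (\<phi> n) x) \<bullet> h)) (at x)"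
      by (rule has_derivative_eq_rhs) (simp add: inverse_eq_divide)
    from has_derivative_diff[OF this has_derivative_const[of "e n"]]
    have "grad (\<psi> n) x = (\<phi> n x / sqrt ((\<phi> n x)\<^sup>2 + (e n)\<^sup>2)) *\<^sub>R grad (\<phi> n) x"
      unfolding \<psi>_def by (intro grad_eqI) simp
    moreover have "\<bar>\<phi> n x / sqrt ((\<phi> n x)\<^sup>2 + (e n)\<^sup>2)\<bar> \<le> 1"
    proof -
      have "\<bar>\<phi> n x\<bar> \<le> sqrt ((\<phi> n x)\<^sup>2 + (e n)\<^sup>2)"
        by (rule real_le_rsqrt) simp
      then show ?thesis using pos by (simp add: abs_divide)
    qed
    ultimately show ?thesis
      using mult_right_mono[of "\<bar>\<phi> n x / sqrt ((\<phi> n x)\<^sup>2 + (e n)\<^sup>2)\<bar>" 1 "norm (grad (\<phi> n) x)"] by simp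
  qed
  have close: "\<bar>\<psi> n x - \<bar>\<phi> n x\<bar>\<bar> \<le> e n" for n x
  proof -
    have "sqrt ((\<phi> n x)\<^sup>2 + (e n)\<^sup>2) \<le> \<bar>\<phi> n x\<bar> + e n"
      using sqrt_add_le_add_sqrt[of "(\<phi> n x)\<^sup>2" "(e n)\<^sup>2"] e(1)[of n] by simp
    moreover have "\<bar>\<phi> n x\<bar> \<le> sqrt ((\<phi> n x)\<^sup>2 + (e n)\<^sup>2)"
      by (rule real_le_rsqrt) simp
    ultimately show ?thesis unfolding \<psi>_def using e(1)[of n] by (simp add: abs_le_iff)
  qed
  have Lu: "L2 M u" using H1limD(1)[OF H] .
  have abs_L2: "L2 M (\<lambda>x. \<bar>f x\<bar>)" if "L2 M f" for f :: "'a \<Rightarrow> real"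
    using that unfolding L2_def by auto
  have "sqn M (\<lambda>x. \<psi> n x - \<bar>u x\<bar>) \<le> 2 * ((e n)\<^sup>2 * measure M (space M)) + 2 * sqn M (\<lambda>x. \<phi> n x - u x)" for n
  proof -
    have "sqn M (\<lambda>x. \<psi> n x - \<bar>u x\<bar>) \<le> 2 * sqn M (\<lambda>x. \<psi> n x - \<bar>\<phi> n x\<bar>) + 2 * sqn M (\<lambda>x. \<bar>\<phi> n x\<bar> - \<bar>u x\<bar>)"
      by (intro sqn_triangle abs_L2 Lu L2_test \<phi> \<psi>)
    moreover have "sqn M (\<lambda>x. \<psi> n x - \<bar>\<phi> n x\<bar>) \<le> (LINT x|M. (e n)\<^sup>2)"
      unfolding sqn_def
    proof (rule integral_mono)
      show "integrable M (\<lambda>x. (norm (\<psi> n x - \<bar>\<phi> n x\<bar>))\<^sup>2)"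
        by (intro L2_integrable L2_diff abs_L2 L2_test \<phi> \<psi>)
      show "integrable M (\<lambda>x. (e n)\<^sup>2)"
        using finite_measure.integrable_const[OF finite_measure_M] .
      show "(norm (\<psi> n x - \<bar>\<phi> n x\<bar>))\<^sup>2 \<le> (e n)\<^sup>2" for x
        using close[of n x] by (intro power_mono) auto
    qed
    moreover have "sqn M (\<lambda>x. \<bar>\<phi> n x\<bar> - \<bar>u x\<bar>) \<le> sqn M (\<lambda>x. \<phi> n x - u x)"
      unfolding sqn_def
    proof (rule integral_mono)
      show "integrable M (\<lambda>x. (norm (\<bar>\<phi> n x\<bar> - \<bar>u x\<bar>))\<^sup>2)" "integrable M (\<lambda>x. (norm (\<phi> n x - u x))\<^sup>2)"
        by (intro L2_integrable L2_diff abs_L2 L2_test \<phi> \<psi> Lu)+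
      show "(norm (\<bar>\<phi> n x\<bar> - \<bar>u x\<bar>))\<^sup>2 \<le> (norm (\<phi> n x - u x))\<^sup>2" for x
        by (intro power_mono) auto
    qed
    ultimately show ?thesis by (simp add: mult.commute[of "(e n)\<^sup>2"])
  qed
  note up = this
  have "(\<lambda>n. 2 * ((e n)\<^sup>2 * measure M (space M)) + 2 * sqn M (\<lambda>x. \<phi> n x - u x)) \<longlonglongrightarrow> 2 * (0\<^sup>2 * measure M (space M)) + 2 * 0"
    by (intro tendsto_intros e \<phi>)
  then have lim: "(\<lambda>n. sqn M (\<lambda>x. \<psi> n x - \<bar>u x\<bar>)) \<longlonglongrightarrow> 0"
    by (intro null_sequence_squeeze[OF sqn_nonneg up]) simp
  have bound: "sqn M (grad (\<psi> n)) \<le> sqn M (grad (\<phi> n))" for n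
    unfolding sqn_def using grad_\<psi> by (intro integral_mono L2_integrable L2_grad \<phi> \<psi> power_mono) auto
  have "(\<lambda>n. sqn M (grad (\<phi> n))) \<longlonglongrightarrow> sqn M G"
    by (intro sqn_tendsto L2_grad(1)[OF \<phi>(1)] H1limD(2)[OF H] \<phi>(3))
  then obtain G' where "H1lim (\<lambda>x. \<bar>u x\<bar>) G'" "sqn M G' \<le> sqn M G"
    using H1lim_lsc[OF H1lim_test[OF \<psi>] abs_L2[OF Lu] lim bound] by blast
  then show ?thesis using that by blast
qed

section \<open>Poincare and Sobolev inequalities, compact embedding\<close>

lemma poincare:
  obtains C where "0 < C" "\<And>u G. H1lim u G \<Longrightarrow> sqn M u \<le> C * sqn M G"
proof -
  obtain C where C: "0 < C" "\<And>\<phi>. \<phi> \<in> test_functions \<Omega> \<Longrightarrow>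
    (LINT x|lborel. (\<phi> x)\<^sup>2) \<le> C * (LINT x|lborel. (norm (grad \<phi> x))\<^sup>2)"
    using poincare_test_function[OF bounded_\<Omega>] by metis
  have "sqn M u \<le> C * sqn M G" if H: "H1lim u G" for u G
  proof -
    obtain \<phi> where \<phi>: "\<And>n::nat. \<phi> n \<in> test_functions \<Omega>" "(\<lambda>n. sqn M (\<lambda>x. \<phi> n x - u x)) \<longlonglongrightarrow> 0"
      "(\<lambda>n. sqn M (\<lambda>x. grad (\<phi> n) x - G x)) \<longlonglongrightarrow> 0"
      using H by (rule H1limE) (rule that)
    show ?thesis
    proof (rule LIMSEQ_le)
      show "(\<lambda>n. sqn M (\<phi> n)) \<longlonglongrightarrow> sqn M u"
        by (intro sqn_tendsto L2_test(1)[OF \<phi>(1)] H1limD(1)[OF H] \<phi>(2))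
      show "(\<lambda>n. C * sqn M (grad (\<phi> n))) \<longlonglongrightarrow> C * sqn M G"
        by (intro tendsto_mult_left sqn_tendsto L2_grad(1)[OF \<phi>(1)] H1limD(2)[OF H] \<phi>(3))
      show "\<exists>N. \<forall>n\<ge>N. sqn M (\<phi> n) \<le> C * sqn M (grad (\<phi> n))"
        using C(2)[OF \<phi>(1)] by (simp add: L2_test[OF \<phi>(1)] L2_grad[OF \<phi>(1)])
    qed
  qed
  then show ?thesis using that C(1) by blast
qed

lemma subseq_L2_AE:
  fixes f :: "nat \<Rightarrow> 'a \<Rightarrow> real"
  assumes f: "\<And>n. L2 M (f n)" "L2 M f0" and lim: "(\<lambda>n. sqn M (\<lambda>x. f n x - f0 x)) \<longlonglongrightarrow> 0"
  obtains r where "strict_mono (r :: nat \<Rightarrow> nat)" "AE x in M. (\<lambda>k. f (r k) x) \<longlonglongrightarrow> f0 x"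
proof -
  obtain r g where g: "L2 M g" "(\<lambda>n. sqn M (\<lambda>x. f n x - g x)) \<longlonglongrightarrow> 0"
    "strict_mono (r :: nat \<Rightarrow> nat)" "AE x in M. (\<lambda>k. f (r k) x) \<longlonglongrightarrow> g x"
    using L2_limit_AE_subseq[OF f(1) L2_convergent_imp_Cauchy[OF f lim]] by blast
  have "AE x in M. g x = f0 x"
    by (rule L2_limit_unique[OF f(1) g(1,2) f(2) lim])
  with g(4) have "AE x in M. (\<lambda>k. f (r k) x) \<longlonglongrightarrow> f0 x"
    by eventually_elim simp
  then show ?thesis using that g(3) by blast
qed

lemma fatou_power4:
  fixes f :: "nat \<Rightarrow> 'a \<Rightarrow> real"
  assumes f: "\<And>n. f n \<in> borel_measurable M" "f0 \<in> borel_measurable M" "\<And>n. integrable M (\<lambda>x. f n x ^ 4)"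
    and ae: "AE x in M. (\<lambda>k. f k x) \<longlonglongrightarrow> f0 x"
    and bound: "\<And>n. (LINT x|M. f n x ^ 4) \<le> c n" and c: "c \<longlonglongrightarrow> c0"
  shows "integrable M (\<lambda>x. f0 x ^ 4)" "(LINT x|M. f0 x ^ 4) \<le> c0"
proof -
  note [measurable] = f(1,2)
  have "0 \<le> (LINT x|M. f n x ^ 4)" for n by simp
  then have c0: "0 \<le> c0"
    using bound by (intro LIMSEQ_le_const[OF c]) (meson order_trans)
  have "(\<integral>\<^sup>+x. ennreal (f0 x ^ 4) \<partial>M) = (\<integral>\<^sup>+x. liminf (\<lambda>k. ennreal (f k x ^ 4)) \<partial>M)"
  proof (rule nn_integral_cong_AE)
    show "AE x in M. ennreal (f0 x ^ 4) = liminf (\<lambda>k. ennreal (f k x ^ 4))"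
      using ae
    proof eventually_elim
      case (elim x)
      then have "(\<lambda>k. ennreal (f k x ^ 4)) \<longlonglongrightarrow> ennreal (f0 x ^ 4)"
        by (intro tendsto_ennrealI tendsto_intros)
      then show ?case by (rule lim_imp_Liminf[OF trivial_limit_sequentially, symmetric])
    qed
  qed
  also have "\<dots> \<le> liminf (\<lambda>k. \<integral>\<^sup>+x. ennreal (f k x ^ 4) \<partial>M)"
    by (rule nn_integral_liminf) measurable
  also have "\<dots> \<le> liminf (\<lambda>k. ennreal (c k))"
  proof (intro Liminf_mono always_eventually allI)
    fix k
    have "(\<integral>\<^sup>+x. ennreal (f k x ^ 4) \<partial>M) = ennreal (LINT x|M. f k x ^ 4)"
      using f(3) by (intro nn_integral_eq_integral) auto
    then show "(\<integral>\<^sup>+x. ennreal (f k x ^ 4) \<partial>M) \<le> ennreal (c k)"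
      using bound by (simp add: ennreal_leI)
  qed
  also have "\<dots> = ennreal c0"
    by (intro lim_imp_Liminf tendsto_ennrealI c) simp
  finally have le: "(\<integral>\<^sup>+x. ennreal (f0 x ^ 4) \<partial>M) \<le> ennreal c0" .
  show int: "integrable M (\<lambda>x. f0 x ^ 4)"
  proof (rule integrableI_bounded)
    have "(\<integral>\<^sup>+x. ennreal (norm (f0 x ^ 4)) \<partial>M) = (\<integral>\<^sup>+x. ennreal (f0 x ^ 4) \<partial>M)" by simp
    also have "\<dots> < \<infinity>" using le by (simp add: le_less_trans)
    finally show "(\<integral>\<^sup>+x. ennreal (norm (f0 x ^ 4)) \<partial>M) < \<infinity>" .
  qed measurable
  have "(\<integral>\<^sup>+x. ennreal (f0 x ^ 4) \<partial>M) = ennreal (LINT x|M. f0 x ^ 4)"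
    using int by (intro nn_integral_eq_integral) auto
  then show "(LINT x|M. f0 x ^ 4) \<le> c0"
    using le c0 by simp
qed

lemma L4_test:
  assumes "\<phi> \<in> test_functions \<Omega>"
  shows "integrable M (\<lambda>x. \<phi> x ^ 4)" "(LINT x|M. \<phi> x ^ 4) = (LINT x|lborel. \<phi> x ^ 4)"
proof -
  have "compactly_supported (\<lambda>x. \<phi> x ^ 4)"
    using compactly_supported_test_function[OF assms] by (rule compactly_supported_power) simp
  then show "integrable M (\<lambda>x. \<phi> x ^ 4)" "(LINT x|M. \<phi> x ^ 4) = (LINT x|lborel. \<phi> x ^ 4)"
    using compactly_supported_M[of "\<lambda>x. \<phi> x ^ 4"] test_function_eq_0_outside[OF assms] by simp_all
qed

text \<open>Fatou along an almost everywhere convergent sequence of test functions. This yields the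
  integrability of \<open>u x ^ 4\<close> together with the bound.\<close>

lemma H1lim_L4:
  assumes dim: "DIM('a) \<le> 3"
  obtains C where "0 < C" "\<And>u G. H1lim u G \<Longrightarrow> integrable M (\<lambda>x. u x ^ 4) \<and> (LINT x|M. u x ^ 4) \<le> C * (sqn M u + sqn M G)\<^sup>2"
proof -
  obtain C where C: "0 < C" "\<And>(\<phi>::'a \<Rightarrow> real) \<Omega>. \<phi> \<in> test_functions \<Omega> \<Longrightarrow>
    (LINT x|lborel. \<phi> x ^ 4) \<le> C * ((LINT x|lborel. (\<phi> x)\<^sup>2) + (LINT x|lborel. (norm (grad \<phi> x))\<^sup>2))\<^sup>2"
    using test_function_L4[OF dim] by metis
  have "integrable M (\<lambda>x. u x ^ 4) \<and> (LINT x|M. u x ^ 4) \<le> C * (sqn M u + sqn M G)\<^sup>2" if H: "H1lim u G" for u G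
  proof -
    obtain \<phi> where \<phi>: "\<And>n::nat. \<phi> n \<in> test_functions \<Omega>" "(\<lambda>n. sqn M (\<lambda>x. \<phi> n x - u x)) \<longlonglongrightarrow> 0"
      "(\<lambda>n. sqn M (\<lambda>x. grad (\<phi> n) x - G x)) \<longlonglongrightarrow> 0"
      using H by (rule H1limE) (rule that)
    have L: "L2 M u" "L2 M G" using H1limD[OF H] .
    obtain r where r: "strict_mono (r :: nat \<Rightarrow> nat)" "AE x in M. (\<lambda>k. \<phi> (r k) x) \<longlonglongrightarrow> u x"
      using subseq_L2_AE[OF L2_test(1)[OF \<phi>(1)] L(1) \<phi>(2)] by blast
    have "(\<lambda>n. C * (sqn M (\<phi> n) + sqn M (grad (\<phi> n)))\<^sup>2) \<longlonglongrightarrow> C * (sqn M u + sqn M G)\<^sup>2"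
      by (intro tendsto_intros sqn_tendsto L2_test(1)[OF \<phi>(1)] L2_grad(1)[OF \<phi>(1)] L \<phi>(2,3))
    then have lim: "(\<lambda>k. C * (sqn M (\<phi> (r k)) + sqn M (grad (\<phi> (r k))))\<^sup>2) \<longlonglongrightarrow> C * (sqn M u + sqn M G)\<^sup>2"
      using LIMSEQ_subseq_LIMSEQ[OF _ r(1)] by (auto simp: o_def)
    have b: "(LINT x|M. \<phi> (r k) x ^ 4) \<le> C * (sqn M (\<phi> (r k)) + sqn M (grad (\<phi> (r k))))\<^sup>2" for k
      using C(2)[OF \<phi>(1), of "r k"] by (simp add: L4_test[OF \<phi>(1)] L2_test[OF \<phi>(1)] L2_grad[OF \<phi>(1)])
    show ?thesis
      using fatou_power4[OF test_function_measurable(2)[OF \<phi>(1)] _ L4_test(1)[OF \<phi>(1)] r(2) b lim] L(1)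
      by (auto simp: L2_def)
  qed
  then show ?thesis using that C(1) by blast
qed

text \<open>Cauchy-Schwarz for \<open>f\<^sup>2\<close> and the constant 1, on a set of finite
  measure.\<close>

lemma sqn_le_L4:
  fixes f :: "'a \<Rightarrow> real"
  assumes f: "f \<in> borel_measurable M" "integrable M (\<lambda>x. f x ^ 4)"
  shows "L2 M f" "(sqn M f)\<^sup>2 \<le> measure M (space M) * (LINT x|M. f x ^ 4)"
proof -
  note [measurable] = f(1)
  have sq: "L2 M (\<lambda>x. (f x)\<^sup>2)"
    using f(2) unfolding L2_def by (simp flip: power_mult)
  then have "integrable M (\<lambda>x. (f x)\<^sup>2)" by (rule L2_imp_integrable)
  then show "L2 M f" unfolding L2_def by simp
  have "(LINT x|M. (f x)\<^sup>2 \<bullet> 1)\<^sup>2 \<le> sqn M (\<lambda>x. (f x)\<^sup>2) * sqn M (\<lambda>x. 1 :: real)"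
    by (rule L2_cauchy_schwarz[OF sq L2_const])
  then show "(sqn M f)\<^sup>2 \<le> measure M (space M) * (LINT x|M. f x ^ 4)"
    unfolding sqn_def by (simp add: mult.commute flip: power_mult)
qed

lemma L4_diff_integrable:
  fixes f g :: "'a \<Rightarrow> real"
  assumes [measurable]: "f \<in> borel_measurable M" "g \<in> borel_measurable M"
    and "integrable M (\<lambda>x. f x ^ 4)" "integrable M (\<lambda>x. g x ^ 4)"
  shows "integrable M (\<lambda>x. (f x - g x) ^ 4)"
proof -
  have "integrable M (\<lambda>x. 8 * (f x ^ 4 + g x ^ 4))" using assms by simp
  then show ?thesis
  proof (rule Bochner_Integration.integrable_bound)
    show "AE x in M. norm ((f x - g x) ^ 4) \<le> norm (8 * (f x ^ 4 + g x ^ 4))"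
      by (rule AE_I2) (use power4_diff_le[of "f _" "g _"] in simp)
  qed measurable
qed

text \<open>Each \<open>u n\<close> is replaced by a test function that is close in both components,
  and \<open>H1lim_L4\<close> controls the cost in \<open>L^4\<close>. The test functions have a
  limit in \<open>L^2\<close>; Fatou upgrades the convergence to \<open>L^4\<close>, and lower
  semicontinuity supplies a gradient for the limit.\<close>

lemma H1lim_L4_compact:
  assumes dim: "DIM('a) \<le> 3" and H: "\<And>n. H1lim (u n) (G n)"
    and bound: "\<And>n. sqn M (u n) \<le> B" "\<And>n. sqn M (G n) \<le> B"
  obtains r u0 G0 where "strict_mono (r :: nat \<Rightarrow> nat)" "H1lim u0 G0"
    "(\<lambda>n. LINT x|M. (u (r n) x - u0 x) ^ 4) \<longlonglongrightarrow> 0"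
proof -
  obtain C where C: "0 < C" "\<And>u G. H1lim u G \<Longrightarrow> integrable M (\<lambda>x. u x ^ 4)"
    "\<And>u G. H1lim u G \<Longrightarrow> (LINT x|M. u x ^ 4) \<le> C * (sqn M u + sqn M G)\<^sup>2"
    using H1lim_L4[OF dim] by metis
  define e where "e n = inverse (real (Suc n))" for n
  have e: "0 < e n" "e n \<le> 1" "e \<longlonglongrightarrow> 0" for n
    unfolding e_def using LIMSEQ_inverse_real_of_nat by (auto simp: inverse_le_1_iff)
  have "\<exists>\<phi>\<in>test_functions \<Omega>. sqn M (\<lambda>x. \<phi> x - u n x) < e n \<and> sqn M (\<lambda>x. grad \<phi> x - G n x) < e n" for n
    using H1lim_approx[OF H e(1), of n n] by metis
  then obtain \<phi> where \<phi>: "\<And>n. \<phi> n \<in> test_functions \<Omega>" "\<And>n. sqn M (\<lambda>x. \<phi> n x - u n x) < e n"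
    "\<And>n. sqn M (\<lambda>x. grad (\<phi> n) x - G n x) < e n"
    by metis
  have Lu: "L2 M (u n)" and LG: "L2 M (G n)" for n using H1limD[OF H] .
  have b\<phi>: "sqn M (\<phi> n) \<le> 2 + 2 * B" for n
    using sqn_triangle[OF L2_test(1)[OF \<phi>(1)] Lu L2_0, of n n] \<phi>(2)[of n] e(2)[of n] bound(1)[of n] by simp
  have bg: "sqn M (grad (\<phi> n)) \<le> 2 + 2 * B" for n
    using sqn_triangle[OF L2_grad(1)[OF \<phi>(1)] LG L2_0, of n n] \<phi>(3)[of n] e(2)[of n] bound(2)[of n] by simp
  obtain r where r: "strict_mono (r :: nat \<Rightarrow> nat)"
    and cauchy4: "\<And>e. 0 < e \<Longrightarrow> \<exists>n0. \<forall>m\<ge>n0. \<forall>n\<ge>n0. (LINT x|lborel. (\<phi> (r m) x - \<phi> (r n) x) ^ 4) < e"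
    by (rule test_functions_L4_compact[OF open_\<Omega> bounded_\<Omega> dim \<phi>(1) b\<phi>[unfolded L2_test(2)[OF \<phi>(1)]]
          bg[unfolded L2_grad(2)[OF \<phi>(1)]]]) (rule that)
  define \<psi> where "\<psi> n = \<phi> (r n)" for n
  have \<psi>: "\<psi> n \<in> test_functions \<Omega>" for n unfolding \<psi>_def by (rule \<phi>)
  have \<psi>d: "(\<lambda>x. \<psi> m x - \<psi> n x) \<in> test_functions \<Omega>" for m n
    using \<psi> by (intro test_functions_diff)
  have [measurable]: "\<psi> n \<in> borel_measurable M" for n
    using \<psi> by (rule test_function_measurable)
  have c4: "\<exists>n0. \<forall>m\<ge>n0. \<forall>n\<ge>n0. (LINT x|M. (\<psi> m x - \<psi> n x) ^ 4) < e" if "0 < e" for e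
    using cauchy4[OF that] by (simp add: L4_test(2)[OF \<psi>d]) (simp add: \<psi>_def)
  define V where "V = measure M (space M) + 1"
  have V: "0 < V" unfolding V_def by (simp add: add_nonneg_pos)
  have c2: "\<exists>N. \<forall>m\<ge>N. \<forall>n\<ge>N. sqn M (\<lambda>x. \<psi> m x - \<psi> n x) < d" if d: "0 < d" for d
  proof -
    obtain N where N: "\<And>m n. N \<le> m \<Longrightarrow> N \<le> n \<Longrightarrow> (LINT x|M. (\<psi> m x - \<psi> n x) ^ 4) < d\<^sup>2 / V"
      using c4[of "d\<^sup>2 / V"] d V by auto
    have "sqn M (\<lambda>x. \<psi> m x - \<psi> n x) < d" if "N \<le> m" "N \<le> n" for m n
    proof -
      have "(sqn M (\<lambda>x. \<psi> m x - \<psi> n x))\<^sup>2 \<le> measure M (space M) * (LINT x|M. (\<psi> m x - \<psi> n x) ^ 4)"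
        by (rule sqn_le_L4(2)) (auto intro: L4_test(1)[OF \<psi>d])
      also have "\<dots> \<le> V * (LINT x|M. (\<psi> m x - \<psi> n x) ^ 4)"
        unfolding V_def by (intro mult_right_mono) auto
      also have "\<dots> < V * (d\<^sup>2 / V)"
        using N[OF that] V by (intro mult_strict_left_mono)
      finally have "(sqn M (\<lambda>x. \<psi> m x - \<psi> n x))\<^sup>2 < d\<^sup>2" using V by simp
      then show ?thesis using d by (simp add: power2_less_imp_less)
    qed
    then show ?thesis by blast
  qed
  obtain s u0 where u0: "L2 M u0" "(\<lambda>n. sqn M (\<lambda>x. \<psi> n x - u0 x)) \<longlonglongrightarrow> 0"
    and s: "strict_mono (s :: nat \<Rightarrow> nat)" "AE x in M. (\<lambda>k. \<psi> (s k) x) \<longlonglongrightarrow> u0 x"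
    using L2_limit_AE_subseq[OF L2_test(1)[OF \<psi>] c2] by blast
  have [measurable]: "u0 \<in> borel_measurable M" using u0(1) by (simp add: L2_def)
  have b\<psi>: "sqn M (grad (\<psi> n)) \<le> 2 + 2 * B" for n unfolding \<psi>_def by (rule bg)
  obtain G0 where G0: "H1lim u0 G0"
    using H1lim_lsc[OF H1lim_test[OF \<psi>] u0 b\<psi> tendsto_const] by blast
  have lim\<psi>: "(\<lambda>n. LINT x|M. (\<psi> n x - u0 x) ^ 4) \<longlonglongrightarrow> 0"
  proof (rule LIMSEQ_I)
    fix d :: real assume d: "0 < d"
    obtain N where N: "\<And>m n. N \<le> m \<Longrightarrow> N \<le> n \<Longrightarrow> (LINT x|M. (\<psi> m x - \<psi> n x) ^ 4) < d / 2"
      using c4[of "d / 2"] d by auto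
    have "(LINT x|M. (\<psi> n x - u0 x) ^ 4) \<le> d / 2" if n: "N \<le> n" for n
    \<comment> \<open>The Cauchy bound is passed to the limit in one index; the shift by
      \<open>N\<close> puts \<open>s (k + N)\<close> into the range where it holds.\<close>
    proof (rule fatou_power4(2)[where f = "\<lambda>k x. \<psi> n x - \<psi> (s (k + N)) x" and c = "\<lambda>_. d / 2"])
      show "AE x in M. (\<lambda>k. \<psi> n x - \<psi> (s (k + N)) x) \<longlonglongrightarrow> \<psi> n x - u0 x"
        using s(2)
      proof eventually_elim
        case (elim x)
        then show ?case
          using LIMSEQ_ignore_initial_segment[OF elim, of N] by (intro tendsto_diff tendsto_const)
      qed
      show "(LINT x|M. (\<psi> n x - \<psi> (s (k + N)) x) ^ 4) \<le> d / 2" for k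
        using N[OF n, of "s (k + N)"] seq_suble[OF s(1), of "k + N"] by simp
    qed (auto intro: L4_test(1)[OF \<psi>d])
    then show "\<exists>N. \<forall>n\<ge>N. norm ((LINT x|M. (\<psi> n x - u0 x) ^ 4) - 0) < d"
      using d by (intro exI[of _ N]) force
  qed
  have meas_u[measurable]: "u n \<in> borel_measurable M" for n using Lu by (simp add: L2_def)
  have u4: "integrable M (\<lambda>x. u n x ^ 4)" for n by (rule C(2)[OF H])
  have u04: "integrable M (\<lambda>x. u0 x ^ 4)" by (rule C(2)[OF G0])
  have "(LINT x|M. (u (r n) x - u0 x) ^ 4) \<le> 8 * (C * (2 * e (r n))\<^sup>2 + (LINT x|M. (\<psi> n x - u0 x) ^ 4))" for n
  proof -
    have diff: "H1lim (\<lambda>x. u (r n) x - \<psi> n x) (\<lambda>x. G (r n) x - grad (\<psi> n) x)"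
      by (rule H1lim_diff[OF H H1lim_test[OF \<psi>]])
    have i1: "integrable M (\<lambda>x. (u (r n) x - \<psi> n x) ^ 4)" by (rule C(2)[OF diff])
    have i2: "integrable M (\<lambda>x. (\<psi> n x - u0 x) ^ 4)"
      by (intro L4_diff_integrable L4_test \<psi> u04) measurable
    have "(LINT x|M. (u (r n) x - u0 x) ^ 4) \<le> (LINT x|M. 8 * ((u (r n) x - \<psi> n x) ^ 4 + (\<psi> n x - u0 x) ^ 4))"
    proof (rule integral_mono)
      show "integrable M (\<lambda>x. (u (r n) x - u0 x) ^ 4)"
        by (intro L4_diff_integrable u4 u04) measurable
      show "(u (r n) x - u0 x) ^ 4 \<le> 8 * ((u (r n) x - \<psi> n x) ^ 4 + (\<psi> n x - u0 x) ^ 4)" for x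
        using power4_add_le[of "u (r n) x - \<psi> n x" "\<psi> n x - u0 x"] by simp
    qed (use i1 i2 in simp)
    also have "\<dots> = 8 * ((LINT x|M. (u (r n) x - \<psi> n x) ^ 4) + (LINT x|M. (\<psi> n x - u0 x) ^ 4))"
      using i1 i2 by simp
    also have "(LINT x|M. (u (r n) x - \<psi> n x) ^ 4) \<le> C * (sqn M (\<lambda>x. u (r n) x - \<psi> n x) + sqn M (\<lambda>x. G (r n) x - grad (\<psi> n) x))\<^sup>2"
      by (rule C(3)[OF diff])
    also have "\<dots> \<le> C * (2 * e (r n))\<^sup>2"
    proof (intro mult_left_mono power_mono)
      show "sqn M (\<lambda>x. u (r n) x - \<psi> n x) + sqn M (\<lambda>x. G (r n) x - grad (\<psi> n) x) \<le> 2 * e (r n)"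
        unfolding sqn_minus_commute[of M "u (r n)"] sqn_minus_commute[of M "G (r n)"] \<psi>_def
        using \<phi>(2)[of "r n"] \<phi>(3)[of "r n"] by simp
    qed (use C in auto)
    finally show ?thesis by simp
  qed
  note up = this
  have "(\<lambda>n. 8 * (C * (2 * e (r n))\<^sup>2 + (LINT x|M. (\<psi> n x - u0 x) ^ 4))) \<longlonglongrightarrow> 8 * (C * (2 * 0)\<^sup>2 + 0)"
    using LIMSEQ_subseq_LIMSEQ[OF e(3) r] by (intro tendsto_intros lim\<psi>) (simp add: o_def)
  then have "(\<lambda>n. LINT x|M. (u (r n) x - u0 x) ^ 4) \<longlonglongrightarrow> 0"
    by (intro null_sequence_squeeze[OF _ up]) simp_all
  then show ?thesis using that r G0 by blast
qed

end

section \<open>Pairings with functions in \<open>L\<^sup>4\<close>\<close>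

text \<open>The abstract minimisation works in a real vector space. Pointwise operations turn pairs
  of total functions into one, without passing to classes of functions.\<close>

instantiation "fun" :: (type, real_vector) real_vector
begin

definition scaleR_fun :: "real \<Rightarrow> ('a \<Rightarrow> 'b) \<Rightarrow> 'a \<Rightarrow> 'b" where
  "scaleR_fun r f = (\<lambda>x. r *\<^sub>R f x)"

instance
  by standard (simp_all add: scaleR_fun_def fun_eq_iff scaleR_add_right scaleR_add_left)

end

context bounded_domain
begin

definition L4 :: "('a \<Rightarrow> real) \<Rightarrow> bool" where
  "L4 u \<longleftrightarrow> u \<in> borel_measurable M \<and> integrable M (\<lambda>x. u x ^ 4)"

text \<open>The \<open>L^4\<close> norm as an iterated square root, which matches two successive
  applications of Cauchy-Schwarz.\<close>

definition p4 :: "('a \<Rightarrow> real) \<Rightarrow> real" where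
  "p4 u = sqrt (sqrt (LINT x|M. u x ^ 4))"

lemma p4_nonneg [simp]: "0 \<le> p4 u"
  unfolding p4_def by simp

lemma p4_power4: "p4 u ^ 4 = (LINT x|M. u x ^ 4)"
proof -
  have "p4 u ^ 4 = ((p4 u)\<^sup>2)\<^sup>2" by simp
  then show ?thesis unfolding p4_def by (simp del: power_mult_numeral)
qed

lemma p4_square: "(p4 u)\<^sup>2 = sqrt (LINT x|M. u x ^ 4)"
  unfolding p4_def by simp

lemma L4_square_L2: "L4 u \<Longrightarrow> L2 M (\<lambda>x. (u x)\<^sup>2)"
  unfolding L4_def L2_def by (auto simp flip: power_mult)

lemma L4_mult_L2:
  assumes "L4 a" "L4 b"
  shows "L2 M (\<lambda>x. a x * b x)"
proof -
  have "integrable M (\<lambda>x. (a x)\<^sup>2 * (b x)\<^sup>2)"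
    by (intro L2_mult_integrable L4_square_L2 assms)
  then show ?thesis
    using assms unfolding L2_def L4_def by (auto simp: power_mult_distrib)
qed

lemma sqn_mult_le:
  assumes "L4 a" "L4 b"
  shows "sqn M (\<lambda>x. a x * b x) \<le> (p4 a * p4 b)\<^sup>2"
proof -
  have "sqn M (\<lambda>x. a x * b x) = (LINT x|M. (a x)\<^sup>2 \<bullet> (b x)\<^sup>2)"
    unfolding sqn_def by (simp add: power_mult_distrib)
  also have "\<dots> \<le> sqrt (sqn M (\<lambda>x. (a x)\<^sup>2) * sqn M (\<lambda>x. (b x)\<^sup>2))"
    by (intro real_le_rsqrt L2_cauchy_schwarz L4_square_L2 assms)
  also have "\<dots> = (p4 a * p4 b)\<^sup>2"
    unfolding power_mult_distrib p4_square sqn_def by (simp add: real_sqrt_mult flip: power_mult)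
  finally show ?thesis .
qed

text \<open>Hoelder's inequality for four factors: Cauchy-Schwarz between the two products, then
  within each of them.\<close>

lemma L4_mult4:
  assumes "L4 a" "L4 b" "L4 c" "L4 d"
  shows "integrable M (\<lambda>x. a x * b x * c x * d x)"
    "\<bar>LINT x|M. a x * b x * c x * d x\<bar> \<le> p4 a * p4 b * p4 c * p4 d"
proof -
  have eq: "(\<lambda>x. a x * b x * c x * d x) = (\<lambda>x. (a x * b x) * (c x * d x))"
    by (auto simp: mult_ac)
  note ab = L4_mult_L2[OF assms(1,2)] and cd = L4_mult_L2[OF assms(3,4)]
  show "integrable M (\<lambda>x. a x * b x * c x * d x)"
    unfolding eq by (rule L2_mult_integrable[OF ab cd])
  have "(LINT x|M. a x * b x * c x * d x)\<^sup>2 \<le> sqn M (\<lambda>x. a x * b x) * sqn M (\<lambda>x. c x * d x)"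
    unfolding eq using L2_cauchy_schwarz[OF ab cd] by simp
  also have "\<dots> \<le> (p4 a * p4 b)\<^sup>2 * (p4 c * p4 d)\<^sup>2"
    by (intro mult_mono sqn_mult_le assms) auto
  also have "\<dots> = (p4 a * p4 b * p4 c * p4 d)\<^sup>2"
    by (simp add: power_mult_distrib mult_ac)
  finally show "\<bar>LINT x|M. a x * b x * c x * d x\<bar> \<le> p4 a * p4 b * p4 c * p4 d"
    by (simp add: abs_le_square_iff[symmetric] abs_mult)
qed

lemma L4_add:
  assumes "L4 u" "L4 v"
  shows "L4 (\<lambda>x. u x + v x)"
proof -
  have [measurable]: "u \<in> borel_measurable M" "v \<in> borel_measurable M" using assms by (auto simp: L4_def)
  have "integrable M (\<lambda>x. 8 * (u x ^ 4 + v x ^ 4))" using assms by (simp add: L4_def)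
  then have "integrable M (\<lambda>x. (u x + v x) ^ 4)"
  proof (rule Bochner_Integration.integrable_bound)
    show "AE x in M. norm ((u x + v x) ^ 4) \<le> norm (8 * (u x ^ 4 + v x ^ 4))"
      by (rule AE_I2) (use power4_add_le[of "u _" "v _"] in simp)
  qed measurable
  then show ?thesis unfolding L4_def by simp
qed

lemma L4_cmult: "L4 u \<Longrightarrow> L4 (\<lambda>x. c * u x)"
  unfolding L4_def by (auto simp: power_mult_distrib)

lemma L4_abs: "L4 u \<Longrightarrow> L4 (\<lambda>x. \<bar>u x\<bar>)"
  unfolding L4_def by auto

lemma powr_4_abs: "\<bar>a::real\<bar> powr 4 = a ^ 4"
  by (cases "a = 0") simp_all

lemma Lp_4_iff: "u \<in> Lp 4 \<Omega> \<longleftrightarrow> L4 u"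
  unfolding Lp_def L4_def by (simp add: powr_4_abs)

lemma Lp_norm_4: "Lp_norm 4 \<Omega> u = p4 u"
proof -
  have "0 \<le> (LINT x|M. u x ^ 4)" by simp
  then have "(LINT x|M. u x ^ 4) powr (1 / 4) = ((LINT x|M. u x ^ 4) powr (1 / 2)) powr (1 / 2)"
    by (simp add: powr_powr)
  then show ?thesis
    unfolding Lp_norm_def p4_def by (simp add: powr_4_abs powr_half_sqrt)
qed

lemma Lp_norm_43: "f \<in> Lp (4/3) \<Omega> \<Longrightarrow> (LINT x|M. \<bar>f x\<bar> powr (4/3)) = Lp_norm (4/3) \<Omega> f powr (4/3)"
  for f :: "'a \<Rightarrow> real"
  unfolding Lp_norm_def by (simp add: powr_powr)

lemma young_43: "0 \<le> a \<Longrightarrow> 0 \<le> b \<Longrightarrow> a * b \<le> 3 / 4 * a powr (4 / 3) + 1 / 4 * b ^ 4" for a b :: real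
  using Youngs_inequality[of "4/3" 4 a b] by (cases "b = 0") auto

lemma Lp_43_integrable:
  fixes f :: "'a \<Rightarrow> real"
  assumes f: "f \<in> Lp (4/3) \<Omega>" and u: "L4 u"
  shows "integrable M (\<lambda>x. f x * u x)"
proof -
  have [measurable]: "f \<in> borel_measurable M" "u \<in> borel_measurable M"
    using f u by (auto simp: Lp_def L4_def)
  have "integrable M (\<lambda>x. 3 / 4 * \<bar>f x\<bar> powr (4 / 3) + 1 / 4 * u x ^ 4)"
    using f u by (simp add: Lp_def L4_def)
  then show ?thesis
  proof (rule Bochner_Integration.integrable_bound)
    show "AE x in M. norm (f x * u x) \<le> norm (3 / 4 * \<bar>f x\<bar> powr (4 / 3) + 1 / 4 * u x ^ 4)"
      by (rule AE_I2) (use young_43[of "\<bar>f _\<bar>" "\<bar>u _\<bar>"] in \<open>simp add: abs_mult\<close>)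
  qed measurable
qed

lemma AE_0_of_integral:
  assumes "integrable M h" "\<And>x. 0 \<le> h x" "integral\<^sup>L M h = (0::real)"
  shows "AE x in M. h x = 0"
  using integral_nonneg_eq_0_iff_AE[OF assms(1)] assms by auto

text \<open>Young's inequality is applied after division by the norms, so that the two integrals
  become 3/4 and 1/4. If a norm vanishes, the product is zero almost everywhere.\<close>

lemma holder_43:
  fixes f :: "'a \<Rightarrow> real"
  assumes f: "f \<in> Lp (4/3) \<Omega>" and u: "L4 u"
  shows "\<bar>LINT x|M. f x * u x\<bar> \<le> Lp_norm (4/3) \<Omega> f * p4 u"
proof -
  define A where "A = Lp_norm (4/3) \<Omega> f"
  define B where "B = p4 u"
  have A: "(LINT x|M. \<bar>f x\<bar> powr (4/3)) = A powr (4/3)" "0 \<le> A"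
    unfolding A_def using Lp_norm_43[OF f] by (auto simp: Lp_norm_def)
  have B: "(LINT x|M. u x ^ 4) = B ^ 4" "0 \<le> B"
    unfolding B_def using p4_power4 by auto
  have fi: "integrable M (\<lambda>x. \<bar>f x\<bar> powr (4/3))" and ui: "integrable M (\<lambda>x. u x ^ 4)"
    using f u by (auto simp: Lp_def L4_def)
  show ?thesis
  proof (cases "A = 0 \<or> B = 0")
    case True
    then have "AE x in M. f x * u x = 0"
    proof
      assume "A = 0"
      then have "AE x in M. \<bar>f x\<bar> powr (4/3) = 0"
        using A by (intro AE_0_of_integral fi) auto
      then show ?thesis by eventually_elim simp
    next
      assume "B = 0"
      then have "AE x in M. u x ^ 4 = 0"
        using B by (intro AE_0_of_integral ui) auto
      then show ?thesis by eventually_elim simp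
    qed
    then have "(LINT x|M. f x * u x) = 0"
      by (rule integral_eq_zero_AE)
    then show ?thesis using A(2) B(2) unfolding A_def B_def by simp
  next
    case False
    then have pos: "0 < A" "0 < B" using A(2) B(2) by auto
    have "\<bar>LINT x|M. f x * u x\<bar> \<le> (LINT x|M. \<bar>f x * u x\<bar>)"
      using integral_norm_bound[of M "\<lambda>x. f x * u x"] by simp
    also have "\<dots> \<le> (LINT x|M. A * B * (3 / 4 * (\<bar>f x\<bar> powr (4/3) / A powr (4/3)) + 1 / 4 * (u x ^ 4 / B ^ 4)))"
    proof (rule integral_mono)
      show "integrable M (\<lambda>x. \<bar>f x * u x\<bar>)" using Lp_43_integrable[OF f u] by simp
      show "integrable M (\<lambda>x. A * B * (3 / 4 * (\<bar>f x\<bar> powr (4/3) / A powr (4/3)) + 1 / 4 * (u x ^ 4 / B ^ 4)))"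
        using fi ui by simp
      fix x
      have "\<bar>f x\<bar> / A * (\<bar>u x\<bar> / B) \<le> 3 / 4 * (\<bar>f x\<bar> powr (4/3) / A powr (4/3)) + 1 / 4 * (u x ^ 4 / B ^ 4)"
        using young_43[of "\<bar>f x\<bar> / A" "\<bar>u x\<bar> / B"] pos by (simp add: powr_divide power_divide)
      then have "A * B * (\<bar>f x\<bar> / A * (\<bar>u x\<bar> / B)) \<le> A * B * (3 / 4 * (\<bar>f x\<bar> powr (4/3) / A powr (4/3)) + 1 / 4 * (u x ^ 4 / B ^ 4))"
        using pos by (intro mult_left_mono) auto
      then show "\<bar>f x * u x\<bar> \<le> A * B * (3 / 4 * (\<bar>f x\<bar> powr (4/3) / A powr (4/3)) + 1 / 4 * (u x ^ 4 / B ^ 4))"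
        using pos by (simp add: abs_mult)
    qed
    also have "\<dots> = A * B * (3 / 4 * (A powr (4/3) / A powr (4/3)) + 1 / 4 * (B ^ 4 / B ^ 4))"
      using fi ui A(1) B(1) by simp
    also have "\<dots> = A * B" using pos by simp
    finally show ?thesis unfolding A_def B_def .
  qed
qed

section \<open>Dirichlet forms and the best Sobolev constant\<close>

lemma H01_add: "u \<in> H01 \<Omega> \<Longrightarrow> v \<in> H01 \<Omega> \<Longrightarrow> (\<lambda>x. u x + v x) \<in> H01 \<Omega>"
  by (rule H01I[OF H1lim_add[OF H01D H01D]])

lemma H01_cmult: "u \<in> H01 \<Omega> \<Longrightarrow> (\<lambda>x. c * u x) \<in> H01 \<Omega>"
  by (rule H01I[OF H1lim_cmult[OF H01D]])

lemma H01_test: "\<phi> \<in> test_functions \<Omega> \<Longrightarrow> \<phi> \<in> H01 \<Omega>"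
  by (rule H01I[OF H1lim_test])

lemma H01_0: "(\<lambda>x. 0) \<in> H01 \<Omega>"
  by (rule H01_test[OF test_functions_0])

lemma H01_abs: "u \<in> H01 \<Omega> \<Longrightarrow> (\<lambda>x. \<bar>u x\<bar>) \<in> H01 \<Omega>"
  using H1lim_abs[OF H01D] H01I by metis

lemma H01_L2: "u \<in> H01 \<Omega> \<Longrightarrow> L2 M u" "u \<in> H01 \<Omega> \<Longrightarrow> L2 M (weak_gradient \<Omega> u)"
  using H1limD H01D by blast+

lemma weak_gradient_add_AE:
  "u \<in> H01 \<Omega> \<Longrightarrow> v \<in> H01 \<Omega> \<Longrightarrow>
    AE x in M. weak_gradient \<Omega> (\<lambda>x. u x + v x) x = weak_gradient \<Omega> u x + weak_gradient \<Omega> v x"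
  by (rule H1lim_weak_gradient(1)[OF H1lim_add[OF H01D H01D]])

lemma weak_gradient_cmult_AE:
  "u \<in> H01 \<Omega> \<Longrightarrow> AE x in M. weak_gradient \<Omega> (\<lambda>x. c * u x) x = c *\<^sub>R weak_gradient \<Omega> u x"
  by (rule H1lim_weak_gradient(1)[OF H1lim_cmult[OF H01D]])

definition dirichlet :: "real \<Rightarrow> ('a \<Rightarrow> real) \<Rightarrow> ('a \<Rightarrow> real) \<Rightarrow> real" where
  "dirichlet l u v = (LINT x|M. weak_gradient \<Omega> u x \<bullet> weak_gradient \<Omega> v x + l * u x * v x)"

lemma dirichlet_integrable:
  assumes "u \<in> H01 \<Omega>" "v \<in> H01 \<Omega>"
  shows "integrable M (\<lambda>x. weak_gradient \<Omega> u x \<bullet> weak_gradient \<Omega> v x)" "integrable M (\<lambda>x. l * u x * v x)"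
  using L2_inner_integrable[OF H01_L2(2)[OF assms(1)] H01_L2(2)[OF assms(2)]]
    L2_mult_integrable[OF H01_L2(1)[OF assms(1)] H01_L2(1)[OF assms(2)]]
  by (simp_all add: mult.assoc)

lemma dirichlet_sym: "dirichlet l u v = dirichlet l v u"
  unfolding dirichlet_def by (simp add: inner_commute mult_ac)

lemma dirichlet_add:
  assumes "u \<in> H01 \<Omega>" "v \<in> H01 \<Omega>" "w \<in> H01 \<Omega>"
  shows "dirichlet l (\<lambda>x. u x + v x) w = dirichlet l u w + dirichlet l v w"
proof -
  note [measurable] = L2_measurable[OF H01_L2(1)[OF assms(1)]] L2_measurable[OF H01_L2(1)[OF assms(2)]]
    L2_measurable[OF H01_L2(1)[OF assms(3)]] L2_measurable[OF H01_L2(2)[OF assms(1)]]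
    L2_measurable[OF H01_L2(2)[OF assms(2)]] L2_measurable[OF H01_L2(2)[OF assms(3)]]
    L2_measurable[OF H01_L2(2)[OF H01_add[OF assms(1,2)]]]
  have "dirichlet l (\<lambda>x. u x + v x) w = (LINT x|M. (weak_gradient \<Omega> u x \<bullet> weak_gradient \<Omega> w x + l * u x * w x)
      + (weak_gradient \<Omega> v x \<bullet> weak_gradient \<Omega> w x + l * v x * w x))"
    unfolding dirichlet_def
  proof (rule integral_cong_AE)
    show "AE x in M. weak_gradient \<Omega> (\<lambda>x. u x + v x) x \<bullet> weak_gradient \<Omega> w x + l * (u x + v x) * w x
        = (weak_gradient \<Omega> u x \<bullet> weak_gradient \<Omega> w x + l * u x * w x) + (weak_gradient \<Omega> v x \<bullet> weak_gradient \<Omega> w x + l * v x * w x)"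
      using weak_gradient_add_AE[OF assms(1,2)]
      by eventually_elim (simp add: inner_add_left algebra_simps)
  qed measurable
  also have "\<dots> = dirichlet l u w + dirichlet l v w"
    unfolding dirichlet_def
    using dirichlet_integrable(1)[OF assms(1,3)] dirichlet_integrable(2)[OF assms(1,3), of l]
      dirichlet_integrable(1)[OF assms(2,3)] dirichlet_integrable(2)[OF assms(2,3), of l] by simp
  finally show ?thesis .
qed

lemma dirichlet_cmult:
  assumes "u \<in> H01 \<Omega>" "w \<in> H01 \<Omega>"
  shows "dirichlet l (\<lambda>x. c * u x) w = c * dirichlet l u w"
proof -
  note [measurable] = L2_measurable[OF H01_L2(1)[OF assms(1)]] L2_measurable[OF H01_L2(1)[OF assms(2)]]
    L2_measurable[OF H01_L2(2)[OF assms(1)]] L2_measurable[OF H01_L2(2)[OF assms(2)]]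
    L2_measurable[OF H01_L2(2)[OF H01_cmult[OF assms(1), of c]]]
  have "dirichlet l (\<lambda>x. c * u x) w = (LINT x|M. c * (weak_gradient \<Omega> u x \<bullet> weak_gradient \<Omega> w x + l * u x * w x))"
    unfolding dirichlet_def
  proof (rule integral_cong_AE)
    show "AE x in M. weak_gradient \<Omega> (\<lambda>x. c * u x) x \<bullet> weak_gradient \<Omega> w x + l * (c * u x) * w x
        = c * (weak_gradient \<Omega> u x \<bullet> weak_gradient \<Omega> w x + l * u x * w x)"
      using weak_gradient_cmult_AE[OF assms(1), of c]
      by eventually_elim (simp add: algebra_simps)
  qed measurable
  then show ?thesis unfolding dirichlet_def by simp
qed

lemma dirichlet_self:
  assumes "u \<in> H01 \<Omega>"
  shows "dirichlet l u u = sqn M (weak_gradient \<Omega> u) + l * sqn M u"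
proof -
  have "(norm (u x))\<^sup>2 = u x * u x" for x
    by (simp add: power2_eq_square)
  then show ?thesis
    unfolding dirichlet_def sqn_def power2_norm_eq_inner[of "weak_gradient \<Omega> u _"]
    using dirichlet_integrable(1)[OF assms assms] dirichlet_integrable(2)[OF assms assms, of l]
      L2_mult_integrable[OF H01_L2(1)[OF assms] H01_L2(1)[OF assms]]
    by (simp add: mult.assoc)
qed

lemma sqn_0_AE:
  assumes "L2 M u" "sqn M u = 0"
  shows "AE x in M. u x = 0"
proof -
  have "AE x in M. (norm (u x))\<^sup>2 = 0"
    using assms by (intro AE_0_of_integral L2_integrable) (auto simp: sqn_def)
  then show ?thesis by eventually_elim simp
qed

lemma weak_gradient_0_AE:
  assumes u: "u \<in> H01 \<Omega>" and ae: "AE x in M. u x = 0"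
  shows "AE x in M. weak_gradient \<Omega> u x = 0"
proof -
  have "is_L2_weak_gradient \<Omega> u (\<lambda>x. 0)"
    unfolding is_L2_weak_gradient_def
  proof (intro conjI ballI)
    show "(\<lambda>x. 0) \<in> Lp 2 \<Omega>" unfolding Lp_2_iff by simp
    fix \<phi> b
    have "AE x in M. u x * frechet_derivative \<phi> (at x) b = 0"
      using ae by eventually_elim simp
    then show "(LINT x|M. u x * frechet_derivative \<phi> (at x) b) = - (LINT x|M. (0 \<bullet> b) * \<phi> x)"
      by (simp add: integral_eq_zero_AE)
  qed
  then show ?thesis by (rule weak_gradient_AE(2))
qed

lemma nonzero_test_function:
  assumes "\<Omega> \<noteq> {}"
  obtains \<phi> where "\<phi> \<in> test_functions \<Omega>" "0 < sqn M \<phi>"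
proof -
  obtain a r where ar: "0 < r" "cball a r \<subseteq> \<Omega>"
    using assms open_\<Omega> open_contains_cball by blast
  define \<phi> where "\<phi> = ball_bump a r 1"
  have \<phi>: "\<phi> \<in> test_functions \<Omega>"
    unfolding \<phi>_def using ar by (intro ball_bump_test_function) auto
  have "sqn M \<phi> \<noteq> 0"
  proof
    assume "sqn M \<phi> = 0"
    then have "AE x in M. \<phi> x = 0"
      by (rule sqn_0_AE[OF L2_test(1)[OF \<phi>]])
    then have "AE x in lebesgue. x \<in> \<Omega> \<longrightarrow> \<phi> x = 0"
      using open_\<Omega> by (subst (asm) AE_restrict_space_iff) auto
    then have "AE x in lebesgue. x \<notin> ball a r"
    proof eventually_elim
      case (elim x)
      then show ?case
        using ball_bump_pos_iff[of 1 r a x] ar subsetD[OF order_trans[OF ball_subset_cball ar(2)], of x]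
        unfolding \<phi>_def by fastforce
    qed
    then have "ball a r \<in> null_sets lebesgue"
      using AE_iff_null_sets[of "ball a r" lebesgue] by simp
    then have "measure lebesgue (ball a r) = 0"
      by (auto simp: null_sets_def measure_def)
    moreover have "measure lebesgue (ball a r) = measure lborel (ball a r)"
      by (rule measure_completion) simp
    ultimately show False using content_ball_pos[OF ar(1), of a] by simp
  qed
  then show ?thesis
    using that[OF \<phi>] sqn_nonneg[of M \<phi>] by linarith
qed

lemma H01_L4:
  assumes dim: "DIM('a) \<le> 3"
  obtains S where "0 < S" "\<And>u. u \<in> H01 \<Omega> \<Longrightarrow> L4 u \<and> p4 u \<le> S * sqrt (sqn M (weak_gradient \<Omega> u))"
proof -
  obtain C where C: "0 < C" "\<And>u G. H1lim u G \<Longrightarrow> integrable M (\<lambda>x. u x ^ 4)"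
    "\<And>u G. H1lim u G \<Longrightarrow> (LINT x|M. u x ^ 4) \<le> C * (sqn M u + sqn M G)\<^sup>2"
    using H1lim_L4[OF dim] by metis
  obtain P where P: "0 < P" "\<And>u G. H1lim u G \<Longrightarrow> sqn M u \<le> P * sqn M G"
    using poincare by metis
  \<comment> \<open>Two square roots of \<open>C * ((P + 1) * G)\<^sup>2\<close> with
    \<open>G\<close> the Dirichlet integral; Poincare has absorbed the \<open>L^2\<close>
    term.\<close>
  define S where "S = sqrt (sqrt C * (P + 1))"
  have "L4 u \<and> p4 u \<le> S * sqrt (sqn M (weak_gradient \<Omega> u))" if u: "u \<in> H01 \<Omega>" for u
  proof
    note H = H01D[OF u]
    show "L4 u" unfolding L4_def using C(2)[OF H] L2_measurable[OF H1limD(1)[OF H]] by simp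
    let ?G = "sqn M (weak_gradient \<Omega> u)"
    have "sqn M u + ?G \<le> (P + 1) * ?G" using P(2)[OF H] by (simp add: algebra_simps)
    then have "(sqn M u + ?G)\<^sup>2 \<le> ((P + 1) * ?G)\<^sup>2" by (intro power_mono) auto
    then have "(LINT x|M. u x ^ 4) \<le> C * ((P + 1) * ?G)\<^sup>2"
      using C(1) C(3)[OF H] by (meson mult_left_mono less_imp_le order_trans)
    then have "sqrt (LINT x|M. u x ^ 4) \<le> sqrt (C * ((P + 1) * ?G)\<^sup>2)"
      by (rule real_sqrt_le_mono)
    also have "\<dots> = sqrt C * (P + 1) * ?G"
      using P(1) by (simp add: real_sqrt_mult abs_mult)
    finally have "p4 u \<le> sqrt (sqrt C * (P + 1) * ?G)"
      unfolding p4_def by (rule real_sqrt_le_mono)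
    then show "p4 u \<le> S * sqrt ?G" unfolding S_def by (simp add: real_sqrt_mult)
  qed
  then show ?thesis using that[of S] C(1) P(1) unfolding S_def by auto
qed

text \<open>\<open>LEAST\<close> over the reals is meaningful only if a minimum exists. The
  admissible constants are bounded below because a nonempty \<open>\<Omega>\<close> carries a
  function with nonzero gradient, and their infimum is admissible because each single inequality is
  closed in the constant.\<close>

lemma sobolev_S4_bound:
  assumes dim: "DIM('a) \<le> 3" and ne: "\<Omega> \<noteq> {}" and u: "u \<in> H01 \<Omega>"
  shows "L4 u" "p4 u \<le> sobolev_S4 \<Omega> * sqrt (sqn M (weak_gradient \<Omega> u))"
proof -
  define P where "P S \<longleftrightarrow> (\<forall>u\<in>H01 \<Omega>. u \<in> Lp 4 \<Omega> \<and>
    Lp_norm 4 \<Omega> u \<le> S * sqrt (LINT x|M. (norm (weak_gradient \<Omega> u x))\<^sup>2))" for S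
  have P_iff: "P S \<longleftrightarrow> (\<forall>u\<in>H01 \<Omega>. L4 u \<and> p4 u \<le> S * sqrt (sqn M (weak_gradient \<Omega> u)))" for S
    unfolding P_def Lp_4_iff Lp_norm_4 sqn_def ..
  obtain S1 where S1: "P S1"
    unfolding P_iff using H01_L4[OF dim] by metis
  obtain \<phi> where \<phi>: "\<phi> \<in> test_functions \<Omega>" "0 < sqn M \<phi>"
    using nonzero_test_function[OF ne] by metis
  obtain c where c: "0 < c" "\<And>u G. H1lim u G \<Longrightarrow> sqn M u \<le> c * sqn M G"
    using poincare by metis
  have \<phi>H: "\<phi> \<in> H01 \<Omega>" using H01_test[OF \<phi>(1)] .
  have "0 < c * sqn M (weak_gradient \<Omega> \<phi>)"
    using c(2)[OF H01D[OF \<phi>H]] \<phi>(2) by linarith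
  then have g: "0 < sqn M (weak_gradient \<Omega> \<phi>)"
    using c(1) by (simp add: zero_less_mult_iff)
  have P_nonneg: "0 \<le> S" if "P S" for S
  proof -
    have "0 \<le> S * sqrt (sqn M (weak_gradient \<Omega> \<phi>))"
      using that \<phi>H p4_nonneg[of \<phi>] unfolding P_iff by (meson order_trans)
    then show ?thesis using g by (simp add: zero_le_mult_iff)
  qed
  have bdd: "bdd_below {S. P S}" using P_nonneg by (intro bdd_belowI[of _ 0]) simp
  have "P (Inf {S. P S})"
  proof (rule P_iff[THEN iffD2], intro ballI conjI)
    fix u assume u: "u \<in> H01 \<Omega>"
    show "L4 u" using S1 u unfolding P_iff by blast
    let ?d = "sqrt (sqn M (weak_gradient \<Omega> u))"
    have le: "p4 u \<le> S * ?d" if "P S" for S using that u unfolding P_iff by blast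
    show "p4 u \<le> Inf {S. P S} * ?d"
    proof (cases "?d = 0")
      case True
      then show ?thesis using le[OF S1] by simp
    next
      case False
      then have d: "0 < ?d" by (metis less_eq_real_def real_sqrt_ge_zero sqn_nonneg)
      have "p4 u / ?d \<le> Inf {S. P S}"
      proof (rule cInf_greatest)
        show "{S. P S} \<noteq> {}" using S1 by blast
        show "p4 u / ?d \<le> S" if "S \<in> {S. P S}" for S
          using le[of S] that d by (simp add: divide_le_eq)
      qed
      then show ?thesis using d by (simp add: divide_le_eq)
    qed
  qed
  note PInf = this
  have "Inf {S. P S} \<le> S" if "P S" for S
    using that bdd by (intro cInf_lower) auto
  then have "(LEAST S. P S) = Inf {S. P S}" by (intro Least_equality PInf)
  then have "sobolev_S4 \<Omega> = Inf {S. P S}" unfolding sobolev_S4_def P_def[symmetric] .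
  then have "P (sobolev_S4 \<Omega>)" using PInf by simp
  then show "L4 u" "p4 u \<le> sobolev_S4 \<Omega> * sqrt (sqn M (weak_gradient \<Omega> u))"
    using u unfolding P_iff by auto
qed

end

section \<open>The coupled system\<close>

context bounded_domain
begin

definition quad :: "('a \<Rightarrow> real) \<Rightarrow> ('a \<Rightarrow> real) \<Rightarrow> ('a \<Rightarrow> real) \<Rightarrow> ('a \<Rightarrow> real) \<Rightarrow> real" where
  "quad a b c d = (LINT x|M. a x * b x * c x * d x)"

lemma quad_swap: "quad a b c d = quad b a c d" "quad a b c d = quad a c b d" "quad a b c d = quad a b d c"
  unfolding quad_def by (simp_all add: mult_ac)

lemma quad_add1:
  assumes "L4 u" "L4 v" "L4 b" "L4 c" "L4 d"
  shows "quad (\<lambda>x. u x + v x) b c d = quad u b c d + quad v b c d"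
  unfolding quad_def using L4_mult4(1)[OF assms(1,3-5)] L4_mult4(1)[OF assms(2,3-5)]
  by (simp add: distrib_right)

lemma quad_add3:
  assumes "L4 u" "L4 v" "L4 b" "L4 c" "L4 d"
  shows "quad b c (\<lambda>x. u x + v x) d = quad b c u d + quad b c v d"
  unfolding quad_def using L4_mult4(1)[OF assms(3,4,1,5)] L4_mult4(1)[OF assms(3,4,2,5)]
  by (simp add: distrib_right distrib_left)

lemma quad_cmult1: "quad (\<lambda>x. r * u x) b c d = r * quad u b c d"
  and quad_cmult3: "quad b c (\<lambda>x. r * u x) d = r * quad b c u d"
proof -
  have "(LINT x|M. r * u x * b x * c x * d x) = (LINT x|M. r * (u x * b x * c x * d x))"
    by (simp add: mult_ac)
  then show "quad (\<lambda>x. r * u x) b c d = r * quad u b c d"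
    unfolding quad_def by simp
  have "(LINT x|M. b x * c x * (r * u x) * d x) = (LINT x|M. r * (b x * c x * u x * d x))"
    by (simp add: mult_ac)
  then show "quad b c (\<lambda>x. r * u x) d = r * quad b c u d"
    unfolding quad_def by simp
qed

lemma quad_bound:
  assumes "L4 a" "L4 b" "L4 c" "L4 d" "p4 a \<le> A" "p4 b \<le> B" "p4 c \<le> C" "p4 d \<le> D"
  shows "\<bar>quad a b c d\<bar> \<le> A * B * C * D"
proof -
  have "\<bar>quad a b c d\<bar> \<le> p4 a * p4 b * p4 c * p4 d"
    unfolding quad_def by (rule L4_mult4(2)[OF assms(1-4)])
  also have "\<dots> \<le> A * B * C * D"
    using assms(5-8) p4_nonneg[of a] p4_nonneg[of b] p4_nonneg[of c] p4_nonneg[of d]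
    by (intro mult_mono mult_nonneg_nonneg) linarith+
  finally show ?thesis .
qed

lemma quad_mono:
  assumes "L4 a" "L4 b" "L4 c" "L4 d" "L4 a'" "L4 b'" "L4 c'" "L4 d'"
    and "\<And>x. a x * b x * c x * d x \<le> a' x * b' x * c' x * d' x"
  shows "quad a b c d \<le> quad a' b' c' d'"
  unfolding quad_def using assms by (intro integral_mono L4_mult4(1)) auto

lemma quad_self: "quad u u u u = p4 u ^ 4"
  unfolding quad_def p4_power4 by (simp add: power4_eq_xxxx)

lemma L4_limit_imp_L2_limit:
  assumes u: "\<And>n. L4 (u n)" "L4 u0" and lim: "(\<lambda>n. LINT x|M. (u n x - u0 x) ^ 4) \<longlonglongrightarrow> 0"
  shows "(\<lambda>n. sqn M (\<lambda>x. u n x - u0 x)) \<longlonglongrightarrow> 0"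
proof (rule null_sequence_squeeze[OF sqn_nonneg])
  fix n
  have "L4 (\<lambda>x. u n x - u0 x)"
    using L4_add[OF u(1) L4_cmult[OF u(2), of "-1"], of n] by simp
  then have "(sqn M (\<lambda>x. u n x - u0 x))\<^sup>2 \<le> measure M (space M) * (LINT x|M. (u n x - u0 x) ^ 4)"
    by (intro sqn_le_L4(2)) (auto simp: L4_def)
  then show "sqn M (\<lambda>x. u n x - u0 x) \<le> sqrt (measure M (space M) * (LINT x|M. (u n x - u0 x) ^ 4))"
    by (rule real_le_rsqrt)
next
  have "(\<lambda>n. sqrt (measure M (space M) * (LINT x|M. (u n x - u0 x) ^ 4))) \<longlonglongrightarrow> sqrt (measure M (space M) * 0)"
    by (intro tendsto_intros lim)
  then show "(\<lambda>n. sqrt (measure M (space M) * (LINT x|M. (u n x - u0 x) ^ 4))) \<longlonglongrightarrow> 0" by simp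
qed

lemma bounded_real_subseq:
  fixes a :: "nat \<Rightarrow> real"
  assumes "\<And>n. 0 \<le> a n" "\<And>n. a n \<le> B"
  obtains r l where "strict_mono (r :: nat \<Rightarrow> nat)" "(\<lambda>n. a (r n)) \<longlonglongrightarrow> l"
proof -
  have "\<forall>n. a n \<in> {0..B}" using assms by auto
  then obtain l r where "strict_mono (r :: nat \<Rightarrow> nat)" "(a \<circ> r) \<longlonglongrightarrow> l"
    using compact_Icc[of 0 B] unfolding compact_def by metis
  then show ?thesis using that by (auto simp: o_def)
qed

text \<open>Two extractions: the first makes the Dirichlet norms converge, the second is the compact
  embedding. The limit \<open>e\<close> is reported separately, since the gradients need not
  converge strongly.\<close>

lemma H01_compact:
  assumes dim: "DIM('a) \<le> 3" and u: "\<And>n. u n \<in> H01 \<Omega>" and bound: "\<And>n. sqn M (weak_gradient \<Omega> (u n)) \<le> B"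
  obtains r u0 e where "strict_mono (r :: nat \<Rightarrow> nat)" "u0 \<in> H01 \<Omega>"
    "(\<lambda>n. LINT x|M. (u (r n) x - u0 x) ^ 4) \<longlonglongrightarrow> 0"
    "(\<lambda>n. sqn M (weak_gradient \<Omega> (u (r n)))) \<longlonglongrightarrow> e" "sqn M (weak_gradient \<Omega> u0) \<le> e"
    "(\<lambda>n. sqn M (u (r n))) \<longlonglongrightarrow> sqn M u0"
proof -
  obtain P where P: "0 < P" "\<And>u G. H1lim u G \<Longrightarrow> sqn M u \<le> P * sqn M G"
    using poincare by metis
  obtain S where S: "0 < S" "\<And>u. u \<in> H01 \<Omega> \<Longrightarrow> L4 u \<and> p4 u \<le> S * sqrt (sqn M (weak_gradient \<Omega> u))"
    using H01_L4[OF dim] by metis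
  have B0: "0 \<le> B" using bound[of 0] sqn_nonneg[of M] by (meson order_trans)
  obtain r1 e where r1: "strict_mono (r1 :: nat \<Rightarrow> nat)" "(\<lambda>n. sqn M (weak_gradient \<Omega> (u (r1 n)))) \<longlonglongrightarrow> e"
    using bounded_real_subseq[of "\<lambda>n. sqn M (weak_gradient \<Omega> (u n))" B] bound by auto
  have b1: "sqn M (u (r1 n)) \<le> (P + 1) * B" for n
  proof -
    have "sqn M (u (r1 n)) \<le> P * sqn M (weak_gradient \<Omega> (u (r1 n)))" by (rule P(2)[OF H01D[OF u]])
    also have "\<dots> \<le> P * B" using P(1) bound by (intro mult_left_mono) auto
    also have "\<dots> \<le> (P + 1) * B" using B0 by (simp add: distrib_right)
    finally show ?thesis .
  qed
  have b2: "sqn M (weak_gradient \<Omega> (u (r1 n))) \<le> (P + 1) * B" for n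
  proof -
    have "B \<le> (P + 1) * B" using B0 P(1) by (simp add: distrib_right)
    then show ?thesis using bound[of "r1 n"] by linarith
  qed
  obtain r2 u0 G0 where r2: "strict_mono (r2 :: nat \<Rightarrow> nat)" and H0: "H1lim u0 G0"
    and lim4: "(\<lambda>n. LINT x|M. (u (r1 (r2 n)) x - u0 x) ^ 4) \<longlonglongrightarrow> 0"
    by (rule H1lim_L4_compact[OF dim H01D[OF u] b1 b2]) (rule that)
  define r where "r n = r1 (r2 n)" for n
  have r: "strict_mono r" unfolding r_def using r1(1) r2 by (simp add: strict_mono_def)
  have u0: "u0 \<in> H01 \<Omega>" using H01I[OF H0] .
  have l4: "(\<lambda>n. LINT x|M. (u (r n) x - u0 x) ^ 4) \<longlonglongrightarrow> 0" using lim4 unfolding r_def .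
  have l2: "(\<lambda>n. sqn M (\<lambda>x. u (r n) x - u0 x)) \<longlonglongrightarrow> 0"
    using S(2)[OF u] S(2)[OF u0] by (intro L4_limit_imp_L2_limit l4) auto
  have lg: "(\<lambda>n. sqn M (weak_gradient \<Omega> (u (r n)))) \<longlonglongrightarrow> e"
    using LIMSEQ_subseq_LIMSEQ[OF r1(2) r2] unfolding r_def o_def .
  obtain G1 where G1: "H1lim u0 G1" "sqn M G1 \<le> e"
    by (rule H1lim_lsc[OF H01D[OF u] H01_L2(1)[OF u0] l2 order_refl lg]) (rule that)
  have "sqn M (weak_gradient \<Omega> u0) \<le> e" using H1lim_weak_gradient(3)[OF G1(1)] G1(2) by simp
  moreover have "(\<lambda>n. sqn M (u (r n))) \<longlonglongrightarrow> sqn M u0"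
    by (rule sqn_tendsto[OF H01_L2(1)[OF u] H01_L2(1)[OF u0] l2])
  ultimately show ?thesis using that r u0 l4 lg by blast
qed

end

locale coupled_system = bounded_domain \<Omega> for \<Omega> :: "'a::euclidean_space set" +
  fixes l1 l2 \<mu>1 \<mu>2 \<beta> :: real and f g :: "'a \<Rightarrow> real"
  assumes dim: "DIM('a) \<le> 3" and nonempty: "\<Omega> \<noteq> {}"
    and pos: "0 < l1" "0 < l2" "0 < \<mu>1" "0 < \<mu>2" "0 < \<beta>"
    and f: "f \<in> Lp (4/3) \<Omega>" and g: "g \<in> Lp (4/3) \<Omega>"
begin

section \<open>The energy forms of the system\<close>

definition H :: "(('a \<Rightarrow> real) \<times> ('a \<Rightarrow> real)) set" where
  "H = {z. fst z \<in> H01 \<Omega> \<and> snd z \<in> H01 \<Omega>}"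

definition E :: "('a \<Rightarrow> real) \<times> ('a \<Rightarrow> real) \<Rightarrow> ('a \<Rightarrow> real) \<times> ('a \<Rightarrow> real) \<Rightarrow> real" where
  "E z w = dirichlet l1 (fst z) (fst w) + dirichlet l2 (snd z) (snd w)"

text \<open>The symmetric four-linear form with
  \<open>T z z z z = \<mu>\<^sub>1 \<integral> u\<^sup>4 + \<mu>\<^sub>2 \<integral> v\<^sup>4 + 2 \<beta> \<integral> u\<^sup>2 v\<^sup>2\<close> for \<open>z = (u, v)\<close>.\<close>

definition T where
  "T a b c d = \<mu>1 * quad (fst a) (fst b) (fst c) (fst d) + \<mu>2 * quad (snd a) (snd b) (snd c) (snd d)
    + \<beta> / 3 * (quad (fst a) (fst b) (snd c) (snd d) + quad (fst a) (fst c) (snd b) (snd d)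
      + quad (fst a) (fst d) (snd b) (snd c) + quad (fst b) (fst c) (snd a) (snd d)
      + quad (fst b) (fst d) (snd a) (snd c) + quad (fst c) (fst d) (snd a) (snd b))"

definition L :: "('a \<Rightarrow> real) \<times> ('a \<Rightarrow> real) \<Rightarrow> real" where
  "L z = (LINT x|M. f x * fst z x + g x * snd z x)"

definition q :: "('a \<Rightarrow> real) \<times> ('a \<Rightarrow> real) \<Rightarrow> real" where
  "q z = p4 (fst z) + p4 (snd z)"

text \<open>The factor 2 accounts for the two components in \<open>q\<close>. Modulus and summand 1
  make the constant positive and no smaller than the Sobolev constant, without a separate discussion
  of its sign.\<close>

definition S :: real where "S = 2 * (\<bar>sobolev_S4 \<Omega>\<bar> + 1)"

lemma H_L4: "z \<in> H \<Longrightarrow> L4 (fst z)" "z \<in> H \<Longrightarrow> L4 (snd z)"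
  unfolding H_def using sobolev_S4_bound(1)[OF dim nonempty] by auto

lemma H_H01: "z \<in> H \<Longrightarrow> fst z \<in> H01 \<Omega>" "z \<in> H \<Longrightarrow> snd z \<in> H01 \<Omega>"
  unfolding H_def by auto

lemma subspace_H: "subspace H"
  unfolding H_def subspace_def
  using H01_add H01_cmult H01_0 by (auto simp: plus_fun_def scaleR_fun_def zero_fun_def)

lemma fst_snd_linear:
  "fst (x + y) = (\<lambda>a. fst x a + fst y a)" "snd (x + y) = (\<lambda>a. snd x a + snd y a)"
  "fst (r *\<^sub>R x) = (\<lambda>a. r * fst x a)" "snd (r *\<^sub>R x) = (\<lambda>a. r * snd x a)"
  for x y :: "('a \<Rightarrow> real) \<times> ('a \<Rightarrow> real)"
  by (auto simp: plus_fun_def scaleR_fun_def)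

lemma q_components: "p4 (fst z) \<le> q z" "p4 (snd z) \<le> q z" "0 \<le> q z"
  unfolding q_def by auto

text \<open>By Hoelder each \<open>quad\<close> is at most the product of the four values of
  \<open>q\<close>; the six mixed terms with weight \<open>\<beta> / 3\<close> add up to
  \<open>2 * \<beta>\<close>.\<close>

lemma T_bound:
  assumes "a \<in> H" "b \<in> H" "c \<in> H" "d \<in> H"
  shows "\<bar>T a b c d\<bar> \<le> (\<mu>1 + \<mu>2 + 2 * \<beta>) * (q a * q b * q c * q d)"
proof -
  let ?Q = "q a * q b * q c * q d"
  have Q: "\<bar>quad u v w y\<bar> \<le> ?Q" if "u \<in> {fst a, snd a}" "v \<in> {fst b, snd b}" "w \<in> {fst c, snd c}" "y \<in> {fst d, snd d}" for u v w y
    using that assms by (intro quad_bound) (auto intro: H_L4 q_components)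
  have e1: "\<bar>\<mu>1 * quad (fst a) (fst b) (fst c) (fst d)\<bar> \<le> \<mu>1 * ?Q"
    using mult_left_mono[OF Q[of "fst a" "fst b" "fst c" "fst d"], of \<mu>1] pos by (simp add: abs_mult)
  have e2: "\<bar>\<mu>2 * quad (snd a) (snd b) (snd c) (snd d)\<bar> \<le> \<mu>2 * ?Q"
    using mult_left_mono[OF Q[of "snd a" "snd b" "snd c" "snd d"], of \<mu>2] pos by (simp add: abs_mult)
  \<comment> \<open>Reorders the factors so that each slot belongs to the same pair as in
    \<open>Q\<close>.\<close>
  have s: "quad (fst a) (fst c) (snd b) (snd d) = quad (fst a) (snd b) (fst c) (snd d)"
    "quad (fst a) (fst d) (snd b) (snd c) = quad (fst a) (snd b) (snd c) (fst d)"
    "quad (fst b) (fst c) (snd a) (snd d) = quad (snd a) (fst b) (fst c) (snd d)"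
    "quad (fst b) (fst d) (snd a) (snd c) = quad (snd a) (fst b) (snd c) (fst d)"
    "quad (fst c) (fst d) (snd a) (snd b) = quad (snd a) (snd b) (fst c) (fst d)"
    by (simp_all add: quad_def mult_ac)
  have "\<bar>quad (fst a) (fst b) (snd c) (snd d) + quad (fst a) (fst c) (snd b) (snd d)
      + quad (fst a) (fst d) (snd b) (snd c) + quad (fst b) (fst c) (snd a) (snd d)
      + quad (fst b) (fst d) (snd a) (snd c) + quad (fst c) (fst d) (snd a) (snd b)\<bar> \<le> 6 * ?Q"
    unfolding s
    using Q[of "fst a" "fst b" "snd c" "snd d"] Q[of "fst a" "snd b" "fst c" "snd d"] Q[of "fst a" "snd b" "snd c" "fst d"]
      Q[of "snd a" "fst b" "fst c" "snd d"] Q[of "snd a" "fst b" "snd c" "fst d"] Q[of "snd a" "snd b" "fst c" "fst d"]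
    by simp
  then have "\<beta> / 3 * \<bar>quad (fst a) (fst b) (snd c) (snd d) + quad (fst a) (fst c) (snd b) (snd d)
      + quad (fst a) (fst d) (snd b) (snd c) + quad (fst b) (fst c) (snd a) (snd d)
      + quad (fst b) (fst d) (snd a) (snd c) + quad (fst c) (fst d) (snd a) (snd b)\<bar> \<le> \<beta> / 3 * (6 * ?Q)"
    using pos by (intro mult_left_mono) auto
  then have e3: "\<bar>\<beta> / 3 * (quad (fst a) (fst b) (snd c) (snd d) + quad (fst a) (fst c) (snd b) (snd d)
      + quad (fst a) (fst d) (snd b) (snd c) + quad (fst b) (fst c) (snd a) (snd d)
      + quad (fst b) (fst d) (snd a) (snd c) + quad (fst c) (fst d) (snd a) (snd b))\<bar> \<le> 2 * \<beta> * ?Q"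
    using pos by (simp add: abs_mult)
  have "\<bar>T a b c d\<bar> \<le> \<mu>1 * ?Q + \<mu>2 * ?Q + 2 * \<beta> * ?Q"
    unfolding T_def using e1 e2 e3 by linarith
  then show ?thesis by (simp add: algebra_simps)
qed

text \<open>The coupling term is nonnegative since \<open>\<beta>\<close> is positive, and 1/8 comes
  from \<open>power4_add_le\<close> for the two components.\<close>

lemma T_lower:
  assumes "z \<in> H"
  shows "min \<mu>1 \<mu>2 / 8 * q z ^ 4 \<le> T z z z z"
proof -
  have b: "0 \<le> quad (fst z) (fst z) (snd z) (snd z)"
  proof -
    have "fst z x * fst z x * snd z x * snd z x = (fst z x * snd z x)\<^sup>2" for x
      by (simp add: power2_eq_square mult_ac)
    then show ?thesis unfolding quad_def by simp
  qed
  have "q z ^ 4 \<le> 8 * (p4 (fst z) ^ 4 + p4 (snd z) ^ 4)"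
    unfolding q_def by (rule power4_add_le)
  then have "min \<mu>1 \<mu>2 / 8 * q z ^ 4 \<le> min \<mu>1 \<mu>2 / 8 * (8 * (p4 (fst z) ^ 4 + p4 (snd z) ^ 4))"
    using pos by (intro mult_left_mono) auto
  also have "\<dots> = min \<mu>1 \<mu>2 * p4 (fst z) ^ 4 + min \<mu>1 \<mu>2 * p4 (snd z) ^ 4"
    by (simp add: distrib_left)
  also have "\<dots> \<le> \<mu>1 * p4 (fst z) ^ 4 + \<mu>2 * p4 (snd z) ^ 4"
    by (intro add_mono mult_right_mono) auto
  also have "\<dots> \<le> T z z z z"
  proof -
    have "quad (snd z) (snd z) (fst z) (fst z) = quad (fst z) (fst z) (snd z) (snd z)"
      by (simp add: quad_def mult_ac)
    then show ?thesis
      unfolding T_def quad_self using b pos by (simp add: quad_def mult_ac)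
  qed
  finally show ?thesis .
qed

lemma E_self: "z \<in> H \<Longrightarrow> E z z = (sqn M (weak_gradient \<Omega> (fst z)) + l1 * sqn M (fst z))
    + (sqn M (weak_gradient \<Omega> (snd z)) + l2 * sqn M (snd z))"
  unfolding E_def using H_H01[of z] by (simp add: dirichlet_self)

lemma E_nonneg: "z \<in> H \<Longrightarrow> 0 \<le> E z z"
  using pos by (simp add: E_self)

lemma gradient_le_E: "z \<in> H \<Longrightarrow> sqn M (weak_gradient \<Omega> (fst z)) \<le> E z z"
    "z \<in> H \<Longrightarrow> sqn M (weak_gradient \<Omega> (snd z)) \<le> E z z"
proof -
  assume z: "z \<in> H"
  have "0 \<le> l1 * sqn M (fst z)" "0 \<le> l2 * sqn M (snd z)" "0 \<le> sqn M (weak_gradient \<Omega> (fst z))"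
    "0 \<le> sqn M (weak_gradient \<Omega> (snd z))"
    using pos by auto
  then show "sqn M (weak_gradient \<Omega> (fst z)) \<le> E z z" "sqn M (weak_gradient \<Omega> (snd z)) \<le> E z z"
    unfolding E_self[OF z] by linarith+
qed

lemma q_bound:
  assumes z: "z \<in> H"
  shows "q z \<le> S * sqrt (E z z)"
proof -
  have *: "p4 u \<le> (\<bar>sobolev_S4 \<Omega>\<bar> + 1) * sqrt (E z z)"
    if u: "u \<in> H01 \<Omega>" "sqn M (weak_gradient \<Omega> u) \<le> E z z" for u
  proof -
    have "p4 u \<le> sobolev_S4 \<Omega> * sqrt (sqn M (weak_gradient \<Omega> u))"
      by (rule sobolev_S4_bound(2)[OF dim nonempty u(1)])
    also have "\<dots> \<le> (\<bar>sobolev_S4 \<Omega>\<bar> + 1) * sqrt (E z z)"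
      using u(2) by (intro mult_mono) auto
    finally show ?thesis .
  qed
  have "q z \<le> (\<bar>sobolev_S4 \<Omega>\<bar> + 1) * sqrt (E z z) + (\<bar>sobolev_S4 \<Omega>\<bar> + 1) * sqrt (E z z)"
    unfolding q_def by (intro add_mono * H_H01[OF z] gradient_le_E z)
  then show ?thesis unfolding S_def by (simp add: algebra_simps)
qed

lemma L_eq: "z \<in> H \<Longrightarrow> L z = (LINT x|M. f x * fst z x) + (LINT x|M. g x * snd z x)"
  unfolding L_def using Lp_43_integrable[OF f H_L4(1)] Lp_43_integrable[OF g H_L4(2)] by simp

lemma L_q:
  assumes "z \<in> H" "Lp_norm (4/3) \<Omega> f \<le> A" "Lp_norm (4/3) \<Omega> g \<le> A"
  shows "\<bar>L z\<bar> \<le> A * q z"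
proof -
  have "\<bar>LINT x|M. f x * fst z x\<bar> \<le> A * p4 (fst z)"
    using holder_43[OF f H_L4(1)[OF assms(1)]] mult_right_mono[OF assms(2) p4_nonneg[of "fst z"]] by linarith
  moreover have "\<bar>LINT x|M. g x * snd z x\<bar> \<le> A * p4 (snd z)"
    using holder_43[OF g H_L4(2)[OF assms(1)]] mult_right_mono[OF assms(3) p4_nonneg[of "snd z"]] by linarith
  ultimately show ?thesis
    unfolding L_eq[OF assms(1)] q_def distrib_left by linarith
qed

lemma p4_tendsto_0:
  assumes "(\<lambda>n. LINT x|M. (u n x - v x) ^ 4) \<longlonglongrightarrow> 0"
  shows "(\<lambda>n. p4 (\<lambda>x. u n x - v x)) \<longlonglongrightarrow> 0"
  using tendsto_real_sqrt[OF tendsto_real_sqrt[OF assms]] unfolding p4_def by simp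

text \<open>The extraction for the second component is nested in that for the first. Each component
  contributes its own limit of Dirichlet integrals, while the terms of order zero converge to those
  of the limit.\<close>

lemma compact:
  assumes z: "\<And>n. z n \<in> H" and bound: "\<And>n. E (z n) (z n) \<le> B"
  shows "\<exists>r z0 e. strict_mono (r :: nat \<Rightarrow> nat) \<and> z0 \<in> H \<and> (\<lambda>n. q (z (r n) - z0)) \<longlonglongrightarrow> 0 \<and>
    (\<lambda>n. E (z (r n)) (z (r n))) \<longlonglongrightarrow> e \<and> E z0 z0 \<le> e"
proof -
  have b1: "sqn M (weak_gradient \<Omega> (fst (z n))) \<le> B" for n
    using gradient_le_E(1)[OF z] bound by (rule order_trans)
  obtain r1 u e1 where r1: "strict_mono (r1 :: nat \<Rightarrow> nat)" and u: "u \<in> H01 \<Omega>"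
    "(\<lambda>n. LINT x|M. (fst (z (r1 n)) x - u x) ^ 4) \<longlonglongrightarrow> 0"
    "(\<lambda>n. sqn M (weak_gradient \<Omega> (fst (z (r1 n))))) \<longlonglongrightarrow> e1" "sqn M (weak_gradient \<Omega> u) \<le> e1"
    "(\<lambda>n. sqn M (fst (z (r1 n)))) \<longlonglongrightarrow> sqn M u"
    by (rule H01_compact[OF dim H_H01(1)[OF z] b1]) (rule that)
  have b2: "sqn M (weak_gradient \<Omega> (snd (z (r1 n)))) \<le> B" for n
    using gradient_le_E(2)[OF z] bound by (rule order_trans)
  obtain r2 v e2 where r2: "strict_mono (r2 :: nat \<Rightarrow> nat)" and v: "v \<in> H01 \<Omega>"
    "(\<lambda>n. LINT x|M. (snd (z (r1 (r2 n))) x - v x) ^ 4) \<longlonglongrightarrow> 0"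
    "(\<lambda>n. sqn M (weak_gradient \<Omega> (snd (z (r1 (r2 n)))))) \<longlonglongrightarrow> e2" "sqn M (weak_gradient \<Omega> v) \<le> e2"
    "(\<lambda>n. sqn M (snd (z (r1 (r2 n))))) \<longlonglongrightarrow> sqn M v"
    by (rule H01_compact[OF dim H_H01(2)[OF z] b2]) (rule that)
  define r where "r n = r1 (r2 n)" for n
  have r: "strict_mono r" unfolding r_def using r1 r2 by (simp add: strict_mono_def)
  note sub = LIMSEQ_subseq_LIMSEQ[OF _ r2, unfolded o_def]
  have z0: "(u, v) \<in> H" unfolding H_def using u v by simp
  have "(\<lambda>n. p4 (\<lambda>x. fst (z (r n)) x - u x) + p4 (\<lambda>x. snd (z (r n)) x - v x)) \<longlonglongrightarrow> 0 + 0"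
    unfolding r_def by (intro tendsto_add p4_tendsto_0 v(2) sub[OF u(2)])
  moreover have "q (z (r n) - (u, v)) = p4 (\<lambda>x. fst (z (r n)) x - u x) + p4 (\<lambda>x. snd (z (r n)) x - v x)" for n
    unfolding q_def by (simp add: fun_diff_def)
  ultimately have "(\<lambda>n. q (z (r n) - (u, v))) \<longlonglongrightarrow> 0" by simp
  moreover have "(\<lambda>n. E (z (r n)) (z (r n))) \<longlonglongrightarrow> (e1 + l1 * sqn M u) + (e2 + l2 * sqn M v)"
    unfolding E_self[OF z] r_def by (intro tendsto_intros v sub[OF u(3)] sub[OF u(5)])
  moreover have "E (u, v) (u, v) \<le> (e1 + l1 * sqn M u) + (e2 + l2 * sqn M v)"
    using E_self[OF z0] u(4) v(4) by simp
  ultimately show ?thesis using r z0 by blast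
qed

section \<open>Passage to absolute values\<close>

definition abs_pair :: "('a \<Rightarrow> real) \<times> ('a \<Rightarrow> real) \<Rightarrow> ('a \<Rightarrow> real) \<times> ('a \<Rightarrow> real)" where
  "abs_pair z = (\<lambda>x. \<bar>fst z x\<bar>, \<lambda>x. \<bar>snd z x\<bar>)"

lemma abs_pair_H: "z \<in> H \<Longrightarrow> abs_pair z \<in> H"
  unfolding H_def abs_pair_def using H01_abs by auto

lemma sqn_gradient_abs: "u \<in> H01 \<Omega> \<Longrightarrow> sqn M (weak_gradient \<Omega> (\<lambda>x. \<bar>u x\<bar>)) \<le> sqn M (weak_gradient \<Omega> u)"
  using H1lim_abs[OF H01D] H1lim_weak_gradient(3) by metis

lemma abs_pair_E: "z \<in> H \<Longrightarrow> E (abs_pair z) (abs_pair z) \<le> E z z"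
  using E_self[of z] E_self[OF abs_pair_H, of z] sqn_gradient_abs[OF H_H01(1), of z] sqn_gradient_abs[OF H_H01(2), of z]
  by (simp add: abs_pair_def sqn_def)

lemma quad_le_abs:
  assumes "L4 a" "L4 b" "L4 c" "L4 d"
  shows "quad a b c d \<le> quad (\<lambda>x. \<bar>a x\<bar>) (\<lambda>x. \<bar>b x\<bar>) (\<lambda>x. \<bar>c x\<bar>) (\<lambda>x. \<bar>d x\<bar>)"
  using assms by (intro quad_mono L4_abs) (simp_all flip: abs_mult)

text \<open>All coefficients of \<open>T\<close> are positive, so moduli can be taken inside each
  integral.\<close>

lemma T_le_abs:
  assumes "a \<in> H" "b \<in> H" "c \<in> H" "d \<in> H"
  shows "T a b c d \<le> T (abs_pair a) (abs_pair b) (abs_pair c) (abs_pair d)"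
  unfolding T_def abs_pair_def fst_conv snd_conv
  using assms pos by (intro add_mono mult_left_mono quad_le_abs H_L4) auto

lemma abs_pair_idem: "abs_pair (abs_pair z) = abs_pair z"
  unfolding abs_pair_def by simp

lemma integral_mult_le_abs:
  fixes h :: "'a \<Rightarrow> real"
  assumes "h \<in> Lp (4/3) \<Omega>" "L4 u" "AE x in M. 0 \<le> h x"
  shows "(LINT x|M. h x * u x) \<le> (LINT x|M. h x * \<bar>u x\<bar>)"
proof (rule integral_mono_AE)
  show "integrable M (\<lambda>x. h x * u x)" "integrable M (\<lambda>x. h x * \<bar>u x\<bar>)"
    using assms L4_abs by (auto intro: Lp_43_integrable)
  show "AE x in M. h x * u x \<le> h x * \<bar>u x\<bar>"
    using assms(3) by eventually_elim (simp add: mult_left_mono)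
qed

lemma abs_pair_L:
  assumes "AE x in M. 0 \<le> f x" "AE x in M. 0 \<le> g x" and z: "z \<in> H"
  shows "L z \<le> L (abs_pair z)"
  using integral_mult_le_abs[OF f H_L4(1)[OF z] assms(1)] integral_mult_le_abs[OF g H_L4(2)[OF z] assms(2)]
    L_eq[OF z] L_eq[OF abs_pair_H[OF z]]
  by (simp add: abs_pair_def)

text \<open>The largest radius that the condition
  \<open>6 * K * S ^ 4 * \<rho>\<^sup>2 \<le> 1\<close> admits for
  \<open>K = \<mu>1 + \<mu>2 + 2 * \<beta>\<close>.\<close>

definition \<rho> :: real where
  "\<rho> = sqrt (1 / (6 * (\<mu>1 + \<mu>2 + 2 * \<beta>) * S ^ 4))"

lemma S_pos: "0 < S"
  unfolding S_def by (simp add: add_nonneg_pos)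

lemma \<rho>_pos: "0 < \<rho>"
  unfolding \<rho>_def using pos S_pos by simp

lemma E_add:
  assumes "x \<in> H" "y \<in> H" "z \<in> H"
  shows "E (x + y) z = E x z + E y z"
  unfolding E_def fst_snd_linear using assms[THEN H_H01(1)] assms[THEN H_H01(2)]
  by (simp add: dirichlet_add)

lemma E_scale:
  assumes "x \<in> H" "z \<in> H"
  shows "E (r *\<^sub>R x) z = r * E x z"
  unfolding E_def fst_snd_linear using assms[THEN H_H01(1)] assms[THEN H_H01(2)]
  by (simp add: dirichlet_cmult algebra_simps)

lemma T_add:
  assumes "x \<in> H" "y \<in> H" "a \<in> H" "b \<in> H" "c \<in> H"
  shows "T (x + y) a b c = T x a b c + T y a b c"
  unfolding T_def fst_snd_linear using assms[THEN H_L4(1)] assms[THEN H_L4(2)]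
  by (simp add: quad_add1 quad_add3 algebra_simps)

lemma T_scale: "T (r *\<^sub>R x) a b c = r * T x a b c"
  unfolding T_def fst_snd_linear by (simp add: quad_cmult1 quad_cmult3 algebra_simps)

lemma T_sym: "T x a b c = T a x b c" "T x a b c = T x b a c" "T x a b c = T x a c b"
  unfolding T_def by (simp_all add: quad_swap add_ac)

lemma L_add: "\<lbrakk>x \<in> H; y \<in> H\<rbrakk> \<Longrightarrow> L (x + y) = L x + L y"
proof -
  assume xy: "x \<in> H" "y \<in> H"
  then have "x + y \<in> H" using subspace_H by (rule subspace_add[rotated])
  from L_eq[OF this] show ?thesis
    unfolding L_eq[OF xy(1)] L_eq[OF xy(2)] fst_snd_linear
    using Lp_43_integrable[OF f H_L4(1)[OF xy(1)]] Lp_43_integrable[OF f H_L4(1)[OF xy(2)]]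
      Lp_43_integrable[OF g H_L4(2)[OF xy(1)]] Lp_43_integrable[OF g H_L4(2)[OF xy(2)]]
    by (simp add: distrib_left)
qed

lemma L_scale: "L (r *\<^sub>R x) = r * L x"
proof -
  have "(LINT y|M. f y * (r * fst x y) + g y * (r * snd x y)) = (LINT y|M. r * (f y * fst x y + g y * snd x y))"
    by (simp add: algebra_simps)
  then show ?thesis unfolding L_def fst_snd_linear by simp
qed

text \<open>The larger data norm serves as \<open>C\<close>, and multiplied by \<open>S\<close> as
  \<open>\<eta>\<close>. The factor 8 in the assumption leaves a margin of 2 over the condition
  \<open>4 * \<eta> < \<rho>\<close>.\<close>

lemma quartic_energy_instance:
  assumes small: "8 * S * max (Lp_norm (4/3) \<Omega> f) (Lp_norm (4/3) \<Omega> g) < \<rho>"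
    and m: "m = id \<or> (m = abs_pair \<and> (AE x in M. 0 \<le> f x) \<and> (AE x in M. 0 \<le> g x))"
  shows "quartic_energy H E T L q m (\<mu>1 + \<mu>2 + 2 * \<beta>) (min \<mu>1 \<mu>2 / 8) S
    (max (Lp_norm (4/3) \<Omega> f) (Lp_norm (4/3) \<Omega> g) * S) \<rho> (max (Lp_norm (4/3) \<Omega> f) (Lp_norm (4/3) \<Omega> g))"
proof
  let ?A = "max (Lp_norm (4/3) \<Omega> f) (Lp_norm (4/3) \<Omega> g)"
  have A: "0 \<le> ?A" unfolding Lp_norm_def by (simp add: max_def)
  show "subspace H" by (rule subspace_H)
  show "E (x + y) z = E x z + E y z" if "x \<in> H" "y \<in> H" "z \<in> H" for x y z using that by (rule E_add)
  show "E (r *\<^sub>R x) z = r * E x z" if "x \<in> H" "z \<in> H" for r x z using that by (rule E_scale)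
  show "E x z = E z x" for x z unfolding E_def by (simp add: dirichlet_sym)
  show "0 \<le> E x x" if "x \<in> H" for x using that by (rule E_nonneg)
  show "T (x + y) a b c = T x a b c + T y a b c" if "x \<in> H" "y \<in> H" "a \<in> H" "b \<in> H" "c \<in> H" for x y a b c
    using that by (rule T_add)
  show "T (r *\<^sub>R x) a b c = r * T x a b c" for r x a b c by (rule T_scale)
  show "T x a b c = T a x b c" "T x a b c = T x b a c" "T x a b c = T x a c b" for x a b c by (rule T_sym)+
  show "L (x + y) = L x + L y" if "x \<in> H" "y \<in> H" for x y using that by (rule L_add)
  show "L (r *\<^sub>R x) = r * L x" for r x by (rule L_scale)
  show "0 \<le> q x" for x by (rule q_components)
  show "\<bar>T x a b c\<bar> \<le> (\<mu>1 + \<mu>2 + 2 * \<beta>) * (q x * q a * q b * q c)" if "x \<in> H" "a \<in> H" "b \<in> H" "c \<in> H" for x a b c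
    using that by (rule T_bound)
  show "min \<mu>1 \<mu>2 / 8 * q x ^ 4 \<le> T x x x x" if "x \<in> H" for x using that by (rule T_lower)
  show "q x \<le> S * sqrt (E x x)" if "x \<in> H" for x using that by (rule q_bound)
  show Lq: "\<bar>L x\<bar> \<le> ?A * q x" if "x \<in> H" for x by (rule L_q[OF that]) auto
  show "\<bar>L x\<bar> \<le> ?A * S * sqrt (E x x)" if "x \<in> H" for x
    using Lq[OF that] mult_left_mono[OF q_bound[OF that] A] by (simp add: mult.assoc)
  show "0 < \<mu>1 + \<mu>2 + 2 * \<beta>" "0 < min \<mu>1 \<mu>2 / 8" using pos by auto
  show "0 < S" by (rule S_pos)
  show "0 < \<rho>" by (rule \<rho>_pos)
  show "4 * (?A * S) < \<rho>"
  proof -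
    have "0 \<le> ?A * S" using A S_pos by simp
    then show ?thesis using small by (simp add: mult_ac)
  qed
  show "6 * (\<mu>1 + \<mu>2 + 2 * \<beta>) * S ^ 4 * \<rho>\<^sup>2 \<le> 1"
  proof -
    have "0 < 6 * (\<mu>1 + \<mu>2 + 2 * \<beta>) * S ^ 4" using pos S_pos by simp
    then show ?thesis unfolding \<rho>_def by (simp add: real_sqrt_pow2)
  qed
  show "\<exists>r z0 e. strict_mono (r :: nat \<Rightarrow> nat) \<and> z0 \<in> H \<and> (\<lambda>n. q (z (r n) - z0)) \<longlonglongrightarrow> 0 \<and>
      (\<lambda>n. E (z (r n)) (z (r n))) \<longlonglongrightarrow> e \<and> E z0 z0 \<le> e"
    if "\<And>n. z n \<in> H" "\<And>n. E (z n) (z n) \<le> B" for z B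
    using that by (rule compact)
  show "\<exists>w\<in>H. 0 < q w"
  proof -
    obtain \<phi> where \<phi>: "\<phi> \<in> test_functions \<Omega>" "0 < sqn M \<phi>"
      using nonzero_test_function[OF nonempty] by metis
    have w: "(\<phi>, \<lambda>x. 0) \<in> H" unfolding H_def using H01_test[OF \<phi>(1)] H01_0 by simp
    have L4: "L4 \<phi>" using H_L4(1)[OF w] by simp
    have "p4 \<phi> \<noteq> 0"
    proof
      assume "p4 \<phi> = 0"
      then have "(sqn M \<phi>)\<^sup>2 \<le> 0"
        using sqn_le_L4(2)[of \<phi>] L4 p4_power4[of \<phi>] unfolding L4_def by simp
      then show False using \<phi>(2) by simp
    qed
    then have "0 < p4 \<phi>" using p4_nonneg[of \<phi>] by linarith
    then have "0 < q (\<phi>, \<lambda>x. 0)" unfolding q_def by (simp add: add_pos_nonneg)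
    then show ?thesis using w by blast
  qed
  from m consider "m = id" | "m = abs_pair" "AE x in M. 0 \<le> f x" "AE x in M. 0 \<le> g x" by blast
  note m_cases = this
  show "m x \<in> H" if "x \<in> H" for x using m_cases that by cases (auto intro: abs_pair_H)
  show "E (m x) (m x) \<le> E x x" if "x \<in> H" for x using m_cases that by cases (auto intro: abs_pair_E)
  show "T x x x x \<le> T (m x) (m x) (m x) (m x)" if "x \<in> H" for x
    using m_cases that by cases (auto intro: T_le_abs)
  \<comment> \<open>\<open>abs_pair\<close> is idempotent, so taking moduli in all slots leaves
    those of \<open>m x\<close> unchanged.\<close>
  show "T (m x) (m x) y y \<le> T (m x) (m x) (m y) (m y)" if "x \<in> H" "y \<in> H" for x y
    using m_cases
  proof cases
    case 2
    then show ?thesis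
      using T_le_abs[OF abs_pair_H[OF that(1)] abs_pair_H[OF that(1)] that(2) that(2)] by (simp add: abs_pair_idem)
  qed simp
  show "T (m x) y y y \<le> T (m x) (m y) (m y) (m y)" if "x \<in> H" "y \<in> H" for x y
    using m_cases
  proof cases
    case 2
    then show ?thesis
      using T_le_abs[OF abs_pair_H[OF that(1)] that(2) that(2) that(2)] by (simp add: abs_pair_idem)
  qed simp
  show "L x \<le> L (m x)" if "x \<in> H" for x
    using m_cases
  proof cases
    case 2
    then show ?thesis using abs_pair_L[OF 2(2,3) that] by simp
  qed simp
qed

section \<open>Weak solutions as critical points\<close>

lemma weak_equation:
  assumes z: "z \<in> H" and h: "h \<in> H"
  shows "(LINT x|M. weak_gradient \<Omega> (fst z) x \<bullet> weak_gradient \<Omega> (fst h) x + weak_gradient \<Omega> (snd z) x \<bullet> weak_gradient \<Omega> (snd h) x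
        + l1 * fst z x * fst h x + l2 * snd z x * snd h x
        - \<mu>1 * fst z x ^ 3 * fst h x - \<mu>2 * snd z x ^ 3 * snd h x
        - \<beta> * fst z x * (snd z x)\<^sup>2 * fst h x - \<beta> * (fst z x)\<^sup>2 * snd z x * snd h x
        - f x * fst h x - g x * snd h x) = E z h - T z z z h - L h"
proof -
  let ?u = "fst z" and ?v = "snd z" and ?p = "fst h" and ?r = "snd h"
  note L4 = H_L4[OF z] H_L4[OF h] and HH = H_H01[OF z] H_H01[OF h]
  \<comment> \<open>The integrand is regrouped into blocks that are integrable one by one.\<close>
  have "(LINT x|M. weak_gradient \<Omega> ?u x \<bullet> weak_gradient \<Omega> ?p x + weak_gradient \<Omega> ?v x \<bullet> weak_gradient \<Omega> ?r x
        + l1 * ?u x * ?p x + l2 * ?v x * ?r x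
        - \<mu>1 * ?u x ^ 3 * ?p x - \<mu>2 * ?v x ^ 3 * ?r x
        - \<beta> * ?u x * (?v x)\<^sup>2 * ?p x - \<beta> * (?u x)\<^sup>2 * ?v x * ?r x
        - f x * ?p x - g x * ?r x)
    = (LINT x|M. ((weak_gradient \<Omega> ?u x \<bullet> weak_gradient \<Omega> ?p x + l1 * ?u x * ?p x)
        + (weak_gradient \<Omega> ?v x \<bullet> weak_gradient \<Omega> ?r x + l2 * ?v x * ?r x))
        - (\<mu>1 * (?u x * ?u x * ?u x * ?p x) + \<mu>2 * (?v x * ?v x * ?v x * ?r x)
          + (\<beta> * (?u x * ?p x * ?v x * ?v x) + \<beta> * (?u x * ?u x * ?v x * ?r x)))
        - (f x * ?p x + g x * ?r x))"
    by (intro Bochner_Integration.integral_cong refl) (simp add: power2_eq_square power3_eq_cube algebra_simps)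
  also have "\<dots> = E z h - (\<mu>1 * quad ?u ?u ?u ?p + \<mu>2 * quad ?v ?v ?v ?r + (\<beta> * quad ?u ?p ?v ?v + \<beta> * quad ?u ?u ?v ?r)) - L h"
    unfolding E_def dirichlet_def quad_def L_def
    using dirichlet_integrable(1)[OF HH(1,3)] dirichlet_integrable(2)[OF HH(1,3), of l1]
      dirichlet_integrable(1)[OF HH(2,4)] dirichlet_integrable(2)[OF HH(2,4), of l2]
      L4_mult4(1)[OF L4(1,1,1,3)] L4_mult4(1)[OF L4(2,2,2,4)] L4_mult4(1)[OF L4(1,3,2,2)] L4_mult4(1)[OF L4(1,1,2,4)]
      Lp_43_integrable[OF f L4(3)] Lp_43_integrable[OF g L4(4)]
    by simp
  \<comment> \<open>In \<open>T z z z h\<close> the six mixed terms are of two kinds, three of each,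
    so the weight \<open>\<beta> / 3\<close> becomes \<open>\<beta>\<close>.\<close>
  also have "\<mu>1 * quad ?u ?u ?u ?p + \<mu>2 * quad ?v ?v ?v ?r + (\<beta> * quad ?u ?p ?v ?v + \<beta> * quad ?u ?u ?v ?r) = T z z z h"
    unfolding T_def by (simp add: field_simps)
  finally show ?thesis .
qed

lemma weak_solution_iff:
  "weak_solution l1 l2 \<mu>1 \<mu>2 \<beta> \<Omega> f g u v \<longleftrightarrow> (u, v) \<in> H \<and> (\<forall>h\<in>H. E (u, v) h - T (u, v) (u, v) (u, v) h - L h = 0)"
proof (cases "(u, v) \<in> H")
  case True
  have "weak_solution l1 l2 \<mu>1 \<mu>2 \<beta> \<Omega> f g u v \<longleftrightarrow>
    (\<forall>\<phi>\<in>H01 \<Omega>. \<forall>\<psi>\<in>H01 \<Omega>. E (u, v) (\<phi>, \<psi>) - T (u, v) (u, v) (u, v) (\<phi>, \<psi>) - L (\<phi>, \<psi>) = 0)"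
  proof -
    have pair: "(\<phi>, \<psi>) \<in> H" if "\<phi> \<in> H01 \<Omega>" "\<psi> \<in> H01 \<Omega>" for \<phi> \<psi> using that unfolding H_def by simp
    note eq = weak_equation[OF True pair, unfolded fst_conv snd_conv]
    show ?thesis
      unfolding weak_solution_def using H_H01[OF True] by (simp add: eq cong: ball_cong)
  qed
  then show ?thesis using True unfolding H_def by auto
next
  case False
  then show ?thesis unfolding weak_solution_def H_def by auto
qed

lemma energy_eq:
  assumes z: "(u, v) \<in> H"
  shows "energy l1 l2 \<mu>1 \<mu>2 \<beta> \<Omega> f g u v = E (u, v) (u, v) / 2 - T (u, v) (u, v) (u, v) (u, v) / 4 - L (u, v)"
proof -
  have u: "u \<in> H01 \<Omega>" "v \<in> H01 \<Omega>" using H_H01[OF z] by auto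
  have d: "(LINT x|M. (norm (weak_gradient \<Omega> w x))\<^sup>2 + l * (w x)\<^sup>2) = dirichlet l w w" for l w
    unfolding dirichlet_def by (simp add: power2_norm_eq_inner) (simp add: power2_eq_square mult.assoc)
  have "(H_norm l1 l2 \<Omega> u v)\<^sup>2 = E (u, v) (u, v)"
    unfolding H_norm_def d using E_nonneg[OF z] by (simp add: E_def)
  moreover have "(LINT x|M. (u x)\<^sup>2 * (v x)\<^sup>2) = quad u u v v"
    unfolding quad_def by (simp add: power2_eq_square mult.assoc)
  moreover have "quad v v u u = quad u u v v" by (simp add: quad_def mult_ac)
  ultimately show ?thesis
    unfolding energy_def Lp_norm_4 T_def L_def by (simp add: quad_self field_simps)
qed

lemma finite_energy_H:
  assumes z: "(u, v) \<in> H"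
  shows "finite_energy \<Omega> f g u v"
proof -
  note u = H_H01[OF z, simplified] and L4 = H_L4[OF z, simplified]
  have "integrable M (\<lambda>x. (u x)\<^sup>2 * (v x)\<^sup>2)"
    using L4_mult4(1)[OF L4(1,1,2,2)] by (simp add: power2_eq_square mult.assoc)
  moreover have "u \<in> H1 \<Omega>" "v \<in> H1 \<Omega>" using u unfolding H01_def by auto
  ultimately show ?thesis
    unfolding finite_energy_def Lp_4_iff using L4 Lp_43_integrable[OF f L4(1)] Lp_43_integrable[OF g L4(2)] by simp
qed

lemma Lp_43_imp_integrable:
  fixes h :: "'a \<Rightarrow> real"
  assumes "h \<in> Lp (4/3) \<Omega>"
  shows "integrable M h"
proof -
  have "L4 (\<lambda>x. 1)" unfolding L4_def using finite_measure.integrable_const[OF finite_measure_M] by simp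
  from Lp_43_integrable[OF assms this] show ?thesis by simp
qed

lemma dirichlet_0_AE:
  assumes "u \<in> H01 \<Omega>" "AE x in M. u x = 0"
  shows "dirichlet l u w = 0"
proof -
  have "AE x in M. weak_gradient \<Omega> u x \<bullet> weak_gradient \<Omega> w x + l * u x * w x = 0"
    using weak_gradient_0_AE[OF assms] assms(2) by eventually_elim simp
  then show ?thesis unfolding dirichlet_def by (rule integral_eq_zero_AE)
qed

lemma quad_0_AE: "AE x in M. a x = 0 \<Longrightarrow> quad a b c d = 0"
  unfolding quad_def by (rule integral_eq_zero_AE) (auto elim: eventually_mono)

lemma quad_0 [simp]: "quad (\<lambda>x. 0) b c d = 0" "quad a (\<lambda>x. 0) c d = 0" "quad a b (\<lambda>x. 0) d = 0" "quad a b c (\<lambda>x. 0) = 0"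
  unfolding quad_def by simp_all

lemma dirichlet_0_right: "u \<in> H01 \<Omega> \<Longrightarrow> dirichlet l u (\<lambda>x. 0) = 0"
  using dirichlet_0_AE[OF H01_0, of l u] dirichlet_sym by simp

lemma solution_nontrivial:
  assumes sol: "weak_solution l1 l2 \<mu>1 \<mu>2 \<beta> \<Omega> f g u v"
    and fg: "nonzero_on \<Omega> f" "nonzero_on \<Omega> g"
  shows "nonzero_on \<Omega> u" "nonzero_on \<Omega> v"
proof -
  have z: "(u, v) \<in> H" and eq: "\<And>h. h \<in> H \<Longrightarrow> E (u, v) h - T (u, v) (u, v) (u, v) h - L h = 0"
    using sol unfolding weak_solution_iff by auto
  note uv = H_H01[OF z, simplified]
  show "nonzero_on \<Omega> u"
    unfolding nonzero_on_def
  proof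
    assume u0: "AE x in M. u x = 0"
    have "AE x in M. f x = 0"
    proof (rule fundamental_lemma[OF open_\<Omega> Lp_43_imp_integrable[OF f]])
      fix \<phi> assume "\<phi> \<in> test_functions \<Omega>"
      \<comment> \<open>A test pair with zero second component isolates the first equation, in which
        every term except the one with \<open>f\<close> contains \<open>u\<close>.\<close>
      then have h: "(\<phi>, \<lambda>x. 0) \<in> H" unfolding H_def using H01_test H01_0 by simp
      show "(LINT x|M. f x * \<phi> x) = 0"
        using eq[OF h] dirichlet_0_AE[OF uv(1) u0] quad_0_AE[OF u0] dirichlet_0_right[OF uv(2)]
        unfolding E_def T_def L_def by simp
    qed
    then show False using fg(1) unfolding nonzero_on_def by blast
  qed
  show "nonzero_on \<Omega> v"
    unfolding nonzero_on_def
  proof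
    assume v0: "AE x in M. v x = 0"
    \<comment> \<open>The mixed terms of \<open>T\<close> carry \<open>v\<close> in their third
      slot, which \<open>quad_0_AE\<close> reaches only after a permutation.\<close>
    have v0': "quad a b v d = 0" for a b d
      using quad_0_AE[OF v0] quad_swap by metis
    have "AE x in M. g x = 0"
    proof (rule fundamental_lemma[OF open_\<Omega> Lp_43_imp_integrable[OF g]])
      fix \<phi> assume "\<phi> \<in> test_functions \<Omega>"
      then have h: "(\<lambda>x. 0, \<phi>) \<in> H" unfolding H_def using H01_test H01_0 by simp
      show "(LINT x|M. g x * \<phi> x) = 0"
        using eq[OF h] dirichlet_0_AE[OF uv(2) v0] quad_0_AE[OF v0] v0' dirichlet_0_right[OF uv(1)]
        unfolding E_def T_def L_def by simp
    qed
    then show False using fg(2) unfolding nonzero_on_def by blast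
  qed
qed

lemma two_solutions:
  assumes small: "8 * S * max (Lp_norm (4/3) \<Omega> f) (Lp_norm (4/3) \<Omega> g) < \<rho>"
    and m: "m = id \<or> (m = abs_pair \<and> (AE x in M. 0 \<le> f x) \<and> (AE x in M. 0 \<le> g x))"
  obtains x w t where "0 < t" "m x \<in> H" "m w \<in> H"
    "weak_solution l1 l2 \<mu>1 \<mu>2 \<beta> \<Omega> f g (fst (m x)) (snd (m x))"
    "weak_solution l1 l2 \<mu>1 \<mu>2 \<beta> \<Omega> f g (\<lambda>y. fst (m x) y + t * fst (m w) y) (\<lambda>y. snd (m x) y + t * snd (m w) y)"
    "distinct_pairs \<Omega> (fst (m x)) (snd (m x)) (\<lambda>y. fst (m x) y + t * fst (m w) y) (\<lambda>y. snd (m x) y + t * snd (m w) y)"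
    "\<And>u v. weak_solution l1 l2 \<mu>1 \<mu>2 \<beta> \<Omega> f g u v \<Longrightarrow>
      energy l1 l2 \<mu>1 \<mu>2 \<beta> \<Omega> f g (fst (m x)) (snd (m x)) \<le> energy l1 l2 \<mu>1 \<mu>2 \<beta> \<Omega> f g u v"
proof -
  interpret Q: quartic_energy H E T L q m "\<mu>1 + \<mu>2 + 2 * \<beta>" "min \<mu>1 \<mu>2 / 8" S
    "max (Lp_norm (4/3) \<Omega> f) (Lp_norm (4/3) \<Omega> g) * S" \<rho> "max (Lp_norm (4/3) \<Omega> f) (Lp_norm (4/3) \<Omega> g)"
    by (rule quartic_energy_instance[OF small m])
  show ?thesis
  proof (rule Q.two_critical_points)
    fix x w and t :: real
    assume x: "x \<in> H" and w: "w \<in> H" and t: "0 < t" and qw: "0 < q (m w)"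
      and sx: "\<And>h. h \<in> H \<Longrightarrow> Q.DJ (m x) h = 0" and sw: "\<And>h. h \<in> H \<Longrightarrow> Q.DJ (m x + t *\<^sub>R m w) h = 0"
      and min: "\<And>z. z \<in> H \<Longrightarrow> (\<And>h. h \<in> H \<Longrightarrow> Q.DJ z h = 0) \<Longrightarrow> Q.J (m x) \<le> Q.J z"
    have mx: "m x \<in> H" and mw: "m w \<in> H" using Q.m_V x w by auto
    have sum: "(\<lambda>y. fst (m x) y + t * fst (m w) y, \<lambda>y. snd (m x) y + t * snd (m w) y) = m x + t *\<^sub>R m w"
      by (rule prod_eqI) (simp_all add: fst_snd_linear[unfolded] plus_fun_def scaleR_fun_def)
    have s1: "weak_solution l1 l2 \<mu>1 \<mu>2 \<beta> \<Omega> f g (fst (m x)) (snd (m x))"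
      unfolding weak_solution_iff prod.collapse using mx sx unfolding Q.DJ_def by blast
    have s2: "weak_solution l1 l2 \<mu>1 \<mu>2 \<beta> \<Omega> f g (\<lambda>y. fst (m x) y + t * fst (m w) y) (\<lambda>y. snd (m x) y + t * snd (m w) y)"
      unfolding weak_solution_iff sum using mx mw sw unfolding Q.DJ_def by simp
    have d: "distinct_pairs \<Omega> (fst (m x)) (snd (m x)) (\<lambda>y. fst (m x) y + t * fst (m w) y) (\<lambda>y. snd (m x) y + t * snd (m w) y)"
      unfolding distinct_pairs_def
    proof
      assume "AE y in M. fst (m x) y = fst (m x) y + t * fst (m w) y \<and> snd (m x) y = snd (m x) y + t * snd (m w) y"
      \<comment> \<open>Since \<open>t\<close> is nonzero, equality almost everywhere would make
        \<open>m w\<close> vanish almost everywhere, against \<open>0 < q (m w)\<close>.\<close>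
      then have ae: "AE y in M. fst (m w) y = 0 \<and> snd (m w) y = 0"
        by eventually_elim (use t in simp)
      have "AE y in M. fst (m w) y ^ 4 = 0" "AE y in M. snd (m w) y ^ 4 = 0"
        using ae by (eventually_elim, simp)+
      then have "p4 (fst (m w)) = 0" "p4 (snd (m w)) = 0"
        unfolding p4_def by (simp_all add: integral_eq_zero_AE)
      then show False using qw unfolding q_def by simp
    qed
    have en: "energy l1 l2 \<mu>1 \<mu>2 \<beta> \<Omega> f g (fst (m x)) (snd (m x)) \<le> energy l1 l2 \<mu>1 \<mu>2 \<beta> \<Omega> f g u v"
      if "weak_solution l1 l2 \<mu>1 \<mu>2 \<beta> \<Omega> f g u v" for u v
    proof -
      have uv: "(u, v) \<in> H" and "\<And>h. h \<in> H \<Longrightarrow> Q.DJ (u, v) h = 0"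
        using that unfolding weak_solution_iff Q.DJ_def by auto
      then have "Q.J (m x) \<le> Q.J (u, v)" by (rule min)
      then show ?thesis
        using energy_eq[OF uv] energy_eq[of "fst (m x)" "snd (m x)"] mx unfolding Q.J_def by simp
    qed
    show ?thesis by (rule that[OF t mx mw s1 s2 d en])
  qed
qed

lemma existence:
  assumes small: "8 * S * max (Lp_norm (4/3) \<Omega> f) (Lp_norm (4/3) \<Omega> g) < \<rho>"
    and fg: "nonzero_on \<Omega> f" "nonzero_on \<Omega> g"
  shows "two_nontrivial_solutions l1 l2 \<mu>1 \<mu>2 \<beta> \<Omega> f g"
    and "positive_on \<Omega> f \<Longrightarrow> positive_on \<Omega> g \<Longrightarrow> positive_ground_and_bound_states l1 l2 \<mu>1 \<mu>2 \<beta> \<Omega> f g"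
proof -
  show "two_nontrivial_solutions l1 l2 \<mu>1 \<mu>2 \<beta> \<Omega> f g"
  proof (rule two_solutions[OF small disjI1[OF refl]])
    fix x w t
    assume "weak_solution l1 l2 \<mu>1 \<mu>2 \<beta> \<Omega> f g (fst (id x)) (snd (id x))"
      "weak_solution l1 l2 \<mu>1 \<mu>2 \<beta> \<Omega> f g (\<lambda>y. fst (id x) y + t * fst (id w) y) (\<lambda>y. snd (id x) y + t * snd (id w) y)"
      "distinct_pairs \<Omega> (fst (id x)) (snd (id x)) (\<lambda>y. fst (id x) y + t * fst (id w) y) (\<lambda>y. snd (id x) y + t * snd (id w) y)"
    then show ?thesis
      unfolding two_nontrivial_solutions_def nontrivial_solution_def
      using solution_nontrivial[OF _ fg] by blast
  qed
  assume fgp: "positive_on \<Omega> f" "positive_on \<Omega> g"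
  then have m: "abs_pair = id \<or> (abs_pair = abs_pair \<and> (AE x in M. 0 \<le> f x) \<and> (AE x in M. 0 \<le> g x))"
    unfolding positive_on_def by blast
  show "positive_ground_and_bound_states l1 l2 \<mu>1 \<mu>2 \<beta> \<Omega> f g"
  proof (rule two_solutions[OF small m])
    fix x w and t :: real
    let ?u = "fst (abs_pair x)" and ?v = "snd (abs_pair x)"
    let ?w = "\<lambda>y. fst (abs_pair x) y + t * fst (abs_pair w) y" and ?z = "\<lambda>y. snd (abs_pair x) y + t * snd (abs_pair w) y"
    assume t: "0 < t" and s1: "weak_solution l1 l2 \<mu>1 \<mu>2 \<beta> \<Omega> f g ?u ?v"
      and s2: "weak_solution l1 l2 \<mu>1 \<mu>2 \<beta> \<Omega> f g ?w ?z"
      and d: "distinct_pairs \<Omega> ?u ?v ?w ?z"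
      and min: "\<And>u v. weak_solution l1 l2 \<mu>1 \<mu>2 \<beta> \<Omega> f g u v \<Longrightarrow>
        energy l1 l2 \<mu>1 \<mu>2 \<beta> \<Omega> f g ?u ?v \<le> energy l1 l2 \<mu>1 \<mu>2 \<beta> \<Omega> f g u v"
    \<comment> \<open>The second solution is a sum of nonnegative functions, as \<open>t\<close> is
      positive; that no component vanishes comes from the equations.\<close>
    have p: "positive_on \<Omega> ?u" "positive_on \<Omega> ?v" "positive_on \<Omega> ?w" "positive_on \<Omega> ?z"
      unfolding positive_on_def using solution_nontrivial[OF s1 fg] solution_nontrivial[OF s2 fg] t
      by (auto simp: abs_pair_def intro!: always_eventually add_nonneg_nonneg)
    have "finite_energy \<Omega> f g ?w ?z"
      using s2 unfolding weak_solution_iff by (intro finite_energy_H) blast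
    then have "positive_bound_state l1 l2 \<mu>1 \<mu>2 \<beta> \<Omega> f g ?w ?z"
      unfolding positive_bound_state_def using s2 p(3,4) by (intro conjI)
    moreover have "positive_ground_state l1 l2 \<mu>1 \<mu>2 \<beta> \<Omega> f g ?u ?v"
      unfolding positive_ground_state_def using s1 p(1,2) min by (intro conjI allI impI) auto
    ultimately show ?thesis
      unfolding positive_ground_and_bound_states_def using d by (intro exI conjI)
  qed
qed

end

text \<open>This is \<open>\<rho> / (8 * S)\<close> with the Sobolev constant turned into a
  variable, so that it can be fixed before \<open>\<Omega>\<close> and the data. It is uniform in
  \<open>l1\<close> and \<open>l2\<close>, because the terms of order zero only enlarge
  \<open>E\<close>.\<close>

definition smallness_radius :: "real \<Rightarrow> real \<Rightarrow> real \<Rightarrow> real \<Rightarrow> real" where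
  "smallness_radius \<mu>1 \<mu>2 \<beta> s =
    sqrt (1 / (6 * (\<mu>1 + \<mu>2 + 2 * \<beta>) * (2 * (\<bar>s\<bar> + 1)) ^ 4)) / (8 * (2 * (\<bar>s\<bar> + 1)))"

lemma smallness_radius_pos: "0 < \<mu>1 \<Longrightarrow> 0 < \<mu>2 \<Longrightarrow> 0 < \<beta> \<Longrightarrow> 0 < smallness_radius \<mu>1 \<mu>2 \<beta> s"
  unfolding smallness_radius_def by (intro divide_pos_pos) (auto simp: add_nonneg_pos)

text \<open>The dimension enters as a type. Stating the result for every type of dimension at most 3
  lets one radius function serve the three instances of the theorem.\<close>

lemma coupled_system_existence:
  assumes "DIM('a::euclidean_space) \<le> 3" and "0 < l1 \<and> 0 < l2 \<and> 0 < \<mu>1 \<and> 0 < \<mu>2 \<and> 0 < \<beta>"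
  shows "\<forall>\<Omega> :: 'a set. domain \<Omega> \<and> bounded \<Omega> \<longrightarrow>
    0 < smallness_radius \<mu>1 \<mu>2 \<beta> (sobolev_S4 \<Omega>) \<and>
    (\<forall>f \<in> Lp (4/3) \<Omega>. \<forall>g \<in> Lp (4/3) \<Omega>.
       nonzero_on \<Omega> f \<and> nonzero_on \<Omega> g \<and>
       max (Lp_norm (4/3) \<Omega> f) (Lp_norm (4/3) \<Omega> g) < smallness_radius \<mu>1 \<mu>2 \<beta> (sobolev_S4 \<Omega>) \<longrightarrow>
       two_nontrivial_solutions l1 l2 \<mu>1 \<mu>2 \<beta> \<Omega> f g \<and>
       (positive_on \<Omega> f \<and> positive_on \<Omega> g \<longrightarrow>
          positive_ground_and_bound_states l1 l2 \<mu>1 \<mu>2 \<beta> \<Omega> f g))"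
  (is "\<forall>\<Omega>. ?D \<Omega> \<longrightarrow> ?pos \<Omega> \<and> ?sol \<Omega>")
proof (intro allI impI)
  fix \<Omega> :: "'a set" assume \<Omega>: "domain \<Omega> \<and> bounded \<Omega>"
  have R: "two_nontrivial_solutions l1 l2 \<mu>1 \<mu>2 \<beta> \<Omega> f g \<and>
      (positive_on \<Omega> f \<and> positive_on \<Omega> g \<longrightarrow> positive_ground_and_bound_states l1 l2 \<mu>1 \<mu>2 \<beta> \<Omega> f g)"
    if fg: "f \<in> Lp (4/3) \<Omega>" "g \<in> Lp (4/3) \<Omega>" "nonzero_on \<Omega> f" "nonzero_on \<Omega> g"
      and small: "max (Lp_norm (4/3) \<Omega> f) (Lp_norm (4/3) \<Omega> g) < smallness_radius \<mu>1 \<mu>2 \<beta> (sobolev_S4 \<Omega>)" for f g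
  proof -
    interpret coupled_system \<Omega> l1 l2 \<mu>1 \<mu>2 \<beta> f g
      using assms \<Omega> fg(1,2) unfolding domain_def by unfold_locales auto
    have "smallness_radius \<mu>1 \<mu>2 \<beta> (sobolev_S4 \<Omega>) = \<rho> / (8 * S)"
      unfolding smallness_radius_def \<rho>_def S_def ..
    moreover define A where "A = max (Lp_norm (4/3) \<Omega> f) (Lp_norm (4/3) \<Omega> g)"
    ultimately have "A < \<rho> / (8 * S)"
      using small by simp
    then have "8 * S * A < \<rho>"
      using S_pos by (simp add: pos_less_divide_eq mult_ac)
    note ex = existence[OF this[unfolded A_def] fg(3,4)]
    show ?thesis
    proof (intro conjI impI)
      show "two_nontrivial_solutions l1 l2 \<mu>1 \<mu>2 \<beta> \<Omega> f g" by (rule ex(1))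
      assume "positive_on \<Omega> f \<and> positive_on \<Omega> g"
      then show "positive_ground_and_bound_states l1 l2 \<mu>1 \<mu>2 \<beta> \<Omega> f g" by (elim conjE) (rule ex(2))
    qed
  qed
  show "?pos \<Omega> \<and> ?sol \<Omega>"
  proof
    show "?pos \<Omega>"
      using assms(2) by (intro smallness_radius_pos) auto
  qed (intro ballI impI, elim conjE, rule R, assumption+)
qed

theorem theorem1p1:
  shows "\<exists>\<Lambda> :: real \<Rightarrow> real \<Rightarrow> real \<Rightarrow> real \<Rightarrow> real \<Rightarrow> real \<Rightarrow> real.
    \<forall>l1 l2 \<mu>1 \<mu>2 \<beta> :: real. 0 < l1 \<and> 0 < l2 \<and> 0 < \<mu>1 \<and> 0 < \<mu>2 \<and> 0 < \<beta> \<longrightarrow>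
       (\<forall>\<Omega> :: (real^1) set. domain \<Omega> \<and> bounded \<Omega> \<longrightarrow>
          0 < \<Lambda> l1 l2 \<mu>1 \<mu>2 \<beta> (sobolev_S4 \<Omega>) \<and>
          (\<forall>f \<in> Lp (4/3) \<Omega>. \<forall>g \<in> Lp (4/3) \<Omega>.
             nonzero_on \<Omega> f \<and> nonzero_on \<Omega> g \<and>
             max (Lp_norm (4/3) \<Omega> f) (Lp_norm (4/3) \<Omega> g) < \<Lambda> l1 l2 \<mu>1 \<mu>2 \<beta> (sobolev_S4 \<Omega>) \<longrightarrow>
             two_nontrivial_solutions l1 l2 \<mu>1 \<mu>2 \<beta> \<Omega> f g \<and>
             (positive_on \<Omega> f \<and> positive_on \<Omega> g \<longrightarrow>
                positive_ground_and_bound_states l1 l2 \<mu>1 \<mu>2 \<beta> \<Omega> f g))) \<and>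
       (\<forall>\<Omega> :: (real^2) set. domain \<Omega> \<and> bounded \<Omega> \<longrightarrow>
          0 < \<Lambda> l1 l2 \<mu>1 \<mu>2 \<beta> (sobolev_S4 \<Omega>) \<and>
          (\<forall>f \<in> Lp (4/3) \<Omega>. \<forall>g \<in> Lp (4/3) \<Omega>.
             nonzero_on \<Omega> f \<and> nonzero_on \<Omega> g \<and>
             max (Lp_norm (4/3) \<Omega> f) (Lp_norm (4/3) \<Omega> g) < \<Lambda> l1 l2 \<mu>1 \<mu>2 \<beta> (sobolev_S4 \<Omega>) \<longrightarrow>
             two_nontrivial_solutions l1 l2 \<mu>1 \<mu>2 \<beta> \<Omega> f g \<and>
             (positive_on \<Omega> f \<and> positive_on \<Omega> g \<longrightarrow>
                positive_ground_and_bound_states l1 l2 \<mu>1 \<mu>2 \<beta> \<Omega> f g))) \<and>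
       (\<forall>\<Omega> :: (real^3) set. domain \<Omega> \<and> bounded \<Omega> \<longrightarrow>
          0 < \<Lambda> l1 l2 \<mu>1 \<mu>2 \<beta> (sobolev_S4 \<Omega>) \<and>
          (\<forall>f \<in> Lp (4/3) \<Omega>. \<forall>g \<in> Lp (4/3) \<Omega>.
             nonzero_on \<Omega> f \<and> nonzero_on \<Omega> g \<and>
             max (Lp_norm (4/3) \<Omega> f) (Lp_norm (4/3) \<Omega> g) < \<Lambda> l1 l2 \<mu>1 \<mu>2 \<beta> (sobolev_S4 \<Omega>) \<longrightarrow>
             two_nontrivial_solutions l1 l2 \<mu>1 \<mu>2 \<beta> \<Omega> f g \<and>
             (positive_on \<Omega> f \<and> positive_on \<Omega> g \<longrightarrow>
                positive_ground_and_bound_states l1 l2 \<mu>1 \<mu>2 \<beta> \<Omega> f g)))"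
  by (rule exI[of _ "\<lambda>l1 l2 \<mu>1 \<mu>2 \<beta> s. smallness_radius \<mu>1 \<mu>2 \<beta> s"],
      intro allI impI, intro conjI; rule coupled_system_existence; simp)

end
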